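(* Let the distribution $d\mu(x)=f(x)\,dx$ of agent types be a probability measure given by a density $f\in W^{1,1}$ on $\overline{X}\subset\mathbf{R}^n$. Assume that the preference function $b(x,y)$ satisfies hypotheses (B0)--(B3) listed in the context and that the manufacturing cost $c:\overline{Y}\to\mathbf{R}$ is $b^*$-convex. Suppose further that the convex domain $X_{y_\emptyset}=D_yb(X,y_\emptyset)$ has no $n-1$ dimensional facets in its boundary. Then any minimizer $u\in\mathcal{U}_0$ of the principal's losses $L$ coincides with the reservation utility on a set $$U_0:=\{x\in\overline{X}\mid u(x)=b(x,y_\emptyset)-c(y_\emptyset)\}$$ whose interior contains a positive fraction of the agents, i.e. $\mu(\operatorname{int}U_0)>0$. Such agents select the null product $y_\emptyset$, i.e. $y_b(x,Du(x))=y_\emptyset$.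
   Context: $\overline{Z}$ denotes the closure of a set $Z\subset\mathbf{R}^n$. Hypotheses on $b$: (B0) $b\in C^4(\overline{X}\times\overline{Y})$, where $X,Y\subset\mathbf{R}^n$ are open and bounded. (B1) (bi-twist) For each $(x_0,y_0)\in\overline{X}\times\overline{Y}$, the maps $y\in\overline{Y}\mapsto D_xb(x_0,y)$ and $x\in\overline{X}\mapsto D_yb(x,y_0)$ are diffeomorphisms onto their ranges. (B2) (bi-convexity) For each $(x_0,y_0)\in\overline{X}\times\overline{Y}$, the sets $X_{y_0}:=D_yb(X,y_0)$ and $Y_{x_0}:=D_xb(x_0,Y)$ are convex subsets of $\mathbf{R}^n$. (B3) (non-negative cross-curvature) $$\frac{\partial^4}{\partial s^2\partial t^2}\Big|_{(s,t)=(0,0)}b(x(s),y(t))\ge 0$$ for each curve $t\in[-1,1]\mapsto (D_yb(x(t),y(0)),D_xb(x(0),y(t)))$ forming an affinely parameterized line segment in $\overline{X}_{y(0)}\times\overline{Y}_{x(0)}\subset\mathbf{R}^{2n}$, where $\overline{X}_{y}=D_yb(\overline{X},y)$ and $\overline{Y}_{x}=D_xb(x,\overline{Y})$. For $x\in\overline{X}$ and $q\in\overline{Y}_x$, $y_b(x,q)\in\overline{Y}$ denotes the unique solution of $D_xb(x,y_b(x,q))=q$. Transforms: for $v:\overline{Y}\to\mathbf{R}\cup\{+\infty\}$ and $u:\overline{X}\to\mathbf{R}$ put $v^b(x)=\sup_{y\in\overline{Y}}b(x,y)-v(y)$ and $u^{b^*}(y)=\sup_{x\in\overline{X}}b(x,y)-u(x)$.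 A function $u:\overline{X}\to\mathbf{R}$ is $b$-convex if $u=(u^{b^*})^b$; a function $v:\overline{Y}\to\mathbf{R}$ is $b^*$-convex if $v=(v^b)^{b^*}$. $\mathcal{V}^b_{\overline{Y}}$ denotes the set of $b$-convex functions. A point $y_\emptyset\in\overline{Y}$ (the null product) is fixed; $b(x,y_\emptyset)-c(y_\emptyset)$ is the reservation utility, and $\mathcal{U}_0:=\{u\in\mathcal{V}^b_{\overline{Y}}\mid u(\cdot)\ge b(\cdot,y_\emptyset)-c(y_\emptyset)\}$. The principal's net losses are $$L(u):=\int_X\big[u(x)+c(y_b(x,Du(x)))-b(x,y_b(x,Du(x)))\big]\,d\mu(x);$$ a $b$-convex function is differentiable Lebesgue-a.e., so the integrand is defined $\mu$-a.e. $f\in W^{1,1}$ means that $f$ and its distributional derivative $Df$ are given by Lebesgue integrable densities. The boundary of a convex domain in $\mathbf{R}^n$ has an $n-1$ dimensional facet if it contains a convex set of dimension $n-1$ (a flat side, contained in a supporting hyperplane); in dimension $n=1$ the endpoints of an interval count as $0$-dimensional facets, so the hypothesis is never satisfied when $n=1$. *)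

theory Defs
  imports "HOL-Analysis.Analysis" "HOL-Probability.Probability_Measure"
begin

section \<open>Differentiability up to the boundary\<close>

text \<open>
  For an open set \<open>S\<close>, membership in \<open>C\<^sup>k(closure S)\<close> means: the function is \<open>C\<^sup>k\<close> on \<open>S\<close> and all
  its partial derivatives of order at most \<open>k\<close> extend continuously from \<open>S\<close> to the closure of \<open>S\<close>.
  Iterated directional derivatives in arbitrary directions \<open>v\<close> stand for the partial derivatives.
  For \<open>S = UNIV\<close> the predicate \<open>extends_Ck k UNIV f\<close> is ordinary \<open>C\<^sup>k\<close> smoothness.
\<close>

primrec extends_Ck ::
  "nat \<Rightarrow> 'a::real_normed_vector set \<Rightarrow> ('a \<Rightarrow> 'b::real_normed_vector) \<Rightarrow> bool" where
  "extends_Ck 0 S f \<longleftrightarrow> (\<exists>g. continuous_on (closure S) g \<and> (\<forall>x\<in>S. g x = f x))"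
| "extends_Ck (Suc k) S f \<longleftrightarrow>
     (\<exists>g. continuous_on (closure S) g \<and> (\<forall>x\<in>S. g x = f x)) \<and>
     (\<forall>x\<in>S. f differentiable (at x)) \<and>
     (\<forall>v. extends_Ck k S (\<lambda>x. frechet_derivative f (at x) v))"

definition Ck_closure ::
  "nat \<Rightarrow> 'a::real_normed_vector set \<Rightarrow> ('a \<Rightarrow> 'b::real_normed_vector) \<Rightarrow> bool" where
  "Ck_closure k S f \<longleftrightarrow> continuous_on (closure S) f \<and> extends_Ck k S f"

text \<open>
  \<open>F\<close> is a diffeomorphism of \<open>closure S\<close> onto its range. Here \<open>S\<close> is open and bounded, so for
  injective continuous \<open>F\<close> the image \<open>F ` S\<close> is open (invariance of domain) and its closure is the
  range \<open>F ` closure S\<close>.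
\<close>

definition diffeo_onto_range :: "'a::euclidean_space set \<Rightarrow> ('a \<Rightarrow> 'a) \<Rightarrow> bool" where
  "diffeo_onto_range S F \<longleftrightarrow>
     inj_on F (closure S) \<and> Ck_closure 1 S F \<and>
     Ck_closure 1 (F ` S) (inv_into (closure S) F)"

definition grad :: "('a::real_inner \<Rightarrow> real) \<Rightarrow> 'a \<Rightarrow> 'a" where
  "grad f x = (THE D. GDERIV f x :> D)"


section \<open>The preference function\<close>

text \<open>
  On \<open>closure X \<times> closure Y\<close> the partial gradients of \<open>b\<close> are the continuous extensions of the partial
  gradients on \<open>X \<times> Y\<close>.
\<close>

definition Dx :: "(real^'n) set \<Rightarrow> (real^'n) set \<Rightarrow> (real^'n \<Rightarrow> real^'n \<Rightarrow> real) \<Rightarrow>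
    real^'n \<Rightarrow> real^'n \<Rightarrow> real^'n" where
  "Dx X Y b x y = Lim (at (x, y) within X \<times> Y) (\<lambda>(x', y'). grad (\<lambda>z. b z y') x')"

definition Dy :: "(real^'n) set \<Rightarrow> (real^'n) set \<Rightarrow> (real^'n \<Rightarrow> real^'n \<Rightarrow> real) \<Rightarrow>
    real^'n \<Rightarrow> real^'n \<Rightarrow> real^'n" where
  "Dy X Y b x y = Lim (at (x, y) within X \<times> Y) (\<lambda>(x', y'). grad (\<lambda>z. b x' z) y')"

definition B0 :: "(real^'n) set \<Rightarrow> (real^'n) set \<Rightarrow> (real^'n \<Rightarrow> real^'n \<Rightarrow> real) \<Rightarrow> bool" where
  "B0 X Y b \<longleftrightarrow> open X \<and> bounded X \<and> open Y \<and> bounded Y \<and>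
     Ck_closure 4 (X \<times> Y) (\<lambda>(x, y). b x y)"

definition bi_twist :: "(real^'n) set \<Rightarrow> (real^'n) set \<Rightarrow> (real^'n \<Rightarrow> real^'n \<Rightarrow> real) \<Rightarrow> bool" where
  "bi_twist X Y b \<longleftrightarrow> (\<forall>x0\<in>closure X. \<forall>y0\<in>closure Y.
     diffeo_onto_range Y (\<lambda>y. Dx X Y b x0 y) \<and> diffeo_onto_range X (\<lambda>x. Dy X Y b x y0))"

definition bi_convex :: "(real^'n) set \<Rightarrow> (real^'n) set \<Rightarrow> (real^'n \<Rightarrow> real^'n \<Rightarrow> real) \<Rightarrow> bool" where
  "bi_convex X Y b \<longleftrightarrow> (\<forall>x0\<in>closure X. \<forall>y0\<in>closure Y.
     convex ((\<lambda>x. Dy X Y b x y0) ` X) \<and> convex ((\<lambda>y. Dx X Y b x0 y) ` Y))"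

definition nonneg_cross_curvature ::
    "(real^'n) set \<Rightarrow> (real^'n) set \<Rightarrow> (real^'n \<Rightarrow> real^'n \<Rightarrow> real) \<Rightarrow> bool" where
  "nonneg_cross_curvature X Y b \<longleftrightarrow> (\<forall>\<xi> \<eta>.
     (\<forall>t\<in>{-1..1}. \<xi> t \<in> closure X \<and> \<eta> t \<in> closure Y) \<and>
     (\<exists>p v. \<forall>t\<in>{-1..1}. (Dy X Y b (\<xi> t) (\<eta> 0), Dx X Y b (\<xi> 0) (\<eta> t)) = p + t *\<^sub>R v)
     \<longrightarrow> 0 \<le> (deriv ^^ 2) (\<lambda>s::real. (deriv ^^ 2) (\<lambda>t::real. b (\<xi> s) (\<eta> t)) 0) 0)"

definition y_b :: "(real^'n) set \<Rightarrow> (real^'n) set \<Rightarrow> (real^'n \<Rightarrow> real^'n \<Rightarrow> real) \<Rightarrow>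
    real^'n \<Rightarrow> real^'n \<Rightarrow> real^'n" where
  "y_b X Y b x q = (THE y. y \<in> closure Y \<and> Dx X Y b x y = q)"


section \<open>Transforms and generalized convexity\<close>

definition b_transform :: "(real^'n) set \<Rightarrow> (real^'n \<Rightarrow> real^'n \<Rightarrow> real) \<Rightarrow>
    (real^'n \<Rightarrow> ereal) \<Rightarrow> real^'n \<Rightarrow> ereal" where
  "b_transform Y b v x = (SUP y\<in>closure Y. ereal (b x y) - v y)"

definition bstar_transform :: "(real^'n) set \<Rightarrow> (real^'n \<Rightarrow> real^'n \<Rightarrow> real) \<Rightarrow>
    (real^'n \<Rightarrow> ereal) \<Rightarrow> real^'n \<Rightarrow> ereal" where
  "bstar_transform X b u y = (SUP x\<in>closure X. ereal (b x y) - u x)"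

text \<open>
  Functions on \<open>closure X\<close> or \<open>closure Y\<close> are total functions whose values elsewhere are irrelevant.
\<close>

definition b_convex :: "(real^'n) set \<Rightarrow> (real^'n) set \<Rightarrow> (real^'n \<Rightarrow> real^'n \<Rightarrow> real) \<Rightarrow>
    (real^'n \<Rightarrow> real) \<Rightarrow> bool" where
  "b_convex X Y b u \<longleftrightarrow> (\<forall>x\<in>closure X.
     ereal (u x) = b_transform Y b (bstar_transform X b (\<lambda>x. ereal (u x))) x)"

definition bstar_convex :: "(real^'n) set \<Rightarrow> (real^'n) set \<Rightarrow> (real^'n \<Rightarrow> real^'n \<Rightarrow> real) \<Rightarrow>
    (real^'n \<Rightarrow> real) \<Rightarrow> bool" where
  "bstar_convex X Y b v \<longleftrightarrow> (\<forall>y\<in>closure Y.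
     ereal (v y) = bstar_transform X b (b_transform Y b (\<lambda>y. ereal (v y))) y)"


section \<open>The principal's problem\<close>

definition admissible_utilities :: "(real^'n) set \<Rightarrow> (real^'n) set \<Rightarrow>
    (real^'n \<Rightarrow> real^'n \<Rightarrow> real) \<Rightarrow> (real^'n \<Rightarrow> real) \<Rightarrow> real^'n \<Rightarrow> (real^'n \<Rightarrow> real) set" where
  "admissible_utilities X Y b c y0 =
     {u. b_convex X Y b u \<and> (\<forall>x\<in>closure X. u x \<ge> b x y0 - c y0)}"

definition net_losses :: "(real^'n) set \<Rightarrow> (real^'n) set \<Rightarrow> (real^'n \<Rightarrow> real^'n \<Rightarrow> real) \<Rightarrow>
    (real^'n \<Rightarrow> real) \<Rightarrow> (real^'n) measure \<Rightarrow> (real^'n \<Rightarrow> real) \<Rightarrow> real" where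
  "net_losses X Y b c \<mu> u =
     (LINT x:X|\<mu>. u x + c (y_b X Y b x (grad u x)) - b x (y_b X Y b x (grad u x)))"

definition exclusion_set :: "(real^'n) set \<Rightarrow> (real^'n \<Rightarrow> real^'n \<Rightarrow> real) \<Rightarrow>
    (real^'n \<Rightarrow> real) \<Rightarrow> real^'n \<Rightarrow> (real^'n \<Rightarrow> real) \<Rightarrow> (real^'n) set" where
  "exclusion_set X b c y0 u = {x \<in> closure X. u x = b x y0 - c y0}"


section \<open>Densities in \<open>W\<^sup>1\<^sup>,\<^sup>1\<close> and facets\<close>

definition test_function :: "'a::euclidean_space set \<Rightarrow> ('a \<Rightarrow> real) \<Rightarrow> bool" where
  "test_function S \<phi> \<longleftrightarrow> (\<forall>k. extends_Ck k UNIV \<phi>) \<and>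
     compact (closure {x. \<phi> x \<noteq> 0}) \<and> closure {x. \<phi> x \<noteq> 0} \<subseteq> S"

text \<open>The vector field \<open>g\<close> is the distributional derivative of \<open>f\<close> on the open set \<open>S\<close>.\<close>

definition W11 :: "'a::euclidean_space set \<Rightarrow> ('a \<Rightarrow> real) \<Rightarrow> bool" where
  "W11 S f \<longleftrightarrow> integrable (lebesgue_on S) f \<and>
     (\<exists>g::'a \<Rightarrow> 'a. integrable (lebesgue_on S) g \<and>
       (\<forall>\<phi>. test_function S \<phi> \<longrightarrow> (\<forall>i\<in>Basis.
         (LINT x|lebesgue_on S. f x * frechet_derivative \<phi> (at x) i) =
         - (LINT x|lebesgue_on S. (g x \<bullet> i) * \<phi> x))))"

definition density_on_closure :: "'a::euclidean_space set \<Rightarrow> ('a \<Rightarrow> real) \<Rightarrow> 'a measure" where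
  "density_on_closure X f = density (lebesgue_on (closure X)) (\<lambda>x. ennreal (f x))"

text \<open>
  A flat side of a convex domain in \<open>real^'n\<close>. If \<open>CARD('n) = 1\<close>, a single boundary point qualifies,
  since it has affine dimension \<open>0\<close>.
\<close>

definition has_boundary_facet :: "(real^'n) set \<Rightarrow> bool" where
  "has_boundary_facet S \<longleftrightarrow>
     (\<exists>K. convex K \<and> K \<subseteq> frontier S \<and> aff_dim K = int CARD('n) - 1)"

end

theory Submission
  imports Defs
begin

text \<open>
  Subtract the reservation utility from \<open>u\<close> to get \<open>v = u - (b(\<cdot>, y0) - c(y0)) \<ge> 0\<close>. By (B3), \<open>v\<close> is
  convex in the coordinate \<open>p = D\<^sub>y b(x, y0)\<close>, and since \<open>c\<close> is \<open>b\<^sup>*\<close>-convex there is \<open>a \<in> closure X\<close> with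
  \<open>c(y) \<ge> c(y0) + b(a, y) - b(a, y0)\<close> for all \<open>y\<close>. Compare \<open>u\<close> with the competitor
  \<open>max (u - \<epsilon>) (b(\<cdot>, y0) - c(y0))\<close>, and put \<open>z\<^sub>\<epsilon> = 1 - min v \<epsilon> / \<epsilon>\<close>. Convexity of \<open>x \<mapsto> b(x, y) - b(x, y0)\<close>
  in \<open>p\<close> bounds the loss integrand of \<open>u\<close> from below, and minimality of \<open>u\<close> gives
  \<open>1 \<le> \<integral> f z\<^sub>\<epsilon> - \<integral> f V \<cdot> \<nabla>z\<^sub>\<epsilon>\<close>, where \<open>V\<close> generates the dilations about \<open>a\<close> in the coordinate \<open>p\<close>.

  Integrating by parts against \<open>f \<in> W\<^sup>1\<^sup>,\<^sup>1\<close> moves the derivative to \<open>f V\<close>. The boundary term has a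
  favourable sign, because the dilation field points outwards on the boundary of a convex set; cutting off
  by the concave function "distance to the complement" makes this precise without boundary regularity.
  Hence \<open>1 \<le> \<integral> Q z\<^sub>\<epsilon>\<close> with \<open>Q\<close> integrable and controlled by \<open>f\<close> and its weak gradient. As
  \<open>\<epsilon> \<rightarrow> 0\<close>, \<open>z\<^sub>\<epsilon>\<close> tends to the indicator of the exclusion set, whose boundary is negligible by convexity.
  If \<open>f\<close> vanished almost everywhere on its interior, so would the weak gradient and \<open>Q\<close>, giving \<open>1 \<le> 0\<close>.
\<close>


section \<open>Smooth test functions\<close>

text \<open>The competitor is a price rise: every price goes up by \<epsilon>, while the null
  product stays on offer at \<open>c y0\<close>. Agents who keep their product pay \<epsilon> more,
  so the gain is \<epsilon> times the total mass, which is the \<open>1\<close> in the inequality;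
  only agents with \<open>v < \<epsilon>\<close> can offset it. The gradient of \<open>z\<close> is
  of order 1/\<epsilon>, so no limit can be taken until integration by parts leaves the bounded
  \<open>z\<close> alone. Regularity shapes the rest. The weak derivative of \<open>f\<close> is
  tested against smooth functions of \<open>x\<close>, convexity lives in the coordinate
  \<open>p\<close>, and the field \<open>V z\<close> times a cutoff is merely Lipschitz along
  segments and differentiable almost everywhere. So the weak formula is extended to Lipschitz
  functions by translations, and almost everywhere differentiability is derived for convex functions
  and carried back to \<open>x\<close>. Both \<open>y0\<close> and \<open>a\<close> may be boundary
  points: derivatives of \<open>b\<close> are therefore continued to the closure, and
  \<open>a\<close> is replaced by a point of \<open>X\<close> whose distance in the coordinate
  \<open>p\<close> is below \<epsilon>^2, an error that vanishes even after division by
  \<epsilon>.\<close>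

definition flat_fun :: "nat \<Rightarrow> real \<Rightarrow> real" where
  "flat_fun m t = (if t > 0 then exp (- inverse t) * inverse t ^ m else 0)"

lemma flat_fun_pos: "t > 0 \<Longrightarrow> flat_fun m t > 0"
  and flat_fun_eq_0: "t \<le> 0 \<Longrightarrow> flat_fun m t = 0"
  by (auto simp: flat_fun_def)

lemma flat_fun_tendsto_0: "((\<lambda>t. flat_fun m t) \<longlongrightarrow> 0) (at 0)"
proof -
  have 1: "((\<lambda>t::real. exp (- inverse t) * inverse t ^ m) \<longlongrightarrow> 0) (at_right 0)"
  proof -
    have "((\<lambda>s::real. s ^ m / exp s) \<longlongrightarrow> 0) at_top" by (rule tendsto_power_div_exp_0)
    then have "((\<lambda>t::real. inverse t ^ m / exp (inverse t)) \<longlongrightarrow> 0) (at_right 0)"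
      by (rule filterlim_compose[OF _ filterlim_inverse_at_top_right])
    then show ?thesis by (simp add: exp_minus divide_inverse mult.commute)
  qed
  have r: "(flat_fun m \<longlongrightarrow> 0) (at_right 0)"
    by (rule Lim_transform_eventually[OF 1]) (auto simp: eventually_at_right_field flat_fun_def intro!: exI[of _ 1])
  have l: "(flat_fun m \<longlongrightarrow> 0) (at_left 0)"
    by (rule Lim_transform_eventually[OF tendsto_const]) (auto simp: eventually_at_left_field flat_fun_def intro!: exI[of _ "-1"])
  show ?thesis using r l by (simp add: filterlim_split_at)
qed

lemma flat_fun_has_derivative:
  "(flat_fun m has_real_derivative flat_fun (m + 2) t - real m * flat_fun (Suc m) t) (at t)"
proof -
  consider "t > 0" | "t < 0" | "t = 0" by linarith
  then show ?thesis
  proof cases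
    case 1
    have "((\<lambda>t. exp (- inverse t) * inverse t ^ m) has_real_derivative flat_fun (m + 2) t - real m * flat_fun (Suc m) t) (at t)"
    proof (cases m)
      case 0
      then show ?thesis using 1
        by (auto intro!: derivative_eq_intros simp: flat_fun_def power2_eq_square)
    next
      case (Suc k)
      have "((\<lambda>t. exp (- inverse t) * inverse t ^ Suc k) has_real_derivative
          exp (- inverse t) * (inverse t * inverse t) * inverse t ^ Suc k
          + exp (- inverse t) * (real (Suc k) * inverse t ^ k * (- (inverse t * inverse t)))) (at t)"
        using 1 by (auto intro!: derivative_eq_intros simp: power2_eq_square algebra_simps simp del: inverse_mult_distrib power_Suc)
      then show ?thesis using 1 Suc by (simp add: flat_fun_def algebra_simps)
    qed
    then show ?thesis
      by (rule has_field_derivative_transform_within_open[where S="{0<..}"]) (use 1 in \<open>auto simp: flat_fun_def\<close>)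
  next
    case 2
    have "((\<lambda>t::real. 0) has_real_derivative 0) (at t)" by simp
    then have "(flat_fun m has_real_derivative 0) (at t)"
      by (rule has_field_derivative_transform_within_open[where S="{..<0}"]) (use 2 in \<open>auto simp: flat_fun_def\<close>)
    then show ?thesis using 2 by (simp add: flat_fun_def)
  next
    case 3
    \<comment> \<open>The difference quotient at 0 of the member with index \<open>m\<close> is the
      member with index \<open>Suc m\<close>, so the limit computed before is the
      derivative.\<close>
    have eq: "flat_fun (Suc m) h = (flat_fun m (0 + h) - flat_fun m 0) / h" for h
      by (auto simp: flat_fun_def field_simps)
    have "(flat_fun m has_real_derivative 0) (at 0)"
      unfolding DERIV_def using flat_fun_tendsto_0[of "Suc m"] unfolding eq .
    then show ?thesis using 3 by (simp add: flat_fun_def)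
  qed
qed

text \<open>The class is closed under directional derivatives, so all its members are smooth.\<close>

inductive smooth_expr :: "('a::euclidean_space \<Rightarrow> real) \<Rightarrow> bool" where
  const: "smooth_expr (\<lambda>x. k)"
| inner: "smooth_expr (\<lambda>x. x \<bullet> v)"
| add: "smooth_expr f \<Longrightarrow> smooth_expr g \<Longrightarrow> smooth_expr (\<lambda>x. f x + g x)"
| mult: "smooth_expr f \<Longrightarrow> smooth_expr g \<Longrightarrow> smooth_expr (\<lambda>x. f x * g x)"
| flat: "smooth_expr f \<Longrightarrow> smooth_expr (\<lambda>x. flat_fun m (f x))"

lemma smooth_expr_derivative:
  assumes "smooth_expr f"
  shows "\<exists>D. (\<forall>x. (f has_derivative (D x)) (at x)) \<and> (\<forall>v. smooth_expr (\<lambda>x. D x v))"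
  using assms
proof induction
  case (const k)
  show ?case by (intro exI[of _ "\<lambda>x v. 0"]) (auto intro: smooth_expr.const)
next
  case (inner v)
  show ?case by (intro exI[of _ "\<lambda>x w. w \<bullet> v"]) (auto intro!: smooth_expr.const derivative_eq_intros)
next
  case (add f g)
  then obtain D E where "\<And>x. (f has_derivative D x) (at x)" "\<And>v. smooth_expr (\<lambda>x. D x v)"
    "\<And>x. (g has_derivative E x) (at x)" "\<And>v. smooth_expr (\<lambda>x. E x v)" by blast
  then show ?case by (intro exI[of _ "\<lambda>x v. D x v + E x v"]) (auto intro!: smooth_expr.add derivative_intros)
next
  case (mult f g)
  then obtain D E where "\<And>x. (f has_derivative D x) (at x)" "\<And>v. smooth_expr (\<lambda>x. D x v)"
    "\<And>x. (g has_derivative E x) (at x)" "\<And>v. smooth_expr (\<lambda>x. E x v)" by blast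
  then show ?case using mult.hyps
    by (intro exI[of _ "\<lambda>x v. f x * E x v + D x v * g x"])
       (auto intro!: smooth_expr.add smooth_expr.mult derivative_intros)
next
  case (flat f m)
  then obtain D where D: "\<And>x. (f has_derivative D x) (at x)" "\<And>v. smooth_expr (\<lambda>x. D x v)" by blast
  have 1: "((\<lambda>x. flat_fun m (f x)) has_derivative
     (\<lambda>v. (flat_fun (m + 2) (f x) + (- real m) * flat_fun (Suc m) (f x)) * D x v)) (at x)" for x
    using has_derivative_compose[OF D(1) flat_fun_has_derivative[THEN has_field_derivative_imp_has_derivative]]
    by (simp add: mult.commute)
  have 2: "smooth_expr (\<lambda>x. (flat_fun (m + 2) (f x) + (- real m) * flat_fun (Suc m) (f x)) * D x v)" for v
    by (intro smooth_expr.add smooth_expr.mult smooth_expr.const smooth_expr.flat flat.hyps D(2))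
  show ?case
  proof (rule exI, rule conjI; rule allI)
    fix x show "((\<lambda>x. flat_fun m (f x)) has_derivative
     (\<lambda>x v. (flat_fun (m + 2) (f x) + (- real m) * flat_fun (Suc m) (f x)) * D x v) x) (at x)" by (rule 1)
  next
    fix v show "smooth_expr (\<lambda>x. (\<lambda>x v. (flat_fun (m + 2) (f x) + (- real m) * flat_fun (Suc m) (f x)) * D x v) x v)" by (rule 2)
  qed
qed

lemma smooth_expr_extends_Ck: "smooth_expr f \<Longrightarrow> extends_Ck k UNIV f"
proof (induction k arbitrary: f)
  case 0
  then obtain D where "\<And>x. (f has_derivative D x) (at x)" using smooth_expr_derivative by blast
  then have "continuous_on UNIV f"
    by (meson continuous_at_imp_continuous_on has_derivative_continuous)
  then show ?case by auto
next
  case (Suc k)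
  then obtain D where D: "\<And>x. (f has_derivative D x) (at x)" "\<And>v. smooth_expr (\<lambda>x. D x v)"
    using smooth_expr_derivative by blast
  then have c: "continuous_on UNIV f"
    by (meson continuous_at_imp_continuous_on has_derivative_continuous)
  have "frechet_derivative f (at x) = D x" for x using frechet_derivative_at[OF D(1)] by simp
  then show ?case using Suc.IH D c by (auto simp: differentiable_def)
qed

lemma smooth_expr_sum: "(\<And>i. i \<in> I \<Longrightarrow> smooth_expr (f i)) \<Longrightarrow> smooth_expr (\<lambda>x. \<Sum>i\<in>I. f i x)"
  by (induction I rule: infinite_finite_induct) (auto intro: smooth_expr.const smooth_expr.add)

lemma smooth_expr_norm_diff: "smooth_expr (\<lambda>x. (norm (x - a))\<^sup>2)"
proof -
  have "(norm (x - a))\<^sup>2 = (\<Sum>i\<in>Basis. (x \<bullet> i + - (a \<bullet> i)) * (x \<bullet> i + - (a \<bullet> i)))" for x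
    unfolding power2_norm_eq_inner euclidean_inner[of "x - a" "x - a"] by (simp add: inner_diff_left)
  moreover have "smooth_expr (\<lambda>x. \<Sum>i\<in>Basis. (x \<bullet> i + - (a \<bullet> i)) * (x \<bullet> i + - (a \<bullet> i)))"
    by (intro smooth_expr_sum smooth_expr.intros)
  ultimately show ?thesis by simp
qed

lemma smooth_expr_real_polynomial:
  assumes "real_polynomial_function p" shows "smooth_expr p"
  using assms
proof induction
  case (linear f)
  then have "linear f" by (rule bounded_linear.linear)
  then have *: "f (\<Sum>i\<in>Basis. (x \<bullet> i) *\<^sub>R i) = (\<Sum>i\<in>Basis. (x \<bullet> i) * f i)" for x
    by (simp add: linear_sum linear_scale)
  have "f x = (\<Sum>i\<in>Basis. (x \<bullet> i) * f i)" for x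
    by (subst (1) euclidean_representation[of x, symmetric]) (rule *)
  then have eq: "f = (\<lambda>x. \<Sum>i\<in>Basis. (x \<bullet> i) * f i)" by (rule ext)
  have "smooth_expr (\<lambda>x. (x \<bullet> i) * f i)" for i
    by (rule smooth_expr.mult[OF smooth_expr.inner smooth_expr.const])
  then have "smooth_expr (\<lambda>x. \<Sum>i\<in>Basis. (x \<bullet> i) * f i)"
    by (rule smooth_expr_sum)
  then show ?case by (subst eq)
next
 case (const c) show ?case by (rule smooth_expr.const)
next
 case (add f g) then show ?case by (blast intro: smooth_expr.add)
next
 case (mult f g) then show ?case by (blast intro: smooth_expr.mult)
qed

text \<open>This replaces mollification. \<open>E\<close> is a smooth function that is positive on
  \<open>K\<close> and vanishes off a compact \<open>K'\<close> inside \<open>S\<close>; a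
  polynomial close to \<open>\<psi> / E\<close> on \<open>K'\<close>, multiplied by
  \<open>E\<close>, is smooth, has support in \<open>K'\<close> and is uniformly close to
  \<open>\<psi>\<close>.\<close>

lemma test_function_approx:
  fixes \<psi> :: "'a::euclidean_space \<Rightarrow> real"
  assumes S: "open S" and K: "compact K" "K \<subseteq> S" and c: "continuous_on UNIV \<psi>"
    and z: "\<And>x. x \<notin> K \<Longrightarrow> \<psi> x = 0" and e: "e > 0"
  obtains \<phi> where "test_function S \<phi>" "\<And>x. \<bar>\<phi> x - \<psi> x\<bar> < e"
proof -
  have "\<exists>r>0. cball x r \<subseteq> S" if "x \<in> K" for x
    using S K that open_contains_cball by blast
  then obtain r where r: "\<And>x. x \<in> K \<Longrightarrow> r x > 0 \<and> cball x (r x) \<subseteq> S" by metis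
  have "K \<subseteq> (\<Union>x\<in>K. ball x (r x))" using r by force
  then obtain C where C: "C \<subseteq> K" "finite C" "K \<subseteq> (\<Union>x\<in>C. ball x (r x))"
    using compactE_image[OF K(1), of K "\<lambda>x. ball x (r x)"] by auto
  define E where "E x = (\<Sum>a\<in>C. flat_fun 0 ((r a)\<^sup>2 + (- 1) * (norm (x - a))\<^sup>2))" for x
  define K' where "K' = (\<Union>x\<in>C. cball x (r x))"
  have K': "compact K'" "K' \<subseteq> S" using C r by (auto simp: K'_def)
  have sE: "smooth_expr E" unfolding E_def
    by (intro smooth_expr_sum smooth_expr.intros smooth_expr_norm_diff)
  have Epos: "E x > 0" if "x \<in> K" for x
  proof -
    obtain a where a: "a \<in> C" "x \<in> ball a (r a)" using C(3) \<open>x \<in> K\<close> by blast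
    then have "(norm (x - a))\<^sup>2 < (r a)\<^sup>2"
      by (intro power_strict_mono) (auto simp: dist_norm norm_minus_commute)
    then have "flat_fun 0 ((r a)\<^sup>2 + (- 1) * (norm (x - a))\<^sup>2) > 0" by (intro flat_fun_pos) simp
    then show ?thesis unfolding E_def using a C
      by (intro sum_pos2[of _ a]) (auto simp: flat_fun_def)
  qed
  have E0: "E x = 0" if "x \<notin> K'" for x unfolding E_def
  proof (intro sum.neutral ballI flat_fun_eq_0)
    fix a assume "a \<in> C"
    then have "r a < norm (x - a)" "r a > 0" using that r C by (auto simp: K'_def dist_norm norm_minus_commute)
    then have "(r a)\<^sup>2 \<le> (norm (x - a))\<^sup>2" by (intro power_mono) auto
    then show "(r a)\<^sup>2 + (- 1) * (norm (x - a))\<^sup>2 \<le> 0" by simp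
  qed
  have cE: "continuous_on UNIV E" using smooth_expr_extends_Ck[OF sE, of 0] by (auto cong: continuous_on_cong)
  define h where "h x = \<psi> x / E x" for x
  have ch: "continuous_on UNIV h"
  proof -
    \<comment> \<open>Where \<open>E\<close> vanishes \<open>\<psi>\<close> vanishes as well, and
      there division by zero yields the right value 0. The two open sets overlap and cover the space
      because \<open>E\<close> is positive on \<open>K\<close>.\<close>
    have 1: "continuous_on {x. E x \<noteq> 0} h" unfolding h_def
      by (intro continuous_intros continuous_on_subset[OF c] continuous_on_subset[OF cE]) auto
    have 2: "continuous_on (- K) h"
      by (rule continuous_on_eq[of _ "\<lambda>x. 0"]) (auto simp: h_def z)
    have o1: "open {x. E x \<noteq> 0}"
      using cE by (intro open_Collect_neq) auto
    have o2: "open (- K)" using K(1) compact_imp_closed by blast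
    have "continuous_on ({x. E x \<noteq> 0} \<union> - K) h"
      by (rule continuous_on_open_Un[OF o1 o2 1 2])
    moreover have "{x. E x \<noteq> 0} \<union> - K = UNIV" using Epos by force
    ultimately show ?thesis by simp
  qed
  obtain M where M: "M > 0" "\<And>x. x \<in> K' \<Longrightarrow> \<bar>E x\<bar> \<le> M"
  proof -
    have "compact (E ` K')" by (intro compact_continuous_image continuous_on_subset[OF cE] K') auto
    then have "bounded (E ` K')" by (rule compact_imp_bounded)
    then show ?thesis using that unfolding bounded_pos by (auto simp: real_norm_def)
  qed
  obtain p where p: "real_polynomial_function p" "\<And>x. x \<in> K' \<Longrightarrow> \<bar>h x - p x\<bar> < e / M"
    using Stone_Weierstrass_real_polynomial_function[OF K'(1) continuous_on_subset[OF ch subset_UNIV], of "e / M"] e M by auto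
  define \<phi> where "\<phi> x = E x * p x" for x
  have psi: "\<psi> x = E x * h x" for x
  proof (cases "E x = 0")
    case True
    then have "x \<notin> K" using Epos by force
    then show ?thesis using True z by simp
  qed (simp add: h_def)
  have sup: "closure {x. \<phi> x \<noteq> 0} \<subseteq> K'"
    using E0 K'(1) by (intro closure_minimal compact_imp_closed) (auto simp: \<phi>_def)
  have "test_function S \<phi>"
    unfolding test_function_def
  proof (intro conjI allI)
    show "extends_Ck k UNIV \<phi>" for k
      unfolding \<phi>_def by (intro smooth_expr_extends_Ck smooth_expr.mult sE smooth_expr_real_polynomial p)
    show "compact (closure {x. \<phi> x \<noteq> 0})"
      using compact_Int_closed[OF K'(1) closed_closure, of "{x. \<phi> x \<noteq> 0}"] sup by (simp add: Int_absorb1)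
    show "closure {x. \<phi> x \<noteq> 0} \<subseteq> S" using sup K' by blast
  qed
  moreover have "\<bar>\<phi> x - \<psi> x\<bar> < e" for x
  proof (cases "x \<in> K'")
    case True
    have "\<bar>\<phi> x - \<psi> x\<bar> = \<bar>E x\<bar> * \<bar>h x - p x\<bar>"
      by (simp add: psi \<phi>_def abs_mult[symmetric] algebra_simps abs_minus_commute)
    also have "\<dots> \<le> M * \<bar>h x - p x\<bar>" using M(2)[OF True] by (intro mult_right_mono) auto
    also have "\<dots> < M * (e / M)" using p(2)[OF True] M by (intro mult_strict_left_mono) auto
    finally show ?thesis using M by simp
  next
    case False
    then show ?thesis using E0 e by (simp add: psi \<phi>_def)
  qed
  ultimately show ?thesis using that by blast
qed


section \<open>Weak derivatives tested against Lipschitz functions\<close>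

lemma borel_measurable_lebesgue_AE:
  fixes f g :: "'a::euclidean_space \<Rightarrow> real"
  assumes f: "f \<in> borel_measurable lebesgue" and eq: "AE x in lebesgue. f x = g x"
  shows "g \<in> borel_measurable lebesgue"
proof (rule borel_measurableI)
  fix S :: "real set" assume S: "open S"
  have "f -` S \<inter> space lebesgue \<in> sets lebesgue" using f S by (intro measurable_sets) auto
  then show "g -` S \<inter> space lebesgue \<in> sets lebesgue"
    by (rule completion.in_sets_AE[rotated]) (use eq in \<open>auto elim: eventually_mono\<close>)
qed

lemma borel_measurable_lebesgue_AE_LIMSEQ:
  fixes f :: "nat \<Rightarrow> 'a::euclidean_space \<Rightarrow> real"
  assumes f: "\<And>n. f n \<in> borel_measurable lebesgue" and lim: "AE x in lebesgue. (\<lambda>n. f n x) \<longlonglongrightarrow> g x"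
  shows "g \<in> borel_measurable lebesgue"
proof (rule borel_measurable_lebesgue_AE)
  show "(\<lambda>x. lim (\<lambda>n. f n x)) \<in> borel_measurable lebesgue" using f by (rule borel_measurable_lim_metric)
  show "AE x in lebesgue. lim (\<lambda>n. f n x) = g x" using lim by eventually_elim (rule limI)
qed

lemma integrable_mult_bounded:
  fixes f h :: "'a \<Rightarrow> real"
  assumes f: "integrable M f" and h: "h \<in> borel_measurable M" and B: "AE x in M. f x \<noteq> 0 \<longrightarrow> \<bar>h x\<bar> \<le> B"
  shows "integrable M (\<lambda>x. f x * h x)" "\<bar>LINT x|M. f x * h x\<bar> \<le> B * (LINT x|M. \<bar>f x\<bar>)"
proof -
  have bd: "AE x in M. \<bar>f x * h x\<bar> \<le> B * \<bar>f x\<bar>"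
    using B by eventually_elim (metis abs_ge_zero abs_mult abs_zero mult.commute mult_left_mono mult_zero_left order_refl)
  show i: "integrable M (\<lambda>x. f x * h x)"
    by (rule Bochner_Integration.integrable_bound[of M "\<lambda>x. B * \<bar>f x\<bar>"]) (use f h bd in \<open>auto elim!: eventually_mono\<close>)
  have "\<bar>LINT x|M. f x * h x\<bar> \<le> (LINT x|M. \<bar>f x * h x\<bar>)" by (rule integral_abs_bound)
  also have "\<dots> \<le> (LINT x|M. B * \<bar>f x\<bar>)"
    by (rule integral_mono_AE) (use f i bd in auto)
  finally show "\<bar>LINT x|M. f x * h x\<bar> \<le> B * (LINT x|M. \<bar>f x\<bar>)" by simp
qed

text \<open>Bound and limit are asked for only where \<open>f\<close> is nonzero. Since
  \<open>f\<close> will be an extension by zero, the factors may behave arbitrarily outside its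
  domain; this is also why the product \<open>f x * k x\<close>, rather than \<open>k\<close>, is
  shown measurable.\<close>

lemma integral_dominated_mult:
  fixes f :: "'a::euclidean_space \<Rightarrow> real"
  assumes f: "integrable lebesgue f" and h: "\<And>n. h n \<in> borel_measurable lebesgue"
    and B: "\<And>n. AE x in lebesgue. f x \<noteq> 0 \<longrightarrow> \<bar>h n x\<bar> \<le> B"
    and lim: "AE x in lebesgue. f x \<noteq> 0 \<longrightarrow> (\<lambda>n. h n x) \<longlonglongrightarrow> k x"
  shows "integrable lebesgue (\<lambda>x. f x * k x)"
    "(\<lambda>n. LINT x|lebesgue. f x * h n x) \<longlonglongrightarrow> (LINT x|lebesgue. f x * k x)"
proof -
  have fm: "f \<in> borel_measurable lebesgue" using f by auto
  have lim': "AE x in lebesgue. (\<lambda>n. f x * h n x) \<longlonglongrightarrow> f x * k x"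
    using lim
  proof eventually_elim
    case (elim x)
    then show ?case by (cases "f x = 0") (auto intro: tendsto_mult)
  qed
  have km: "(\<lambda>x. f x * k x) \<in> borel_measurable lebesgue"
    by (rule borel_measurable_lebesgue_AE_LIMSEQ[OF _ lim']) (intro borel_measurable_times fm h)
  have bd: "AE x in lebesgue. norm (f x * h n x) \<le> B * \<bar>f x\<bar>" for n
    using B[of n] by eventually_elim
      (metis abs_ge_zero abs_mult abs_zero mult.commute mult_left_mono mult_zero_left order_refl real_norm_def)
  show "integrable lebesgue (\<lambda>x. f x * k x)"
    by (rule integrable_dominated_convergence[OF km _ _ lim' bd]) (use f fm h in auto)
  show "(\<lambda>n. LINT x|lebesgue. f x * h n x) \<longlonglongrightarrow> (LINT x|lebesgue. f x * k x)"
    by (rule integral_dominated_convergence[OF km _ _ lim' bd]) (use f fm h in auto)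
qed

text \<open>Here \<open>f\<close> and \<open>g\<close> are the extensions by zero of functions on \<open>S\<close>.\<close>

definition has_weak_derivative_on ::
  "('a::euclidean_space \<Rightarrow> real) \<Rightarrow> ('a \<Rightarrow> real) \<Rightarrow> 'a \<Rightarrow> 'a set \<Rightarrow> bool" where
  "has_weak_derivative_on f g e S \<longleftrightarrow>
     integrable lebesgue f \<and> integrable lebesgue g \<and> (\<forall>x. x \<notin> S \<longrightarrow> f x = 0 \<and> g x = 0) \<and>
     (\<forall>\<phi>. test_function S \<phi> \<longrightarrow>
        (LINT x|lebesgue. f x * frechet_derivative \<phi> (at x) e) = - (LINT x|lebesgue. g x * \<phi> x))"

lemma W11_weak_derivative:
  assumes W: "W11 S f" and S: "S \<in> sets lebesgue"
  obtains g :: "'a::euclidean_space \<Rightarrow> 'a"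
  where "\<And>i. i \<in> Basis \<Longrightarrow>
    has_weak_derivative_on (\<lambda>x. indicator S x * f x) (\<lambda>x. indicator S x * (g x \<bullet> i)) i S"
proof -
  obtain g where f: "integrable (lebesgue_on S) f" and g: "integrable (lebesgue_on S) g"
    and eq: "\<And>\<phi> i. test_function S \<phi> \<Longrightarrow> i \<in> Basis \<Longrightarrow>
         (LINT x|lebesgue_on S. f x * frechet_derivative \<phi> (at x) i) =
         - (LINT x|lebesgue_on S. (g x \<bullet> i) * \<phi> x)"
    using W unfolding W11_def by blast
  have S': "S \<inter> space lebesgue \<in> sets lebesgue" using S by simp
  have int: "(LINT x|lebesgue_on S. h x) = (LINT x|lebesgue. indicator S x * h x)" for h :: "'a \<Rightarrow> real"
    using integral_restrict_space[OF S', of h] by simp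
  have itg: "integrable (lebesgue_on S) h \<longleftrightarrow> integrable lebesgue (\<lambda>x. indicator S x * h x)" for h :: "'a \<Rightarrow> real"
    using integrable_restrict_space[OF S', of h] by simp
  have "has_weak_derivative_on (\<lambda>x. indicator S x * f x) (\<lambda>x. indicator S x * (g x \<bullet> i)) i S"
    if i: "i \<in> Basis" for i
    unfolding has_weak_derivative_on_def
  proof (intro conjI allI impI)
    show "integrable lebesgue (\<lambda>x. indicator S x * f x)" using f by (simp add: itg)
    have "integrable (lebesgue_on S) (\<lambda>x. g x \<bullet> i)" using g by auto
    then show "integrable lebesgue (\<lambda>x. indicator S x * (g x \<bullet> i))" by (simp add: itg)
  next
    fix \<phi> :: "'a \<Rightarrow> real" assume "test_function S \<phi>"
    from eq[OF this i]
    show "(LINT x|lebesgue. indicator S x * f x * frechet_derivative \<phi> (at x) i) =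
         - (LINT x|lebesgue. indicator S x * (g x \<bullet> i) * \<phi> x)"
      by (simp add: int mult.assoc)
  qed auto
  then show ?thesis using that by blast
qed

lemma extends_0_UNIV: "(\<exists>g. continuous_on UNIV g \<and> (\<forall>x. g x = f x)) \<longleftrightarrow> continuous_on UNIV f"
proof
  assume "\<exists>g. continuous_on UNIV g \<and> (\<forall>x. g x = f x)"
  then obtain g where "continuous_on UNIV g" "\<forall>x. g x = f x" by blast
  moreover from this have "g = f" by (intro ext) simp
  ultimately show "continuous_on UNIV f" by simp
qed blast

lemma extends_Ck_translate:
  fixes f :: "'a::real_normed_vector \<Rightarrow> 'b::real_normed_vector"
  shows "extends_Ck k UNIV f \<Longrightarrow> extends_Ck k UNIV (\<lambda>x. f (x + c))"
proof (induction k arbitrary: f)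
  case 0
  then have "continuous_on UNIV f" by (simp add: extends_0_UNIV)
  then have "continuous_on UNIV (\<lambda>x. f (x + c))"
    by (rule continuous_on_compose2[of UNIV f]) (auto intro!: continuous_intros)
  then show ?case by (simp add: extends_0_UNIV)
next
  case (Suc k)
  have d: "((\<lambda>x. f (x + c)) has_derivative frechet_derivative f (at (x + c))) (at x)" for x
  proof -
    have "(f has_derivative frechet_derivative f (at (x + c))) (at (x + c))"
      using Suc.prems by (auto simp: frechet_derivative_works[symmetric])
    moreover have "((\<lambda>x. x + c) has_derivative (\<lambda>h. h)) (at x)"
      by (auto intro!: derivative_eq_intros)
    ultimately show ?thesis by (rule has_derivative_compose[rotated])
  qed
  have fd: "frechet_derivative (\<lambda>x. f (x + c)) (at x) v = frechet_derivative f (at (x + c)) v" for x v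
    using frechet_derivative_at[OF d[of x]] by simp
  have c: "continuous_on UNIV (\<lambda>x. f (x + c))"
    using d by (meson continuous_at_imp_continuous_on has_derivative_continuous)
  show ?case
    unfolding extends_Ck.simps
  proof (intro conjI allI ballI)
    show "\<exists>g. continuous_on (closure UNIV) g \<and> (\<forall>x\<in>UNIV. g x = f (x + c))" using c by auto
    show "(\<lambda>x. f (x + c)) differentiable (at x)" for x using d differentiableI by blast
    show "extends_Ck k UNIV (\<lambda>x. frechet_derivative (\<lambda>x. f (x + c)) (at x) v)" for v
      unfolding fd using Suc.prems by (intro Suc.IH) simp
  qed
qed

lemma test_function_properties:
  assumes "test_function S (\<phi> :: 'a::euclidean_space \<Rightarrow> real)"
  shows "\<phi> differentiable (at x)" "continuous_on UNIV \<phi>"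
    "continuous_on UNIV (\<lambda>x. frechet_derivative \<phi> (at x) v)"
    "\<exists>B. \<forall>x. \<bar>frechet_derivative \<phi> (at x) v\<bar> \<le> B" "\<exists>B. \<forall>x. \<bar>\<phi> x\<bar> \<le> B"
proof -
  have e: "extends_Ck 1 UNIV \<phi>" and cs: "compact (closure {x. \<phi> x \<noteq> 0})"
    using assms unfolding test_function_def by blast+
  from e show d: "\<phi> differentiable (at x)" for x by simp
  from e show c: "continuous_on UNIV \<phi>" by (simp add: extends_0_UNIV)
  from e show c': "continuous_on UNIV (\<lambda>x. frechet_derivative \<phi> (at x) v)"
    by (simp add: extends_0_UNIV)
  have bd: "\<exists>B. \<forall>x. \<bar>h x\<bar> \<le> B" if h: "continuous_on UNIV h" "\<And>x. x \<notin> closure {x. \<phi> x \<noteq> 0} \<Longrightarrow> h x = 0"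
    for h :: "'a \<Rightarrow> real"
  proof -
    have "compact (h ` closure {x. \<phi> x \<noteq> 0})"
      by (intro compact_continuous_image continuous_on_subset[OF h(1)] cs) auto
    then have "bounded (h ` closure {x. \<phi> x \<noteq> 0})" by (rule compact_imp_bounded)
    then obtain B where "\<And>y. y \<in> h ` closure {x. \<phi> x \<noteq> 0} \<Longrightarrow> \<bar>y\<bar> \<le> B" "B > 0" unfolding bounded_pos by auto
    then have "\<bar>h x\<bar> \<le> B" for x using h(2) by (cases "x \<in> closure {x. \<phi> x \<noteq> 0}") auto
    then show ?thesis by blast
  qed
  show "\<exists>B. \<forall>x. \<bar>\<phi> x\<bar> \<le> B" 
  proof (rule bd[OF c])
    fix x assume "x \<notin> closure {x. \<phi> x \<noteq> 0}"
    then show "\<phi> x = 0" using closure_subset[of "{x. \<phi> x \<noteq> 0}"] by blast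
  qed
  show "\<exists>B. \<forall>x. \<bar>frechet_derivative \<phi> (at x) v\<bar> \<le> B"
  proof (rule bd[OF c'])
    fix x assume x: "x \<notin> closure {x. \<phi> x \<noteq> 0}"
    have "((\<lambda>x. 0) has_derivative (\<lambda>x. 0)) (at x)" by simp
    then have "(\<phi> has_derivative (\<lambda>x. 0)) (at x)"
      by (rule has_derivative_transform_within_open[where s="- closure {x. \<phi> x \<noteq> 0}"])
         (use x closure_subset[of "{x. \<phi> x \<noteq> 0}"] in auto)
    then show "frechet_derivative \<phi> (at x) v = 0" using frechet_derivative_at by metis
  qed
qed

lemma borel_measurable_lebesgue_continuous:
  assumes "continuous_on UNIV (f :: 'a::euclidean_space \<Rightarrow> real)"
  shows "f \<in> borel_measurable lebesgue"
proof -
  have "f \<in> borel_measurable borel" using assms by (rule borel_measurable_continuous_onI)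
  then have "f \<in> borel_measurable lborel" by simp
  then show ?thesis by (rule measurable_completion)
qed

lemma test_function_translate_subset:
  assumes "test_function S \<phi>" and "\<And>x. x \<in> S \<Longrightarrow> x - c \<in> T"
  shows "test_function T (\<lambda>x. \<phi> (x + c))"
proof -
  have 1: "{x. \<phi> (x + c) \<noteq> 0} = (\<lambda>x. - c + x) ` {x. \<phi> x \<noteq> 0}"
  proof (intro set_eqI iffI)
    fix x assume "x \<in> {x. \<phi> (x + c) \<noteq> 0}"
    then show "x \<in> (\<lambda>x. - c + x) ` {x. \<phi> x \<noteq> 0}" by (intro image_eqI[of _ _ "x + c"]) auto
  qed auto
  have 2: "closure {x. \<phi> (x + c) \<noteq> 0} = (\<lambda>x. - c + x) ` closure {x. \<phi> x \<noteq> 0}"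
    unfolding 1 by (rule closure_translation)
  show ?thesis
    unfolding test_function_def
  proof (intro conjI allI)
    show "extends_Ck k UNIV (\<lambda>x. \<phi> (x + c))" for k
      using assms extends_Ck_translate unfolding test_function_def by blast
    show "compact (closure {x. \<phi> (x + c) \<noteq> 0})"
      unfolding 2 by (rule compact_translation) (use assms in \<open>auto simp: test_function_def\<close>)
    show "closure {x. \<phi> (x + c) \<noteq> 0} \<subseteq> T"
      unfolding 2 using assms by (force simp: test_function_def)
  qed
qed

text \<open>As long as the translates of the support stay in \<open>S\<close>, the translated
  integral \<open>J\<close> has derivative \<open>- I\<close> by the weak formula, and the mean
  value inequality does the rest. The bound sees \<open>\<phi>\<close> only through the oscillation
  of its values, so it survives uniform limits in which derivatives are lost.\<close>

lemma weak_derivative_translate: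
  fixes \<phi> :: "'a::euclidean_space \<Rightarrow> real"
  assumes w: "has_weak_derivative_on f g e S" and \<phi>: "test_function S' \<phi>"
    and sub: "\<And>x s. x \<in> S' \<Longrightarrow> 0 \<le> s \<Longrightarrow> s \<le> t \<Longrightarrow> x - s *\<^sub>R e \<in> S" and t: "t \<ge> 0"
    and \<omega>: "\<And>x s. 0 \<le> s \<Longrightarrow> s \<le> t \<Longrightarrow> \<bar>\<phi> (x + s *\<^sub>R e) - \<phi> x\<bar> \<le> \<omega>"
  shows "\<bar>(LINT x|lebesgue. f x * \<phi> (x + t *\<^sub>R e)) - (LINT x|lebesgue. f x * \<phi> x)
     + t * (LINT x|lebesgue. g x * \<phi> x)\<bar> \<le> t * (\<omega> * (LINT x|lebesgue. \<bar>g x\<bar>))"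
proof -
  note \<phi>' = test_function_properties[OF \<phi>]
  have f: "integrable lebesgue f" and g: "integrable lebesgue g" using w by (auto simp: has_weak_derivative_on_def)
  obtain B where B: "\<And>x. \<bar>frechet_derivative \<phi> (at x) e\<bar> \<le> B" using \<phi>'(4) by blast
  obtain C where C: "\<And>x. \<bar>\<phi> x\<bar> \<le> C" using \<phi>'(5) by blast
  have line: "((\<lambda>s. \<phi> (x + s *\<^sub>R e)) has_real_derivative frechet_derivative \<phi> (at (x + s *\<^sub>R e)) e) (at s)" for x s
  proof -
    have "(\<phi> has_derivative frechet_derivative \<phi> (at (x + s *\<^sub>R e))) (at (x + s *\<^sub>R e))"
      using \<phi>'(1) by (simp add: frechet_derivative_works[symmetric])
    moreover have "((\<lambda>s. x + s *\<^sub>R e) has_derivative (\<lambda>h. h *\<^sub>R e)) (at s)"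
      by (auto intro!: derivative_eq_intros)
    ultimately have "((\<lambda>s. \<phi> (x + s *\<^sub>R e)) has_derivative (\<lambda>h. frechet_derivative \<phi> (at (x + s *\<^sub>R e)) (h *\<^sub>R e))) (at s)"
      by (rule has_derivative_compose[rotated])
    moreover have "frechet_derivative \<phi> (at (x + s *\<^sub>R e)) (h *\<^sub>R e) = frechet_derivative \<phi> (at (x + s *\<^sub>R e)) e * h" for h
      using linear_frechet_derivative[OF \<phi>'(1)] by (simp add: linear_scale)
    ultimately show ?thesis by (simp add: has_field_derivative_def)
  qed
  have lip: "\<bar>\<phi> (x + s *\<^sub>R e) - \<phi> (x + r *\<^sub>R e)\<bar> \<le> B * \<bar>s - r\<bar>" for x s r
    using field_differentiable_bound[of UNIV "\<lambda>s. \<phi> (x + s *\<^sub>R e)" "\<lambda>s. frechet_derivative \<phi> (at (x + s *\<^sub>R e)) e" B s r]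
      line B by (auto simp: real_norm_def)
  have mshift: "(\<lambda>x. \<phi> (x + s *\<^sub>R e)) \<in> borel_measurable lebesgue" for s
    by (rule borel_measurable_lebesgue_continuous, rule continuous_on_compose2[OF \<phi>'(2)])
       (auto intro!: continuous_intros)
  have ishift: "integrable lebesgue (\<lambda>x. h x * \<phi> (x + s *\<^sub>R e))" if "integrable lebesgue h" for s h
    using that mshift C by (intro integrable_mult_bounded) auto
  define J where "J s = (LINT x|lebesgue. f x * \<phi> (x + s *\<^sub>R e))" for s
  define I where "I s = (LINT x|lebesgue. g x * \<phi> (x + s *\<^sub>R e))" for s
  have JI: "(J has_real_derivative - I s) (at s)" if s: "0 \<le> s" "s \<le> t" for s
  proof -
    have tf: "test_function S (\<lambda>x. \<phi> (x + s *\<^sub>R e))"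
      by (rule test_function_translate_subset[OF \<phi>]) (use sub s in auto)
    have "frechet_derivative (\<lambda>x. \<phi> (x + s *\<^sub>R e)) (at x) e = frechet_derivative \<phi> (at (x + s *\<^sub>R e)) e" for x
    proof -
      have "(\<phi> has_derivative frechet_derivative \<phi> (at (x + s *\<^sub>R e))) (at (x + s *\<^sub>R e))"
        using \<phi>'(1) by (simp add: frechet_derivative_works[symmetric])
      moreover have "((\<lambda>x. x + s *\<^sub>R e) has_derivative (\<lambda>h. h)) (at x)"
        by (auto intro!: derivative_eq_intros)
      ultimately have "((\<lambda>x. \<phi> (x + s *\<^sub>R e)) has_derivative frechet_derivative \<phi> (at (x + s *\<^sub>R e))) (at x)"
        by (rule has_derivative_compose[rotated])
      then show ?thesis using frechet_derivative_at by metis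
    qed
    then have Ieq: "- I s = (LINT x|lebesgue. f x * frechet_derivative \<phi> (at (x + s *\<^sub>R e)) e)"
      using w tf unfolding has_weak_derivative_on_def I_def by auto
    have "((\<lambda>h. (J (s + h) - J s) / h) \<longlongrightarrow> - I s) (at 0)"
      unfolding tendsto_at_iff_sequentially o_def
    proof (intro allI impI)
      fix X :: "nat \<Rightarrow> real" assume X: "\<forall>i. X i \<in> UNIV - {0}" "X \<longlonglongrightarrow> 0"
      have eq: "(J (s + X n) - J s) / X n =
          (LINT x|lebesgue. f x * ((\<phi> (x + (s + X n) *\<^sub>R e) - \<phi> (x + s *\<^sub>R e)) / X n))" for n
        unfolding J_def
        by (subst Bochner_Integration.integral_diff[symmetric]) (auto intro: ishift f simp: right_diff_distrib)
      show "(\<lambda>n. (J (s + X n) - J s) / X n) \<longlonglongrightarrow> - I s"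
        unfolding eq Ieq
      proof (rule integral_dominated_mult(2)[OF f])
        show "(\<lambda>x. (\<phi> (x + (s + X n) *\<^sub>R e) - \<phi> (x + s *\<^sub>R e)) / X n) \<in> borel_measurable lebesgue" for n
          by (intro borel_measurable_divide borel_measurable_diff mshift) auto
        show "AE x in lebesgue. f x \<noteq> 0 \<longrightarrow> \<bar>(\<phi> (x + (s + X n) *\<^sub>R e) - \<phi> (x + s *\<^sub>R e)) / X n\<bar> \<le> B" for n
        proof (rule AE_I2, rule impI)
          fix x
          have "X n \<noteq> 0" using X by auto
          then show "\<bar>(\<phi> (x + (s + X n) *\<^sub>R e) - \<phi> (x + s *\<^sub>R e)) / X n\<bar> \<le> B"
            using lip[of x "s + X n" s] by (simp add: abs_divide pos_divide_le_eq)
        qed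
        show "AE x in lebesgue. f x \<noteq> 0 \<longrightarrow>
          (\<lambda>n. (\<phi> (x + (s + X n) *\<^sub>R e) - \<phi> (x + s *\<^sub>R e)) / X n) \<longlonglongrightarrow> frechet_derivative \<phi> (at (x + s *\<^sub>R e)) e"
        proof (rule AE_I2, rule impI)
          fix x
          show "(\<lambda>n. (\<phi> (x + (s + X n) *\<^sub>R e) - \<phi> (x + s *\<^sub>R e)) / X n) \<longlonglongrightarrow> frechet_derivative \<phi> (at (x + s *\<^sub>R e)) e"
            using line[of x s] X unfolding DERIV_def tendsto_at_iff_sequentially o_def by blast
        qed
      qed
    qed
    then show ?thesis by (simp add: DERIV_def)
  qed
  \<comment> \<open>Adding the linear term \<open>s * I 0\<close> leaves the derivative
    \<open>- I s + I 0\<close>, which is an integral of \<open>g\<close> against an increment of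
    \<open>\<phi>\<close>.\<close>
  have "\<bar>(J t + t * I 0) - (J 0 + 0 * I 0)\<bar> \<le> (\<omega> * (LINT x|lebesgue. \<bar>g x\<bar>)) * \<bar>t - 0\<bar>"
  proof (rule field_differentiable_bound[of "{0..t}", unfolded real_norm_def])
    fix s assume s: "s \<in> {0..t}"
    show "((\<lambda>s. J s + s * I 0) has_real_derivative (- I s + I 0)) (at s within {0..t})"
      using s by (auto intro!: derivative_eq_intros DERIV_subset[OF JI])
    have "- I s + I 0 = - (LINT x|lebesgue. g x * (\<phi> (x + s *\<^sub>R e) - \<phi> x))"
      unfolding I_def using ishift[OF g, of s] ishift[OF g, of 0]
      by (simp add: right_diff_distrib)
    also have "\<bar>\<dots>\<bar> \<le> \<omega> * (LINT x|lebesgue. \<bar>g x\<bar>)"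
      using integrable_mult_bounded(2)[OF g, of "\<lambda>x. \<phi> (x + s *\<^sub>R e) - \<phi> x" \<omega>] \<omega> s mshift[of s] mshift[of 0]
      by auto
    finally show "\<bar>- I s + I 0\<bar> \<le> \<omega> * (LINT x|lebesgue. \<bar>g x\<bar>)" .
  qed (use t in auto)
  then show ?thesis using t by (simp add: J_def I_def algebra_simps)
qed

text \<open>The previous estimate passes to the uniform limit of test functions. The oscillation
  over a time \<open>t\<close> becomes \<open>L * t\<close>, so the right-hand side is of second
  order in \<open>t\<close>.\<close>

lemma weak_derivative_translate_lipschitz:
  fixes \<psi> :: "'a::euclidean_space \<Rightarrow> real"
  assumes w: "has_weak_derivative_on f g e S" and S: "open S" and e: "norm e \<le> 1"
    and K: "compact K" "K \<subseteq> S" and c: "continuous_on UNIV \<psi>" and z: "\<And>x. x \<notin> K \<Longrightarrow> \<psi> x = 0"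
    and t0: "t0 > 0" and lip: "\<And>x t. 0 \<le> t \<Longrightarrow> t \<le> t0 \<Longrightarrow> \<bar>\<psi> (x + t *\<^sub>R e) - \<psi> x\<bar> \<le> L * t"
  obtains t1 where "t1 > 0"
    "\<And>t. 0 \<le> t \<Longrightarrow> t \<le> t1 \<Longrightarrow>
      \<bar>(LINT x|lebesgue. f x * \<psi> (x + t *\<^sub>R e)) - (LINT x|lebesgue. f x * \<psi> x)
         + t * (LINT x|lebesgue. g x * \<psi> x)\<bar> \<le> t * (L * t * (LINT x|lebesgue. \<bar>g x\<bar>))"
proof -
  have f: "integrable lebesgue f" and g: "integrable lebesgue g" using w by (auto simp: has_weak_derivative_on_def)
  obtain \<epsilon> where \<epsilon>: "\<epsilon> > 0" "(\<Union>x\<in>K. ball x \<epsilon>) \<subseteq> S"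
    using compact_subset_open_imp_ball_epsilon_subset[OF K(1) S K(2)] .
  \<comment> \<open>Half of the room around \<open>K\<close> is for the supports of the
    approximants, the other half for the translation.\<close>
  define S' where "S' = (\<Union>x\<in>K. ball x (\<epsilon> / 2))"
  have S': "open S'" "K \<subseteq> S'" using \<epsilon>(1) by (auto simp: S'_def)
  define t1 where "t1 = min t0 (\<epsilon> / 2)"
  have L: "L \<ge> 0"
  proof -
    have "0 \<le> L * t0" by (rule order_trans[OF abs_ge_zero lip[of t0 0]]) (use t0 in auto)
    then show ?thesis using t0 by (simp add: zero_le_mult_iff)
  qed
  have sub: "x - s *\<^sub>R e \<in> S" if x: "x \<in> S'" and s: "0 \<le> s" "s \<le> t1" for x s
  proof -
    obtain k where k: "k \<in> K" "dist k x < \<epsilon> / 2" using x by (auto simp: S'_def)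
    have "dist x (x - s *\<^sub>R e) = s * norm e" using s by (simp add: dist_norm)
    also have "\<dots> \<le> s * 1" using e s by (intro mult_left_mono) auto
    finally have "dist x (x - s *\<^sub>R e) \<le> \<epsilon> / 2" using s by (simp add: t1_def)
    with k have "dist k (x - s *\<^sub>R e) < \<epsilon>" using dist_triangle[of k "x - s *\<^sub>R e" x] by linarith
    then have "x - s *\<^sub>R e \<in> ball k \<epsilon>" by simp
    then show ?thesis using k(1) \<epsilon>(2) by blast
  qed
  have mshift: "(\<lambda>x. h (x + s *\<^sub>R e)) \<in> borel_measurable lebesgue" if "continuous_on UNIV h" for s and h :: "'a \<Rightarrow> real"
    by (rule borel_measurable_lebesgue_continuous, rule continuous_on_compose2[OF that])
       (auto intro!: continuous_intros)
  have cK: "compact (\<psi> ` K)" by (intro compact_continuous_image continuous_on_subset[OF c] K) auto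
  obtain C where C: "\<And>x. \<bar>\<psi> x\<bar> \<le> C"
  proof -
    obtain B where B: "\<And>y. y \<in> \<psi> ` K \<Longrightarrow> \<bar>y\<bar> \<le> B" "B > 0"
      using compact_imp_bounded[OF cK] unfolding bounded_pos by auto
    have "\<bar>\<psi> x\<bar> \<le> B" for x using B z by (cases "x \<in> K") auto
    then show ?thesis using that by blast
  qed
  define F where "F = (LINT x|lebesgue. \<bar>f x\<bar>)"
  define G where "G = (LINT x|lebesgue. \<bar>g x\<bar>)"
  have FG: "F \<ge> 0" "G \<ge> 0" by (auto simp: F_def G_def)
  have main: "\<bar>(LINT x|lebesgue. f x * \<psi> (x + t *\<^sub>R e)) - (LINT x|lebesgue. f x * \<psi> x)
         + t * (LINT x|lebesgue. g x * \<psi> x)\<bar> \<le> t * (L * t * G)" if t: "0 \<le> t" "t \<le> t1" for t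
  proof (rule field_le_epsilon)
    fix \<delta> :: real assume \<delta>: "\<delta> > 0"
    \<comment> \<open>Replacing \<open>\<phi>\<close> by \<open>\<psi>\<close> costs
      \<open>\<eta> * F\<close> in each of the two integrals of \<open>f\<close>,
      \<open>t * \<eta> * G\<close> in the integral of \<open>g\<close>, and
      \<open>2 * t * \<eta> * G\<close> through the oscillation.\<close>
    define \<eta> where "\<eta> = \<delta> / (3 * t * G + 2 * F + 1)"
    have den: "3 * t * G + 2 * F + 1 > 0" using FG t by (intro add_nonneg_pos add_nonneg_nonneg mult_nonneg_nonneg) auto
    have \<eta>: "\<eta> > 0" "\<eta> * (3 * t * G + 2 * F + 1) = \<delta>" using \<delta> den by (auto simp: \<eta>_def)
    obtain \<phi> where \<phi>: "test_function S' \<phi>" "\<And>x. \<bar>\<phi> x - \<psi> x\<bar> < \<eta>"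
      using test_function_approx[OF S'(1) K(1) S'(2) c z \<eta>(1)] by blast
    note \<phi>' = test_function_properties[OF \<phi>(1)]
    have om: "\<bar>\<phi> (x + s *\<^sub>R e) - \<phi> x\<bar> \<le> L * t + 2 * \<eta>" if s: "0 \<le> s" "s \<le> t" for x s
    proof -
      have "\<bar>\<psi> (x + s *\<^sub>R e) - \<psi> x\<bar> \<le> L * s" using lip s t by (auto simp: t1_def)
      moreover have "L * s \<le> L * t" using L s by (intro mult_left_mono) auto
      ultimately show ?thesis using \<phi>(2)[of x] \<phi>(2)[of "x + s *\<^sub>R e"] by linarith
    qed
    have tr: "\<bar>(LINT x|lebesgue. f x * \<phi> (x + t *\<^sub>R e)) - (LINT x|lebesgue. f x * \<phi> x)
         + t * (LINT x|lebesgue. g x * \<phi> x)\<bar> \<le> t * ((L * t + 2 * \<eta>) * G)"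
      unfolding G_def by (rule weak_derivative_translate[OF w \<phi>(1)]) (use sub t om in auto)
    obtain C' where C': "\<And>x. \<bar>\<phi> x\<bar> \<le> C'" using \<phi>'(5) by blast
    have diff: "\<bar>(LINT x|lebesgue. h x * \<psi> (x + s *\<^sub>R e)) - (LINT x|lebesgue. h x * \<phi> (x + s *\<^sub>R e))\<bar>
        \<le> \<eta> * (LINT x|lebesgue. \<bar>h x\<bar>)" if h: "integrable lebesgue h" for h s
    proof -
      have "(LINT x|lebesgue. h x * \<psi> (x + s *\<^sub>R e)) - (LINT x|lebesgue. h x * \<phi> (x + s *\<^sub>R e))
         = (LINT x|lebesgue. h x * (\<psi> (x + s *\<^sub>R e) - \<phi> (x + s *\<^sub>R e)))"
        using integrable_mult_bounded(1)[OF h mshift[OF c], of s C]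
              integrable_mult_bounded(1)[OF h mshift[OF \<phi>'(2)], of s C'] C C'
        by (simp add: right_diff_distrib)
      also have "\<bar>\<dots>\<bar> \<le> \<eta> * (LINT x|lebesgue. \<bar>h x\<bar>)"
      proof (rule integrable_mult_bounded(2)[OF h])
        show "(\<lambda>x. \<psi> (x + s *\<^sub>R e) - \<phi> (x + s *\<^sub>R e)) \<in> borel_measurable lebesgue"
          by (intro borel_measurable_diff mshift c \<phi>')
        show "AE x in lebesgue. h x \<noteq> 0 \<longrightarrow> \<bar>\<psi> (x + s *\<^sub>R e) - \<phi> (x + s *\<^sub>R e)\<bar> \<le> \<eta>"
          using \<phi>(2) by (intro AE_I2) (simp add: abs_minus_commute less_imp_le)
      qed
      finally show ?thesis .
    qed
    define A A' B B' I I' where defs: "A = (LINT x|lebesgue. f x * \<psi> (x + t *\<^sub>R e))" "A' = (LINT x|lebesgue. f x * \<phi> (x + t *\<^sub>R e))"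
      "B = (LINT x|lebesgue. f x * \<psi> x)" "B' = (LINT x|lebesgue. f x * \<phi> x)"
      "I = (LINT x|lebesgue. g x * \<psi> x)" "I' = (LINT x|lebesgue. g x * \<phi> x)"
    have 1: "\<bar>A - A'\<bar> \<le> \<eta> * F" "\<bar>B - B'\<bar> \<le> \<eta> * F" "\<bar>I - I'\<bar> \<le> \<eta> * G"
      using diff[OF f, of t] diff[OF f, of 0] diff[OF g, of 0] by (auto simp: defs F_def G_def)
    have "\<bar>t * I - t * I'\<bar> \<le> t * (\<eta> * G)"
      using mult_left_mono[OF 1(3) t(1)] t by (simp add: right_diff_distrib[symmetric] abs_mult)
    moreover have "\<bar>A' - B' + t * I'\<bar> \<le> t * ((L * t + 2 * \<eta>) * G)" using tr by (simp add: defs)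
    ultimately have "\<bar>A - B + t * I\<bar> \<le> t * ((L * t + 2 * \<eta>) * G) + \<eta> * F + \<eta> * F + t * (\<eta> * G)"
      using 1 by linarith
    also have "\<dots> = t * (L * t * G) + \<eta> * (3 * t * G + 2 * F)" by (simp add: algebra_simps)
    also have "\<dots> \<le> t * (L * t * G) + \<delta>" using \<eta> by (simp add: algebra_simps)
    finally show "\<bar>(LINT x|lebesgue. f x * \<psi> (x + t *\<^sub>R e)) - (LINT x|lebesgue. f x * \<psi> x)
         + t * (LINT x|lebesgue. g x * \<psi> x)\<bar> \<le> t * (L * t * G) + \<delta>" by (simp add: defs)
  qed
  show ?thesis
    by (rule that[of t1]) (use t0 \<epsilon> main in \<open>auto simp: t1_def G_def\<close>)
qed

text \<open>Divide the translation estimate by \<open>t\<close> and let \<open>t\<close> tend to 0: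
  the difference quotients of \<open>\<psi>\<close> are bounded by \<open>L\<close> and converge
  almost everywhere on \<open>S\<close>, so dominated convergence gives the weak formula with the
  pointwise directional derivative \<open>d\<close>.\<close>

lemma weak_derivative_lipschitz:
  fixes \<psi> :: "'a::euclidean_space \<Rightarrow> real"
  assumes w: "has_weak_derivative_on f g e S" and S: "open S" and e: "norm e \<le> 1"
    and K: "compact K" "K \<subseteq> S" and c: "continuous_on UNIV \<psi>" and z: "\<And>x. x \<notin> K \<Longrightarrow> \<psi> x = 0"
    and t0: "t0 > 0" and lip: "\<And>x t. 0 \<le> t \<Longrightarrow> t \<le> t0 \<Longrightarrow> \<bar>\<psi> (x + t *\<^sub>R e) - \<psi> x\<bar> \<le> L * t"
    and d: "AE x in lebesgue. x \<in> S \<longrightarrow> ((\<lambda>t. (\<psi> (x + t *\<^sub>R e) - \<psi> x) / t) \<longlongrightarrow> d x) (at 0)"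
  shows "integrable lebesgue (\<lambda>x. f x * d x)"
    "(LINT x|lebesgue. f x * d x) = - (LINT x|lebesgue. g x * \<psi> x)"
proof -
  have f: "integrable lebesgue f" and g: "integrable lebesgue g" and f0: "\<And>x. x \<notin> S \<Longrightarrow> f x = 0"
    using w by (auto simp: has_weak_derivative_on_def)
  obtain t1 where t1: "t1 > 0" and bd: "\<And>t. 0 \<le> t \<Longrightarrow> t \<le> t1 \<Longrightarrow>
      \<bar>(LINT x|lebesgue. f x * \<psi> (x + t *\<^sub>R e)) - (LINT x|lebesgue. f x * \<psi> x)
         + t * (LINT x|lebesgue. g x * \<psi> x)\<bar> \<le> t * (L * t * (LINT x|lebesgue. \<bar>g x\<bar>))"
    using weak_derivative_translate_lipschitz[OF w S e K c z t0 lip] by blast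
  define T where "T n = min t0 t1 / real (Suc n)" for n
  have Tpos: "T n > 0" for n using t0 t1 by (simp add: T_def)
  have Tle: "T n \<le> t0" "T n \<le> t1" for n
  proof -
    have "min t0 t1 * 1 \<le> min t0 t1 * real (Suc n)" using t0 t1 by (intro mult_left_mono) auto
    then have "T n \<le> min t0 t1"
      unfolding T_def by (simp only: pos_divide_le_eq of_nat_0_less_iff zero_less_Suc mult_1_right)
    then show "T n \<le> t0" "T n \<le> t1" by auto
  qed
  have Tlim: "T \<longlonglongrightarrow> 0" unfolding T_def
    using tendsto_mult[OF tendsto_const LIMSEQ_inverse_real_of_nat, of "min t0 t1"] by (simp add: divide_inverse)
  have mshift: "(\<lambda>x. \<psi> (x + s *\<^sub>R e)) \<in> borel_measurable lebesgue" for s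
    by (rule borel_measurable_lebesgue_continuous, rule continuous_on_compose2[OF c])
       (auto intro!: continuous_intros)
  have m0: "\<psi> \<in> borel_measurable lebesgue" using mshift[of 0] by simp
  obtain C where C: "\<And>x. \<bar>\<psi> x\<bar> \<le> C"
  proof -
    have cK: "compact (\<psi> ` K)" by (intro compact_continuous_image continuous_on_subset[OF c] K) auto
    obtain B where B: "\<And>y. y \<in> \<psi> ` K \<Longrightarrow> \<bar>y\<bar> \<le> B" "B > 0"
      using compact_imp_bounded[OF cK] unfolding bounded_pos by auto
    have "\<bar>\<psi> x\<bar> \<le> B" for x using B z by (cases "x \<in> K") auto
    then show ?thesis using that by blast
  qed
  define q where "q n x = (\<psi> (x + T n *\<^sub>R e) - \<psi> x) / T n" for n x
  have qm: "q n \<in> borel_measurable lebesgue" for n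
    unfolding q_def[abs_def] by (intro borel_measurable_divide borel_measurable_diff mshift m0) auto
  have qb: "\<bar>q n x\<bar> \<le> L" for n x
    using lip[of "T n" x] Tpos[of n] Tle[of n] by (simp add: q_def abs_divide pos_divide_le_eq)
  have qlim: "AE x in lebesgue. f x \<noteq> 0 \<longrightarrow> (\<lambda>n. q n x) \<longlonglongrightarrow> d x"
    using d
  proof eventually_elim
    case (elim x)
    show ?case
    proof
      assume "f x \<noteq> 0"
      then have "((\<lambda>t. (\<psi> (x + t *\<^sub>R e) - \<psi> x) / t) \<longlongrightarrow> d x) (at 0)" using elim f0 by blast
      moreover have "\<forall>n. T n \<in> UNIV - {0}" using Tpos by (simp add: less_imp_neq[symmetric])
      ultimately show "(\<lambda>n. q n x) \<longlonglongrightarrow> d x"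
        using Tlim unfolding tendsto_at_iff_sequentially q_def o_def by blast
    qed
  qed
  have dm: "integrable lebesgue (\<lambda>x. f x * d x)"
    "(\<lambda>n. LINT x|lebesgue. f x * q n x) \<longlonglongrightarrow> (LINT x|lebesgue. f x * d x)"
    by (rule integral_dominated_mult[OF f qm _ qlim, of L]; use qb in auto)+
  show "integrable lebesgue (\<lambda>x. f x * d x)" by (rule dm)
  let ?G = "LINT x|lebesgue. \<bar>g x\<bar>"
  let ?I = "LINT x|lebesgue. g x * \<psi> x"
  have "\<bar>(LINT x|lebesgue. f x * q n x) + ?I\<bar> \<le> T n * (L * ?G)" for n
  proof -
    have "(LINT x|lebesgue. f x * q n x) = (LINT x|lebesgue. (f x * \<psi> (x + T n *\<^sub>R e) - f x * \<psi> x) / T n)"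
      by (simp add: q_def right_diff_distrib)
    also have "\<dots> = ((LINT x|lebesgue. f x * \<psi> (x + T n *\<^sub>R e)) - (LINT x|lebesgue. f x * \<psi> x)) / T n"
      using integrable_mult_bounded(1)[OF f mshift, of "T n" C] integrable_mult_bounded(1)[OF f m0, of C] C
      by simp
    finally have "(LINT x|lebesgue. f x * q n x) + ?I =
      ((LINT x|lebesgue. f x * \<psi> (x + T n *\<^sub>R e)) - (LINT x|lebesgue. f x * \<psi> x) + T n * ?I) / T n"
      using Tpos[of n] by (simp add: field_simps)
    also have "\<bar>\<dots>\<bar> \<le> T n * (L * ?G)"
      using bd[of "T n"] Tpos[of n] Tle[of n] by (simp add: abs_divide pos_divide_le_eq algebra_simps)
    finally show ?thesis .
  qed
  then have "eventually (\<lambda>n. norm ((LINT x|lebesgue. f x * q n x) + ?I) \<le> T n * (L * ?G)) sequentially"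
    by (intro always_eventually) simp
  moreover have "(\<lambda>n. T n * (L * ?G)) \<longlonglongrightarrow> 0"
    using tendsto_mult[OF Tlim tendsto_const[of "L * ?G"]] by (simp only: mult_zero_left)
  ultimately have "(\<lambda>n. (LINT x|lebesgue. f x * q n x) + ?I) \<longlonglongrightarrow> 0"
    by (rule Lim_null_comparison)
  then have "(\<lambda>n. ((LINT x|lebesgue. f x * q n x) + ?I) - ?I) \<longlonglongrightarrow> 0 - ?I"
    by (intro tendsto_diff tendsto_const)
  then have "(\<lambda>n. (LINT x|lebesgue. f x * q n x)) \<longlonglongrightarrow> - ?I" by simp
  with dm(2) show "(LINT x|lebesgue. f x * d x) = - ?I" by (rule LIMSEQ_unique)
qed

section \<open>Vanishing of the weak derivative on open sets where the function vanishes\<close>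

lemma frechet_derivative_outside_support:
  assumes "test_function S \<phi>" "x \<notin> S" shows "frechet_derivative \<phi> (at x) v = 0"
proof -
  have x: "x \<notin> closure {x. \<phi> x \<noteq> 0}" using assms by (auto simp: test_function_def)
  have "((\<lambda>x. 0) has_derivative (\<lambda>x. 0)) (at x)" by simp
  then have "(\<phi> has_derivative (\<lambda>x. 0)) (at x)"
    by (rule has_derivative_transform_within_open[where s="- closure {x. \<phi> x \<noteq> 0}"])
       (use x closure_subset[of "{x. \<phi> x \<noteq> 0}"] in auto)
  then show ?thesis using frechet_derivative_at by metis
qed

text \<open>Test functions supported in \<open>U\<close> do not see \<open>f\<close>, so
  \<open>g\<close> integrates to 0 against them, hence against continuous functions supported in
  some \<open>K k\<close>, and in the limit against a cutoff times the sign of \<open>g\<close>.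
  That last integral is a weighted L1 norm of \<open>g\<close>.\<close>

lemma weak_derivative_vanishes:
  assumes w: "has_weak_derivative_on f g e S" and U: "open U" "U \<subseteq> S" "bounded U"
    and f0: "AE x in lebesgue. x \<in> U \<longrightarrow> f x = 0"
  shows "AE x in lebesgue. x \<in> U \<longrightarrow> g x = 0"
proof -
  have f: "integrable lebesgue f" and g: "integrable lebesgue g"
    using w by (auto simp: has_weak_derivative_on_def)
  define K where "K k = {x. infdist x (- U) \<ge> inverse (real (Suc k))}" for k :: nat
  have "U \<noteq> UNIV" using U(3) not_bounded_UNIV by metis
  then have neU: "- U \<noteq> {}" by auto
  have KU: "K k \<subseteq> U" for k
  proof
    fix x assume "x \<in> K k"
    then have "infdist x (- U) > 0" using less_le_trans[of 0 "inverse (real (Suc k))"] by (simp add: K_def)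
    then have "x \<notin> - U" by (metis infdist_zero less_irrefl)
    then show "x \<in> U" by simp
  qed
  have cK: "compact (K k)" for k
  proof -
    have "closed (K k)" unfolding K_def by (intro closed_Collect_le continuous_intros)
    moreover have "bounded (K k)" using KU U(3) bounded_subset by blast
    ultimately show ?thesis by (simp add: compact_eq_bounded_closed)
  qed
  have int0: "(LINT x|lebesgue. g x * \<psi> x) = 0"
    if c: "continuous_on UNIV \<psi>" and z: "\<And>x. x \<notin> K k \<Longrightarrow> \<psi> x = 0" for \<psi> :: "'a \<Rightarrow> real" and k
  proof -
    have "\<bar>LINT x|lebesgue. g x * \<psi> x\<bar> \<le> 0 + \<delta>" if \<delta>: "\<delta> > 0" for \<delta>
    proof -
      define G where "G = (LINT x|lebesgue. \<bar>g x\<bar>)"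
      have G: "G \<ge> 0" by (simp add: G_def)
      define \<eta> where "\<eta> = \<delta> / (G + 1)"
      have \<eta>: "\<eta> > 0" "\<eta> * G \<le> \<delta>" using \<delta> G by (auto simp: \<eta>_def field_simps)
      obtain \<phi> where \<phi>: "test_function U \<phi>" "\<And>x. \<bar>\<phi> x - \<psi> x\<bar> < \<eta>"
        using test_function_approx[OF U(1) cK KU c z \<eta>(1)] by blast
      note \<phi>' = test_function_properties[OF \<phi>(1)]
      obtain C' where C': "\<And>x. \<bar>\<phi> x\<bar> \<le> C'" using \<phi>'(5) by blast
      have "test_function S \<phi>" using \<phi>(1) U(2) by (auto simp: test_function_def)
      then have "(LINT x|lebesgue. g x * \<phi> x) = - (LINT x|lebesgue. f x * frechet_derivative \<phi> (at x) e)"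
        using w by (auto simp: has_weak_derivative_on_def)
      also have "(LINT x|lebesgue. f x * frechet_derivative \<phi> (at x) e) = (LINT x::'a|lebesgue. 0)"
      proof (rule integral_cong_AE)
        show "(\<lambda>x. f x * frechet_derivative \<phi> (at x) e) \<in> borel_measurable lebesgue"
          by (rule borel_measurable_times, rule borel_measurable_integrable[OF f],
              rule borel_measurable_lebesgue_continuous, rule \<phi>'(3))
        show "AE x in lebesgue. f x * frechet_derivative \<phi> (at x) e = 0"
          using f0 by eventually_elim (use frechet_derivative_outside_support[OF \<phi>(1)] in auto)
      qed auto
      finally have 0: "(LINT x|lebesgue. g x * \<phi> x) = 0" by simp
      have bp: "\<bar>\<psi> x\<bar> \<le> C' + \<eta>" for x using C'[of x] \<phi>(2)[of x] by linarith
      have "(LINT x|lebesgue. g x * \<psi> x) = (LINT x|lebesgue. g x * (\<psi> x - \<phi> x)) + (LINT x|lebesgue. g x * \<phi> x)"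
        using integrable_mult_bounded(1)[OF g borel_measurable_lebesgue_continuous[OF c], of "C' + \<eta>"]
              integrable_mult_bounded(1)[OF g borel_measurable_lebesgue_continuous[OF \<phi>'(2)], of C'] bp C'
        by (simp add: right_diff_distrib)
      moreover have "\<bar>LINT x|lebesgue. g x * (\<psi> x - \<phi> x)\<bar> \<le> \<eta> * G" unfolding G_def
        by (rule integrable_mult_bounded(2)[OF g])
           (use \<phi>(2) in \<open>auto intro!: borel_measurable_lebesgue_continuous continuous_intros c \<phi>' AE_I2 simp: abs_minus_commute less_imp_le\<close>)
      ultimately show ?thesis using 0 \<eta> by simp
    qed
    then have "\<bar>LINT x|lebesgue. g x * \<psi> x\<bar> \<le> 0" by (rule field_le_epsilon)
    then show ?thesis by simp
  qed
  \<comment> \<open>Lebesgue measurability of the sign is used in the form that it is an almost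
    everywhere limit of continuous functions.\<close>
  have "(\<lambda>x. sgn (g x)) \<in> borel_measurable lebesgue" using g by auto
  then have "(\<lambda>x. sgn (g x)) measurable_on UNIV"
    by (rule lebesgue_measurable_imp_measurable_on) simp
  then obtain N h where N: "negligible N" and h: "\<And>n. continuous_on UNIV (h n)"
    and hl: "\<And>x. x \<notin> N \<Longrightarrow> (\<lambda>n. h n x) \<longlonglongrightarrow> sgn (g x)"
    unfolding measurable_on_def by auto
  have AEN: "AE x in lebesgue. x \<notin> N" using N negligible_iff_null_sets AE_not_in by blast
  have each: "AE x in lebesgue. x \<in> K k \<longrightarrow> g x = 0" for k
  proof -
    define \<kappa> where "\<kappa> x = min 1 (max 0 (real (Suc (Suc k)) * infdist x (- U) - 1))" for x
    have c\<kappa>: "continuous_on UNIV \<kappa>" unfolding \<kappa>_def by (intro continuous_intros)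
    have \<kappa>0: "\<kappa> x = 0" if "x \<notin> K (Suc k)" for x
      using that by (auto simp: K_def \<kappa>_def field_simps)
    have \<kappa>b: "0 \<le> \<kappa> x" "\<kappa> x \<le> 1" for x by (auto simp: \<kappa>_def)
    have \<kappa>pos: "\<kappa> x > 0" if "x \<in> K k" for x
    proof -
      have "inverse (real (Suc (Suc k))) < inverse (real (Suc k))" by (intro less_imp_inverse_less) auto
      moreover have "inverse (real (Suc k)) \<le> infdist x (- U)" using that unfolding K_def by blast
      ultimately have "inverse (real (Suc (Suc k))) < infdist x (- U)" by (rule less_le_trans)
      then show ?thesis by (auto simp: \<kappa>_def field_simps)
    qed
    \<comment> \<open>Clamping to [-1, 1] supplies the dominating bound and does not change the
      limit \<open>sgn (g x)\<close>; the factor \<open>\<kappa>\<close> is positive on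
      \<open>K k\<close> and supported in \<open>K (Suc k)\<close>.\<close>
    define m where "m n x = \<kappa> x * max (-1) (min 1 (h n x))" for n x
    have cm: "continuous_on UNIV (m n)" for n unfolding m_def by (intro continuous_intros c\<kappa> h)
    have "(LINT x|lebesgue. g x * m n x) = 0" for n
      by (rule int0[OF cm, where k="Suc k"]) (simp add: m_def \<kappa>0)
    moreover have "(\<lambda>n. LINT x|lebesgue. g x * m n x) \<longlonglongrightarrow> (LINT x|lebesgue. g x * (\<kappa> x * max (-1) (min 1 (sgn (g x)))))"
    proof (rule integral_dominated_mult(2)[OF g, where B=1])
      show "m n \<in> borel_measurable lebesgue" for n by (rule borel_measurable_lebesgue_continuous[OF cm])
      show "AE x in lebesgue. g x \<noteq> 0 \<longrightarrow> \<bar>m n x\<bar> \<le> 1" for n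
      proof (rule AE_I2, rule impI)
        fix x
        have "\<bar>m n x\<bar> \<le> 1 * 1" unfolding m_def abs_mult using \<kappa>b[of x] by (intro mult_mono) auto
        then show "\<bar>m n x\<bar> \<le> 1" by simp
      qed
      show "AE x in lebesgue. g x \<noteq> 0 \<longrightarrow> (\<lambda>n. m n x) \<longlonglongrightarrow> \<kappa> x * max (-1) (min 1 (sgn (g x)))"
        using AEN by eventually_elim (auto simp: m_def intro!: tendsto_intros hl)
    qed
    ultimately have "(LINT x|lebesgue. g x * (\<kappa> x * max (-1) (min 1 (sgn (g x))))) = 0"
      by (simp add: LIMSEQ_const_iff)
    moreover have "g x * (\<kappa> x * max (-1) (min 1 (sgn (g x)))) = \<bar>g x\<bar> * \<kappa> x" for x
      by (auto simp: sgn_if)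
    ultimately have i0: "(LINT x|lebesgue. \<bar>g x\<bar> * \<kappa> x) = 0" by simp
    have "integrable lebesgue (\<lambda>x. \<bar>g x\<bar> * \<kappa> x)"
      by (rule integrable_mult_bounded(1)[of _ _ _ 1]) (use g c\<kappa> \<kappa>b borel_measurable_lebesgue_continuous in auto)
    then have "AE x in lebesgue. \<bar>g x\<bar> * \<kappa> x = 0"
      using integral_nonneg_eq_0_iff_AE[of lebesgue "\<lambda>x. \<bar>g x\<bar> * \<kappa> x"] i0 \<kappa>b by auto
    then show ?thesis by eventually_elim (use \<kappa>pos in force)
  qed
  have "AE x in lebesgue. \<forall>k. x \<in> K k \<longrightarrow> g x = 0" unfolding AE_all_countable using each by (rule allI)
  then show ?thesis
  proof eventually_elim
    case (elim x)
    show ?case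
    proof
      assume x: "x \<in> U"
      have "closed (- U)" using U by auto
      then have "infdist x (- U) > 0" using x neU in_closed_iff_infdist_zero[of "- U" x] infdist_nonneg[of x "- U"]
        by (simp add: order_less_le)
      then obtain k where "inverse (real (Suc k)) < infdist x (- U)" using reals_Archimedean by blast
      then have "x \<in> K k" by (simp add: K_def del: of_nat_Suc)
      then show "g x = 0" using elim by blast
    qed
  qed
qed


section \<open>Almost everywhere differentiability of convex functions\<close>

lemma convex_on_symmetric_difference_quotient:
  fixes F :: "'a::euclidean_space \<Rightarrow> real"
  assumes F: "convex_on P F" and P: "x - t *\<^sub>R i \<in> P" "x \<in> P" "x + t *\<^sub>R i \<in> P" and s: "0 < s" "s \<le> t"
  shows "F (x + s *\<^sub>R i) - F x \<le> (s / t) * (F (x + t *\<^sub>R i) - F x)"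
    "0 \<le> F (x + s *\<^sub>R i) + F (x - s *\<^sub>R i) - 2 * F x"
    "(F (x + s *\<^sub>R i) + F (x - s *\<^sub>R i) - 2 * F x) / s \<le> (F (x + t *\<^sub>R i) + F (x - t *\<^sub>R i) - 2 * F x) / t"
proof -
  have st: "0 \<le> s / t" "s / t \<le> 1" "t > 0" using s by auto
  have dir: "F (x + s *\<^sub>R j) - F x \<le> (s / t) * (F (x + t *\<^sub>R j) - F x)" if "x + t *\<^sub>R j \<in> P" for j
  proof -
    have eq: "(1 - s / t) *\<^sub>R x + (s / t) *\<^sub>R (x + t *\<^sub>R j) = x + s *\<^sub>R j"
      using st by (simp add: algebra_simps)
    have "F ((1 - s / t) *\<^sub>R x + (s / t) *\<^sub>R (x + t *\<^sub>R j)) \<le> (1 - s / t) * F x + (s / t) * F (x + t *\<^sub>R j)"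
      by (rule convex_onD[OF F]) (use st that P in auto)
    then have "F (x + s *\<^sub>R j) \<le> (1 - s / t) * F x + (s / t) * F (x + t *\<^sub>R j)" unfolding eq .
    then show ?thesis by (simp add: algebra_simps)
  qed
  show 1: "F (x + s *\<^sub>R i) - F x \<le> (s / t) * (F (x + t *\<^sub>R i) - F x)" by (rule dir[OF P(3)])
  have 2: "F (x - s *\<^sub>R i) - F x \<le> (s / t) * (F (x - t *\<^sub>R i) - F x)"
    using dir[of "- i"] P(1) by simp
  have "(F (x + s *\<^sub>R i) + F (x - s *\<^sub>R i) - 2 * F x) \<le> (s / t) * (F (x + t *\<^sub>R i) + F (x - t *\<^sub>R i) - 2 * F x)"
  proof -
    have "(s / t) * (F (x + t *\<^sub>R i) + F (x - t *\<^sub>R i) - 2 * F x)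
      = (s / t) * (F (x + t *\<^sub>R i) - F x) + (s / t) * (F (x - t *\<^sub>R i) - F x)" by (simp add: algebra_simps)
    then show ?thesis using 1 2 by linarith
  qed
  then show "(F (x + s *\<^sub>R i) + F (x - s *\<^sub>R i) - 2 * F x) / s \<le> (F (x + t *\<^sub>R i) + F (x - t *\<^sub>R i) - 2 * F x) / t"
    using s by (simp add: field_simps)
  have cP: "convex P" using F by (rule convex_on_imp_convex)
  have "x + s *\<^sub>R j \<in> P" if "x + t *\<^sub>R j \<in> P" for j
  proof -
    have "(1 - s / t) *\<^sub>R x + (s / t) *\<^sub>R (x + t *\<^sub>R j) \<in> P"
      using convexD_alt[OF cP P(2) that st(1,2)] .
    moreover have "(1 - s / t) *\<^sub>R x + (s / t) *\<^sub>R (x + t *\<^sub>R j) = x + s *\<^sub>R j"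
      using st by (simp add: algebra_simps)
    ultimately show ?thesis by simp
  qed
  from this[of i] this[of "- i"] P have "x + s *\<^sub>R i \<in> P" "x - s *\<^sub>R i \<in> P" by auto
  then have "F ((1 - 1 / 2) *\<^sub>R (x + s *\<^sub>R i) + (1 / 2) *\<^sub>R (x - s *\<^sub>R i)) \<le> (1 - 1 / 2) * F (x + s *\<^sub>R i) + (1 / 2) * F (x - s *\<^sub>R i)"
    by (intro convex_onD[OF F]) auto
  moreover have "(1 - 1 / 2) *\<^sub>R (x + s *\<^sub>R i) + (1 / 2) *\<^sub>R (x - s *\<^sub>R i) = x"
    by (simp add: scaleR_add_right[symmetric] scaleR_2[symmetric])
  ultimately show "0 \<le> F (x + s *\<^sub>R i) + F (x - s *\<^sub>R i) - 2 * F x" by simp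
qed

text \<open>\<open>D\<close> is the right derivative, the infimum of the increasing right slopes.
  The vanishing symmetric second difference forces the left slopes to the same value. An upper bound
  is enough, since convexity later supplies the matching lower one.\<close>

lemma convex_on_partial_bound:
  fixes F :: "'a::euclidean_space \<Rightarrow> real"
  assumes F: "convex_on P F" and P: "open P" "x \<in> P" and i: "norm i = 1"
    and q: "(\<lambda>n. (F (x + inverse (real (Suc n)) *\<^sub>R i) + F (x - inverse (real (Suc n)) *\<^sub>R i) - 2 * F x) * real (Suc n)) \<longlonglongrightarrow> 0"
  obtains D where "\<And>e. e > 0 \<Longrightarrow> \<exists>d>0. \<forall>t. \<bar>t\<bar> \<le> d \<longrightarrow> x + t *\<^sub>R i \<in> P \<and> F (x + t *\<^sub>R i) \<le> F x + D * t + e * \<bar>t\<bar>"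
proof -
  obtain r where r: "r > 0" "cball x r \<subseteq> P" using P open_contains_cball by blast
  have inP: "x + t *\<^sub>R i \<in> P" "x - t *\<^sub>R i \<in> P" if "\<bar>t\<bar> \<le> r" for t
    using r that i by (auto simp: dist_norm subset_eq)
  note D = convex_on_symmetric_difference_quotient[OF F]
  define A where "A t = (F (x + t *\<^sub>R i) - F x) / t" for t
  have Amono: "A s \<le> A t" if "0 < s" "s \<le> t" "t \<le> r" for s t
    using D(1)[of x t i s] that inP[of t] P by (simp add: A_def field_simps)
  have Alow: "A t \<ge> - ((F (x - r *\<^sub>R i) - F x) / r)" if t: "0 < t" "t \<le> r" for t
  proof -
    have "F (x - t *\<^sub>R i) - F x \<le> (t / r) * (F (x - r *\<^sub>R i) - F x)"
      using D(1)[of x r "- i" t] t inP[of r] P by simp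
    then have "- ((F (x - r *\<^sub>R i) - F x) / r) * t \<le> - (F (x - t *\<^sub>R i) - F x)" using r by (simp add: field_simps)
    moreover have "- (F (x - t *\<^sub>R i) - F x) \<le> F (x + t *\<^sub>R i) - F x"
      using D(2)[of x t i t] t inP[of t] P by simp
    ultimately have "- ((F (x - r *\<^sub>R i) - F x) / r) * t \<le> F (x + t *\<^sub>R i) - F x" by (rule order_trans)
    then show ?thesis unfolding A_def pos_le_divide_eq[OF t(1)] .
  qed
  define D0 where "D0 = Inf (A ` {0<..r})"
  have bdd: "bdd_below (A ` {0<..r})" using Alow by (intro bdd_belowI2[of _ "- ((F (x - r *\<^sub>R i) - F x) / r)"]) auto
  have D0le: "D0 \<le> A t" if "0 < t" "t \<le> r" for t
    unfolding D0_def using bdd that by (intro cInf_lower) auto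
  show ?thesis
  proof (rule that[of D0])
    fix e :: real assume e: "e > 0"
    have "\<exists>t\<in>{0<..r}. A t < D0 + e / 2"
    proof -
      have "A ` {0<..r} \<noteq> {}" using r by auto
      then show ?thesis using cInf_lessD[of "A ` {0<..r}" "D0 + e / 2"] e unfolding D0_def by auto
    qed
    then obtain t where t: "0 < t" "t \<le> r" "A t < D0 + e / 2" by auto
    have "eventually (\<lambda>n. \<bar>(F (x + inverse (real (Suc n)) *\<^sub>R i) + F (x - inverse (real (Suc n)) *\<^sub>R i) - 2 * F x) * real (Suc n)\<bar> < e / 2) sequentially"
      using q[THEN tendstoD, of "e / 2"] e by simp
    moreover have "eventually (\<lambda>n. inverse (real (Suc n)) < t) sequentially"
      using LIMSEQ_inverse_real_of_nat t(1) by (rule order_tendstoD(2))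
    ultimately have "eventually (\<lambda>n. inverse (real (Suc n)) < t \<and> \<bar>(F (x + inverse (real (Suc n)) *\<^sub>R i) + F (x - inverse (real (Suc n)) *\<^sub>R i) - 2 * F x) * real (Suc n)\<bar> < e / 2) sequentially"
      by eventually_elim auto
    then obtain n where n: "inverse (real (Suc n)) < t" "\<bar>(F (x + inverse (real (Suc n)) *\<^sub>R i) + F (x - inverse (real (Suc n)) *\<^sub>R i) - 2 * F x) * real (Suc n)\<bar> < e / 2"
      unfolding eventually_sequentially by blast
    define d where "d = inverse (real (Suc n))"
    have d: "d > 0" "d < t" using n(1) by (auto simp: d_def)
    have n2: "\<bar>F (x + d *\<^sub>R i) + F (x - d *\<^sub>R i) - 2 * F x\<bar> / d < e / 2"
      using n(2) by (simp only: d_def divide_inverse inverse_inverse_eq abs_mult abs_of_nat)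
    have Ad: "A d < D0 + e / 2" using Amono[of d t] d t by linarith
    have Bd: "(F (x - d *\<^sub>R i) - F x) / d \<le> - D0 + e"
    proof -
      have "(F (x - d *\<^sub>R i) - F x) / d = (F (x + d *\<^sub>R i) + F (x - d *\<^sub>R i) - 2 * F x) / d - A d"
        using d by (simp add: A_def field_simps)
      moreover have "(F (x + d *\<^sub>R i) + F (x - d *\<^sub>R i) - 2 * F x) / d \<le> \<bar>F (x + d *\<^sub>R i) + F (x - d *\<^sub>R i) - 2 * F x\<bar> / d"
        using d by (intro divide_right_mono) auto
      ultimately show ?thesis using n2 D0le[of d] d t e by linarith
    qed
    show "\<exists>d>0. \<forall>t. \<bar>t\<bar> \<le> d \<longrightarrow> x + t *\<^sub>R i \<in> P \<and> F (x + t *\<^sub>R i) \<le> F x + D0 * t + e * \<bar>t\<bar>"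
    proof (intro exI[of _ d] conjI allI impI)
      fix s assume s: "\<bar>s\<bar> \<le> d"
      show "x + s *\<^sub>R i \<in> P" using inP[of s] s d t by auto
      consider "s = 0" | "s > 0" | "s < 0" by linarith
      then show "F (x + s *\<^sub>R i) \<le> F x + D0 * s + e * \<bar>s\<bar>"
      proof cases
        case 2
        have "A s \<le> A d" using s d t 2 by (intro Amono) auto
        with Ad e have "A s \<le> D0 + e" by linarith
        then show ?thesis using 2 by (simp add: A_def pos_divide_le_eq algebra_simps)
      next
        case 3
        define t' where "t' = - s"
        have t': "0 < t'" "t' \<le> d" using s 3 by (auto simp: t'_def)
        have "F (x - t' *\<^sub>R i) - F x \<le> (t' / d) * (F (x - d *\<^sub>R i) - F x)"
          using D(1)[of x d "- i" t'] t' inP[of d] d t P by simp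
        also have "\<dots> = t' * ((F (x - d *\<^sub>R i) - F x) / d)" by simp
        also have "\<dots> \<le> t' * (- D0 + e)" using Bd t' by (intro mult_left_mono) auto
        finally show ?thesis using 3 by (simp add: t'_def algebra_simps)
      qed simp
    qed (use d in auto)
  qed
qed

text \<open>For convex functions partial derivatives suffice: \<open>x + h\<close> is the average of
  the \<open>N\<close> points that move \<open>N\<close> times as far along one axis each, so Jensen
  adds up the bounds along the axes. The lower bound comes from
  \<open>2 * F x \<le> F (x + h) + F (x - h)\<close> and the upper bound at
  \<open>- h\<close>.\<close>

lemma convex_on_differentiable_of_partials:
  fixes F :: "'a::euclidean_space \<Rightarrow> real"
  assumes F: "convex_on P F" and P: "open P" "x \<in> P"
    and q: "\<And>i. i \<in> Basis \<Longrightarrow> (\<lambda>n. (F (x + inverse (real (Suc n)) *\<^sub>R i) + F (x - inverse (real (Suc n)) *\<^sub>R i) - 2 * F x) * real (Suc n)) \<longlonglongrightarrow> 0"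
  shows "F differentiable (at x)"
proof -
  have "\<exists>D. \<forall>e>0. \<exists>d>0. \<forall>t. \<bar>t\<bar> \<le> d \<longrightarrow> x + t *\<^sub>R i \<in> P \<and> F (x + t *\<^sub>R i) \<le> F x + D * t + e * \<bar>t\<bar>"
    if "i \<in> Basis" for i
    using convex_on_partial_bound[OF F P _ q[OF that]] that by (metis norm_Basis)
  then obtain D where D: "\<And>i e. i \<in> Basis \<Longrightarrow> e > 0 \<Longrightarrow>
      \<exists>d>0. \<forall>t. \<bar>t\<bar> \<le> d \<longrightarrow> x + t *\<^sub>R i \<in> P \<and> F (x + t *\<^sub>R i) \<le> F x + D i * t + e * \<bar>t\<bar>" by metis
  define N where "N = real DIM('a)"
  have N: "N > 0" by (simp add: N_def)
  define D' where "D' h = (\<Sum>i\<in>Basis. D i * (h \<bullet> i))" for h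
  have bl: "bounded_linear D'" unfolding D'_def
    by (intro bounded_linear_sum bounded_linear_const_mult bounded_linear_inner_left)
  obtain r where r: "r > 0" "ball x r \<subseteq> P" using P open_contains_ball by blast
  have upper: "\<exists>d>0. \<forall>h. norm h < d \<longrightarrow> F (x + h) \<le> F x + D' h + e * norm h" if e: "e > 0" for e
  proof -
    define e' where "e' = e / N"
    have e': "e' > 0" using e N by (simp add: e'_def)
    have "\<forall>i\<in>Basis. \<exists>d>0. \<forall>t. \<bar>t\<bar> \<le> d \<longrightarrow> x + t *\<^sub>R i \<in> P \<and> F (x + t *\<^sub>R i) \<le> F x + D i * t + e' * \<bar>t\<bar>"
      using D e' by blast
    then obtain d where d: "\<And>i. i \<in> Basis \<Longrightarrow> d i > 0"
      "\<And>i t. i \<in> Basis \<Longrightarrow> \<bar>t\<bar> \<le> d i \<Longrightarrow> x + t *\<^sub>R i \<in> P \<and> F (x + t *\<^sub>R i) \<le> F x + D i * t + e' * \<bar>t\<bar>"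
      by metis
    \<comment> \<open>Divided by \<open>N\<close> because the points in the average are displaced by
      \<open>N * (h \<bullet> i)\<close>.\<close>
    define d0 where "d0 = Min (d ` Basis) / N"
    have d0: "d0 > 0" using d(1) N by (simp add: d0_def)
    have "F (x + h) \<le> F x + D' h + e * norm h" if h: "norm h < d0" for h
    proof -
      have le: "\<bar>N * (h \<bullet> i)\<bar> \<le> d i" if i: "i \<in> Basis" for i
      proof -
        have "\<bar>N * (h \<bullet> i)\<bar> = N * \<bar>h \<bullet> i\<bar>" using N by (simp add: abs_mult)
        also have "\<dots> \<le> N * d0" using N h Basis_le_norm[OF i, of h] by (intro mult_left_mono) auto
        also have "\<dots> = Min (d ` Basis)" using N by (simp add: d0_def)
        also have "\<dots> \<le> d i" using i by simp
        finally show ?thesis .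
      qed
      have "x + h = (\<Sum>i\<in>(Basis::'a set). inverse N *\<^sub>R (x + (N * (h \<bullet> i)) *\<^sub>R i))"
      proof -
        have "(\<Sum>i\<in>(Basis::'a set). inverse N *\<^sub>R (x + (N * (h \<bullet> i)) *\<^sub>R i))
          = (\<Sum>i\<in>(Basis::'a set). inverse N *\<^sub>R x + (h \<bullet> i) *\<^sub>R i)"
          using N by (intro sum.cong) (auto simp: scaleR_add_right field_simps)
        also have "\<dots> = (N * inverse N) *\<^sub>R x + h"
          by (simp add: sum.distrib euclidean_representation sum_constant_scaleR N_def)
        finally show ?thesis using N by simp
      qed
      then have "F (x + h) = F (\<Sum>i\<in>(Basis::'a set). inverse N *\<^sub>R (x + (N * (h \<bullet> i)) *\<^sub>R i))" by simp
      also have "\<dots> \<le> (\<Sum>i\<in>(Basis::'a set). inverse N * F (x + (N * (h \<bullet> i)) *\<^sub>R i))"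
        by (rule convex_on_sum[OF _ _ F]) (use le d N in \<open>auto simp: N_def\<close>)
      also have "\<dots> \<le> (\<Sum>i\<in>(Basis::'a set). inverse N * (F x + D i * (N * (h \<bullet> i)) + e' * \<bar>N * (h \<bullet> i)\<bar>))"
        using le d N by (intro sum_mono mult_left_mono) auto
      also have "\<dots> = (\<Sum>i\<in>(Basis::'a set). inverse N * F x + D i * (h \<bullet> i) + e' * \<bar>h \<bullet> i\<bar>)"
        using N by (intro sum.cong) (auto simp: field_simps abs_mult)
      also have "\<dots> = F x + D' h + (\<Sum>i\<in>(Basis::'a set). e' * \<bar>h \<bullet> i\<bar>)"
        using N by (simp add: sum.distrib D'_def N_def)
      also have "(\<Sum>i\<in>(Basis::'a set). e' * \<bar>h \<bullet> i\<bar>) \<le> (\<Sum>i\<in>(Basis::'a set). e' * norm h)"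
        using e' by (intro sum_mono mult_left_mono Basis_le_norm) auto
      also have "\<dots> = e * norm h" using N by (simp add: e'_def N_def)
      finally show ?thesis by simp
    qed
    then show ?thesis using d0 by blast
  qed
  have "(F has_derivative D') (at x)"
    unfolding has_derivative_at_alt
  proof (intro conjI allI impI bl)
    fix e :: real assume "e > 0"
    then obtain d where d: "d > 0" "\<And>h. norm h < d \<Longrightarrow> F (x + h) \<le> F x + D' h + e * norm h"
      using upper by blast
    show "\<exists>d>0. \<forall>y. norm (y - x) < d \<longrightarrow> norm (F y - F x - D' (y - x)) \<le> e * norm (y - x)"
    proof (intro exI[of _ "min d r"] conjI allI impI)
      fix y assume y: "norm (y - x) < min d r"
      define h where "h = y - x"
      have h: "norm h < d" "norm h < r" "y = x + h" using y by (auto simp: h_def)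
      have in': "x + h \<in> P" "x - h \<in> P" using h r by (auto simp: subset_eq dist_norm)
      have "F ((1 - 1 / 2) *\<^sub>R (x + h) + (1 / 2) *\<^sub>R (x - h)) \<le> (1 - 1 / 2) * F (x + h) + (1 / 2) * F (x - h)"
        by (intro convex_onD[OF F]) (use in' in auto)
      moreover have "(1 - 1 / 2) *\<^sub>R (x + h) + (1 / 2) *\<^sub>R (x - h) = x"
        by (simp add: scaleR_add_right[symmetric] scaleR_2[symmetric])
      ultimately have "2 * F x \<le> F (x + h) + F (x - h)" by simp
      moreover have "F (x - h) \<le> F x - D' h + e * norm h"
        using d(2)[of "- h"] h linear_neg[OF bounded_linear.linear[OF bl]] by simp
      moreover have "F (x + h) \<le> F x + D' h + e * norm h" using d(2) h by simp
      ultimately have "\<bar>F (x + h) - F x - D' h\<bar> \<le> e * norm h" by linarith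
      then show "norm (F y - F x - D' (y - x)) \<le> e * norm (y - x)" by (simp add: h)
    qed (use d r in auto)
  qed
  then show ?thesis by (rule differentiableI)
qed

text \<open>These are the first-order Taylor bounds of the convex function
  \<open>(max 0 t)\<^sup>2\<close>, whose derivative \<open>2 * max 0 t\<close> has Lipschitz
  constant 2.\<close>

lemma positive_part_square_diff:
  fixes t d :: real
  shows "2 * max 0 t * d \<le> (max 0 (t + d))\<^sup>2 - (max 0 t)\<^sup>2"
    "(max 0 (t + d))\<^sup>2 - (max 0 t)\<^sup>2 \<le> 2 * max 0 t * d + d\<^sup>2"
proof -
  consider "t \<ge> 0" "t + d \<ge> 0" | "t \<ge> 0" "t + d < 0" | "t < 0" "t + d \<ge> 0" | "t < 0" "t + d < 0" by linarith
  then have "2 * max 0 t * d \<le> (max 0 (t + d))\<^sup>2 - (max 0 t)\<^sup>2 \<and> (max 0 (t + d))\<^sup>2 - (max 0 t)\<^sup>2 \<le> 2 * max 0 t * d + d\<^sup>2"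
  proof cases
    case 1 then show ?thesis by (simp add: power2_eq_square algebra_simps)
  next
    case 2
    have "t * (t + 2 * d) \<le> 0" using 2 by (intro mult_nonneg_nonpos) auto
    moreover have "(t + d)\<^sup>2 \<ge> 0" by simp
    ultimately show ?thesis using 2 by (simp add: power2_eq_square algebra_simps)
  next
    case 3
    then have "(t + d)\<^sup>2 \<le> d\<^sup>2" by (intro power_mono) auto
    then show ?thesis using 3 by simp
  next
    case 4 then show ?thesis by simp
  qed
  then show "2 * max 0 t * d \<le> (max 0 (t + d))\<^sup>2 - (max 0 t)\<^sup>2"
    "(max 0 (t + d))\<^sup>2 - (max 0 t)\<^sup>2 \<le> 2 * max 0 t * d + d\<^sup>2" by auto
qed

text \<open>The square makes the truncated paraboloid differentiable with Lipschitz gradient. No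
  more smoothness is needed, as only second differences of order \<open>h\<^sup>2\<close> are
  used.\<close>

definition bump :: "'a::euclidean_space \<Rightarrow> real \<Rightarrow> 'a \<Rightarrow> real" where
  "bump a r x = (max 0 (r\<^sup>2 - (norm (x - a))\<^sup>2))\<^sup>2"

text \<open>With \<open>t\<close> the untruncated height, the steps change it by \<open>d1\<close>
  and \<open>d2\<close>, each at most \<open>5 * h * r\<close> in size. The squares contribute 25
  each and the linear terms, which add up to \<open>- 4 * max 0 t * h\<^sup>2\<close>, contribute 4,
  whence 54.\<close>

lemma bump_second_difference:
  fixes a x i :: "'a::euclidean_space"
  assumes i: "norm i = 1" and h: "0 < h" "h \<le> r" and x: "norm (x - a) \<le> 2 * r"
  shows "\<bar>bump a r (x + h *\<^sub>R i) + bump a r (x - h *\<^sub>R i) - 2 * bump a r x\<bar> \<le> 54 * r\<^sup>2 * h\<^sup>2"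
proof -
  define t where "t = r\<^sup>2 - (norm (x - a))\<^sup>2"
  define k where "k = (x - a) \<bullet> i"
  define d1 where "d1 = - 2 * h * k - h\<^sup>2"
  define d2 where "d2 = 2 * h * k - h\<^sup>2"
  have "\<bar>k\<bar> \<le> norm (x - a) * norm i" unfolding k_def by (rule Cauchy_Schwarz_ineq2)
  then have k: "\<bar>k\<bar> \<le> 2 * r" using x i by simp
  have e1: "r\<^sup>2 - (norm (x + h *\<^sub>R i - a))\<^sup>2 = t + d1"
  proof -
    have "x + h *\<^sub>R i - a = (x - a) + h *\<^sub>R i" by simp
    then show ?thesis using i unfolding t_def d1_def k_def
      by (simp only: power2_norm_eq_inner inner_add_left inner_add_right norm_eq_1)
         (simp add: inner_commute power2_eq_square norm_eq_1 algebra_simps)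
  qed
  have e2: "r\<^sup>2 - (norm (x - h *\<^sub>R i - a))\<^sup>2 = t + d2"
  proof -
    have "x - h *\<^sub>R i - a = (x - a) - h *\<^sub>R i" by simp
    then show ?thesis using i unfolding t_def d2_def k_def
      by (simp only: power2_norm_eq_inner inner_diff_left inner_diff_right norm_eq_1)
         (simp add: inner_commute power2_eq_square norm_eq_1 algebra_simps)
  qed
  have hk: "h * \<bar>k\<bar> \<le> h * (2 * r)" using h k by (intro mult_left_mono) auto
  have hh: "h\<^sup>2 \<le> h * r" using h by (simp add: power2_eq_square)
  have "\<bar>d1\<bar> \<le> 2 * (h * \<bar>k\<bar>) + h\<^sup>2" "\<bar>d2\<bar> \<le> 2 * (h * \<bar>k\<bar>) + h\<^sup>2"
  proof -
    have "\<bar>h * k\<bar> = h * \<bar>k\<bar>" using h by (simp add: abs_mult)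
    then have "h * k \<le> h * \<bar>k\<bar>" "- (h * k) \<le> h * \<bar>k\<bar>" by linarith+
    moreover have "0 \<le> h\<^sup>2" by (rule zero_le_power2)
    moreover have "d1 = - (2 * (h * k)) - h\<^sup>2" "d2 = 2 * (h * k) - h\<^sup>2" by (simp_all add: d1_def d2_def)
    ultimately show "\<bar>d1\<bar> \<le> 2 * (h * \<bar>k\<bar>) + h\<^sup>2" "\<bar>d2\<bar> \<le> 2 * (h * \<bar>k\<bar>) + h\<^sup>2"
      by linarith+
  qed
  with hk hh have "\<bar>d1\<bar> \<le> 5 * (h * r)" "\<bar>d2\<bar> \<le> 5 * (h * r)" by linarith+
  then have "d1\<^sup>2 \<le> (5 * (h * r))\<^sup>2" "d2\<^sup>2 \<le> (5 * (h * r))\<^sup>2"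
    by (metis abs_le_square_iff abs_of_nonneg abs_ge_zero order_trans)+
  then have d: "d1\<^sup>2 \<le> 25 * r\<^sup>2 * h\<^sup>2" "d2\<^sup>2 \<le> 25 * r\<^sup>2 * h\<^sup>2" by (simp_all add: power_mult_distrib mult.commute)
  have t0: "0 \<le> max 0 t" "max 0 t \<le> r\<^sup>2" by (auto simp: t_def)
  have "2 * max 0 t * d1 + 2 * max 0 t * d2 = - (4 * (max 0 t * h\<^sup>2))" by (simp add: d1_def d2_def algebra_simps)
  moreover have "0 \<le> max 0 t * h\<^sup>2" "max 0 t * h\<^sup>2 \<le> r\<^sup>2 * h\<^sup>2" using t0 by (auto intro: mult_right_mono)
  moreover have "bump a r (x + h *\<^sub>R i) = (max 0 (t + d1))\<^sup>2" "bump a r (x - h *\<^sub>R i) = (max 0 (t + d2))\<^sup>2"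
    "bump a r x = (max 0 t)\<^sup>2" unfolding bump_def e1 e2 t_def by simp_all
  ultimately show ?thesis
    using positive_part_square_diff[of t d1] positive_part_square_diff[of t d2] d by linarith
qed

section \<open>Second differences of convex functions vanish almost everywhere to first
  order\<close>

lemma integrable_bounded_cball:
  fixes f :: "'a::euclidean_space \<Rightarrow> real"
  assumes "f \<in> borel_measurable lborel" "\<And>x. \<bar>f x\<bar> \<le> C * indicator (cball a R) x"
  shows "integrable lborel f"
proof (rule Bochner_Integration.integrable_bound)
  have "integrable lborel (indicator (cball a R) :: 'a \<Rightarrow> real)"
    by (intro integrable_real_indicator emeasure_lborel_cball_finite) auto
  then show "integrable lborel (\<lambda>x. C * indicator (cball a R) x)" by simp
  show "AE x in lborel. norm (f x) \<le> norm (C * indicator (cball a R) x)"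
    using assms(2) by (intro AE_I2) (metis abs_ge_self order_trans real_norm_def)
qed fact

lemma lborel_integral_shift:
  fixes f :: "'a::euclidean_space \<Rightarrow> real"
  assumes "f \<in> borel_measurable borel"
  shows "(LINT x|lborel. f (x + c)) = (LINT x|lborel. f x)"
proof -
  have "(LINT x|lborel. f x) = (LINT x|distr lborel borel ((+) c). f x)" by (simp add: lborel_distr_plus)
  also have "\<dots> = (LINT x|lborel. f (c + x))" using assms by (intro integral_distr) auto
  finally show ?thesis by (simp add: add.commute)
qed

text \<open>Discrete integration by parts: translation invariance moves the second difference from
  \<open>F\<close> to the bump, where it is of order \<open>h\<^sup>2\<close>, so the weighted
  quotients have integral of order \<open>h\<close>. By convexity they are nonnegative and decrease
  as \<open>h\<close> decreases, so a small integral forces a zero limit almost everywhere.\<close>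

lemma convex_on_second_difference_AE:
  fixes F :: "'a::euclidean_space \<Rightarrow> real"
  assumes F: "convex_on P F" and P: "open P" and r: "r > 0" "cball a (2 * r) \<subseteq> P" and i: "norm i = 1"
  shows "AE x in lborel. x \<in> ball a r \<longrightarrow> (\<lambda>n. (F (x + inverse (real (Suc n)) *\<^sub>R i) + F (x - inverse (real (Suc n)) *\<^sub>R i) - 2 * F x) * real (Suc n)) \<longlonglongrightarrow> 0"
proof -
  obtain n0 where n0: "inverse (real (Suc n0)) < r" using reals_Archimedean[OF r(1)] by blast
  \<comment> \<open>The shift by \<open>n0\<close> keeps the step below \<open>r\<close>, so that
    \<open>x + h n *\<^sub>R i\<close> stays in the ball where \<open>F\<close> is controlled; the
    limit does not depend on it.\<close>
  define h where "h n = inverse (real (Suc (n + n0)))" for n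
  have h: "0 < h n" "h n \<le> r" for n
  proof -
    have "h n \<le> inverse (real (Suc n0))" unfolding h_def by (intro le_imp_inverse_le) auto
    then show "h n \<le> r" using n0 by linarith
    show "0 < h n" by (simp add: h_def)
  qed
  have hdec: "h m \<le> h n" if "n \<le> m" for n m unfolding h_def using that by (intro le_imp_inverse_le) auto
  have hlim: "h \<longlonglongrightarrow> 0" unfolding h_def by (rule LIMSEQ_ignore_initial_segment[OF LIMSEQ_inverse_real_of_nat])
  define F' where "F' x = indicator (cball a (2 * r)) x * F x" for x
  have cF: "continuous_on (cball a (2 * r)) F"
    using convex_on_continuous[OF P F] r(2) continuous_on_subset by blast
  have F'm: "F' \<in> borel_measurable borel"
    using borel_measurable_continuous_on_indicator[OF _ cF] by (simp add: F'_def[abs_def])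
  obtain M where M: "\<And>x. x \<in> cball a (2 * r) \<Longrightarrow> \<bar>F x\<bar> \<le> M" "M > 0"
  proof -
    obtain B where "B > 0" "\<And>y. y \<in> F ` cball a (2 * r) \<Longrightarrow> norm y \<le> B"
      using compact_imp_bounded[OF compact_continuous_image[OF cF compact_cball]] unfolding bounded_pos by blast
    then show ?thesis using that[of B] by simp
  qed
  have F'b: "\<bar>F' x\<bar> \<le> M * indicator (cball a (2 * r)) x" for x using M by (auto simp: F'_def indicator_def)
  have F'b': "\<bar>F' x\<bar> \<le> M" for x using M(2) F'b[of x] by (cases "x \<in> cball a (2 * r)") (auto simp: indicator_def)
  define \<rho> where "\<rho> = bump a r"
  have \<rho>c: "continuous_on UNIV \<rho>" unfolding \<rho>_def bump_def[abs_def] by (intro continuous_intros)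
  have \<rho>m: "\<rho> \<in> borel_measurable borel" by (rule borel_measurable_continuous_onI[OF \<rho>c])
  have \<rho>0: "\<rho> x \<ge> 0" for x by (simp add: \<rho>_def bump_def)
  have \<rho>out: "\<rho> x = 0" if "x \<notin> ball a r" for x
  proof -
    have "r \<le> norm (x - a)" using that by (simp add: dist_norm norm_minus_commute)
    then have "r\<^sup>2 \<le> (norm (x - a))\<^sup>2" using r by (intro power_mono) auto
    then show ?thesis by (simp add: \<rho>_def bump_def)
  qed
  have \<rho>pos: "\<rho> x > 0" if "x \<in> ball a r" for x
  proof -
    have "norm (x - a) < r" using that by (simp add: dist_norm norm_minus_commute)
    then have "(norm (x - a))\<^sup>2 < r\<^sup>2" using r by (intro power_strict_mono) auto
    then show ?thesis by (simp add: \<rho>_def bump_def)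
  qed
  have \<rho>b: "\<rho> x \<le> (r\<^sup>2)\<^sup>2 * indicator (cball a r) x" for x
  proof (cases "x \<in> ball a r")
    case True
    have "(max 0 (r\<^sup>2 - (norm (x - a))\<^sup>2))\<^sup>2 \<le> (r\<^sup>2)\<^sup>2" by (rule power_mono) auto
    moreover have "x \<in> cball a r" using True by auto
    ultimately show ?thesis by (simp only: \<rho>_def bump_def indicator_simps mult_1_right)
  next
    case False
    then show ?thesis using \<rho>out[of x] by simp
  qed
  define q where "q n x = (F' (x + h n *\<^sub>R i) + F' (x - h n *\<^sub>R i) - 2 * F' x) / h n" for n x
  have qm: "q n \<in> borel_measurable borel" for n
    unfolding q_def[abs_def]
    by (intro borel_measurable_divide borel_measurable_diff borel_measurable_add borel_measurable_times borel_measurable_const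
         F'm measurable_compose[OF _ F'm] borel_measurable_continuous_onI continuous_intros)
  have inb: "x + h n *\<^sub>R i \<in> cball a (2 * r)" "x - h n *\<^sub>R i \<in> cball a (2 * r)" "x \<in> cball a (2 * r)"
    if "x \<in> ball a r" for x n
  proof -
    have 1: "norm (a - x) < r" using that by (simp add: dist_norm)
    have 2: "norm (h n *\<^sub>R i) \<le> r" using h[of n] i by simp
    have eq: "a - (x + h n *\<^sub>R i) = a - x - h n *\<^sub>R i" "a - (x - h n *\<^sub>R i) = a - x + h n *\<^sub>R i" by simp_all
    have "norm (a - (x + h n *\<^sub>R i)) \<le> 2 * r" "norm (a - (x - h n *\<^sub>R i)) \<le> 2 * r" "norm (a - x) \<le> 2 * r"
      unfolding eq using 1 2 norm_triangle_ineq4[of "a - x" "h n *\<^sub>R i"] norm_triangle_ineq[of "a - x" "h n *\<^sub>R i"] r(1)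
      by linarith+
    then show "x + h n *\<^sub>R i \<in> cball a (2 * r)" "x - h n *\<^sub>R i \<in> cball a (2 * r)" "x \<in> cball a (2 * r)"
      by (simp_all only: mem_cball dist_norm)
  qed
  have q: "q n x = (F (x + h n *\<^sub>R i) + F (x - h n *\<^sub>R i) - 2 * F x) / h n" if "x \<in> ball a r" for x n
    using inb[OF that] by (simp add: q_def F'_def)
  have q0: "q n x \<ge> 0" if "x \<in> ball a r" for x n
    unfolding q[OF that]
    by (intro divide_nonneg_pos convex_on_symmetric_difference_quotient(2)[OF F _ _ _ _ order_refl])
       (use inb[OF that] r h in auto)
  have qdec: "q m x \<le> q n x" if "x \<in> ball a r" "n \<le> m" for x n m
    unfolding q[OF that(1)]
    by (intro convex_on_symmetric_difference_quotient(3)[OF F]) (use inb[OF that(1)] r h hdec[OF that(2)] in auto)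
  have p0: "\<rho> x * q n x \<ge> 0" for x n using \<rho>0 q0 \<rho>out by (cases "x \<in> ball a r") auto
  have pdec: "\<rho> x * q m x \<le> \<rho> x * q n x" if "n \<le> m" for x n m
    using \<rho>0 qdec[OF _ that] \<rho>out by (cases "x \<in> ball a r") (auto intro!: mult_left_mono)
  have pi: "integrable lborel (\<lambda>x. \<rho> x * F' (x + c))" for c
  proof (rule integrable_bounded_cball)
    show "(\<lambda>x. \<rho> x * F' (x + c)) \<in> borel_measurable lborel" using \<rho>m F'm by measurable
    show "\<bar>\<rho> x * F' (x + c)\<bar> \<le> ((r\<^sup>2)\<^sup>2 * M) * indicator (cball a r) x" for x
    proof -
      have "\<bar>\<rho> x * F' (x + c)\<bar> \<le> ((r\<^sup>2)\<^sup>2 * indicator (cball a r) x) * M"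
        unfolding abs_mult using \<rho>b[of x] \<rho>0[of x] F'b'[of "x + c"] M by (intro mult_mono) auto
      then show ?thesis by (simp add: mult.commute mult.left_commute)
    qed
  qed
  have pi2: "integrable lborel (\<lambda>x. \<rho> (x + c) * F' x)" for c
  proof (rule integrable_bounded_cball)
    show "(\<lambda>x. \<rho> (x + c) * F' x) \<in> borel_measurable lborel" using \<rho>m F'm by measurable
    show "\<bar>\<rho> (x + c) * F' x\<bar> \<le> ((r\<^sup>2)\<^sup>2 * M) * indicator (cball a (2 * r)) x" for x
    proof -
      have "(r\<^sup>2)\<^sup>2 * indicator (cball a r) (x + c) \<le> (r\<^sup>2)\<^sup>2 * (1::real)"
        by (intro mult_left_mono) (auto simp: indicator_def)
      then have "\<rho> (x + c) \<le> (r\<^sup>2)\<^sup>2" using \<rho>b[of "x + c"] by linarith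
      then have "\<bar>\<rho> (x + c) * F' x\<bar> \<le> (r\<^sup>2)\<^sup>2 * (M * indicator (cball a (2 * r)) x)"
        unfolding abs_mult using \<rho>0[of "x + c"] F'b[of x] M by (intro mult_mono) auto
      then show ?thesis by (simp add: mult.assoc)
    qed
  qed
  have shift: "(LINT x|lborel. \<rho> x * F' (x + c)) = (LINT x|lborel. \<rho> (x + (- c)) * F' x)" for c
    using lborel_integral_shift[of "\<lambda>x. \<rho> (x + (- c)) * F' x" c] \<rho>m F'm by simp
  have pq: "\<rho> x * q n x = (\<rho> x * F' (x + h n *\<^sub>R i) + \<rho> x * F' (x + (- h n *\<^sub>R i)) - 2 * (\<rho> x * F' (x + 0))) / h n" for x n
    by (simp add: q_def algebra_simps)
  have pqi: "integrable lborel (\<lambda>x. \<rho> x * q n x)" for n unfolding pq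
    by (intro integrable_divide_zero Bochner_Integration.integrable_diff Bochner_Integration.integrable_add integrable_mult_right impI pi)
  have lin: "(LINT x|lborel. (f1 x + f2 x - 2 * f3 x) / d) = ((LINT x|lborel. f1 x) + (LINT x|lborel. f2 x) - 2 * (LINT x|lborel. f3 x)) / d"
    if "integrable lborel f1" "integrable lborel f2" "integrable lborel f3" for f1 f2 f3 :: "'a \<Rightarrow> real" and d
    using that by simp
  define V where "V = (LINT x|lborel. M * indicator (cball a (2 * r)) (x::'a))"
  have small: "(LINT x|lborel. \<rho> x * q n x) \<le> 54 * r\<^sup>2 * V * h n" for n
  proof -
    have "(LINT x|lborel. \<rho> x * q n x) = ((LINT x|lborel. \<rho> (x + (- (h n *\<^sub>R i))) * F' x)
        + (LINT x|lborel. \<rho> (x + - (- h n *\<^sub>R i)) * F' x) - 2 * (LINT x|lborel. \<rho> (x + - 0) * F' x)) / h n"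
      unfolding pq shift[symmetric] by (rule lin[OF pi pi pi])
    also have "\<dots> = (LINT x|lborel. (\<rho> (x + (- (h n *\<^sub>R i))) * F' x
        + \<rho> (x + - (- h n *\<^sub>R i)) * F' x - 2 * (\<rho> (x + - 0) * F' x)) / h n)"
      by (rule lin[OF pi2 pi2 pi2, symmetric])
    also have "\<dots> \<le> (LINT x|lborel. 54 * r\<^sup>2 * h n * (M * indicator (cball a (2 * r)) x))"
    proof (rule integral_mono)
      show "integrable lborel (\<lambda>x. (\<rho> (x + (- (h n *\<^sub>R i))) * F' x
        + \<rho> (x + - (- h n *\<^sub>R i)) * F' x - 2 * (\<rho> (x + - 0) * F' x)) / h n)"
        by (intro integrable_divide_zero Bochner_Integration.integrable_diff Bochner_Integration.integrable_add integrable_mult_right impI pi2)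
      show "integrable lborel (\<lambda>x. 54 * r\<^sup>2 * h n * (M * indicator (cball a (2 * r)) (x::'a)))"
        by (intro integrable_mult_right impI integrable_real_indicator emeasure_lborel_cball_finite) auto
      fix x
      have eq: "\<rho> (x + (- (h n *\<^sub>R i))) * F' x + \<rho> (x + - (- h n *\<^sub>R i)) * F' x - 2 * (\<rho> (x + - 0) * F' x)
        = (\<rho> (x + h n *\<^sub>R i) + \<rho> (x - h n *\<^sub>R i) - 2 * \<rho> x) * F' x" by (simp add: algebra_simps)
      have "\<dots> \<le> (54 * r\<^sup>2 * (h n)\<^sup>2) * (M * indicator (cball a (2 * r)) x)"
      proof (cases "x \<in> cball a (2 * r)")
        case True
        have "(\<rho> (x + h n *\<^sub>R i) + \<rho> (x - h n *\<^sub>R i) - 2 * \<rho> x) * F' x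
          \<le> \<bar>\<rho> (x + h n *\<^sub>R i) + \<rho> (x - h n *\<^sub>R i) - 2 * \<rho> x\<bar> * \<bar>F' x\<bar>"
          by (metis abs_ge_self abs_mult)
        also have "\<dots> \<le> (54 * r\<^sup>2 * (h n)\<^sup>2) * (M * indicator (cball a (2 * r)) x)"
          unfolding \<rho>_def
          by (intro mult_mono bump_second_difference i h F'b) (use True in \<open>auto simp: dist_norm norm_minus_commute\<close>)
        finally show ?thesis .
      next
        case False
        then show ?thesis by (simp add: F'_def)
      qed
      then show "(\<rho> (x + (- (h n *\<^sub>R i))) * F' x + \<rho> (x + - (- h n *\<^sub>R i)) * F' x - 2 * (\<rho> (x + - 0) * F' x)) / h n
        \<le> 54 * r\<^sup>2 * h n * (M * indicator (cball a (2 * r)) x)"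
        unfolding eq using h[of n] by (simp add: pos_divide_le_eq power2_eq_square mult_ac)
    qed
    also have "\<dots> = 54 * r\<^sup>2 * V * h n" by (simp add: V_def)
    finally show ?thesis .
  qed
  \<comment> \<open>The monotone limit lies below every weighted quotient, so its integral is at
    most a constant times \<open>h n\<close> for every \<open>n\<close>.\<close>
  define G where "G x = lim (\<lambda>n. \<rho> x * q n x)" for x
  have Glim: "(\<lambda>n. \<rho> x * q n x) \<longlonglongrightarrow> G x" for x
  proof -
    have "decseq (\<lambda>n. \<rho> x * q n x)" using pdec by (simp add: decseq_def)
    then obtain l where "(\<lambda>n. \<rho> x * q n x) \<longlonglongrightarrow> l" using decseq_convergent[of "\<lambda>n. \<rho> x * q n x" 0] p0 by blast
    then have "convergent (\<lambda>n. \<rho> x * q n x)" by (rule convergentI)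
    then show ?thesis unfolding G_def by (rule convergent_LIMSEQ_iff[THEN iffD1])
  qed
  have Gle: "G x \<le> \<rho> x * q n x" for x n
    by (rule decseq_ge[OF _ Glim]) (use pdec in \<open>simp add: decseq_def\<close>)
  have G0: "G x \<ge> 0" for x by (rule LIMSEQ_le_const[OF Glim]) (use p0 in auto)
  have Gm: "G \<in> borel_measurable borel" unfolding G_def[abs_def]
    by (intro borel_measurable_lim_metric borel_measurable_times \<rho>m qm)
  have Gi: "integrable lborel G"
    by (rule Bochner_Integration.integrable_bound[OF pqi[of 0]]) (use Gm G0 Gle[of _ 0] p0[of _ 0] in auto)
  have "(LINT x|lborel. G x) \<le> 54 * r\<^sup>2 * V * h n" for n
    using integral_mono[OF Gi pqi[of n] Gle[of _ n]] small[of n] by linarith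
  moreover have "(\<lambda>n. 54 * r\<^sup>2 * V * h n) \<longlonglongrightarrow> 54 * r\<^sup>2 * V * 0"
    by (intro tendsto_intros hlim)
  ultimately have "(LINT x|lborel. G x) \<le> 0" by (intro LIMSEQ_le_const[of "\<lambda>n. 54 * r\<^sup>2 * V * h n" 0]) auto
  moreover have "(LINT x|lborel. G x) \<ge> 0" using G0 by simp
  ultimately have "(LINT x|lborel. G x) = 0" by (rule antisym)
  then have "AE x in lborel. G x = 0"
    using integral_nonneg_eq_0_iff_AE[OF Gi] G0 by simp
  then show ?thesis
  proof eventually_elim
    case (elim x)
    show ?case
    proof
      assume x: "x \<in> ball a r"
      have "(\<lambda>n. \<rho> x * q n x / \<rho> x) \<longlonglongrightarrow> 0 / \<rho> x"
        using Glim[of x] elim \<rho>pos[OF x] by (intro tendsto_divide tendsto_const) auto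
      then have "(\<lambda>n. q n x) \<longlonglongrightarrow> 0" using \<rho>pos[OF x] by simp
      then have "(\<lambda>n. (F (x + inverse (real (Suc (n + n0))) *\<^sub>R i) + F (x - inverse (real (Suc (n + n0))) *\<^sub>R i) - 2 * F x) * real (Suc (n + n0))) \<longlonglongrightarrow> 0"
        unfolding q[OF x] h_def by (simp add: divide_inverse del: of_nat_Suc)
      then show "(\<lambda>n. (F (x + inverse (real (Suc n)) *\<^sub>R i) + F (x - inverse (real (Suc n)) *\<^sub>R i) - 2 * F x) * real (Suc n)) \<longlonglongrightarrow> 0"
        by (rule LIMSEQ_offset)
    qed
  qed
qed

proposition convex_on_differentiable_AE:
  fixes F :: "'a::euclidean_space \<Rightarrow> real"
  assumes F: "convex_on P F" and P: "open P"
  shows "negligible {x \<in> P. \<not> F differentiable (at x)}" (is "negligible ?N")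
  unfolding locally_negligible_alt[of ?N]
proof
  fix a assume "a \<in> ?N"
  then have "a \<in> P" by auto
  then obtain r' where r': "r' > 0" "cball a r' \<subseteq> P" using P open_contains_cball by blast
  define r where "r = r' / 2"
  have r: "r > 0" "cball a (2 * r) \<subseteq> P" using r' by (auto simp: r_def)
  have ae: "AE x in lborel. \<forall>i\<in>Basis. x \<in> ball a r \<longrightarrow> (\<lambda>n. (F (x + inverse (real (Suc n)) *\<^sub>R i) + F (x - inverse (real (Suc n)) *\<^sub>R i) - 2 * F x) * real (Suc n)) \<longlonglongrightarrow> 0"
    by (intro AE_finite_allI finite_Basis convex_on_second_difference_AE[OF F P r]) auto
  have inP: "x \<in> P" if "x \<in> ball a r" for x using that r by (force simp: subset_eq)
  define Q where "Q x \<longleftrightarrow> (x \<in> ball a r \<longrightarrow> F differentiable (at x))" for x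
  have "AE x in lborel. Q x"
    using ae
  proof eventually_elim
    case (elim x)
    then show ?case
      unfolding Q_def using inP by (auto intro!: convex_on_differentiable_of_partials[OF F P])
  qed
  then obtain N where N: "{x \<in> space lborel. \<not> Q x} \<subseteq> N" "emeasure lborel N = 0" "N \<in> sets lborel"
    by (rule AE_E)
  then have "N \<in> null_sets lebesgue" by (intro null_sets_completionI) (simp add: null_sets_def)
  then have "negligible N" by (simp add: negligible_iff_null_sets)
  moreover have "?N \<inter> ball a r \<subseteq> N" using N(1) by (auto simp: Q_def)
  ultimately have "negligible (?N \<inter> ball a r)" by (rule negligible_subset)
  moreover have "openin (top_of_set ?N) (?N \<inter> ball a r)" by (simp add: openin_open_Int)
  ultimately show "\<exists>U. openin (top_of_set ?N) U \<and> a \<in> U \<and> negligible U"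
    using \<open>a \<in> ?N\<close> r by (intro exI[of _ "?N \<inter> ball a r"]) auto
qed


section \<open>Partial derivatives of the preference function\<close>

primrec iter_deriv ::
  "'a list \<Rightarrow> ('a::real_normed_vector \<Rightarrow> 'b::real_normed_vector) \<Rightarrow> 'a \<Rightarrow> 'b" where
  "iter_deriv [] f = f"
| "iter_deriv (v # vs) f = iter_deriv vs (\<lambda>x. frechet_derivative f (at x) v)"

lemma iter_deriv_snoc: "iter_deriv (vs @ [v]) f = (\<lambda>x. frechet_derivative (iter_deriv vs f) (at x) v)"
  by (induction vs arbitrary: f) auto

lemma extends_Ck_iter_deriv:
  "extends_Ck k S f \<Longrightarrow> length vs \<le> k \<Longrightarrow> extends_Ck (k - length vs) S (iter_deriv vs f)"
proof (induction vs arbitrary: k f)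
  case (Cons v vs)
  then obtain k' where "k = Suc k'" by (cases k) auto
  then show ?case using Cons by auto
qed simp

lemma extends_Ck_continuous: "extends_Ck k S f \<Longrightarrow> \<exists>g. continuous_on (closure S) g \<and> (\<forall>x\<in>S. g x = f x)"
  by (cases k) auto

lemma linear_pair_expand:
  fixes D :: "(real^'n) \<times> (real^'n) \<Rightarrow> real"
  assumes "linear D"
  shows "D (h, k) = (\<Sum>i\<in>UNIV. h $ i * D (axis i 1, 0)) + (\<Sum>j\<in>UNIV. k $ j * D (0, axis j 1))"
proof -
  have l1: "linear (\<lambda>h. D (h, 0))"
    using linear_compose[OF _ assms, of "\<lambda>h. (h, 0)"] by (simp add: o_def linear_iff)
  have l2: "linear (\<lambda>k. D (0, k))"
    using linear_compose[OF _ assms, of "\<lambda>k. (0, k)"] by (simp add: o_def linear_iff)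
  have ex: "f v = (\<Sum>i\<in>UNIV. v $ i * f (axis i 1))" if "linear f" for f :: "real^'n \<Rightarrow> real" and v
  proof -
    have "f v = f (\<Sum>i\<in>UNIV. v $ i *s axis i 1)" by (simp only: basis_expansion)
    also have "\<dots> = (\<Sum>i\<in>UNIV. v $ i * f (axis i 1))"
      using that by (simp add: linear_sum linear_scale scalar_mult_eq_scaleR)
    finally show ?thesis .
  qed
  have "D (h, k) = D ((h, 0) + (0, k))" by simp
  also have "\<dots> = D (h, 0) + D (0, k)" by (rule linear_add[OF assms])
  finally show ?thesis using ex[OF l1, of h] ex[OF l2, of k] by simp
qed

text \<open>
  \<open>partials_of E X Y b\<close>: \<open>E [\<alpha>, \<beta>, \<dots>]\<close> is the continuous extension to the closure of
  \<open>X \<times> Y\<close> of the iterated partial derivative of \<open>b\<close>, first in \<open>\<alpha>\<close>, then in \<open>\<beta>\<close>, and so on;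
  \<open>Inl i\<close> stands for the \<open>i\<close>-th coordinate of \<open>x\<close> and \<open>Inr j\<close> for the \<open>j\<close>-th coordinate of \<open>y\<close>.
\<close>

definition partials_of :: "(('n::finite + 'n) list \<Rightarrow> (real^'n) \<times> (real^'n) \<Rightarrow> real) \<Rightarrow>
    (real^'n) set \<Rightarrow> (real^'n) set \<Rightarrow> (real^'n \<Rightarrow> real^'n \<Rightarrow> real) \<Rightarrow> bool" where
  "partials_of E X Y b \<longleftrightarrow> E [] = (\<lambda>(x, y). b x y) \<and>
     (\<forall>\<alpha>. length \<alpha> \<le> 4 \<longrightarrow> continuous_on (closure X \<times> closure Y) (E \<alpha>)) \<and>
     (\<forall>\<alpha> x y. length \<alpha> < 4 \<longrightarrow> x \<in> X \<longrightarrow> y \<in> Y \<longrightarrow>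
        (E \<alpha> has_derivative (\<lambda>(h, k). (\<Sum>i\<in>UNIV. h $ i * E (\<alpha> @ [Inl i]) (x, y))
           + (\<Sum>j\<in>UNIV. k $ j * E (\<alpha> @ [Inr j]) (x, y)))) (at (x, y)))"

lemma B0_partials:
  fixes X Y :: "(real^'n) set"
  assumes "B0 X Y b"
  obtains E where "partials_of E X Y b"
proof -
  define S where "S = X \<times> Y"
  define f where "f = (\<lambda>(x, y). b x y)"
  have op: "open S" and C: "continuous_on (closure S) f" "extends_Ck 4 S f"
    using assms by (auto simp: B0_def Ck_closure_def S_def f_def open_Times)
  define dir where "dir = case_sum (\<lambda>i. (axis i 1, 0)) (\<lambda>j. (0, axis j 1) :: (real^'n) \<times> (real^'n))"
  have "\<exists>g. continuous_on (closure S) g \<and> (\<forall>x\<in>S. g x = iter_deriv (map dir \<alpha>) f x)" if "length \<alpha> \<le> 4" for \<alpha>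
    using extends_Ck_continuous[OF extends_Ck_iter_deriv[OF C(2), of "map dir \<alpha>"]] that by simp
  \<comment> \<open>For the empty list the extension is fixed to be \<open>b\<close> itself: values
    of \<open>b\<close> on the boundary enter the problem, so agreement in the interior would not be
    enough.\<close>
  then have "\<exists>g. (length \<alpha> \<le> 4 \<longrightarrow> continuous_on (closure S) g \<and> (\<forall>x\<in>S. g x = iter_deriv (map dir \<alpha>) f x)) \<and> (\<alpha> = [] \<longrightarrow> g = f)" for \<alpha>
    using C(1) by (cases "\<alpha> = []") (auto intro: exI[of _ f])
  then obtain E where E: "\<And>\<alpha>. length \<alpha> \<le> 4 \<Longrightarrow> continuous_on (closure S) (E \<alpha>)"
    "\<And>\<alpha> x. length \<alpha> \<le> 4 \<Longrightarrow> x \<in> S \<Longrightarrow> E \<alpha> x = iter_deriv (map dir \<alpha>) f x" "E [] = f"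
    by metis
  have der: "(E \<alpha> has_derivative (\<lambda>(h, k). (\<Sum>i\<in>UNIV. h $ i * E (\<alpha> @ [Inl i]) (x, y))
           + (\<Sum>j\<in>UNIV. k $ j * E (\<alpha> @ [Inr j]) (x, y)))) (at (x, y))"
    if l: "length \<alpha> < 4" and xy: "(x, y) \<in> S" for \<alpha> x y
  proof -
    let ?g = "iter_deriv (map dir \<alpha>) f"
    let ?D = "frechet_derivative ?g (at (x, y))"
    obtain k where k: "4 - length \<alpha> = Suc k" using l by (metis Suc_diff_Suc)
    have "extends_Ck (Suc k) S ?g" using extends_Ck_iter_deriv[OF C(2), of "map dir \<alpha>"] l k by simp
    then have dif: "?g differentiable (at (x, y))" using xy by simp
    then have "(?g has_derivative ?D) (at (x, y))" by (simp add: frechet_derivative_works[symmetric])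
    then have "(E \<alpha> has_derivative ?D) (at (x, y))"
      by (rule has_derivative_transform_within_open[OF _ op xy]) (use E(2) l in auto)
    moreover have "?D (h, k) = (\<Sum>i\<in>UNIV. h $ i * E (\<alpha> @ [Inl i]) (x, y))
           + (\<Sum>j\<in>UNIV. k $ j * E (\<alpha> @ [Inr j]) (x, y))" for h k
    proof -
      have "?D (axis i 1, 0) = E (\<alpha> @ [Inl i]) (x, y)" for i
        using E(2)[of "\<alpha> @ [Inl i]"] l xy by (simp add: iter_deriv_snoc dir_def)
      moreover have "?D (0, axis j 1) = E (\<alpha> @ [Inr j]) (x, y)" for j
        using E(2)[of "\<alpha> @ [Inr j]"] l xy by (simp add: iter_deriv_snoc dir_def)
      ultimately show ?thesis
        using linear_pair_expand[OF linear_frechet_derivative[OF dif], of h k] by simp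
    qed
    then have "?D = (\<lambda>(h, k). (\<Sum>i\<in>UNIV. h $ i * E (\<alpha> @ [Inl i]) (x, y))
           + (\<Sum>j\<in>UNIV. k $ j * E (\<alpha> @ [Inr j]) (x, y)))" by (intro ext) auto
    ultimately show ?thesis by simp
  qed
  have "partials_of E X Y b"
    unfolding partials_of_def
  proof (intro conjI allI impI)
    show "E [] = (\<lambda>(x, y). b x y)" using E(3) f_def by simp
    show "continuous_on (closure X \<times> closure Y) (E \<alpha>)" if "length \<alpha> \<le> 4" for \<alpha>
      using E(1)[OF that] by (simp add: S_def closure_Times)
  qed (use der in \<open>auto simp: S_def\<close>)
  then show ?thesis using that by blast
qed

text \<open>The point \<open>y0\<close> may lie on the boundary of \<open>Y\<close>, where nothing
  is assumed to be differentiable directly. The mean value estimate for interior \<open>y'\<close>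
  is uniform near \<open>y\<close>, because the extended derivatives are continuous, and so it
  passes to the limit.\<close>

lemma partial_derivative_closure:
  fixes X :: "(real^'n) set" and Y :: "'b::metric_space set" and \<Phi> :: "(real^'n) \<times> 'b \<Rightarrow> real"
  assumes X: "open X" and \<Phi>: "continuous_on (X \<times> closure Y) \<Phi>"
    and \<Psi>: "\<And>i. continuous_on (X \<times> closure Y) (\<Psi> i)"
    and d: "\<And>x y. x \<in> X \<Longrightarrow> y \<in> Y \<Longrightarrow> ((\<lambda>x. \<Phi> (x, y)) has_derivative (\<lambda>h. \<Sum>i\<in>UNIV. h $ i * \<Psi> i (x, y))) (at x)"
    and x: "x \<in> X" and y: "y \<in> closure Y"
  shows "((\<lambda>x. \<Phi> (x, y)) has_derivative (\<lambda>h. \<Sum>i\<in>UNIV. h $ i * \<Psi> i (x, y))) (at x)"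
  unfolding has_derivative_at_alt
proof (intro conjI allI impI)
  show "bounded_linear (\<lambda>h. \<Sum>i\<in>UNIV. h $ i * \<Psi> i (x, y))"
    by (intro bounded_linear_sum bounded_linear_mult_left[THEN bounded_linear_compose, unfolded o_def] bounded_linear_vec_nth)
  fix e :: real assume e: "e > 0"
  define N where "N = real CARD('n)"
  have N: "N > 0" by (simp add: N_def)
  obtain r where r: "r > 0" "ball x r \<subseteq> X" using X x open_contains_ball by blast
  have "\<exists>\<delta>>0. \<forall>z\<in>X \<times> closure Y. dist z (x, y) < \<delta> \<longrightarrow> \<bar>\<Psi> i z - \<Psi> i (x, y)\<bar> < e / N" for i
    using \<Psi>[of i] x y e N unfolding continuous_on_iff dist_real_def by (simp add: divide_pos_pos)
  then obtain \<delta> where \<delta>: "\<And>i. \<delta> i > 0"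
    "\<And>i z. z \<in> X \<times> closure Y \<Longrightarrow> dist z (x, y) < \<delta> i \<Longrightarrow> \<bar>\<Psi> i z - \<Psi> i (x, y)\<bar> < e / N" by metis
  define \<delta>0 where "\<delta>0 = min r (Min (range \<delta>) / 2)"
  have \<delta>0: "\<delta>0 > 0" "\<delta>0 \<le> r" using r \<delta>(1) by (auto simp: \<delta>0_def)
  have \<delta>i: "2 * \<delta>0 \<le> \<delta> i" for i
  proof -
    have "Min (range \<delta>) \<le> \<delta> i" by simp
    then show ?thesis using min.cobounded2[of r "Min (range \<delta>) / 2"] unfolding \<delta>0_def by linarith
  qed
  have near: "\<bar>\<Psi> i (x', y') - \<Psi> i (x, y)\<bar> \<le> e / N" if "dist x' x < \<delta>0" "dist y' y < \<delta>0" "y' \<in> closure Y" for x' y' i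
  proof -
    have "dist (x', y') (x, y) \<le> dist x' x + dist y' y"
      unfolding dist_Pair_Pair by (rule sqrt_sum_squares_le_sum) auto
    then have "dist (x', y') (x, y) < \<delta> i" using that \<delta>i[of i] by linarith
    moreover have "x' \<in> X" using that \<delta>0 r by (auto simp: subset_eq dist_commute)
    ultimately show ?thesis using \<delta>(2)[of "(x', y')" i] that by auto
  qed
  have bound: "\<bar>\<Phi> (x', y') - \<Phi> (x, y') - (\<Sum>i\<in>UNIV. (x' - x) $ i * \<Psi> i (x, y))\<bar> \<le> e * norm (x' - x)"
    if x': "dist x' x < \<delta>0" and y': "y' \<in> Y" "dist y' y < \<delta>0" for x' y'
  proof -
    let ?g = "\<lambda>z. \<Phi> (z, y') - (\<Sum>i\<in>UNIV. z $ i * \<Psi> i (x, y))"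
    have "norm (?g x' - ?g x) \<le> e * norm (x' - x)"
    proof (rule differentiable_bound[where S="ball x \<delta>0" and f'="\<lambda>z h. (\<Sum>i\<in>UNIV. h $ i * \<Psi> i (z, y')) - (\<Sum>i\<in>UNIV. h $ i * \<Psi> i (x, y))"])
      fix z assume z: "z \<in> ball x \<delta>0"
      then have "z \<in> X" using \<delta>0 r by auto
      have "((\<lambda>z. \<Phi> (z, y')) has_derivative (\<lambda>h. \<Sum>i\<in>UNIV. h $ i * \<Psi> i (z, y'))) (at z)"
        by (rule d[OF \<open>z \<in> X\<close> y'(1)])
      moreover have "((\<lambda>z. \<Sum>i\<in>UNIV. z $ i * \<Psi> i (x, y)) has_derivative (\<lambda>h. \<Sum>i\<in>UNIV. h $ i * \<Psi> i (x, y))) (at z)"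
        by (intro has_derivative_sum has_derivative_mult_left bounded_linear_imp_has_derivative bounded_linear_vec_nth)
      ultimately have "(?g has_derivative (\<lambda>h. (\<Sum>i\<in>UNIV. h $ i * \<Psi> i (z, y')) - (\<Sum>i\<in>UNIV. h $ i * \<Psi> i (x, y)))) (at z)"
        by (rule has_derivative_diff)
      then show "(?g has_derivative (\<lambda>h. (\<Sum>i\<in>UNIV. h $ i * \<Psi> i (z, y')) - (\<Sum>i\<in>UNIV. h $ i * \<Psi> i (x, y)))) (at z within ball x \<delta>0)"
        by (rule has_derivative_at_withinI)
      show "onorm (\<lambda>h. (\<Sum>i\<in>UNIV. h $ i * \<Psi> i (z, y')) - (\<Sum>i\<in>UNIV. h $ i * \<Psi> i (x, y))) \<le> e"
      proof (rule onorm_le)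
        fix h :: "real^'n"
        have "norm ((\<Sum>i\<in>UNIV. h $ i * \<Psi> i (z, y')) - (\<Sum>i\<in>UNIV. h $ i * \<Psi> i (x, y)))
          = \<bar>\<Sum>i\<in>UNIV. h $ i * (\<Psi> i (z, y') - \<Psi> i (x, y))\<bar>"
          by (simp add: sum_subtractf right_diff_distrib)
        also have "\<dots> \<le> (\<Sum>i\<in>UNIV. \<bar>h $ i\<bar> * \<bar>\<Psi> i (z, y') - \<Psi> i (x, y)\<bar>)"
          by (rule order_trans[OF sum_abs]) (simp add: abs_mult)
        also have "\<dots> \<le> (\<Sum>i\<in>(UNIV::'n set). norm h * (e / N))"
          using near[of z y'] z y' closure_subset[of Y]
          by (intro sum_mono mult_mono component_le_norm_cart) (auto simp: dist_commute)
        also have "\<dots> = e * norm h" using N by (simp add: N_def)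
        finally show "norm ((\<Sum>i\<in>UNIV. h $ i * \<Psi> i (z, y')) - (\<Sum>i\<in>UNIV. h $ i * \<Psi> i (x, y))) \<le> e * norm h" .
      qed
    qed (use x' \<delta>0 in \<open>auto simp: dist_commute\<close>)
    then show ?thesis by (simp add: sum_subtractf left_diff_distrib algebra_simps)
  qed
  show "\<exists>d>0. \<forall>x'. norm (x' - x) < d \<longrightarrow>
     norm (\<Phi> (x', y) - \<Phi> (x, y) - (\<Sum>i\<in>UNIV. (x' - x) $ i * \<Psi> i (x, y))) \<le> e * norm (x' - x)"
  proof (intro exI[of _ \<delta>0] conjI allI impI \<delta>0(1))
    fix x' assume "norm (x' - x) < \<delta>0"
    then have x': "dist x' x < \<delta>0" by (simp add: dist_norm)
    then have x'X: "x' \<in> X" using \<delta>0 r by (auto simp: subset_eq dist_commute)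
    obtain w where w: "\<And>n. w n \<in> Y" "w \<longlonglongrightarrow> y" using y closure_sequential by metis
    have wc: "w n \<in> closure Y" for n using w(1) closure_subset by blast
    have lim: "(\<lambda>n. \<Phi> (z, w n)) \<longlonglongrightarrow> \<Phi> (z, y)" if "z \<in> X" for z
      by (rule continuous_on_tendsto_compose[OF \<Phi>]) (use that y wc w in \<open>auto intro!: tendsto_intros always_eventually\<close>)
    have "(\<lambda>n. \<bar>\<Phi> (x', w n) - \<Phi> (x, w n) - (\<Sum>i\<in>UNIV. (x' - x) $ i * \<Psi> i (x, y))\<bar>) \<longlonglongrightarrow>
       \<bar>\<Phi> (x', y) - \<Phi> (x, y) - (\<Sum>i\<in>UNIV. (x' - x) $ i * \<Psi> i (x, y))\<bar>"
      by (intro tendsto_intros lim x x'X)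
    moreover have "eventually (\<lambda>n. dist (w n) y < \<delta>0) sequentially" using w(2) \<delta>0(1) by (rule tendstoD)
    then have "eventually (\<lambda>n. \<bar>\<Phi> (x', w n) - \<Phi> (x, w n) - (\<Sum>i\<in>UNIV. (x' - x) $ i * \<Psi> i (x, y))\<bar> \<le> e * norm (x' - x)) sequentially"
      by eventually_elim (use bound x' w in blast)
    ultimately show "norm (\<Phi> (x', y) - \<Phi> (x, y) - (\<Sum>i\<in>UNIV. (x' - x) $ i * \<Psi> i (x, y))) \<le> e * norm (x' - x)"
      unfolding real_norm_def by (rule tendsto_upperbound) simp
  qed
qed

section \<open>Gradients of the preference function up to the boundary\<close>

lemma grad_eqI: "GDERIV f x :> D \<Longrightarrow> grad f x = (D :: 'a::real_inner)"
proof -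
  assume D: "GDERIV f x :> D"
  have "D' = D" if "GDERIV f x :> D'" for D'
  proof -
    have "(\<lambda>h. h \<bullet> D') = (\<lambda>h. h \<bullet> D)" using D that unfolding gderiv_def by (rule has_derivative_unique[rotated])
    then have "(D' - D) \<bullet> D' = (D' - D) \<bullet> D" by meson
    then have "(D' - D) \<bullet> (D' - D) = 0" by (simp add: inner_diff_right)
    then show ?thesis by simp
  qed
  then show ?thesis unfolding grad_def using D by blast
qed

context
  fixes E :: "('n::finite + 'n) list \<Rightarrow> (real^'n) \<times> (real^'n) \<Rightarrow> real" and X Y b
  assumes E: "partials_of E X Y b" and XY: "open X" "open Y"
begin

lemma partials_continuous: "length \<alpha> \<le> 4 \<Longrightarrow> continuous_on (closure X \<times> closure Y) (E \<alpha>)"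
  using E by (auto simp: partials_of_def)

lemma partials_b: "E [] (x, y) = b x y"
  using E by (auto simp: partials_of_def)

lemma partials_derivative:
  "length \<alpha> < 4 \<Longrightarrow> x \<in> X \<Longrightarrow> y \<in> Y \<Longrightarrow>
    (E \<alpha> has_derivative (\<lambda>(h, k). (\<Sum>i\<in>UNIV. h $ i * E (\<alpha> @ [Inl i]) (x, y))
           + (\<Sum>j\<in>UNIV. k $ j * E (\<alpha> @ [Inr j]) (x, y)))) (at (x, y))"
  using E by (auto simp: partials_of_def)

lemma partials_x:
  assumes "length \<alpha> < 4" "x \<in> X" "y \<in> closure Y"
  shows "((\<lambda>x. E \<alpha> (x, y)) has_derivative (\<lambda>h. \<Sum>i\<in>UNIV. h $ i * E (\<alpha> @ [Inl i]) (x, y))) (at x)"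
proof (rule partial_derivative_closure[OF XY(1), of Y "E \<alpha>" "\<lambda>i. E (\<alpha> @ [Inl i])", OF _ _ _ assms(2,3)])
  have sub: "X \<times> closure Y \<subseteq> closure X \<times> closure Y" using closure_subset by blast
  show "continuous_on (X \<times> closure Y) (E \<alpha>)" "continuous_on (X \<times> closure Y) (E (\<alpha> @ [Inl i]))" for i
    using partials_continuous[of \<alpha>] partials_continuous[of "\<alpha> @ [Inl i]"] assms(1) continuous_on_subset[OF _ sub] by auto
  fix x y assume xy: "x \<in> X" "y \<in> Y"
  have "((\<lambda>x. (x, y)) has_derivative (\<lambda>h. (h, 0))) (at x)" by (auto intro!: derivative_eq_intros)
  from has_derivative_compose[OF this partials_derivative[OF assms(1) xy]]
  show "((\<lambda>x. E \<alpha> (x, y)) has_derivative (\<lambda>h. \<Sum>i\<in>UNIV. h $ i * E (\<alpha> @ [Inl i]) (x, y))) (at x)" by simp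
qed

lemma partials_y:
  assumes "length \<alpha> < 4" "x \<in> closure X" "y \<in> Y"
  shows "((\<lambda>y. E \<alpha> (x, y)) has_derivative (\<lambda>h. \<Sum>i\<in>UNIV. h $ i * E (\<alpha> @ [Inr i]) (x, y))) (at y)"
proof -
  have "((\<lambda>y. (\<lambda>(y, x). E \<alpha> (x, y)) (y, x)) has_derivative
     (\<lambda>h. \<Sum>i\<in>UNIV. h $ i * (\<lambda>i (y, x). E (\<alpha> @ [Inr i]) (x, y)) i (y, x))) (at y)"
  proof (rule partial_derivative_closure[OF XY(2) _ _ _ assms(3,2)])
    have co: "continuous_on (Y \<times> closure X) (\<lambda>(y, x). E \<beta> (x, y))" if "length \<beta> \<le> 4" for \<beta>
    proof -
      have "continuous_on (Y \<times> closure X) (\<lambda>z. E \<beta> (snd z, fst z))"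
        by (rule continuous_on_compose2[OF partials_continuous[OF that]])
           (auto intro!: continuous_intros intro: subsetD[OF closure_subset[of Y]])
      then show ?thesis by (simp add: case_prod_unfold)
    qed
    show "continuous_on (Y \<times> closure X) (\<lambda>(y, x). E \<alpha> (x, y))"
      "continuous_on (Y \<times> closure X) (\<lambda>(y, x). E (\<alpha> @ [Inr i]) (x, y))" for i
      using assms(1) by (auto intro!: co)
    fix y x assume xy: "y \<in> Y" "x \<in> X"
    have "((\<lambda>y. (x, y)) has_derivative (\<lambda>h. (0, h))) (at y)" by (auto intro!: derivative_eq_intros)
    from has_derivative_compose[OF this partials_derivative[OF assms(1) xy(2,1)]]
    show "((\<lambda>y. (\<lambda>(y, x). E \<alpha> (x, y)) (y, x)) has_derivative
     (\<lambda>h. \<Sum>i\<in>UNIV. h $ i * (\<lambda>i (y, x). E (\<alpha> @ [Inr i]) (x, y)) i (y, x))) (at y)" by simp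
  qed
  then show ?thesis by simp
qed

lemma partials_grad_x:
  assumes "x \<in> X" "y \<in> closure Y"
  shows "GDERIV (\<lambda>x. b x y) x :> (\<chi> i. E [Inl i] (x, y))"
  using partials_x[of "[]", OF _ assms] by (simp add: gderiv_def inner_vec_def partials_b)

lemma partials_grad_y:
  assumes "x \<in> closure X" "y \<in> Y"
  shows "GDERIV (\<lambda>y. b x y) y :> (\<chi> i. E [Inr i] (x, y))"
  using partials_y[of "[]", OF _ assms] by (simp add: gderiv_def inner_vec_def partials_b)

lemma closure_product_nontrivial:
  assumes "x \<in> closure X" "y \<in> closure Y"
  shows "at (x, y) within X \<times> Y \<noteq> bot"
proof -
  have "(x, y) \<in> closure (X \<times> Y)" using assms by (simp add: closure_Times)
  then have "(x, y) islimpt X \<times> Y"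
    using XY open_Times[of X Y] by (metis closure_def UnE interior_limit_point interior_open mem_Collect_eq)
  then show ?thesis by (simp add: trivial_limit_within)
qed

lemma Lim_partials:
  assumes "x \<in> closure X" "y \<in> closure Y"
    and g: "\<And>x y. x \<in> X \<Longrightarrow> y \<in> Y \<Longrightarrow> g (x, y) = (\<chi> i. E [\<iota> i] (x, y))"
  shows "Lim (at (x, y) within X \<times> Y) g = (\<chi> i. E [\<iota> i] (x, y))"
proof (rule tendsto_Lim[OF closure_product_nontrivial[OF assms(1,2)]])
  have "((\<lambda>z. \<chi> i. E [\<iota> i] z) \<longlongrightarrow> (\<chi> i. E [\<iota> i] (x, y))) (at (x, y) within X \<times> Y)"
  proof (rule tendsto_vec_lambda)
    fix i
    have "continuous_on (closure X \<times> closure Y) (E [\<iota> i])" by (rule partials_continuous) simp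
    then have "(E [\<iota> i] \<longlongrightarrow> E [\<iota> i] (x, y)) (at (x, y) within closure X \<times> closure Y)"
      using assms by (auto simp: continuous_on_def)
    then show "(E [\<iota> i] \<longlongrightarrow> E [\<iota> i] (x, y)) (at (x, y) within X \<times> Y)"
      by (rule tendsto_within_subset) (use closure_subset in blast)
  qed
  moreover have "eventually (\<lambda>z. (\<chi> i. E [\<iota> i] z) = g z) (at (x, y) within X \<times> Y)"
    unfolding eventually_at_filter by (rule always_eventually) (use g in auto)
  ultimately show "(g \<longlongrightarrow> (\<chi> i. E [\<iota> i] (x, y))) (at (x, y) within X \<times> Y)"
    by (rule Lim_transform_eventually)
qed

lemma Dx_partials:
  assumes "x \<in> closure X" "y \<in> closure Y"
  shows "Dx X Y b x y = (\<chi> i. E [Inl i] (x, y))"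
  unfolding Dx_def
proof (rule Lim_partials[OF assms])
  fix x y assume "x \<in> X" "y \<in> Y"
  then have "GDERIV (\<lambda>z. b z y) x :> (\<chi> i. E [Inl i] (x, y))"
    using closure_subset by (intro partials_grad_x) auto
  then show "(\<lambda>(x', y'). grad (\<lambda>z. b z y') x') (x, y) = (\<chi> i. E [Inl i] (x, y))"
    by (simp add: grad_eqI)
qed

lemma Dy_partials:
  assumes "x \<in> closure X" "y \<in> closure Y"
  shows "Dy X Y b x y = (\<chi> i. E [Inr i] (x, y))"
  unfolding Dy_def
proof (rule Lim_partials[OF assms])
  fix x y assume "x \<in> X" "y \<in> Y"
  then have "GDERIV (\<lambda>z. b x z) y :> (\<chi> i. E [Inr i] (x, y))"
    using closure_subset by (intro partials_grad_y) auto
  then show "(\<lambda>(x', y'). grad (\<lambda>z. b x' z) y') (x, y) = (\<chi> i. E [Inr i] (x, y))"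
    by (simp add: grad_eqI)
qed

end


section \<open>Curves whose image is a segment\<close>

text \<open>Near \<open>z\<close> the first factor is of the order of the increment and the second
  tends to 0. No derivative of \<open>g\<close> is required, which is what allows an implicitly
  given function to be differentiated below.\<close>

lemma has_derivative_mult_zero:
  fixes f g :: "'a::real_normed_vector \<Rightarrow> real"
  assumes f: "(f has_derivative f') (at z)" "f z = 0" and g: "isCont g z" "g z = 0"
  shows "((\<lambda>z. f z * g z) has_derivative (\<lambda>h. 0)) (at z)"
  unfolding has_derivative_at_alt
proof (intro conjI allI impI)
  fix e :: real assume e: "e > 0"
  have bl: "bounded_linear f'" using f(1) by (rule has_derivative_bounded_linear)
  obtain K where K: "K > 0" "\<And>h. norm (f' h) \<le> norm h * K" using bounded_linear.pos_bounded[OF bl] by blast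
  obtain d1 where d1: "d1 > 0" "\<And>y. norm (y - z) < d1 \<Longrightarrow> norm (f y - f z - f' (y - z)) \<le> 1 * norm (y - z)"
    using f(1) unfolding has_derivative_at_alt by (metis zero_less_one)
  have "e / (K + 1) > 0" using e K by simp
  then obtain d2 where d2: "d2 > 0" "\<And>y. dist y z < d2 \<Longrightarrow> dist (g y) (g z) < e / (K + 1)"
    using g(1) unfolding continuous_at_eps_delta by (meson dist_commute)
  show "\<exists>d>0. \<forall>y. norm (y - z) < d \<longrightarrow> norm (f y * g y - f z * g z - 0) \<le> e * norm (y - z)"
  proof (intro exI[of _ "min d1 d2"] conjI allI impI)
    fix y assume y: "norm (y - z) < min d1 d2"
    have "\<bar>f y\<bar> \<le> norm (f y - f z - f' (y - z)) + norm (f' (y - z))"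
      using f(2) by simp
    also have "\<dots> \<le> (K + 1) * norm (y - z)" using d1(2)[of y] K(2)[of "y - z"] y by (simp add: algebra_simps)
    finally have 1: "\<bar>f y\<bar> \<le> (K + 1) * norm (y - z)" .
    have 2: "\<bar>g y\<bar> \<le> e / (K + 1)" using d2(2)[of y] y g(2) by (simp add: dist_norm)
    have "\<bar>f y\<bar> * \<bar>g y\<bar> \<le> ((K + 1) * norm (y - z)) * (e / (K + 1))" using 1 2 K by (intro mult_mono) auto
    also have "\<dots> = e * norm (y - z)" using K by simp
    finally show "norm (f y * g y - f z * g z - 0) \<le> e * norm (y - z)" using f(2) by (simp add: abs_mult)
  qed (use d1 d2 in auto)
qed simp

lemma has_derivative_vec_iff:
  fixes f :: "'a::real_normed_vector \<Rightarrow> real^'n"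
  shows "(f has_derivative f') (at a) \<longleftrightarrow> (\<forall>i. ((\<lambda>x. f x $ i) has_derivative (\<lambda>x. f' x $ i)) (at a))"
  by (subst has_derivative_componentwise_within)
     (auto simp: Basis_vec_def inner_axis)

lemma has_real_derivative_compose_curve:
  fixes f :: "'a::real_normed_vector \<Rightarrow> real" and c :: "real \<Rightarrow> 'a"
  assumes c: "(c has_derivative (\<lambda>h. h *\<^sub>R c')) (at s)" and f: "(f has_derivative f') (at (c s))"
  shows "((\<lambda>s. f (c s)) has_real_derivative f' c') (at s)"
proof -
  have "linear f'" using f has_derivative_linear by blast
  then have "f' (h *\<^sub>R c') = f' c' * h" for h by (simp add: linear_scale)
  then show ?thesis using has_derivative_compose[OF c f] by (simp add: has_field_derivative_def)
qed

text \<open>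
  If \<open>A w *v W w = r w\<close> with \<open>A\<close>, \<open>r\<close> differentiable and \<open>W\<close> merely continuous at \<open>z\<close>, then
  \<open>W\<close> is differentiable at \<open>z\<close>: the error term \<open>(A w - A z) *v (W w - W z)\<close> is of higher order.
\<close>

lemma implicit_derivative:
  fixes A :: "'z::real_normed_vector \<Rightarrow> real^'n^'n" and W r :: "'z \<Rightarrow> real^'n"
  assumes A: "\<And>j i. ((\<lambda>z. A z $ j $ i) has_derivative (\<lambda>h. dA h $ j $ i)) (at z)"
    and r: "(r has_derivative dr) (at z)" and W: "isCont W z"
    and eq: "eventually (\<lambda>w. A w *v W w = r w) (at z)" and eq0: "A z *v W z = r z"
    and B: "bounded_linear B" "\<And>w. B (A z *v w) = w"
  shows "(W has_derivative (\<lambda>h. B (dr h - dA h *v W z))) (at z)"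
proof -
  \<comment> \<open>Wherever the equation holds, \<open>R w\<close> equals
    \<open>A z *v (W w - W z)\<close>; yet in the form chosen here \<open>W w\<close> occurs only in
    a product of two factors that vanish at \<open>z\<close>.\<close>
  define R where "R w = r w - r z - (A w - A z) *v W z - (A w - A z) *v (W w - W z)" for w
  have "(R has_derivative (\<lambda>h. dr h - dA h *v W z)) (at z)"
    unfolding has_derivative_vec_iff
  proof
    fix j
    have 1: "((\<lambda>w. r w $ j) has_derivative (\<lambda>h. dr h $ j)) (at z)"
      using r unfolding has_derivative_vec_iff by blast
    have 2: "((\<lambda>w. \<Sum>i\<in>UNIV. (A w $ j $ i - A z $ j $ i) * W z $ i) has_derivative (\<lambda>h. \<Sum>i\<in>UNIV. dA h $ j $ i * W z $ i)) (at z)"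
      by (auto intro!: derivative_eq_intros A)
    have 3: "((\<lambda>w. \<Sum>i\<in>UNIV. (A w $ j $ i - A z $ j $ i) * (W w $ i - W z $ i)) has_derivative (\<lambda>h. \<Sum>i\<in>(UNIV::'n set). 0)) (at z)"
    proof (intro has_derivative_sum has_derivative_mult_zero)
      show "((\<lambda>w. A w $ j $ i - A z $ j $ i) has_derivative (\<lambda>h. dA h $ j $ i)) (at z)" for i
        by (auto intro!: derivative_eq_intros A)
      show "isCont (\<lambda>w. W w $ i - W z $ i) z" for i
        by (intro continuous_intros W)
    qed auto
    have "((\<lambda>w. r w $ j - r z $ j - (\<Sum>i\<in>UNIV. (A w $ j $ i - A z $ j $ i) * W z $ i)
       - (\<Sum>i\<in>UNIV. (A w $ j $ i - A z $ j $ i) * (W w $ i - W z $ i)))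
       has_derivative (\<lambda>h. dr h $ j - 0 - (\<Sum>i\<in>UNIV. dA h $ j $ i * W z $ i) - (\<Sum>i\<in>(UNIV::'n set). 0))) (at z)"
      by (intro has_derivative_diff 1 2 3 has_derivative_const)
    then show "((\<lambda>w. R w $ j) has_derivative (\<lambda>h. (dr h - dA h *v W z) $ j)) (at z)"
      by (simp add: R_def matrix_vector_mult_def)
  qed
  then have "((\<lambda>w. W z + B (R w)) has_derivative (\<lambda>h. 0 + B (dr h - dA h *v W z))) (at z)"
    by (intro has_derivative_add has_derivative_const bounded_linear.has_derivative[OF B(1)])
  then have D: "((\<lambda>w. W z + B (R w)) has_derivative (\<lambda>h. B (dr h - dA h *v W z))) (at z)" by simp
  have B0: "B 0 = 0" using B(1) by (simp add: bounded_linear.linear linear_0)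
  have RW: "R w = A z *v (W w - W z)" if "A w *v W w = r w" for w
    using that eq0 by (simp add: R_def matrix_vector_mult_diff_distrib matrix_vector_mult_diff_rdistrib)
  have "eventually (\<lambda>w. W z + B (R w) = W w) (at z)"
    using eq by eventually_elim (simp add: RW B(2))
  moreover have "W z + B (R z) = W z" by (simp add: R_def B0)
  ultimately show ?thesis using has_derivative_transform_eventually[OF D] by auto
qed

text \<open>Velocity and acceleration are carried as explicit functions. Continuity of the
  acceleration is demanded because the exchange of mixed derivatives needs continuous derivatives of
  total order up to four, two of them along each curve.\<close>

definition C2_curve :: "real set \<Rightarrow> (real \<Rightarrow> real^'n) \<Rightarrow> (real \<Rightarrow> real^'n) \<Rightarrow> (real \<Rightarrow> real^'n) \<Rightarrow> (real^'n) set \<Rightarrow> bool" where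
  "C2_curve I \<xi> \<xi>1 \<xi>2 S \<longleftrightarrow> open I \<and> continuous_on I \<xi>2 \<and>
     (\<forall>s\<in>I. \<xi> s \<in> S \<and> (\<xi> has_derivative (\<lambda>h. h *\<^sub>R \<xi>1 s)) (at s) \<and> (\<xi>1 has_derivative (\<lambda>h. h *\<^sub>R \<xi>2 s)) (at s))"

text \<open>This serves both coordinates, \<open>x\<close> to \<open>D_y b(x, y)\<close> and
  \<open>y\<close> to \<open>D_x b(x, y)\<close>. \<open>A\<close> is the Jacobian and
  \<open>T\<close> holds its partial derivatives; of the inverse only first derivatives are assumed,
  and second-order information comes from \<open>T\<close>.\<close>

locale C2_diffeo =
  fixes S :: "(real^'n) set" and F :: "real^'n \<Rightarrow> real^'n" and A :: "real^'n \<Rightarrow> real^'n^'n"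
    and T :: "'n \<Rightarrow> 'n \<Rightarrow> 'n \<Rightarrow> real^'n \<Rightarrow> real"
  assumes S: "open S"
    and F_derivative: "\<And>x. x \<in> S \<Longrightarrow> (F has_derivative (\<lambda>h. A x *v h)) (at x)"
    and A_derivative: "\<And>x j i. x \<in> S \<Longrightarrow> ((\<lambda>x. A x $ j $ i) has_derivative (\<lambda>h. \<Sum>k\<in>UNIV. h $ k * T j i k x)) (at x)"
    and T_continuous: "\<And>j i k. continuous_on S (T j i k)"
    and diffeo: "diffeo_onto_range S F"
begin

definition G where "G = inv_into (closure S) F"
definition G' where "G' q = frechet_derivative G (at q)"

lemma inj_F: "inj_on F (closure S)" and F_continuous: "continuous_on (closure S) F"
  and G_continuous: "continuous_on (closure (F ` S)) G" and G_ext: "extends_Ck 1 (F ` S) G"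
  using diffeo by (auto simp: diffeo_onto_range_def Ck_closure_def G_def)

lemma G_F: "x \<in> closure S \<Longrightarrow> G (F x) = x"
  unfolding G_def by (rule inv_into_f_f[OF inj_F])

lemma F_G: "q \<in> F ` S \<Longrightarrow> F (G q) = q" and G_in: "q \<in> F ` S \<Longrightarrow> G q \<in> S"
  using G_F closure_subset[of S] by auto

lemma open_image: "open (F ` S)"
proof (rule invariance_of_domain)
  show "continuous_on S F" using F_continuous closure_subset continuous_on_subset by blast
  show "inj_on F S" using inj_F closure_subset inj_on_subset by blast
qed (rule S)

lemma G_derivative: "q \<in> F ` S \<Longrightarrow> (G has_derivative G' q) (at q)"
  using G_ext by (auto simp: G'_def frechet_derivative_works[symmetric])

lemma linear_G': "q \<in> F ` S \<Longrightarrow> bounded_linear (G' q)"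
  using G_derivative has_derivative_bounded_linear by blast

lemma G'_extension: "\<exists>g. continuous_on (closure (F ` S)) g \<and> (\<forall>q\<in>F ` S. g q = G' q v)"
  using G_ext by (auto simp: G'_def)

lemma G'_continuous: "continuous_on (F ` S) (\<lambda>q. G' q v)"
proof -
  obtain g where "continuous_on (closure (F ` S)) g" "\<forall>q\<in>F ` S. g q = G' q v" using G'_extension by blast
  then show ?thesis using continuous_on_subset[OF _ closure_subset] by (metis (no_types, lifting) continuous_on_cong)
qed

lemma G'_A: assumes x: "x \<in> S" shows "G' (F x) (A x *v w) = w"
proof -
  have "((\<lambda>x. G (F x)) has_derivative (\<lambda>h. G' (F x) (A x *v h))) (at x)"
    by (rule has_derivative_compose[OF F_derivative G_derivative]) (use x in auto)
  moreover have "((\<lambda>x. G (F x)) has_derivative (\<lambda>h. h)) (at x)"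
    by (rule has_derivative_transform_within_open[OF has_derivative_ident S x])
       (simp add: G_F[OF subsetD[OF closure_subset]])
  ultimately have "(\<lambda>h. G' (F x) (A x *v h)) = (\<lambda>h. h)" by (rule has_derivative_unique)
  then show ?thesis by meson
qed

lemma A_G': assumes q: "q \<in> F ` S" shows "A (G q) *v G' q v = v"
proof -
  have "((\<lambda>q. F (G q)) has_derivative (\<lambda>h. A (G q) *v G' q h)) (at q)"
    by (rule has_derivative_compose[OF G_derivative F_derivative]) (use q G_in in auto)
  moreover have "((\<lambda>q. F (G q)) has_derivative (\<lambda>h. h)) (at q)"
    by (rule has_derivative_transform_within_open[OF has_derivative_ident open_image q]) (use F_G in auto)
  ultimately have "(\<lambda>h. A (G q) *v G' q h) = (\<lambda>h. h)" by (rule has_derivative_unique)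
  then show ?thesis by meson
qed

lemma G'_expand: assumes q: "q \<in> F ` S" shows "G' q v = (\<Sum>i\<in>UNIV. v $ i *\<^sub>R G' q (axis i 1))"
proof -
  have l: "linear (G' q)" using linear_G'[OF q] by (rule bounded_linear.linear)
  have "G' q v = G' q (\<Sum>i\<in>UNIV. v $ i *s axis i 1)" by (simp only: basis_expansion)
  also have "\<dots> = (\<Sum>i\<in>UNIV. v $ i *\<^sub>R G' q (axis i 1))"
    using l by (simp add: linear_sum linear_scale scalar_mult_eq_scaleR)
  finally show ?thesis .
qed

lemma G'_continuous_compose:
  assumes "continuous_on D q" "continuous_on D v" "\<And>z. z \<in> D \<Longrightarrow> q z \<in> F ` S"
  shows "continuous_on D (\<lambda>z. G' (q z) (v z))"
proof -
  have "continuous_on D (\<lambda>z. \<Sum>i\<in>UNIV. v z $ i *\<^sub>R G' (q z) (axis i 1))"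
    by (intro continuous_intros assms continuous_on_compose2[OF G'_continuous]) (use assms in auto)
  then show ?thesis using G'_expand assms(3) by (simp cong: continuous_on_cong)
qed

text \<open>The preimage of a segment is twice differentiable although the inverse is only known to
  be C^1: its velocity solves \<open>A (\<zeta> s) *v \<zeta>1 s = v\<close>, and
  \<open>implicit_derivative\<close> differentiates this equation.\<close>

lemma C2_segment:
  assumes J: "open J" and q: "\<And>s. s \<in> J \<Longrightarrow> q + s *\<^sub>R v \<in> F ` S"
  obtains \<zeta>2 where "C2_curve J (\<lambda>s. G (q + s *\<^sub>R v)) (\<lambda>s. G' (q + s *\<^sub>R v) v) \<zeta>2 S"
proof -
  define \<zeta> where "\<zeta> s = G (q + s *\<^sub>R v)" for s
  define \<zeta>1 where "\<zeta>1 s = G' (q + s *\<^sub>R v) v" for s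
  define dA where "dA s = (\<chi> j i. \<Sum>k\<in>UNIV. \<zeta>1 s $ k * T j i k (\<zeta> s))" for s
  define \<zeta>2 where "\<zeta>2 s = - G' (q + s *\<^sub>R v) (dA s *v \<zeta>1 s)" for s
  have line: "((\<lambda>s. q + s *\<^sub>R v) has_derivative (\<lambda>h. h *\<^sub>R v)) (at s)" for s
    by (auto intro!: derivative_eq_intros)
  have lc: "continuous_on J (\<lambda>s. q + s *\<^sub>R v)" by (intro continuous_intros)
  have in_S: "\<zeta> s \<in> S" if "s \<in> J" for s using G_in q that by (simp add: \<zeta>_def)
  have d1: "(\<zeta> has_derivative (\<lambda>h. h *\<^sub>R \<zeta>1 s)) (at s)" if s: "s \<in> J" for s
  proof -
    have "(\<zeta> has_derivative (\<lambda>h. G' (q + s *\<^sub>R v) (h *\<^sub>R v))) (at s)"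
      unfolding \<zeta>_def[abs_def] by (rule has_derivative_compose[OF line G_derivative[OF q[OF s]]])
    then show ?thesis
      using bounded_linear.linear[OF linear_G'[OF q[OF s]]] by (simp add: linear_scale \<zeta>1_def)
  qed
  have c1: "continuous_on J \<zeta>1" unfolding \<zeta>1_def[abs_def]
  proof (rule G'_continuous_compose)
    show "continuous_on J (\<lambda>s. q + s *\<^sub>R v)" by (rule lc)
    show "continuous_on J (\<lambda>s. v)" by (rule continuous_on_const)
    show "q + s *\<^sub>R v \<in> F ` S" if "s \<in> J" for s using that by (rule q)
  qed
  have c0: "continuous_on J \<zeta>"
    by (rule has_derivative_continuous_on) (rule has_derivative_at_withinI[OF d1])
  have cdA: "continuous_on J dA" unfolding dA_def[abs_def]
    by (intro continuous_intros c1 continuous_on_compose2[OF T_continuous c0]) (use in_S in auto)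
  have c2: "continuous_on J \<zeta>2"
  proof -
    have "continuous_on J (\<lambda>s. dA s *v \<zeta>1 s)" unfolding matrix_vector_mult_def
      by (intro continuous_intros c1 cdA)
    then show ?thesis unfolding \<zeta>2_def[abs_def] by (rule continuous_on_minus[OF G'_continuous_compose[OF lc _ q]])
  qed
  have d2: "(\<zeta>1 has_derivative (\<lambda>h. h *\<^sub>R \<zeta>2 s)) (at s)" if s: "s \<in> J" for s
  proof -
    have l: "linear (G' (q + s *\<^sub>R v))" using linear_G'[OF q[OF s]] by (rule bounded_linear.linear)
    have "(\<zeta>1 has_derivative (\<lambda>h. G' (q + s *\<^sub>R v) (0 - (h *\<^sub>R dA s) *v \<zeta>1 s))) (at s)"
    proof (rule implicit_derivative[where A="\<lambda>s. A (\<zeta> s)" and r="\<lambda>s. v"])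
      fix j i
      have "((\<lambda>s. A (\<zeta> s) $ j $ i) has_derivative (\<lambda>h. \<Sum>k\<in>UNIV. (h *\<^sub>R \<zeta>1 s) $ k * T j i k (\<zeta> s))) (at s)"
        by (rule has_derivative_compose[OF d1[OF s] A_derivative[OF in_S[OF s]]])
      then show "((\<lambda>s. A (\<zeta> s) $ j $ i) has_derivative (\<lambda>h. (h *\<^sub>R dA s) $ j $ i)) (at s)"
        by (simp add: dA_def sum_distrib_left mult.assoc)
    next
      show "isCont \<zeta>1 s" using c1 J s by (simp add: continuous_on_eq_continuous_at)
      show "eventually (\<lambda>w. A (\<zeta> w) *v \<zeta>1 w = v) (at s)"
        using eventually_at_in_open'[OF J s]
        by eventually_elim (use A_G' q in \<open>simp add: \<zeta>_def \<zeta>1_def\<close>)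
      show "A (\<zeta> s) *v \<zeta>1 s = v" using A_G' q s by (simp add: \<zeta>_def \<zeta>1_def)
      show "bounded_linear (G' (q + s *\<^sub>R v))" by (rule linear_G'[OF q[OF s]])
      show "G' (q + s *\<^sub>R v) (A (\<zeta> s) *v w) = w" for w
        using G'_A[OF in_S[OF s], of w] F_G[OF q[OF s]] by (simp add: \<zeta>_def)
    qed simp
    moreover have "G' (q + s *\<^sub>R v) (0 - (h *\<^sub>R dA s) *v \<zeta>1 s) = h *\<^sub>R \<zeta>2 s" for h
      using l by (simp add: \<zeta>2_def scaleR_matrix_vector_assoc[symmetric] linear_neg linear_scale)
    ultimately show ?thesis by simp
  qed
  have "C2_curve J \<zeta> \<zeta>1 \<zeta>2 S"
    unfolding C2_curve_def using J c2 in_S d1 d2 by blast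
  then show ?thesis using that unfolding \<zeta>_def[abs_def] \<zeta>1_def[abs_def] by blast
qed

end


section \<open>Convexity from cross-curvature\<close>

text \<open>Schwarz's theorem in a one-sided form: one mixed derivative exists and is continuous,
  and the other one is obtained. The double difference equals \<open>h * k\<close> times a nearby
  value of \<open>Fst\<close> by two mean value steps, and then \<open>k\<close> tends to 0 before
  \<open>h\<close>.\<close>

lemma mixed_partial_swap:
  fixes F Fs Ft Fst :: "real \<Rightarrow> real \<Rightarrow> real"
  assumes I: "open I" and J: "open J"
    and s: "\<And>s t. s \<in> I \<Longrightarrow> t \<in> J \<Longrightarrow> ((\<lambda>s. F s t) has_real_derivative Fs s t) (at s)"
    and t: "\<And>s t. s \<in> I \<Longrightarrow> t \<in> J \<Longrightarrow> ((\<lambda>t. F s t) has_real_derivative Ft s t) (at t)"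
    and st: "\<And>s t. s \<in> I \<Longrightarrow> t \<in> J \<Longrightarrow> ((\<lambda>t. Fs s t) has_real_derivative Fst s t) (at t)"
    and c: "continuous_on (I \<times> J) (\<lambda>(s, t). Fst s t)"
    and s0: "s0 \<in> I" and t0: "t0 \<in> J"
  shows "((\<lambda>s. Ft s t0) has_real_derivative Fst s0 t0) (at s0)"
proof -
  have main: "\<exists>d>0. \<forall>h. h \<noteq> 0 \<longrightarrow> \<bar>h\<bar> < d \<longrightarrow> \<bar>(Ft (s0 + h) t0 - Ft s0 t0) / h - Fst s0 t0\<bar> \<le> e" if e: "e > 0" for e
  proof -
    obtain d0 where d0: "d0 > 0" "\<And>z. z \<in> I \<times> J \<Longrightarrow> dist z (s0, t0) < d0 \<Longrightarrow> \<bar>(\<lambda>(s, t). Fst s t) z - Fst s0 t0\<bar> < e"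
      using c s0 t0 e unfolding continuous_on_iff dist_real_def by force
    obtain d1 where d1: "d1 > 0" "ball s0 d1 \<subseteq> I" using I s0 open_contains_ball by blast
    obtain d2 where d2: "d2 > 0" "ball t0 d2 \<subseteq> J" using J t0 open_contains_ball by blast
    define d where "d = min (d0 / 2) (min d1 d2)"
    have d: "d > 0" using d0 d1 d2 by (simp add: d_def)
    have inI: "x \<in> I" if "\<bar>x - s0\<bar> < d" for x using that d1 by (auto simp: d_def dist_real_def subset_eq abs_minus_commute)
    have inJ: "x \<in> J" if "\<bar>x - t0\<bar> < d" for x using that d2 by (auto simp: d_def dist_real_def subset_eq abs_minus_commute)
    have near: "\<bar>Fst x y - Fst s0 t0\<bar> < e" if "\<bar>x - s0\<bar> < d" "\<bar>y - t0\<bar> < d" for x y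
    proof -
      have "dist (x, y) (s0, t0) \<le> dist x s0 + dist y t0"
        unfolding dist_Pair_Pair by (rule sqrt_sum_squares_le_sum) auto
      then have "dist (x, y) (s0, t0) < d0" using that unfolding d_def dist_real_def by linarith
      then show ?thesis using d0(2)[of "(x, y)"] inI inJ that by auto
    qed
    have mvt: "\<exists>z. \<bar>z - a\<bar> \<le> \<bar>h\<bar> \<and> g (a + h) - g a = h * g' z"
      if "h \<noteq> 0" and D: "\<And>z. \<bar>z - a\<bar> \<le> \<bar>h\<bar> \<Longrightarrow> (g has_real_derivative g' z) (at z)" for g g' :: "real \<Rightarrow> real" and a h
    proof (cases "h > 0")
      case True
      then obtain z where "a < z" "z < a + h" "g (a + h) - g a = (a + h - a) * g' z"
        using MVT2[of a "a + h" g g'] D by (auto simp: abs_if split: if_splits)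
      then show ?thesis by (intro exI[of _ z]) auto
    next
      case False
      then have "h < 0" using that by simp
      then obtain z where "a + h < z" "z < a" "g a - g (a + h) = (a - (a + h)) * g' z"
        using MVT2[of "a + h" a g g'] D by (auto simp: abs_if split: if_splits)
      then show ?thesis by (intro exI[of _ z]) (auto simp: algebra_simps)
    qed
    have "\<bar>(Ft (s0 + h) t0 - Ft s0 t0) / h - Fst s0 t0\<bar> \<le> e" if h: "h \<noteq> 0" "\<bar>h\<bar> < d" for h
    proof -
      have quot: "\<bar>((F (s0 + h) (t0 + k) - F s0 (t0 + k)) - (F (s0 + h) t0 - F s0 t0)) / k / h - Fst s0 t0\<bar> \<le> e"
        if k: "k \<noteq> 0" "\<bar>k\<bar> < d" for k
      proof -
        have "\<exists>z. \<bar>z - s0\<bar> \<le> \<bar>h\<bar> \<and> (F (s0 + h) (t0 + k) - F (s0 + h) t0) - (F s0 (t0 + k) - F s0 t0)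
            = h * (Fs z (t0 + k) - Fs z t0)"
          by (rule mvt[of h s0 "\<lambda>s. F s (t0 + k) - F s t0"])
             (use h k d inI inJ in \<open>auto intro!: DERIV_diff s\<close>)
        then obtain z where z: "\<bar>z - s0\<bar> \<le> \<bar>h\<bar>" "(F (s0 + h) (t0 + k) - F (s0 + h) t0) - (F s0 (t0 + k) - F s0 t0)
            = h * (Fs z (t0 + k) - Fs z t0)" by blast
        have "\<exists>w. \<bar>w - t0\<bar> \<le> \<bar>k\<bar> \<and> Fs z (t0 + k) - Fs z t0 = k * Fst z w"
          by (rule mvt[of k t0 "\<lambda>t. Fs z t"]) (use k h z d inI inJ in \<open>auto intro!: st\<close>)
        then obtain w where w: "\<bar>w - t0\<bar> \<le> \<bar>k\<bar>" "Fs z (t0 + k) - Fs z t0 = k * Fst z w" by blast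
        have "(F (s0 + h) (t0 + k) - F s0 (t0 + k)) - (F (s0 + h) t0 - F s0 t0) = h * (k * Fst z w)"
          using z(2) w(2) by (simp add: algebra_simps)
        then have "((F (s0 + h) (t0 + k) - F s0 (t0 + k)) - (F (s0 + h) t0 - F s0 t0)) / k / h = Fst z w"
          using h k by simp
        then show ?thesis using near[of z w] z w h k by simp
      qed
      have "((\<lambda>k. ((F (s0 + h) (t0 + k) - F (s0 + h) t0) / k - (F s0 (t0 + k) - F s0 t0) / k) / h) \<longlongrightarrow> (Ft (s0 + h) t0 - Ft s0 t0) / h) (at 0)"
        using t[of "s0 + h" t0] t[of s0 t0] inI[of "s0 + h"] h s0 t0 d
        by (intro tendsto_intros) (auto simp: DERIV_def)
      then have lim: "((\<lambda>k. \<bar>((F (s0 + h) (t0 + k) - F (s0 + h) t0) / k - (F s0 (t0 + k) - F s0 t0) / k) / h - Fst s0 t0\<bar>)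
          \<longlongrightarrow> \<bar>(Ft (s0 + h) t0 - Ft s0 t0) / h - Fst s0 t0\<bar>) (at 0)"
        by (rule tendsto_rabs[OF tendsto_diff[OF _ tendsto_const]])
      have "eventually (\<lambda>k. \<bar>((F (s0 + h) (t0 + k) - F (s0 + h) t0) / k - (F s0 (t0 + k) - F s0 t0) / k) / h - Fst s0 t0\<bar> \<le> e) (at 0)"
        unfolding eventually_at
      proof (intro exI[of _ d] conjI ballI impI d)
        fix k :: real assume k: "k \<noteq> 0 \<and> dist k 0 < d"
        have "((F (s0 + h) (t0 + k) - F (s0 + h) t0) / k - (F s0 (t0 + k) - F s0 t0) / k) / h
          = ((F (s0 + h) (t0 + k) - F s0 (t0 + k)) - (F (s0 + h) t0 - F s0 t0)) / k / h"
          by (simp add: diff_divide_distrib)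
        then show "\<bar>((F (s0 + h) (t0 + k) - F (s0 + h) t0) / k - (F s0 (t0 + k) - F s0 t0) / k) / h - Fst s0 t0\<bar> \<le> e"
          using quot[of k] k by simp
      qed
      then show ?thesis using lim by (intro tendsto_upperbound[of _ _ "at (0::real)"]) auto
    qed
    then show ?thesis using d by blast
  qed
  have "((\<lambda>h. (Ft (s0 + h) t0 - Ft s0 t0) / h) \<longlongrightarrow> Fst s0 t0) (at 0)"
    unfolding LIM_eq
  proof (intro allI impI)
    fix r :: real assume "r > 0"
    then obtain d where "d > 0" "\<forall>h. h \<noteq> 0 \<longrightarrow> \<bar>h\<bar> < d \<longrightarrow> \<bar>(Ft (s0 + h) t0 - Ft s0 t0) / h - Fst s0 t0\<bar> \<le> r / 2"
      using main[of "r / 2"] by auto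
    then show "\<exists>s>0. \<forall>x. x \<noteq> 0 \<and> norm (x - 0) < s \<longrightarrow> norm ((Ft (s0 + x) t0 - Ft s0 t0) / x - Fst s0 t0) < r"
      using \<open>r > 0\<close> by (intro exI[of _ d]) force
  qed
  then show ?thesis by (simp add: DERIV_def)
qed

lemma deriv_deriv_eq:
  fixes f g g1 g2 :: "real \<Rightarrow> real"
  assumes I: "open I" "x \<in> I" and fg: "\<And>s. s \<in> I \<Longrightarrow> f s = g s"
    and g: "\<And>s. s \<in> I \<Longrightarrow> (g has_real_derivative g1 s) (at s)"
    and g1: "\<And>s. s \<in> I \<Longrightarrow> (g1 has_real_derivative g2 s) (at s)"
  shows "(deriv ^^ 2) f x = g2 x"
proof -
  have d: "deriv f s = g1 s" if s: "s \<in> I" for s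
    by (rule DERIV_imp_deriv, rule has_field_derivative_transform_within_open[OF g[OF s] I(1) s]) (simp add: fg)
  have "deriv (deriv f) x = g2 x"
    by (rule DERIV_imp_deriv, rule has_field_derivative_transform_within_open[OF g1[OF I(2)] I]) (simp add: d)
  then show ?thesis by (simp add: numeral_2_eq_2)
qed

lemma continuous_on_fst_curve: "continuous_on I f \<Longrightarrow> continuous_on (I \<times> J) (\<lambda>z. f (fst z))"
  and continuous_on_snd_curve: "continuous_on J g \<Longrightarrow> continuous_on (I \<times> J) (\<lambda>z. g (snd z))"
  by (rule continuous_on_compose2[where t=I]; auto intro!: continuous_intros)
     (rule continuous_on_compose2[where t=J]; auto intro!: continuous_intros)

lemma C2_curveD:
  assumes "C2_curve I \<xi> \<xi>1 \<xi>2 S"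
  shows "open I" "continuous_on I \<xi>" "continuous_on I \<xi>1" "continuous_on I \<xi>2"
    "\<And>s. s \<in> I \<Longrightarrow> \<xi> s \<in> S"
    "\<And>s. s \<in> I \<Longrightarrow> (\<xi> has_derivative (\<lambda>h. h *\<^sub>R \<xi>1 s)) (at s)"
    "\<And>s i. s \<in> I \<Longrightarrow> ((\<lambda>s. \<xi>1 s $ i) has_real_derivative \<xi>2 s $ i) (at s)"
proof -
  show "open I" "continuous_on I \<xi>2" "\<And>s. s \<in> I \<Longrightarrow> \<xi> s \<in> S"
    and d: "\<And>s. s \<in> I \<Longrightarrow> (\<xi> has_derivative (\<lambda>h. h *\<^sub>R \<xi>1 s)) (at s)"
    using assms by (auto simp: C2_curve_def)
  have d1: "\<And>s. s \<in> I \<Longrightarrow> (\<xi>1 has_derivative (\<lambda>h. h *\<^sub>R \<xi>2 s)) (at s)"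
    using assms by (auto simp: C2_curve_def)
  show "continuous_on I \<xi>" by (rule has_derivative_continuous_on) (rule has_derivative_at_withinI[OF d])
  show "continuous_on I \<xi>1" by (rule has_derivative_continuous_on) (rule has_derivative_at_withinI[OF d1])
  show "((\<lambda>s. \<xi>1 s $ i) has_real_derivative \<xi>2 s $ i) (at s)" if "s \<in> I" for s i
    using d1[OF that] unfolding has_derivative_vec_iff by (simp add: has_field_derivative_def mult_commute_abs)
qed

section \<open>Derivatives of the preference function along pairs of curves\<close>

locale bi_twisted =
  fixes X Y :: "(real^'n) set" and b :: "real^'n \<Rightarrow> real^'n \<Rightarrow> real"
    and E :: "('n + 'n) list \<Rightarrow> (real^'n) \<times> (real^'n) \<Rightarrow> real"
  assumes E: "partials_of E X Y b"
    and oX: "open X" and oY: "open Y" and bX: "bounded X" and bY: "bounded Y"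
    and twist: "bi_twist X Y b" and conv: "bi_convex X Y b" and ncc: "nonneg_cross_curvature X Y b"
begin

lemmas E_continuous = partials_continuous[OF E oX oY]
lemmas E_Nil = partials_b[OF E oX oY]
lemmas E_x = partials_x[OF E oX oY]
lemmas E_y = partials_y[OF E oX oY]
lemmas Dx_E = Dx_partials[OF E oX oY]
lemmas Dy_E = Dy_partials[OF E oX oY]

lemma clX: "x \<in> X \<Longrightarrow> x \<in> closure X" and clY: "y \<in> Y \<Longrightarrow> y \<in> closure Y"
  using closure_subset by blast+

lemma C2_diffeo_Dy:
  assumes y: "y \<in> closure Y" and "X \<noteq> {}"
  shows "C2_diffeo X (\<lambda>x. Dy X Y b x y) (\<lambda>x. \<chi> j i. E [Inr j, Inl i] (x, y)) (\<lambda>j i k x. E [Inr j, Inl i, Inl k] (x, y))"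
proof
  show "open X" by (rule oX)
  show "((\<lambda>x. Dy X Y b x y) has_derivative (\<lambda>h. (\<chi> j i. E [Inr j, Inl i] (x, y)) *v h)) (at x)" if x: "x \<in> X" for x
  proof (rule has_derivative_transform_within_open[OF _ oX x])
    show "((\<lambda>x. \<chi> j. E [Inr j] (x, y)) has_derivative (\<lambda>h. (\<chi> j i. E [Inr j, Inl i] (x, y)) *v h)) (at x)"
      unfolding has_derivative_vec_iff using E_x[of "[Inr j]" x y for j] x y
      by (auto simp: matrix_vector_mult_def mult.commute)
    show "(\<chi> j. E [Inr j] (x, y)) = Dy X Y b x y" if "x \<in> X" for x
      using Dy_E clX that y by simp
  qed
  show "((\<lambda>x. (\<chi> j i. E [Inr j, Inl i] (x, y)) $ j $ i) has_derivative (\<lambda>h. \<Sum>k\<in>UNIV. h $ k * E [Inr j, Inl i, Inl k] (x, y))) (at x)"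
    if x: "x \<in> X" for x j i
    using E_x[of "[Inr j, Inl i]" x y] x y by simp
  show "continuous_on X (\<lambda>x. E [Inr j, Inl i, Inl k] (x, y))" for j i k
    by (rule continuous_on_compose2[OF E_continuous]) (use clX y in \<open>auto intro!: continuous_intros\<close>)
  show "diffeo_onto_range X (\<lambda>x. Dy X Y b x y)"
    using twist y assms(2) clX by (auto simp: bi_twist_def)
qed

lemma C2_diffeo_Dx:
  assumes x: "x \<in> closure X" and "Y \<noteq> {}"
  shows "C2_diffeo Y (\<lambda>y. Dx X Y b x y) (\<lambda>y. \<chi> i j. E [Inl i, Inr j] (x, y)) (\<lambda>i j k y. E [Inl i, Inr j, Inr k] (x, y))"
proof
  show "open Y" by (rule oY)
  show "((\<lambda>y. Dx X Y b x y) has_derivative (\<lambda>h. (\<chi> i j. E [Inl i, Inr j] (x, y)) *v h)) (at y)" if y: "y \<in> Y" for y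
  proof (rule has_derivative_transform_within_open[OF _ oY y])
    show "((\<lambda>y. \<chi> i. E [Inl i] (x, y)) has_derivative (\<lambda>h. (\<chi> i j. E [Inl i, Inr j] (x, y)) *v h)) (at y)"
      unfolding has_derivative_vec_iff using E_y[of "[Inl i]" x y for i] x y
      by (auto simp: matrix_vector_mult_def mult.commute)
    show "(\<chi> i. E [Inl i] (x, y)) = Dx X Y b x y" if "y \<in> Y" for y
      using Dx_E clY that x by simp
  qed
  show "((\<lambda>y. (\<chi> i j. E [Inl i, Inr j] (x, y)) $ i $ j) has_derivative (\<lambda>h. \<Sum>k\<in>UNIV. h $ k * E [Inl i, Inr j, Inr k] (x, y))) (at y)"
    if y: "y \<in> Y" for y i j
    using E_y[of "[Inl i, Inr j]" x y] x y by simp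
  show "continuous_on Y (\<lambda>y. E [Inl i, Inr j, Inr k] (x, y))" for i j k
    by (rule continuous_on_compose2[OF E_continuous]) (use clY x in \<open>auto intro!: continuous_intros\<close>)
  show "diffeo_onto_range Y (\<lambda>y. Dx X Y b x y)"
    using twist x assms(2) clY by (auto simp: bi_twist_def)
qed

text \<open>\<open>Dt\<close> and \<open>Dtt\<close> are the chain-rule forms of the first and
  second derivative of \<open>E \<alpha> (x, \<eta> t)\<close> in \<open>t\<close>;
  \<open>\<eta>1\<close> and \<open>\<eta>2\<close> are velocity and acceleration.\<close>

definition Dt where
  "Dt \<alpha> x \<eta> \<eta>1 t = (\<Sum>j\<in>UNIV. \<eta>1 t $ j * E (\<alpha> @ [Inr j]) (x, \<eta> t))"

definition Dtt where
  "Dtt \<alpha> x \<eta> \<eta>1 \<eta>2 t = (\<Sum>j\<in>UNIV. \<eta>2 t $ j * E (\<alpha> @ [Inr j]) (x, \<eta> t)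
     + \<eta>1 t $ j * (\<Sum>m\<in>UNIV. \<eta>1 t $ m * E (\<alpha> @ [Inr j, Inr m]) (x, \<eta> t)))"

lemma E_curve_x:
  assumes "length \<alpha> < 4" "C2_curve I \<xi> \<xi>1 \<xi>2 X" "s \<in> I" "y \<in> closure Y"
  shows "((\<lambda>s. E \<alpha> (\<xi> s, y)) has_real_derivative (\<Sum>i\<in>UNIV. \<xi>1 s $ i * E (\<alpha> @ [Inl i]) (\<xi> s, y))) (at s)"
  using has_real_derivative_compose_curve[OF C2_curveD(6)[OF assms(2,3)] E_x[OF assms(1) C2_curveD(5)[OF assms(2,3)] assms(4)]] .

lemma E_curve_y:
  assumes "length \<alpha> < 4" "C2_curve J \<eta> \<eta>1 \<eta>2 Y" "t \<in> J" "x \<in> closure X"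
  shows "((\<lambda>t. E \<alpha> (x, \<eta> t)) has_real_derivative Dt \<alpha> x \<eta> \<eta>1 t) (at t)"
  using has_real_derivative_compose_curve[OF C2_curveD(6)[OF assms(2,3)] E_y[OF assms(1,4) C2_curveD(5)[OF assms(2,3)]]]
  unfolding Dt_def .

lemma Dt_curve_y:
  assumes "length \<alpha> < 3" "C2_curve J \<eta> \<eta>1 \<eta>2 Y" "t \<in> J" "x \<in> closure X"
  shows "((\<lambda>t. Dt \<alpha> x \<eta> \<eta>1 t) has_real_derivative Dtt \<alpha> x \<eta> \<eta>1 \<eta>2 t) (at t)"
proof -
  have "((\<lambda>t. \<eta>1 t $ j * E (\<alpha> @ [Inr j]) (x, \<eta> t)) has_real_derivative
     \<eta>2 t $ j * E (\<alpha> @ [Inr j]) (x, \<eta> t) + Dt (\<alpha> @ [Inr j]) x \<eta> \<eta>1 t * \<eta>1 t $ j) (at t)" for j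
    using assms by (intro DERIV_mult C2_curveD(7)[OF assms(2)] E_curve_y) auto
  then have "((\<lambda>t. \<Sum>j\<in>UNIV. \<eta>1 t $ j * E (\<alpha> @ [Inr j]) (x, \<eta> t)) has_real_derivative
     (\<Sum>j\<in>UNIV. \<eta>2 t $ j * E (\<alpha> @ [Inr j]) (x, \<eta> t) + Dt (\<alpha> @ [Inr j]) x \<eta> \<eta>1 t * \<eta>1 t $ j)) (at t)"
    by (intro DERIV_sum)
  then show ?thesis by (simp add: Dt_def Dtt_def mult.commute)
qed

context
  fixes I J \<xi> \<xi>1 \<xi>2 \<eta> \<eta>1 \<eta>2
  assumes cx: "C2_curve I \<xi> \<xi>1 \<xi>2 X" and cy: "C2_curve J \<eta> \<eta>1 \<eta>2 Y"
begin

text \<open>The subscripts list derivatives of H(s, t) = b(\<xi> s, \<eta> t) in the order in which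
  they are taken, all in \<open>s\<close> before any in \<open>t\<close>. In this order the
  y-indices come after the x-indices in the argument of \<open>E\<close>, so that the
  \<open>t\<close>-derivatives follow from those of \<open>E\<close> along the y-curve.\<close>

definition Hs where "Hs s t = (\<Sum>i\<in>UNIV. \<xi>1 s $ i * E [Inl i] (\<xi> s, \<eta> t))"
definition Hss where "Hss s t = (\<Sum>i\<in>UNIV. \<xi>2 s $ i * E [Inl i] (\<xi> s, \<eta> t)
   + \<xi>1 s $ i * (\<Sum>k\<in>UNIV. \<xi>1 s $ k * E [Inl i, Inl k] (\<xi> s, \<eta> t)))"
definition Hst where "Hst s t = (\<Sum>i\<in>UNIV. \<xi>1 s $ i * Dt [Inl i] (\<xi> s) \<eta> \<eta>1 t)"
definition Hsst where "Hsst s t = (\<Sum>i\<in>UNIV. \<xi>2 s $ i * Dt [Inl i] (\<xi> s) \<eta> \<eta>1 t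
   + \<xi>1 s $ i * (\<Sum>k\<in>UNIV. \<xi>1 s $ k * Dt [Inl i, Inl k] (\<xi> s) \<eta> \<eta>1 t))"
definition Hstt where "Hstt s t = (\<Sum>i\<in>UNIV. \<xi>1 s $ i * Dtt [Inl i] (\<xi> s) \<eta> \<eta>1 \<eta>2 t)"
definition Hsstt where "Hsstt s t = (\<Sum>i\<in>UNIV. \<xi>2 s $ i * Dtt [Inl i] (\<xi> s) \<eta> \<eta>1 \<eta>2 t
   + \<xi>1 s $ i * (\<Sum>k\<in>UNIV. \<xi>1 s $ k * Dtt [Inl i, Inl k] (\<xi> s) \<eta> \<eta>1 \<eta>2 t))"

lemma in_cl: "s \<in> I \<Longrightarrow> \<xi> s \<in> closure X" "t \<in> J \<Longrightarrow> \<eta> t \<in> closure Y"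
  using C2_curveD(5)[OF cx] C2_curveD(5)[OF cy] clX clY by auto

lemma H_s: "s \<in> I \<Longrightarrow> t \<in> J \<Longrightarrow> ((\<lambda>s. E [] (\<xi> s, \<eta> t)) has_real_derivative Hs s t) (at s)"
  using E_curve_x[OF _ cx _ in_cl(2), of "[]" s t] by (simp add: Hs_def)

lemma Hs_s: "s \<in> I \<Longrightarrow> t \<in> J \<Longrightarrow> ((\<lambda>s. Hs s t) has_real_derivative Hss s t) (at s)"
proof -
  assume st: "s \<in> I" "t \<in> J"
  have "((\<lambda>s. \<xi>1 s $ i * E [Inl i] (\<xi> s, \<eta> t)) has_real_derivative
     \<xi>2 s $ i * E [Inl i] (\<xi> s, \<eta> t) + (\<Sum>k\<in>UNIV. \<xi>1 s $ k * E ([Inl i] @ [Inl k]) (\<xi> s, \<eta> t)) * \<xi>1 s $ i) (at s)" for i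
    using st in_cl by (intro DERIV_mult C2_curveD(7)[OF cx] E_curve_x[OF _ cx]) auto
  then have "((\<lambda>s. \<Sum>i\<in>UNIV. \<xi>1 s $ i * E [Inl i] (\<xi> s, \<eta> t)) has_real_derivative
     (\<Sum>i\<in>UNIV. \<xi>2 s $ i * E [Inl i] (\<xi> s, \<eta> t) + (\<Sum>k\<in>UNIV. \<xi>1 s $ k * E ([Inl i] @ [Inl k]) (\<xi> s, \<eta> t)) * \<xi>1 s $ i)) (at s)"
    by (intro DERIV_sum)
  then show ?thesis by (simp add: Hs_def Hss_def mult.commute)
qed

lemma H_t: "s \<in> I \<Longrightarrow> t \<in> J \<Longrightarrow> ((\<lambda>t. E [] (\<xi> s, \<eta> t)) has_real_derivative Dt [] (\<xi> s) \<eta> \<eta>1 t) (at t)"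
  and Ht_t: "s \<in> I \<Longrightarrow> t \<in> J \<Longrightarrow> ((\<lambda>t. Dt [] (\<xi> s) \<eta> \<eta>1 t) has_real_derivative Dtt [] (\<xi> s) \<eta> \<eta>1 \<eta>2 t) (at t)"
  and Hs_t: "s \<in> I \<Longrightarrow> t \<in> J \<Longrightarrow> ((\<lambda>t. Hs s t) has_real_derivative Hst s t) (at t)"
  and Hst_t: "s \<in> I \<Longrightarrow> t \<in> J \<Longrightarrow> ((\<lambda>t. Hst s t) has_real_derivative Hstt s t) (at t)"
  and Hss_t: "s \<in> I \<Longrightarrow> t \<in> J \<Longrightarrow> ((\<lambda>t. Hss s t) has_real_derivative Hsst s t) (at t)"
  and Hsst_t: "s \<in> I \<Longrightarrow> t \<in> J \<Longrightarrow> ((\<lambda>t. Hsst s t) has_real_derivative Hsstt s t) (at t)"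
  unfolding Hs_def Hst_def Hstt_def Hss_def Hsst_def Hsstt_def
  by (intro DERIV_sum DERIV_add DERIV_cmult E_curve_y[OF _ cy] Dt_curve_y[OF _ cy] in_cl; simp)+

lemma E_pair_continuous: "length \<alpha> \<le> 4 \<Longrightarrow> continuous_on (I \<times> J) (\<lambda>z. E \<alpha> (\<xi> (fst z), \<eta> (snd z)))"
  by (rule continuous_on_compose2[OF E_continuous])
     (auto intro!: continuous_on_Pair continuous_on_fst_curve continuous_on_snd_curve C2_curveD(2)[OF cx] C2_curveD(2)[OF cy] in_cl)

lemma curve_components_continuous:
  "continuous_on (I \<times> J) (\<lambda>z. \<xi>1 (fst z) $ i)" "continuous_on (I \<times> J) (\<lambda>z. \<xi>2 (fst z) $ i)"
  "continuous_on (I \<times> J) (\<lambda>z. \<eta>1 (snd z) $ i)" "continuous_on (I \<times> J) (\<lambda>z. \<eta>2 (snd z) $ i)"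
  by (intro continuous_on_component continuous_on_fst_curve continuous_on_snd_curve C2_curveD(3,4)[OF cx] C2_curveD(3,4)[OF cy])+

lemma Dt_continuous: "length \<alpha> \<le> 3 \<Longrightarrow> continuous_on (I \<times> J) (\<lambda>z. Dt \<alpha> (\<xi> (fst z)) \<eta> \<eta>1 (snd z))"
  and Dtt_continuous: "length \<alpha> \<le> 2 \<Longrightarrow> continuous_on (I \<times> J) (\<lambda>z. Dtt \<alpha> (\<xi> (fst z)) \<eta> \<eta>1 \<eta>2 (snd z))"
  unfolding Dt_def Dtt_def
  by (intro continuous_on_sum continuous_on_add continuous_on_mult curve_components_continuous E_pair_continuous; simp)+

lemma H_continuous:
  "continuous_on (I \<times> J) (\<lambda>(s, t). Hst s t)" "continuous_on (I \<times> J) (\<lambda>(s, t). Hstt s t)"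
  "continuous_on (I \<times> J) (\<lambda>(s, t). Hsst s t)" "continuous_on (I \<times> J) (\<lambda>(s, t). Hsstt s t)"
  unfolding Hst_def Hstt_def Hsst_def Hsstt_def case_prod_unfold
  by (intro continuous_on_sum continuous_on_add continuous_on_mult curve_components_continuous Dt_continuous Dtt_continuous; simp)+

text \<open>(B3) differentiates twice in \<open>t\<close> first and then twice in \<open>s\<close>.
  Four exchanges, each feeding the next, turn this order into the one in which the derivatives have
  been computed.\<close>

lemma Ht_s: "s \<in> I \<Longrightarrow> t \<in> J \<Longrightarrow> ((\<lambda>s. Dt [] (\<xi> s) \<eta> \<eta>1 t) has_real_derivative Hst s t) (at s)"
  by (rule mixed_partial_swap[OF C2_curveD(1)[OF cx] C2_curveD(1)[OF cy] H_s H_t Hs_t H_continuous(1)])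

lemma Hst_s: "s \<in> I \<Longrightarrow> t \<in> J \<Longrightarrow> ((\<lambda>s. Hst s t) has_real_derivative Hsst s t) (at s)"
  by (rule mixed_partial_swap[OF C2_curveD(1)[OF cx] C2_curveD(1)[OF cy] Hs_s Hs_t Hss_t H_continuous(3)])

lemma Htt_s: "s \<in> I \<Longrightarrow> t \<in> J \<Longrightarrow> ((\<lambda>s. Dtt [] (\<xi> s) \<eta> \<eta>1 \<eta>2 t) has_real_derivative Hstt s t) (at s)"
  by (rule mixed_partial_swap[OF C2_curveD(1)[OF cx] C2_curveD(1)[OF cy] Ht_s Ht_t Hst_t H_continuous(2)])

lemma Hstt_s: "s \<in> I \<Longrightarrow> t \<in> J \<Longrightarrow> ((\<lambda>s. Hstt s t) has_real_derivative Hsstt s t) (at s)"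
  by (rule mixed_partial_swap[OF C2_curveD(1)[OF cx] C2_curveD(1)[OF cy] Hst_s Hst_t Hsst_t H_continuous(4)])

lemma Hsstt_nonneg:
  assumes sub: "{-1..1} \<subseteq> I" "{-1..1} \<subseteq> J"
    and "\<And>s. s \<in> I \<Longrightarrow> Dy X Y b (\<xi> s) (\<eta> 0) = p1 + s *\<^sub>R v1"
    and "\<And>t. t \<in> J \<Longrightarrow> Dx X Y b (\<xi> 0) (\<eta> t) = p2 + t *\<^sub>R v2"
  shows "0 \<le> Hsstt 0 0"
proof -
  have 0: "0 \<in> I" "0 \<in> J" using sub by auto
  have "\<forall>t\<in>{-1..1}. (Dy X Y b (\<xi> t) (\<eta> 0), Dx X Y b (\<xi> 0) (\<eta> t)) = (p1, p2) + t *\<^sub>R (v1, v2)"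
    using assms by auto
  then have "0 \<le> (deriv ^^ 2) (\<lambda>s. (deriv ^^ 2) (\<lambda>t. b (\<xi> s) (\<eta> t)) 0) 0"
    using ncc sub in_cl unfolding nonneg_cross_curvature_def by blast
  also have "\<dots> = Hsstt 0 0"
  proof (rule deriv_deriv_eq[OF C2_curveD(1)[OF cx] 0(1) _ Htt_s[OF _ 0(2)] Hstt_s[OF _ 0(2)]])
    show "(deriv ^^ 2) (\<lambda>t. b (\<xi> s) (\<eta> t)) 0 = Dtt [] (\<xi> s) \<eta> \<eta>1 \<eta>2 0" if "s \<in> I" for s
      by (rule deriv_deriv_eq[OF C2_curveD(1)[OF cy] 0(2) _ H_t[OF that] Ht_t[OF that]]) (simp add: E_Nil)
  qed
  finally show ?thesis .
qed

end

text \<open>\<open>E [Inl i] (x, \<eta> t)\<close> is a component of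
  \<open>Dx X Y b x (\<eta> t)\<close>, hence affine in \<open>t\<close>; this removes every term
  containing the acceleration of the x-curve.\<close>

lemma Dtt_affine:
  assumes cy: "C2_curve J \<eta> \<eta>1 \<eta>2 Y" and x: "x \<in> closure X"
    and aff: "\<And>t. t \<in> J \<Longrightarrow> Dx X Y b x (\<eta> t) = p + t *\<^sub>R w" and t: "t \<in> J"
  shows "Dtt [Inl i] x \<eta> \<eta>1 \<eta>2 t = 0"
proof -
  note cyD = C2_curveD[OF cy]
  have Ei: "E [Inl i] (x, \<eta> t) = p $ i + t * w $ i" if "t \<in> J" for t
    using Dx_E[OF x clY[OF cyD(5)[OF that]]] aff[OF that] by (simp add: vec_eq_iff)
  have Dt: "Dt [Inl i] x \<eta> \<eta>1 t = w $ i" if t: "t \<in> J" for t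
  proof -
    have "((\<lambda>t. p $ i + t * w $ i) has_real_derivative w $ i) (at t)"
      by (auto intro!: derivative_eq_intros)
    then have "((\<lambda>t. E [Inl i] (x, \<eta> t)) has_real_derivative w $ i) (at t)"
      by (rule has_field_derivative_transform_within_open[OF _ cyD(1) t]) (simp add: Ei)
    then show ?thesis using E_curve_y[OF _ cy t x, of "[Inl i]"] DERIV_unique by auto
  qed
  have "((\<lambda>t. w $ i) has_real_derivative 0) (at t)" by simp
  then have "((\<lambda>t. Dt [Inl i] x \<eta> \<eta>1 t) has_real_derivative 0) (at t)"
    by (rule has_field_derivative_transform_within_open[OF _ cyD(1) t]) (simp add: Dt)
  then show ?thesis using Dt_curve_y[OF _ cy t x, of "[Inl i]"] DERIV_unique by auto
qed

text \<open>
  Along a \<open>y\<close>-segment based at \<open>x0\<close> the cross-curvature depends on the \<open>x\<close>-curve only through its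
  tangent \<open>e\<close>, because the acceleration of the \<open>x\<close>-curve is paired with an affine function of \<open>t\<close>.
\<close>

lemma cross_curvature_nonneg:
  assumes cy: "C2_curve J \<eta> \<eta>1 \<eta>2 Y" and x0: "x0 \<in> X"
    and aff: "\<And>t. t \<in> J \<Longrightarrow> Dx X Y b x0 (\<eta> t) = p + t *\<^sub>R w" and t0: "t0 \<in> J"
  shows "0 \<le> (\<Sum>i\<in>UNIV. e $ i * (\<Sum>k\<in>UNIV. e $ k * Dtt [Inl i, Inl k] x0 \<eta> \<eta>1 \<eta>2 t0))"
proof -
  note cyD = C2_curveD[OF cy]
  have y: "\<eta> t0 \<in> closure Y" using clY cyD(5)[OF t0] by simp
  \<comment> \<open>(B3) wants the x-curve straight in the coordinate taken at the centre of the
    y-curve, so after recentring at \<open>t0\<close> the coordinate belongs to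
    \<open>\<eta> t0\<close>.\<close>
  interpret D: C2_diffeo X "\<lambda>x. Dy X Y b x (\<eta> t0)" "\<lambda>x. \<chi> j i. E [Inr j, Inl i] (x, \<eta> t0)" "\<lambda>j i k x. E [Inr j, Inl i, Inl k] (x, \<eta> t0)"
    by (rule C2_diffeo_Dy[OF y]) (use x0 in auto)
  define q0 where "q0 = Dy X Y b x0 (\<eta> t0)"
  \<comment> \<open>The image of \<open>e\<close> under the Jacobian, so that the preimage of the
    segment in direction \<open>v\<close> has tangent proportional to \<open>e\<close> at
    \<open>x0\<close>.\<close>
  define v where "v = (\<chi> j i. E [Inr j, Inl i] (x0, \<eta> t0)) *v e"
  have "q0 \<in> (\<lambda>x. Dy X Y b x (\<eta> t0)) ` X" using x0 by (simp add: q0_def)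
  then obtain \<epsilon> where \<epsilon>: "\<epsilon> > 0" "ball q0 \<epsilon> \<subseteq> (\<lambda>x. Dy X Y b x (\<eta> t0)) ` X"
    using D.open_image open_contains_ball by blast
  obtain \<delta> where \<delta>: "\<delta> > 0" "ball t0 \<delta> \<subseteq> J" using cyD(1) t0 open_contains_ball by blast
  \<comment> \<open>(B3) speaks of parameters in [-1, 1]. Slowing both curves down by the same
    factor \<open>l\<close> makes them defined on (-2, 2) and only multiplies the fourth derivative
    by the fourth power of \<open>l\<close>.\<close>
  define l where "l = min (\<epsilon> / (2 * (norm v + 1))) (\<delta> / 2)"
  have nv: "norm v + 1 > 0" using norm_ge_zero[of v] by linarith
  have l: "l > 0" using \<epsilon> \<delta> nv by (simp add: l_def)
  have ld: "l \<le> \<delta> / 2" unfolding l_def by (rule min.cobounded2)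
  define I where "I = {-2<..<2::real}"
  have inq: "q0 + s *\<^sub>R (l *\<^sub>R v) \<in> (\<lambda>x. Dy X Y b x (\<eta> t0)) ` X" if s: "s \<in> I" for s
  proof -
    have "norm (s *\<^sub>R (l *\<^sub>R v)) = \<bar>s\<bar> * (l * norm v)" using l by (simp add: abs_mult)
    also have "\<dots> \<le> 2 * (l * norm v)" using s l by (intro mult_right_mono) (auto simp: I_def)
    also have "\<dots> < 2 * (l * (norm v + 1))" using l by simp
    also have "\<dots> \<le> 2 * (\<epsilon> / (2 * (norm v + 1)) * (norm v + 1))"
      using nv by (intro mult_left_mono mult_right_mono) (auto simp: l_def)
    also have "\<dots> = \<epsilon>" using nv by (simp add: field_simps)
    finally have "q0 + s *\<^sub>R (l *\<^sub>R v) \<in> ball q0 \<epsilon>" by (simp add: dist_norm)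
    then show ?thesis using \<epsilon> by blast
  qed
  have inJ: "t0 + l * t \<in> J" if t: "t \<in> I" for t
  proof -
    have "\<bar>l * t\<bar> = l * \<bar>t\<bar>" using l by (simp add: abs_mult)
    also have "\<dots> < l * 2" using t l by (intro mult_strict_left_mono) (auto simp: I_def)
    also have "\<dots> \<le> \<delta>" using ld by simp
    finally show ?thesis using \<delta> by (auto simp: subset_eq dist_real_def)
  qed
  define \<zeta> where "\<zeta> s = D.G (q0 + s *\<^sub>R (l *\<^sub>R v))" for s
  define \<zeta>1 where "\<zeta>1 s = D.G' (q0 + s *\<^sub>R (l *\<^sub>R v)) (l *\<^sub>R v)" for s
  obtain \<zeta>2 where "C2_curve I (\<lambda>s. D.G (q0 + s *\<^sub>R (l *\<^sub>R v))) (\<lambda>s. D.G' (q0 + s *\<^sub>R (l *\<^sub>R v)) (l *\<^sub>R v)) \<zeta>2 X"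
    using D.C2_segment[of I q0 "l *\<^sub>R v"] inq by (auto simp: I_def)
  then have cx: "C2_curve I \<zeta> \<zeta>1 \<zeta>2 X" by (simp add: \<zeta>_def[abs_def] \<zeta>1_def[abs_def])
  have \<zeta>0: "\<zeta> 0 = x0" using D.G_F[OF clX[OF x0]] by (simp add: \<zeta>_def q0_def)
  have \<zeta>10: "\<zeta>1 0 = l *\<^sub>R e"
  proof -
    have "\<zeta>1 0 = D.G' q0 ((\<chi> j i. E [Inr j, Inl i] (x0, \<eta> t0)) *v (l *\<^sub>R e))"
      by (simp add: \<zeta>1_def v_def matrix_vector_mult_scaleR)
    then show ?thesis using D.G'_A[OF x0] by (simp add: q0_def)
  qed
  define \<theta> where "\<theta> t = \<eta> (t0 + l * t)" for t
  define \<theta>1 where "\<theta>1 t = l *\<^sub>R \<eta>1 (t0 + l * t)" for t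
  define \<theta>2 where "\<theta>2 t = l\<^sup>2 *\<^sub>R \<eta>2 (t0 + l * t)" for t
  have cy': "C2_curve I \<theta> \<theta>1 \<theta>2 Y"
    unfolding C2_curve_def
  proof (intro conjI ballI)
    show "open I" by (simp add: I_def)
    show "continuous_on I \<theta>2" unfolding \<theta>2_def[abs_def]
      by (intro continuous_intros continuous_on_compose2[OF cyD(4)]) (use inJ in auto)
    fix t assume t: "t \<in> I"
    show "\<theta> t \<in> Y" using cyD(5)[OF inJ[OF t]] by (simp add: \<theta>_def)
    have line: "((\<lambda>t. t0 + l * t) has_derivative (\<lambda>h. l * h)) (at t)" by (auto intro!: derivative_eq_intros)
    show "(\<theta> has_derivative (\<lambda>h. h *\<^sub>R \<theta>1 t)) (at t)"
      using has_derivative_compose[OF line cyD(6)[OF inJ[OF t]]] by (simp add: \<theta>_def[abs_def] \<theta>1_def mult.commute)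
    have "(\<eta>1 has_derivative (\<lambda>h. h *\<^sub>R \<eta>2 (t0 + l * t))) (at (t0 + l * t))"
      using cy inJ[OF t] by (auto simp: C2_curve_def)
    from has_derivative_scaleR_right[OF has_derivative_compose[OF line this], of l]
    show "(\<theta>1 has_derivative (\<lambda>h. h *\<^sub>R \<theta>2 t)) (at t)"
      by (simp add: \<theta>1_def[abs_def] \<theta>2_def power2_eq_square mult_ac)
  qed
  have sub: "{-1..1} \<subseteq> I" by (auto simp: I_def)
  then have 0: "0 \<in> I" by auto
  have affx: "Dy X Y b (\<zeta> s) (\<theta> 0) = q0 + s *\<^sub>R (l *\<^sub>R v)" if "s \<in> I" for s
    using D.F_G[OF inq[OF that]] by (simp add: \<zeta>_def \<theta>_def)
  have affy: "Dx X Y b x0 (\<theta> t) = (p + t0 *\<^sub>R w) + t *\<^sub>R (l *\<^sub>R w)" if "t \<in> I" for t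
    using aff[OF inJ[OF that]] by (simp add: \<theta>_def algebra_simps)
  have affy': "Dx X Y b (\<zeta> 0) (\<theta> t) = (p + t0 *\<^sub>R w) + t *\<^sub>R (l *\<^sub>R w)" if "t \<in> I" for t
    unfolding \<zeta>0 by (rule affy[OF that])
  have "0 \<le> Hsstt \<zeta> \<zeta>1 \<zeta>2 \<theta> \<theta>1 \<theta>2 0 0"
    by (rule Hsstt_nonneg[OF cx cy' sub sub affx affy']) 
  also have "\<dots> = (\<Sum>i\<in>UNIV. (l * e $ i) * (\<Sum>k\<in>UNIV. (l * e $ k) * Dtt [Inl i, Inl k] x0 \<theta> \<theta>1 \<theta>2 0))"
    using Dtt_affine[OF cy' clX[OF x0] affy 0] unfolding Hsstt_def[OF cx cy'] \<zeta>0 \<zeta>10 by simp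
  also have "\<dots> = (\<Sum>i\<in>UNIV. (l * e $ i) * (\<Sum>k\<in>UNIV. (l * e $ k) * (l\<^sup>2 * Dtt [Inl i, Inl k] x0 \<eta> \<eta>1 \<eta>2 t0)))"
    by (simp add: Dtt_def \<theta>_def \<theta>1_def \<theta>2_def power2_eq_square sum_distrib_left distrib_left mult_ac)
  also have "\<dots> = l\<^sup>2 * l\<^sup>2 * (\<Sum>i\<in>UNIV. e $ i * (\<Sum>k\<in>UNIV. e $ k * Dtt [Inl i, Inl k] x0 \<eta> \<eta>1 \<eta>2 t0))"
    by (simp add: power2_eq_square sum_distrib_left mult_ac)
  finally show ?thesis using l by (simp add: zero_le_mult_iff)
qed

text \<open>Fix \<open>s\<close> and join \<open>y0\<close> to \<open>y1\<close> by the segment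
  \<open>\<eta>\<close> seen from \<open>\<xi> s\<close>. The second \<open>s\<close>-derivative of
  \<open>b\<close> along the x-curve, as a function \<open>?g\<close> of \<open>t\<close>, has
  nonnegative second derivative by cross-curvature and zero slope at \<open>t = 0\<close>, so it
  increases from \<open>y0\<close> to \<open>y1\<close>.\<close>

lemma segment_second_derivative_nonneg:
  assumes cx: "C2_curve I \<xi> \<xi>1 \<xi>2 X" and y0: "y0 \<in> Y" and y1: "y1 \<in> Y"
    and aff: "\<And>s. s \<in> I \<Longrightarrow> Dy X Y b (\<xi> s) y0 = q + s *\<^sub>R v" and s: "s \<in> I"
  shows "(\<Sum>i\<in>UNIV. \<xi>2 s $ i * E [Inl i] (\<xi> s, y0) + \<xi>1 s $ i * (\<Sum>k\<in>UNIV. \<xi>1 s $ k * E [Inl i, Inl k] (\<xi> s, y0)))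
     \<le> (\<Sum>i\<in>UNIV. \<xi>2 s $ i * E [Inl i] (\<xi> s, y1) + \<xi>1 s $ i * (\<Sum>k\<in>UNIV. \<xi>1 s $ k * E [Inl i, Inl k] (\<xi> s, y1)))"
proof -
  note cxD = C2_curveD[OF cx]
  define x0 where "x0 = \<xi> s"
  have x0: "x0 \<in> X" using cxD(5)[OF s] by (simp add: x0_def)
  interpret D: C2_diffeo Y "\<lambda>y. Dx X Y b x0 y" "\<lambda>y. \<chi> i j. E [Inl i, Inr j] (x0, y)" "\<lambda>i j k y. E [Inl i, Inr j, Inr k] (x0, y)"
    by (rule C2_diffeo_Dx[OF clX[OF x0]]) (use y0 in auto)
  define p where "p = Dx X Y b x0 y0"
  define w where "w = Dx X Y b x0 y1 - p"
  \<comment> \<open>An open set of parameters containing [0, 1], so that derivatives at the end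
    points are two-sided.\<close>
  define J where "J = {t. p + t *\<^sub>R w \<in> (\<lambda>y. Dx X Y b x0 y) ` Y}"
  have oJ: "open J"
  proof -
    have "J = (\<lambda>t. p + t *\<^sub>R w) -` ((\<lambda>y. Dx X Y b x0 y) ` Y)" by (auto simp: J_def)
    then show ?thesis using D.open_image by (auto intro!: open_vimage continuous_intros)
  qed
  have J01: "{0..1} \<subseteq> J"
  proof
    fix t :: real assume t: "t \<in> {0..1}"
    have "convex ((\<lambda>y. Dx X Y b x0 y) ` Y)" using conv clX[OF x0] clY[OF y0] by (auto simp: bi_convex_def)
    then have "(1 - t) *\<^sub>R p + t *\<^sub>R Dx X Y b x0 y1 \<in> (\<lambda>y. Dx X Y b x0 y) ` Y"
      using t y0 y1 by (intro convexD_alt) (auto simp: p_def)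
    then show "t \<in> J" by (simp add: J_def w_def algebra_simps)
  qed
  define \<eta> where "\<eta> t = D.G (p + t *\<^sub>R w)" for t
  define \<eta>1 where "\<eta>1 t = D.G' (p + t *\<^sub>R w) w" for t
  obtain \<eta>2 where "C2_curve J (\<lambda>t. D.G (p + t *\<^sub>R w)) (\<lambda>t. D.G' (p + t *\<^sub>R w) w) \<eta>2 Y"
    using D.C2_segment[OF oJ, of p w] by (auto simp: J_def)
  then have cy: "C2_curve J \<eta> \<eta>1 \<eta>2 Y" by (simp add: \<eta>_def[abs_def] \<eta>1_def[abs_def])
  have affy: "Dx X Y b x0 (\<eta> t) = p + t *\<^sub>R w" if "t \<in> J" for t
    using D.F_G that by (auto simp: \<eta>_def J_def)
  have \<eta>01: "\<eta> 0 = y0" "\<eta> 1 = y1"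
    using D.G_F[OF clY[OF y0]] D.G_F[OF clY[OF y1]] by (auto simp: \<eta>_def p_def w_def)
  have J0: "0 \<in> J" using J01 by auto
  let ?g = "\<lambda>t. Hss \<xi> \<xi>1 \<xi>2 \<eta> s t"
  let ?g1 = "\<lambda>t. Hsst \<xi> \<xi>1 \<xi>2 \<eta> \<eta>1 s t"
  let ?g2 = "\<lambda>t. Hsstt \<xi> \<xi>1 \<xi>2 \<eta> \<eta>1 \<eta>2 s t"
  have g2: "0 \<le> ?g2 t" if t: "t \<in> J" for t
    using cross_curvature_nonneg[OF cy x0 affy t, of "\<xi>1 s"] Dtt_affine[OF cy clX[OF x0] affy t]
    unfolding Hsstt_def[OF cx cy] x0_def by simp
  \<comment> \<open>At \<open>t = 0\<close> the \<open>t\<close>-derivative pairs the velocity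
    \<open>\<eta>1 0\<close> with \<open>D_y b(\<xi> r, y0)\<close>, which is affine in
    \<open>r\<close>; its second derivative in \<open>r\<close>, that is \<open>?g1 0\<close>,
    therefore vanishes.\<close>
  have Ht0: "Dt [] (\<xi> r) \<eta> \<eta>1 0 = (\<Sum>j\<in>UNIV. \<eta>1 0 $ j * (q $ j + r * v $ j))" if r: "r \<in> I" for r
  proof -
    have "E [Inr j] (\<xi> r, y0) = q $ j + r * v $ j" for j
      using Dy_E[OF clX[OF cxD(5)[OF r]] clY[OF y0]] aff[OF r] by (simp add: vec_eq_iff)
    then show ?thesis by (simp add: Dt_def \<eta>01)
  qed
  have Hst0: "Hst \<xi> \<xi>1 \<eta> \<eta>1 r 0 = (\<Sum>j\<in>UNIV. \<eta>1 0 $ j * v $ j)" if r: "r \<in> I" for r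
  proof -
    have "((\<lambda>r. \<Sum>j\<in>UNIV. \<eta>1 0 $ j * (q $ j + r * v $ j)) has_real_derivative (\<Sum>j\<in>UNIV. \<eta>1 0 $ j * v $ j)) (at r)"
      by (auto intro!: derivative_eq_intros simp: mult.commute)
    then have "((\<lambda>r. Dt [] (\<xi> r) \<eta> \<eta>1 0) has_real_derivative (\<Sum>j\<in>UNIV. \<eta>1 0 $ j * v $ j)) (at r)"
      by (rule has_field_derivative_transform_within_open[OF _ cxD(1) r]) (simp add: Ht0)
    then show ?thesis using Ht_s[OF cx cy r J0] DERIV_unique by blast
  qed
  have g10: "?g1 0 = 0"
  proof -
    have "((\<lambda>r. \<Sum>j\<in>UNIV. \<eta>1 0 $ j * v $ j) has_real_derivative 0) (at s)" by simp
    then have "((\<lambda>r. Hst \<xi> \<xi>1 \<eta> \<eta>1 r 0) has_real_derivative 0) (at s)"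
      by (rule has_field_derivative_transform_within_open[OF _ cxD(1) s]) (simp add: Hst0)
    then show ?thesis using Hst_s[OF cx cy s J0] DERIV_unique by blast
  qed
  have g1: "0 \<le> ?g1 t" if t: "t \<in> {0..1}" for t
  proof -
    have "?g1 0 \<le> ?g1 t"
    proof (rule DERIV_nonneg_imp_nondecreasing[where f="?g1"])
      fix r :: real assume "0 \<le> r" "r \<le> t"
      then have "r \<in> J" using t J01 by auto
      then show "\<exists>y. DERIV ?g1 r :> y \<and> y \<ge> 0" using Hsst_t[OF cx cy s] g2 by blast
    qed (use t in simp)
    then show ?thesis using g10 by simp
  qed
  have g01: "?g 0 \<le> ?g 1"
  proof (rule DERIV_nonneg_imp_nondecreasing[where f="?g"])
    fix r :: real assume "0 \<le> r" "r \<le> 1"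
    then have "r \<in> {0..1}" by simp
    then show "\<exists>y. DERIV ?g r :> y \<and> y \<ge> 0" using Hss_t[OF cx cy s] g1 J01 by blast
  qed simp
  show ?thesis using g01 by (simp add: Hss_def[OF cx cy] \<eta>01)
qed

text \<open>The intermediate point is asserted to exist instead of being given. In this form the
  statement can be applied to approximations of all the data at once, the intermediate point being
  recovered by compactness.\<close>

lemma b_difference_convex_interior:
  assumes x: "x1 \<in> X" "x2 \<in> X" and y0: "y0 \<in> Y" and y1: "y1 \<in> Y" and l: "0 \<le> l" "l \<le> 1"
  shows "\<exists>x\<in>X. Dy X Y b x y0 = (1 - l) *\<^sub>R Dy X Y b x1 y0 + l *\<^sub>R Dy X Y b x2 y0 \<and>
    b x y1 - b x y0 \<le> (1 - l) * (b x1 y1 - b x1 y0) + l * (b x2 y1 - b x2 y0)"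
proof -
  interpret D: C2_diffeo X "\<lambda>x. Dy X Y b x y0" "\<lambda>x. \<chi> j i. E [Inr j, Inl i] (x, y0)" "\<lambda>j i k x. E [Inr j, Inl i, Inl k] (x, y0)"
    by (rule C2_diffeo_Dy[OF clY[OF y0]]) (use x in auto)
  define q where "q = Dy X Y b x1 y0"
  define v where "v = Dy X Y b x2 y0 - q"
  define I where "I = {s. q + s *\<^sub>R v \<in> (\<lambda>x. Dy X Y b x y0) ` X}"
  have oI: "open I"
  proof -
    have "I = (\<lambda>s. q + s *\<^sub>R v) -` ((\<lambda>x. Dy X Y b x y0) ` X)" by (auto simp: I_def)
    then show ?thesis using D.open_image by (auto intro!: open_vimage continuous_intros)
  qed
  have I01: "{0..1} \<subseteq> I"
  proof
    fix t :: real assume t: "t \<in> {0..1}"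
    have "convex ((\<lambda>x. Dy X Y b x y0) ` X)" using conv clX[OF x(1)] clY[OF y0] by (auto simp: bi_convex_def)
    then have "(1 - t) *\<^sub>R q + t *\<^sub>R Dy X Y b x2 y0 \<in> (\<lambda>x. Dy X Y b x y0) ` X"
      using t x by (intro convexD_alt) (auto simp: q_def)
    then show "t \<in> I" by (simp add: I_def v_def algebra_simps)
  qed
  define \<xi> where "\<xi> s = D.G (q + s *\<^sub>R v)" for s
  define \<xi>1 where "\<xi>1 s = D.G' (q + s *\<^sub>R v) v" for s
  obtain \<xi>2 where "C2_curve I (\<lambda>s. D.G (q + s *\<^sub>R v)) (\<lambda>s. D.G' (q + s *\<^sub>R v) v) \<xi>2 X"
    using D.C2_segment[OF oI, of q v] by (auto simp: I_def)
  then have cx: "C2_curve I \<xi> \<xi>1 \<xi>2 X" by (simp add: \<xi>_def[abs_def] \<xi>1_def[abs_def])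
  have aff: "Dy X Y b (\<xi> s) y0 = q + s *\<^sub>R v" if "s \<in> I" for s
    using D.F_G that by (auto simp: \<xi>_def I_def)
  have \<xi>01: "\<xi> 0 = x1" "\<xi> 1 = x2"
    using D.G_F[OF clX[OF x(1)]] D.G_F[OF clX[OF x(2)]] by (auto simp: \<xi>_def q_def v_def)
  define f where "f s = E [] (\<xi> s, y1) - E [] (\<xi> s, y0)" for s
  define S1 where "S1 y s = (\<Sum>i\<in>UNIV. \<xi>1 s $ i * E [Inl i] (\<xi> s, y))" for y s
  define S2 where "S2 y s = (\<Sum>i\<in>UNIV. \<xi>2 s $ i * E [Inl i] (\<xi> s, y) + \<xi>1 s $ i * (\<Sum>k\<in>UNIV. \<xi>1 s $ k * E [Inl i, Inl k] (\<xi> s, y)))" for y s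
  have f1: "(f has_real_derivative S1 y1 s - S1 y0 s) (at s)" if s: "s \<in> I" for s
    unfolding f_def[abs_def] S1_def
    using E_curve_x[OF _ cx s clY[OF y1], of "[]"] E_curve_x[OF _ cx s clY[OF y0], of "[]"]
    by (auto intro!: DERIV_diff)
  have S1d: "(S1 y has_real_derivative S2 y s) (at s)" if s: "s \<in> I" and y: "y \<in> Y" for s y
  proof -
    have "((\<lambda>s. \<xi>1 s $ i * E [Inl i] (\<xi> s, y)) has_real_derivative
     \<xi>2 s $ i * E [Inl i] (\<xi> s, y) + (\<Sum>k\<in>UNIV. \<xi>1 s $ k * E ([Inl i] @ [Inl k]) (\<xi> s, y)) * \<xi>1 s $ i) (at s)" for i
      using s clY[OF y] by (intro DERIV_mult C2_curveD(7)[OF cx] E_curve_x[OF _ cx]) auto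
    then have "((\<lambda>s. \<Sum>i\<in>UNIV. \<xi>1 s $ i * E [Inl i] (\<xi> s, y)) has_real_derivative
     (\<Sum>i\<in>UNIV. \<xi>2 s $ i * E [Inl i] (\<xi> s, y) + (\<Sum>k\<in>UNIV. \<xi>1 s $ k * E ([Inl i] @ [Inl k]) (\<xi> s, y)) * \<xi>1 s $ i)) (at s)"
      by (intro DERIV_sum)
    then show ?thesis by (simp add: S1_def[abs_def] S2_def mult.commute)
  qed
  have cf: "convex_on {0..1} f"
  proof (rule f''_ge0_imp_convex)
    show "convex {0..1::real}" by simp
    show "(f has_real_derivative S1 y1 s - S1 y0 s) (at s)" if "s \<in> {0..1}" for s using f1 I01 that by blast
    show "((\<lambda>s. S1 y1 s - S1 y0 s) has_real_derivative S2 y1 s - S2 y0 s) (at s)" if "s \<in> {0..1}" for s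
      using I01 that y0 y1 by (intro DERIV_diff S1d) auto
    show "S2 y1 s - S2 y0 s \<ge> 0" if "s \<in> {0..1}" for s
      using segment_second_derivative_nonneg[OF cx y0 y1 aff, of s] I01 that by (auto simp: S2_def)
  qed
  have "f ((1 - l) *\<^sub>R 0 + l *\<^sub>R 1) \<le> (1 - l) * f 0 + l * f 1"
    by (rule convex_onD[OF cf]) (use l in auto)
  then have "b (\<xi> l) y1 - b (\<xi> l) y0 \<le> (1 - l) * (b x1 y1 - b x1 y0) + l * (b x2 y1 - b x2 y0)"
    by (simp add: f_def E_Nil \<xi>01)
  moreover have lI: "l \<in> I" using l I01 by auto
  moreover have "Dy X Y b (\<xi> l) y0 = (1 - l) *\<^sub>R Dy X Y b x1 y0 + l *\<^sub>R Dy X Y b x2 y0"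
    using aff[OF lI] by (simp add: v_def q_def algebra_simps)
  moreover have "\<xi> l \<in> X" using C2_curveD(5)[OF cx lI] .
  ultimately show ?thesis by blast
qed

section \<open>Passage from the interior to the closure\<close>

lemma b_continuous: "continuous_on (closure X \<times> closure Y) (\<lambda>z. b (fst z) (snd z))"
proof -
  have "(\<lambda>z. b (fst z) (snd z)) = E []" using E_Nil by (auto intro!: ext)
  then show ?thesis using E_continuous[of "[]"] by (simp only: list.size zero_le)
qed

lemma Dy_continuous: "continuous_on (closure X \<times> closure Y) (\<lambda>z. Dy X Y b (fst z) (snd z))"
proof -
  have "continuous_on (closure X \<times> closure Y) (\<lambda>z. \<chi> j. E [Inr j] z)"
    by (intro continuous_on_vec_lambda E_continuous) simp
  then show ?thesis by (rule continuous_on_eq) (auto simp: Dy_E)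
qed

lemma Dx_continuous: "continuous_on (closure X \<times> closure Y) (\<lambda>z. Dx X Y b (fst z) (snd z))"
proof -
  have "continuous_on (closure X \<times> closure Y) (\<lambda>z. \<chi> j. E [Inl j] z)"
    by (intro continuous_on_vec_lambda E_continuous) simp
  then show ?thesis by (rule continuous_on_eq) (auto simp: Dx_E)
qed

lemma sequence_tendsto:
  fixes g :: "(real^'n) \<times> (real^'n) \<Rightarrow> 'c::topological_space"
  assumes "continuous_on (closure X \<times> closure Y) g" "xs \<longlonglongrightarrow> x" "ys \<longlonglongrightarrow> y"
    "\<And>n::nat. xs n \<in> closure X" "\<And>n. ys n \<in> closure Y" "x \<in> closure X" "y \<in> closure Y"
  shows "(\<lambda>n. g (xs n, ys n)) \<longlonglongrightarrow> g (x, y)"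
  by (rule continuous_on_tendsto_compose[OF assms(1)]) (use assms in \<open>auto intro!: tendsto_Pair\<close>)

text \<open>All four points are approximated from the interior. A limit of the intermediate points
  has the same image under \<open>D_y b(\<cdot>, y0)\<close> as \<open>x\<close>, and injectivity on
  the closure identifies it with \<open>x\<close>.\<close>

proposition b_difference_convex:
  assumes x1: "x1 \<in> closure X" and x2: "x2 \<in> closure X" and y0: "y0 \<in> closure Y" and y1: "y1 \<in> closure Y"
    and l: "0 \<le> l" "l \<le> 1"
    and x: "x \<in> closure X" and eq: "Dy X Y b x y0 = (1 - l) *\<^sub>R Dy X Y b x1 y0 + l *\<^sub>R Dy X Y b x2 y0"
  shows "b x y1 - b x y0 \<le> (1 - l) * (b x1 y1 - b x1 y0) + l * (b x2 y1 - b x2 y0)"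
proof -
  obtain p where p: "\<And>n. p n \<in> X" "p \<longlonglongrightarrow> x1" using x1 closure_sequential by metis
  obtain q where q: "\<And>n. q n \<in> X" "q \<longlonglongrightarrow> x2" using x2 closure_sequential by metis
  obtain z where z: "\<And>n. z n \<in> Y" "z \<longlonglongrightarrow> y0" using y0 closure_sequential by metis
  obtain w where w: "\<And>n. w n \<in> Y" "w \<longlonglongrightarrow> y1" using y1 closure_sequential by metis
  have "\<exists>x\<in>X. Dy X Y b x (z n) = (1 - l) *\<^sub>R Dy X Y b (p n) (z n) + l *\<^sub>R Dy X Y b (q n) (z n) \<and>
    b x (w n) - b x (z n) \<le> (1 - l) * (b (p n) (w n) - b (p n) (z n)) + l * (b (q n) (w n) - b (q n) (z n))" for n
    by (rule b_difference_convex_interior) (use p q z w l in auto)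
  then obtain m where m: "\<And>n. m n \<in> X"
    "\<And>n. Dy X Y b (m n) (z n) = (1 - l) *\<^sub>R Dy X Y b (p n) (z n) + l *\<^sub>R Dy X Y b (q n) (z n)"
    "\<And>n. b (m n) (w n) - b (m n) (z n) \<le> (1 - l) * (b (p n) (w n) - b (p n) (z n)) + l * (b (q n) (w n) - b (q n) (z n))"
    by metis
  have "compact (closure X)" using bX by (simp add: compact_closure)
  then obtain x' r where x': "x' \<in> closure X" and r: "strict_mono r" "(m \<circ> r) \<longlonglongrightarrow> x'"
    using m(1) clX unfolding compact_def by blast
  have sub: "(\<lambda>n. p (r n)) \<longlonglongrightarrow> x1" "(\<lambda>n. q (r n)) \<longlonglongrightarrow> x2" "(\<lambda>n. z (r n)) \<longlonglongrightarrow> y0" "(\<lambda>n. w (r n)) \<longlonglongrightarrow> y1"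
    "(\<lambda>n. m (r n)) \<longlonglongrightarrow> x'"
    using LIMSEQ_subseq_LIMSEQ[OF p(2) r(1)] LIMSEQ_subseq_LIMSEQ[OF q(2) r(1)]
      LIMSEQ_subseq_LIMSEQ[OF z(2) r(1)] LIMSEQ_subseq_LIMSEQ[OF w(2) r(1)] r(2) by (auto simp: o_def)
  note inc = clX[OF p(1)] clX[OF q(1)] clX[OF m(1)] clY[OF z(1)] clY[OF w(1)]
  note dl = sequence_tendsto[OF Dy_continuous, simplified] and bl = sequence_tendsto[OF b_continuous, simplified]
  have "(\<lambda>n. Dy X Y b (m (r n)) (z (r n))) \<longlonglongrightarrow> Dy X Y b x' y0"
    by (rule dl[OF sub(5,3)]) (use inc x' y0 in auto)
  moreover have "(\<lambda>n. Dy X Y b (m (r n)) (z (r n))) \<longlonglongrightarrow> (1 - l) *\<^sub>R Dy X Y b x1 y0 + l *\<^sub>R Dy X Y b x2 y0"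
    unfolding m(2)
    by (intro tendsto_add tendsto_scaleR tendsto_const dl[OF sub(1,3)] dl[OF sub(2,3)]) (use inc x1 x2 y0 in auto)
  ultimately have "Dy X Y b x' y0 = Dy X Y b x y0" using LIMSEQ_unique eq by metis
  moreover have "inj_on (\<lambda>x. Dy X Y b x y0) (closure X)"
    using twist x y0 by (auto simp: bi_twist_def diffeo_onto_range_def)
  ultimately have [simp]: "x' = x" using x x' by (auto dest: inj_onD)
  have "(\<lambda>n. b (m (r n)) (w (r n)) - b (m (r n)) (z (r n))) \<longlonglongrightarrow> b x y1 - b x y0"
    by (intro tendsto_diff bl) (use sub inc x y0 y1 in auto)
  moreover have "(\<lambda>n. (1 - l) * (b (p (r n)) (w (r n)) - b (p (r n)) (z (r n))) + l * (b (q (r n)) (w (r n)) - b (q (r n)) (z (r n))))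
    \<longlonglongrightarrow> (1 - l) * (b x1 y1 - b x1 y0) + l * (b x2 y1 - b x2 y0)"
    by (intro tendsto_add tendsto_mult tendsto_const tendsto_diff bl) (use sub inc x1 x2 y0 y1 in auto)
  ultimately show ?thesis by (rule LIMSEQ_le) (use m(3) in auto)
qed

end


section \<open>The divergence inequality\<close>

text \<open>\<open>X\<close> is convex only in the coordinate \<open>p\<close>, so a derivative
  bound yields a Lipschitz bound only for pairs joined by a segment inside the set.\<close>

definition seg_lipschitz :: "real \<Rightarrow> 'a::real_normed_vector set \<Rightarrow> ('a \<Rightarrow> 'b::real_normed_vector) \<Rightarrow> bool" where
  "seg_lipschitz L S h \<longleftrightarrow> (\<forall>x y. closed_segment x y \<subseteq> S \<longrightarrow> norm (h x - h y) \<le> L * norm (x - y))"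

lemma seg_lipschitz_of_derivative:
  fixes h :: "'a::euclidean_space \<Rightarrow> 'b::real_normed_vector"
  assumes "\<And>x. x \<in> S \<Longrightarrow> (h has_derivative h' x) (at x)" "\<And>x v. x \<in> S \<Longrightarrow> norm (h' x v) \<le> L * norm v"
  shows "seg_lipschitz L S h"
  unfolding seg_lipschitz_def
proof (intro allI impI)
  fix x y assume sub: "closed_segment x y \<subseteq> S"
  show "norm (h x - h y) \<le> L * norm (x - y)"
  proof (rule differentiable_bound[of "closed_segment x y" h h' L])
    fix w assume w: "w \<in> closed_segment x y"
    then show "(h has_derivative h' w) (at w within closed_segment x y)"
      using sub assms(1) has_derivative_at_withinI by blast
    show "onorm (h' w) \<le> L" by (rule onorm_le) (use w sub assms(2)[of w] in blast)
  qed auto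
qed

lemma seg_lipschitz_mult:
  fixes f g :: "'a::real_normed_vector \<Rightarrow> real"
  assumes f: "seg_lipschitz L S f" "\<And>x. x \<in> S \<Longrightarrow> \<bar>f x\<bar> \<le> B" and g: "seg_lipschitz M S g" "\<And>x. x \<in> S \<Longrightarrow> \<bar>g x\<bar> \<le> C"
    and C: "0 \<le> C"
  shows "seg_lipschitz (L * C + B * M) S (\<lambda>x. f x * g x)"
  unfolding seg_lipschitz_def
proof (intro allI impI)
  fix x y assume sub: "closed_segment x y \<subseteq> S"
  then have xy: "x \<in> S" "y \<in> S" by auto
  have B: "0 \<le> B" using f(2)[OF xy(1)] by linarith
  have lf: "\<bar>f x - f y\<bar> \<le> L * norm (x - y)" and lg: "\<bar>g x - g y\<bar> \<le> M * norm (x - y)"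
    using f(1) g(1) sub by (auto simp: seg_lipschitz_def)
  have "f x * g x - f y * g y = (f x - f y) * g x + f y * (g x - g y)" by (simp add: algebra_simps)
  also have "\<bar>\<dots>\<bar> \<le> \<bar>f x - f y\<bar> * \<bar>g x\<bar> + \<bar>f y\<bar> * \<bar>g x - g y\<bar>"
    by (metis abs_mult abs_triangle_ineq)
  also have "\<dots> \<le> (L * norm (x - y)) * C + B * (M * norm (x - y))"
    using lf lg f(2)[OF xy(2)] g(2)[OF xy(1)] B C by (intro add_mono mult_mono) auto
  finally show "norm (f x * g x - f y * g y) \<le> (L * C + B * M) * norm (x - y)" by (simp add: algebra_simps)
qed

lemma derivative_bound_of_extends_Ck:
  fixes f :: "real^'n \<Rightarrow> real^'n"
  assumes C: "extends_Ck 1 S f" and S: "bounded S"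
    and d: "\<And>x. x \<in> S \<Longrightarrow> (f has_derivative f' x) (at x)"
  obtains K where "K > 0" "\<And>x v. x \<in> S \<Longrightarrow> norm (f' x v) \<le> K * norm v"
proof -
  have "\<exists>B. \<forall>x\<in>S. norm (f' x (axis i 1)) \<le> B" for i
  proof -
    obtain g where g: "continuous_on (closure S) g" "\<forall>x\<in>S. g x = frechet_derivative f (at x) (axis i 1)"
    proof -
      have "\<exists>g. continuous_on (closure S) g \<and> (\<forall>x\<in>S. g x = frechet_derivative f (at x) (axis i 1))"
        using C by simp
      then show ?thesis using that by blast
    qed
    have "compact (g ` closure S)"
      using g(1) S by (intro compact_continuous_image) (auto simp: compact_closure)
    then obtain B where B: "\<forall>y\<in>g ` closure S. norm y \<le> B" using compact_imp_bounded bounded_iff by blast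
    have "norm (f' x (axis i 1)) \<le> B" if "x \<in> S" for x
    proof -
      have "f' x = frechet_derivative f (at x)" using d[OF that] by (rule frechet_derivative_at)
      then show ?thesis using B g(2) that closure_subset by force
    qed
    then show ?thesis by blast
  qed
  then obtain B where B: "\<And>i x. x \<in> S \<Longrightarrow> norm (f' x (axis i 1)) \<le> B i" by metis
  define K where "K = (\<Sum>i\<in>UNIV. \<bar>B i\<bar>) + 1"
  have "norm (f' x v) \<le> K * norm v" if x: "x \<in> S" for x v
  proof -
    have l: "linear (f' x)" using d[OF x] has_derivative_linear by blast
    have "f' x v = f' x (\<Sum>i\<in>UNIV. v $ i *s axis i 1)" by (simp only: basis_expansion)
    also have "\<dots> = (\<Sum>i\<in>UNIV. v $ i *\<^sub>R f' x (axis i 1))"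
      using l by (simp add: linear_sum linear_scale scalar_mult_eq_scaleR)
    also have "norm \<dots> \<le> (\<Sum>i\<in>UNIV. norm (v $ i *\<^sub>R f' x (axis i 1)))" by (rule norm_sum)
    also have "\<dots> \<le> (\<Sum>i\<in>UNIV. norm v * \<bar>B i\<bar>)"
      unfolding norm_scaleR
      using B[OF x] component_le_norm_cart[of v] by (intro sum_mono mult_mono) (auto intro: order_trans[OF _ abs_ge_self])
    also have "\<dots> \<le> K * norm v" by (simp add: K_def sum_distrib_left[symmetric] algebra_simps)
    finally show ?thesis .
  qed
  moreover have "K > 0" unfolding K_def by (intro add_nonneg_pos sum_nonneg) auto
  ultimately show ?thesis using that by blast
qed

text \<open>Balls around \<open>q1\<close> and \<open>q2\<close> with radius the distance to the
  complement have their interiors in \<open>P\<close>, and their convex combination is the ball of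
  radius \<open>r\<close> around \<open>m\<close>. A point \<open>w\<close> of the complement nearer
  than \<open>r\<close> would be \<open>m + r *\<^sub>R v\<close> with \<open>norm v < 1\<close>, a
  combination of points of \<open>P\<close>.\<close>

lemma infdist_complement_concave:
  fixes P :: "'a::real_normed_vector set"
  assumes P: "convex P" "- P \<noteq> {}"
  shows "concave_on P (\<lambda>q. infdist q (- P))"
  unfolding concave_on_def
proof (rule convex_onI)
  fix t :: real and q1 q2 assume t: "0 < t" "t < 1" and q: "q1 \<in> P" "q2 \<in> P"
  define d where "d q = infdist q (- P)" for q
  have ball: "w \<in> P" if "dist w q < d q" for w q
  proof (rule ccontr)
    assume "w \<notin> P"
    then have "d q \<le> dist q w" unfolding d_def by (intro infdist_le) auto
    then show False using that by (simp add: dist_commute)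
  qed
  define m where "m = (1 - t) *\<^sub>R q1 + t *\<^sub>R q2"
  define r where "r = (1 - t) * d q1 + t * d q2"
  have d0: "d q \<ge> 0" for q by (simp add: d_def infdist_nonneg)
  have "r \<le> dist m w" if w: "w \<in> - P" for w
  proof (rule ccontr)
    assume "\<not> r \<le> dist m w"
    then have lt: "norm (w - m) < r" by (simp add: dist_norm norm_minus_commute)
    then have rpos: "r > 0" using norm_ge_zero[of "w - m"] by linarith
    define v where "v = (1 / r) *\<^sub>R (w - m)"
    have nv: "norm v < 1" using lt rpos by (simp add: v_def)
    have in1: "q + d q *\<^sub>R v \<in> P" if "q \<in> P" for q
    proof (cases "d q = 0")
      case False
      then have "d q * norm v < d q * 1" using nv d0[of q] by (intro mult_strict_left_mono) auto
      then show ?thesis using d0[of q] by (intro ball[of _ q]) (simp add: dist_norm)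
    qed (use that in simp)
    have "(1 - t) *\<^sub>R (q1 + d q1 *\<^sub>R v) + t *\<^sub>R (q2 + d q2 *\<^sub>R v) \<in> P"
      using t q in1 by (intro convexD_alt[OF P(1)]) auto
    moreover have "(1 - t) *\<^sub>R (q1 + d q1 *\<^sub>R v) + t *\<^sub>R (q2 + d q2 *\<^sub>R v) = m + r *\<^sub>R v"
      by (simp add: m_def r_def algebra_simps)
    moreover have "m + r *\<^sub>R v = w" using rpos by (simp add: v_def)
    ultimately show False using w by simp
  qed
  then have "r \<le> infdist m (- P)" unfolding infdist_notempty[OF P(2)] by (rule cINF_greatest[OF P(2)])
  then show "- infdist ((1 - t) *\<^sub>R q1 + t *\<^sub>R q2) (- P) \<le> (1 - t) * - infdist q1 (- P) + t * - infdist q2 (- P)"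
    by (simp add: m_def r_def d_def)
qed (rule P)

section \<open>Boundary of the domain and the dilation field\<close>

locale C2_diffeo_bounded = C2_diffeo +
  assumes bounded_S: "bounded S" and convex_image: "convex (F ` S)"
    and T_bounded: "\<exists>M. \<forall>x\<in>S. \<forall>j i k. \<bar>T j i k x\<bar> \<le> M"
begin

abbreviation "P \<equiv> F ` S"

lemma compact_S: "compact (closure S)"
  using bounded_S by (simp add: compact_closure)

lemma compact_image: "compact (F ` closure S)"
  by (rule compact_continuous_image[OF F_continuous compact_S])

lemma bounded_P: "bounded P"
  using compact_imp_bounded[OF compact_image] closure_subset[of S] by (meson bounded_subset image_mono)

lemma image_closure: "F ` closure S = closure P"
proof
  show "F ` closure S \<subseteq> closure P" by (rule image_closure_subset[OF F_continuous]) (auto simp: closure_subset)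
  show "closure P \<subseteq> F ` closure S"
    by (rule closure_minimal) (use closure_subset compact_image compact_imp_closed in blast)+
qed

lemma G_bound: obtains K where "K > 0" "\<And>q v. q \<in> P \<Longrightarrow> norm (G' q v) \<le> K * norm v"
  using derivative_bound_of_extends_Ck[OF G_ext bounded_P G_derivative] by blast

lemma A_bound: obtains K where "K > 0" "\<And>x v. x \<in> S \<Longrightarrow> norm (A x *v v) \<le> K * norm v"
proof -
  have "extends_Ck 1 S F" using diffeo by (auto simp: diffeo_onto_range_def Ck_closure_def)
  from derivative_bound_of_extends_Ck[OF this bounded_S F_derivative] show ?thesis using that by blast
qed

lemma negligible_preimage:
  assumes "negligible N" "N \<subseteq> P" shows "negligible {x \<in> S. F x \<in> N}"
proof -
  have "G differentiable_on N" unfolding differentiable_on_def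
  proof
    fix q assume "q \<in> N"
    then have "G differentiable (at q)" using assms(2) by (intro differentiableI[OF G_derivative]) blast
    then show "G differentiable (at q within N)" by (rule differentiable_at_withinI)
  qed
  then have "negligible (G ` N)" using assms by (intro negligible_differentiable_image_negligible) auto
  moreover have "{x \<in> S. F x \<in> N} \<subseteq> G ` N"
  proof
    fix x assume "x \<in> {x \<in> S. F x \<in> N}"
    then have "x = G (F x)" "F x \<in> N" using G_F closure_subset[of S] by auto
    then show "x \<in> G ` N" by blast
  qed
  ultimately show ?thesis by (rule negligible_subset)
qed

text \<open>No regularity of the boundary of \<open>S\<close> is assumed. It is covered by the image
  of the frontier of the convex set \<open>P\<close> under the inverse, which is Lipschitz on the
  closure because \<open>G'\<close> is bounded and \<open>P\<close> is convex.\<close>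

lemma negligible_boundary: "negligible (closure S - S)"
proof -
  obtain K where K: "K > 0" "\<And>q v. q \<in> P \<Longrightarrow> norm (G' q v) \<le> K * norm v" using G_bound by blast
  have lip: "norm (G q - G r) \<le> K * norm (q - r)" if "q \<in> P" "r \<in> P" for q r
  proof -
    have "seg_lipschitz K P G" by (rule seg_lipschitz_of_derivative[OF G_derivative K(2)])
    then show ?thesis using that convex_image by (auto simp: seg_lipschitz_def closed_segment_subset)
  qed
  have lip': "norm (G q - G r) \<le> K * norm (q - r)" if qr: "q \<in> closure P" "r \<in> closure P" for q r
  proof -
    obtain s where s: "\<And>n. s n \<in> P" "s \<longlonglongrightarrow> q" using qr(1) closure_sequential by metis
    obtain t where t: "\<And>n. t n \<in> P" "t \<longlonglongrightarrow> r" using qr(2) closure_sequential by metis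
    have Gl: "(\<lambda>n. G (w n)) \<longlonglongrightarrow> G w'" if "\<And>n. w n \<in> P" "w \<longlonglongrightarrow> w'" "w' \<in> closure P" for w w'
      by (rule continuous_on_tendsto_compose[OF G_continuous that(2,3)]) (use that closure_subset in \<open>auto intro!: always_eventually\<close>)
    have "(\<lambda>n. norm (G (s n) - G (t n))) \<longlonglongrightarrow> norm (G q - G r)"
      by (intro tendsto_intros Gl) (use s t qr in auto)
    moreover have "(\<lambda>n. K * norm (s n - t n)) \<longlonglongrightarrow> K * norm (q - r)"
      by (intro tendsto_intros s t)
    ultimately show ?thesis by (rule LIMSEQ_le) (use lip s t in auto)
  qed
  have "closure P - P \<subseteq> frontier P" using open_image by (simp add: frontier_def interior_open)
  then have "negligible (closure P - P)" using negligible_convex_frontier[OF convex_image] negligible_subset by blast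
  then have "negligible (G ` (closure P - P))"
    by (rule negligible_locally_Lipschitz_image[rotated]) (use lip' in \<open>auto intro!: exI[of _ UNIV] exI[of _ K]\<close>)
  moreover have "closure S - S \<subseteq> G ` (closure P - P)"
  proof
    fix x assume x: "x \<in> closure S - S"
    have "F x \<notin> P"
    proof
      assume "F x \<in> P"
      then obtain x' where "x' \<in> S" "F x' = F x" by auto
      then show False using x inj_onD[OF inj_F, of x' x] closure_subset[of S] by auto
    qed
    moreover have "F x \<in> closure P" using x image_closure by blast
    ultimately show "x \<in> G ` (closure P - P)" using G_F x by (intro image_eqI[of _ _ "F x"]) auto
  qed
  ultimately show ?thesis by (rule negligible_subset)
qed

text \<open>Invariance of domain sends the interior of the closure to an open subset of
  \<open>closure P\<close>, and a convex open set is the interior of its closure. It ensures that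
  interior points of the exclusion set, taken in the whole space, lie in \<open>X\<close>.\<close>

lemma interior_closure_eq: "interior (closure S) = S"
proof
  show "S \<subseteq> interior (closure S)" using S closure_subset interior_maximal by blast
  show "interior (closure S) \<subseteq> S"
  proof
    fix x assume x: "x \<in> interior (closure S)"
    have "open (F ` interior (closure S))"
    proof (rule invariance_of_domain)
      show "continuous_on (interior (closure S)) F" using F_continuous interior_subset continuous_on_subset by blast
      show "inj_on F (interior (closure S))" using inj_F interior_subset inj_on_subset by blast
    qed simp
    moreover have "F ` interior (closure S) \<subseteq> closure P" using image_closure interior_subset by blast
    ultimately have "F ` interior (closure S) \<subseteq> interior (closure P)" by (rule interior_maximal[rotated])
    also have "\<dots> = P" using convex_interior_closure[OF convex_image] open_image by (simp add: interior_open)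
    finally have "F x \<in> P" using x by blast
    then obtain x' where "x' \<in> S" "F x' = F x" by auto
    then show "x \<in> S" using x inj_onD[OF inj_F, of x' x] closure_subset[of S] interior_subset by auto
  qed
qed

text \<open>The vector field whose flow, in the coordinate \<open>F\<close>, is the dilation centred at \<open>F a\<close>.\<close>

definition V where "V a x = G' (F x) (F x - F a)"

lemma A_V: "x \<in> S \<Longrightarrow> A x *v V a x = F x - F a"
  using A_G'[of "F x"] G_F closure_subset[of S] by (auto simp: V_def)

lemma V_bound: obtains K where "K > 0" "\<And>a x. a \<in> closure S \<Longrightarrow> x \<in> S \<Longrightarrow> norm (V a x) \<le> K"
proof -
  obtain K where K: "K > 0" "\<And>q v. q \<in> P \<Longrightarrow> norm (G' q v) \<le> K * norm v" using G_bound by blast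
  obtain B where B: "B > 0" "\<And>x. x \<in> closure S \<Longrightarrow> norm (F x) \<le> B"
    using compact_imp_bounded[OF compact_image] unfolding bounded_pos by auto
  have "norm (V a x) \<le> K * (2 * B)" if a: "a \<in> closure S" and x: "x \<in> S" for a x
  proof -
    have "norm (V a x) \<le> K * norm (F x - F a)" unfolding V_def using K x by blast
    also have "norm (F x - F a) \<le> norm (F x) + norm (F a)" by (rule norm_triangle_ineq4)
    also have "\<dots> \<le> 2 * B" using B(2)[OF a] B(2)[of x] x closure_subset[of S] by auto
    finally show ?thesis using K by simp
  qed
  then show ?thesis using that[of "K * (2 * B)"] K B by auto
qed

lemma V_continuous: "continuous_on S (V a)"
proof -
  have "continuous_on S F" using F_continuous closure_subset continuous_on_subset by blast
  then show ?thesis unfolding V_def[abs_def]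
    by (intro G'_continuous_compose continuous_intros) auto
qed

text \<open>\<open>V a\<close> solves \<open>A x *v V a x = F x - F a\<close>, so
  \<open>implicit_derivative\<close> applies. The bound does not depend on \<open>a\<close>, because
  the centre of the dilation will vary with \<epsilon>.\<close>

lemma V_derivative:
  obtains K dV where "K > 0"
    "\<And>a x. a \<in> closure S \<Longrightarrow> x \<in> S \<Longrightarrow> (V a has_derivative dV a x) (at x)"
    "\<And>a x h. a \<in> closure S \<Longrightarrow> x \<in> S \<Longrightarrow> norm (dV a x h) \<le> K * norm h"
proof -
  obtain K where K: "K > 0" "\<And>q v. q \<in> P \<Longrightarrow> norm (G' q v) \<le> K * norm v" using G_bound by blast
  obtain C where C: "C > 0" "\<And>a x. a \<in> closure S \<Longrightarrow> x \<in> S \<Longrightarrow> norm (V a x) \<le> C" using V_bound by blast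
  obtain M where M: "\<And>x j i k. x \<in> S \<Longrightarrow> \<bar>T j i k x\<bar> \<le> M" using T_bounded by blast
  define dA where "dA x h = (\<chi> j i. \<Sum>k\<in>UNIV. h $ k * T j i k x)" for x h
  define dV where "dV a x h = G' (F x) (A x *v h - dA x h *v V a x)" for a x h
  define N where "N = real CARD('a)"
  have der: "(V a has_derivative dV a x) (at x)" if a: "a \<in> closure S" and x: "x \<in> S" for a x
    unfolding dV_def[abs_def]
  proof (rule implicit_derivative[where A=A and r="\<lambda>x. F x - F a"])
    show "((\<lambda>x. A x $ j $ i) has_derivative (\<lambda>h. dA x h $ j $ i)) (at x)" for j i
      using A_derivative[OF x] by (simp add: dA_def)
    show "((\<lambda>x. F x - F a) has_derivative (*v) (A x)) (at x)"
      using has_derivative_diff[OF F_derivative[OF x] has_derivative_const[of "F a"]] by simp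
    show "isCont (V a) x" using V_continuous S x by (simp add: continuous_on_eq_continuous_at)
    show "eventually (\<lambda>w. A w *v V a w = F w - F a) (at x)"
      using eventually_at_in_open'[OF S x] by eventually_elim (rule A_V)
    show "A x *v V a x = F x - F a" by (rule A_V[OF x])
    show "bounded_linear (G' (F x))" using linear_G' x by blast
    show "G' (F x) (A x *v w) = w" for w by (rule G'_A[OF x])
  qed
  have "norm (dV a x h) \<le> (1 + K * (N * (N * (N * \<bar>M\<bar> * C)))) * norm h" if a: "a \<in> closure S" and x: "x \<in> S" for a x h
  proof -
    have lin: "linear (G' (F x))" using linear_G' x bounded_linear.linear by blast
    \<comment> \<open>The derivative of \<open>F x - F a\<close> contributes the identity, since
      \<open>G'\<close> inverts \<open>A\<close>; only the variation of the Jacobian has to be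
      estimated.\<close>
    have "dV a x h = h - G' (F x) (dA x h *v V a x)"
      unfolding dV_def using lin by (simp add: linear_diff G'_A[OF x])
    also have "norm \<dots> \<le> norm h + norm (G' (F x) (dA x h *v V a x))" by (rule norm_triangle_ineq4)
    also have "norm (G' (F x) (dA x h *v V a x)) \<le> K * norm (dA x h *v V a x)" using K x by blast
    also have "norm (dA x h *v V a x) \<le> (\<Sum>j\<in>UNIV. \<bar>(dA x h *v V a x) $ j\<bar>)" by (rule norm_le_l1_cart)
    also have "\<dots> \<le> (\<Sum>j\<in>(UNIV::'a set). N * (N * \<bar>M\<bar> * norm h * C))"
    proof (rule sum_mono)
      fix j
      have "\<bar>(dA x h *v V a x) $ j\<bar> \<le> (\<Sum>i\<in>UNIV. \<bar>(\<Sum>k\<in>UNIV. h $ k * T j i k x) * V a x $ i\<bar>)"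
        by (simp add: matrix_vector_mult_def dA_def sum_abs)
      also have "\<dots> \<le> (\<Sum>i\<in>(UNIV::'a set). (N * \<bar>M\<bar> * norm h) * C)"
        unfolding abs_mult
      proof (intro sum_mono mult_mono)
        fix i
        have "\<bar>\<Sum>k\<in>UNIV. h $ k * T j i k x\<bar> \<le> (\<Sum>k\<in>UNIV. \<bar>h $ k * T j i k x\<bar>)" by (rule sum_abs)
        also have "\<dots> \<le> (\<Sum>k\<in>(UNIV::'a set). norm h * \<bar>M\<bar>)"
          unfolding abs_mult using component_le_norm_cart[of h] M[OF x]
          by (intro sum_mono mult_mono) (auto intro: order_trans[OF _ abs_ge_self])
        finally show "\<bar>\<Sum>k\<in>UNIV. h $ k * T j i k x\<bar> \<le> N * \<bar>M\<bar> * norm h" by (simp add: N_def mult_ac)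
        show "\<bar>V a x $ i\<bar> \<le> C" using component_le_norm_cart[of "V a x" i] C(2)[OF a x] by linarith
      qed (use C in \<open>auto simp: N_def\<close>)
      finally show "\<bar>(dA x h *v V a x) $ j\<bar> \<le> N * (N * \<bar>M\<bar> * norm h * C)" by (simp add: N_def mult_ac)
    qed
    also have "\<dots> = N * (N * (N * \<bar>M\<bar> * norm h * C))" by (simp add: N_def)
    finally show ?thesis using K(1) by (simp add: algebra_simps)
  qed
  moreover have "1 + K * (N * (N * (N * \<bar>M\<bar> * C))) > 0"
    using K C by (intro add_pos_nonneg mult_nonneg_nonneg) (auto simp: N_def)
  ultimately show ?thesis using that der by blast
qed

end

lemma differentiable_GDERIV:
  fixes f :: "'a::euclidean_space \<Rightarrow> real"
  assumes "f differentiable (at x)"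
  shows "GDERIV f x :> grad f x"
proof -
  obtain D where D: "(f has_derivative D) (at x)" using assms by (auto simp: differentiable_def)
  have l: "linear D" using D has_derivative_linear by blast
  define v where "v = (\<Sum>i\<in>Basis. D i *\<^sub>R i)"
  have "D h = h \<bullet> v" for h
  proof -
    have "D h = D (\<Sum>i\<in>Basis. (h \<bullet> i) *\<^sub>R i)" by (simp only: euclidean_representation)
    also have "\<dots> = (\<Sum>i\<in>Basis. (h \<bullet> i) * D i)" using l by (simp add: linear_sum linear_scale)
    also have "\<dots> = h \<bullet> v" by (simp add: v_def inner_sum_right mult.commute)
    finally show ?thesis .
  qed
  then have "D = (\<lambda>h. h \<bullet> v)" by (rule ext)
  then have "GDERIV f x :> v" using D by (simp add: gderiv_def)
  then show ?thesis using grad_eqI by metis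
qed

lemma has_derivative_directional:
  assumes "(f has_derivative f') (at x)"
  shows "((\<lambda>t. (f (x + t *\<^sub>R e) - f x :: real) / t) \<longlongrightarrow> f' e) (at 0)"
proof -
  have "((\<lambda>t. x + t *\<^sub>R e) has_derivative (\<lambda>h. h *\<^sub>R e)) (at 0)" by (auto intro!: derivative_eq_intros)
  then have "((\<lambda>t. f (x + t *\<^sub>R e)) has_real_derivative f' e) (at 0)"
    by (rule has_real_derivative_compose_curve) (use assms in simp)
  then show ?thesis by (simp add: DERIV_def)
qed

lemma convex_on_max_const:
  assumes "convex_on P f" shows "convex_on P (\<lambda>x. max (f x) (c::real))"
proof (rule convex_onI)
  fix t :: real and x y assume t: "0 < t" "t < 1" and xy: "x \<in> P" "y \<in> P"
  have "f ((1 - t) *\<^sub>R x + t *\<^sub>R y) \<le> (1 - t) * f x + t * f y"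
    using convex_onD[OF assms] t xy by auto
  also have "\<dots> \<le> (1 - t) * max (f x) c + t * max (f y) c"
    using t by (intro add_mono mult_left_mono) auto
  finally have 1: "f ((1 - t) *\<^sub>R x + t *\<^sub>R y) \<le> (1 - t) * max (f x) c + t * max (f y) c" .
  have "c = (1 - t) * c + t * c" by (simp add: algebra_simps)
  also have "\<dots> \<le> (1 - t) * max (f x) c + t * max (f y) c"
    using t by (intro add_mono mult_left_mono) auto
  finally show "max (f ((1 - t) *\<^sub>R x + t *\<^sub>R y)) c \<le> (1 - t) * max (f x) c + t * max (f y) c"
    using 1 by simp
qed (rule convex_on_imp_convex[OF assms])

lemma seg_lipschitz_continuous_on:
  assumes S: "open S" and h: "seg_lipschitz L S h"
  shows "continuous_on S h"
proof -
  have "isCont h x" if x: "x \<in> S" for x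
  proof -
    obtain r where r: "r > 0" "ball x r \<subseteq> S" using S x open_contains_ball by blast
    have "eventually (\<lambda>y. norm (h y - h x) \<le> L * norm (y - x)) (at x)"
      unfolding eventually_at
    proof (intro exI[of _ r] conjI ballI impI r(1))
      fix y assume "y \<noteq> x \<and> dist y x < r"
      then have "closed_segment y x \<subseteq> ball x r" using r(1) by (intro closed_segment_subset) (auto simp: dist_commute)
      then show "norm (h y - h x) \<le> L * norm (y - x)" using h r(2) by (auto simp: seg_lipschitz_def)
    qed
    moreover have "((\<lambda>y. L * norm (y - x)) \<longlongrightarrow> L * norm (x - x)) (at x)" by (intro tendsto_intros)
    then have "((\<lambda>y. L * norm (y - x)) \<longlongrightarrow> 0) (at x)" by (simp only: diff_self norm_zero mult_zero_right)
    ultimately have "((\<lambda>y. h y - h x) \<longlongrightarrow> 0) (at x)" by (rule Lim_null_comparison)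
    then show ?thesis unfolding isCont_def by (simp add: LIM_zero_cancel)
  qed
  then show ?thesis by (simp add: continuous_at_imp_continuous_on)
qed

lemma borel_measurable_indicator_continuous:
  fixes h :: "'a::euclidean_space \<Rightarrow> real"
  assumes "open S" "continuous_on S h"
  shows "(\<lambda>x. indicator S x * h x) \<in> borel_measurable borel"
  using borel_measurable_continuous_on_indicator[OF _ assms(2)] assms(1) by simp

lemma AE_iff_null_sets_lebesgue:
  "(AE x in lebesgue. x \<in> S \<longrightarrow> Q x) \<longleftrightarrow> negligible {x \<in> S. \<not> Q x}"
proof -
  have "(AE x in lebesgue. x \<in> S \<longrightarrow> Q x) \<longleftrightarrow> {x \<in> space lebesgue. \<not> (x \<in> S \<longrightarrow> Q x)} \<in> null_sets lebesgue"
    by (rule completion.AE_iff_null_sets)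
  also have "{x \<in> space lebesgue. \<not> (x \<in> S \<longrightarrow> Q x)} = {x \<in> S. \<not> Q x}" by auto
  finally show ?thesis by (simp add: negligible_iff_null_sets)
qed

section \<open>Integration by parts with a concave cutoff\<close>

context C2_diffeo_bounded
begin

text \<open>As a function of the distance to the complement of \<open>P\<close> this is the
  piecewise linear ramp from 0 at \<open>\<delta>\<close> to 1 at \<open>2 * \<delta>\<close>.
  Writing it as a difference of two truncations, each concave on \<open>P\<close>, yields
  differentiability almost everywhere.\<close>

definition cutoff :: "real \<Rightarrow> real^'a \<Rightarrow> real" where
  "cutoff \<delta> y = (min (infdist y (- P)) (2 * \<delta>) - min (infdist y (- P)) \<delta>) / \<delta>"

lemma complement_nonempty: "- P \<noteq> {}"
proof -
  have "P \<noteq> UNIV" using bounded_P not_bounded_UNIV by metis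
  then show ?thesis by auto
qed

lemma cutoff_bounds: "\<delta> > 0 \<Longrightarrow> 0 \<le> cutoff \<delta> y" "\<delta> > 0 \<Longrightarrow> cutoff \<delta> y \<le> 1"
  by (auto simp: cutoff_def field_simps min_def)

lemma cutoff_mono: "\<delta> > 0 \<Longrightarrow> infdist y (- P) \<le> infdist y' (- P) \<Longrightarrow> cutoff \<delta> y \<le> cutoff \<delta> y'"
  unfolding cutoff_def by (intro divide_right_mono) (auto simp: min_def)

lemma cutoff_eq_0: "\<delta> > 0 \<Longrightarrow> infdist y (- P) \<le> \<delta> \<Longrightarrow> cutoff \<delta> y = 0"
  and cutoff_eq_1: "\<delta> > 0 \<Longrightarrow> 2 * \<delta> \<le> infdist y (- P) \<Longrightarrow> cutoff \<delta> y = 1"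
  by (auto simp: cutoff_def min_def field_simps)

lemma cutoff_lipschitz:
  assumes "\<delta> > 0" shows "\<bar>cutoff \<delta> y - cutoff \<delta> y'\<bar> \<le> 2 / \<delta> * norm (y - y')"
proof -
  have d: "\<bar>infdist y (- P) - infdist y' (- P)\<bar> \<le> norm (y - y')"
    using infdist_triangle_abs[of y "- P" y'] by (simp add: dist_norm)
  have m: "\<bar>min s c - min s' c\<bar> \<le> \<bar>s - s'\<bar>" for s s' c :: real by (auto simp: min_def)
  have "cutoff \<delta> y - cutoff \<delta> y' = ((min (infdist y (- P)) (2 * \<delta>) - min (infdist y' (- P)) (2 * \<delta>))
      - (min (infdist y (- P)) \<delta> - min (infdist y' (- P)) \<delta>)) / \<delta>"
    by (simp add: cutoff_def diff_divide_distrib)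
  then have "\<bar>cutoff \<delta> y - cutoff \<delta> y'\<bar> = \<bar>(min (infdist y (- P)) (2 * \<delta>) - min (infdist y' (- P)) (2 * \<delta>))
      - (min (infdist y (- P)) \<delta> - min (infdist y' (- P)) \<delta>)\<bar> / \<delta>"
    using assms by (simp add: abs_divide)
  also have "\<dots> \<le> (norm (y - y') + norm (y - y')) / \<delta>"
    by (intro divide_right_mono order_trans[OF abs_triangle_ineq4] add_mono order_trans[OF m d])
       (use assms in simp)
  finally show ?thesis by simp
qed

lemma cutoff_differentiable_AE: "negligible {y \<in> P. \<not> cutoff \<delta> differentiable (at y)}"
proof -
  have op: "open P" by (rule open_image)
  have "convex_on P (\<lambda>y. - infdist y (- P))"
    using infdist_complement_concave[OF convex_image complement_nonempty] by (simp add: concave_on_def)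
  then have "convex_on P (\<lambda>y. max (- infdist y (- P)) (- c))" for c by (rule convex_on_max_const)
  then have n: "negligible {y \<in> P. \<not> (\<lambda>y. max (- infdist y (- P)) (- c)) differentiable (at y)}" for c
    using convex_on_differentiable_AE op by blast
  have eq: "cutoff \<delta> = (\<lambda>y. (- max (- infdist y (- P)) (- (2 * \<delta>)) + max (- infdist y (- P)) (- \<delta>)) / \<delta>)"
    by (rule ext) (auto simp: cutoff_def min_def max_def)
  have "cutoff \<delta> differentiable (at y)"
    if "(\<lambda>y. max (- infdist y (- P)) (- (2 * \<delta>))) differentiable (at y)" "(\<lambda>y. max (- infdist y (- P)) (- \<delta>)) differentiable (at y)" for y
    unfolding eq divide_inverse using that by (intro derivative_intros)
  then show ?thesis
    by (intro negligible_subset[OF negligible_Un[OF n[of "2 * \<delta>"] n[of \<delta>]]]) blast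
qed

text \<open>The distance to the complement of \<open>P\<close> is concave, so it decreases along rays from a point \<open>q\<close> once it is below its value at \<open>q\<close>.\<close>

lemma cutoff_radial:
  assumes \<delta>: "\<delta> > 0" "2 * \<delta> \<le> infdist q (- P)" and q: "q \<in> P" and y: "y \<in> P"
    and D: "(cutoff \<delta> has_derivative D) (at y)"
  shows "D (y - q) \<le> 0"
proof (rule ccontr)
  assume "\<not> D (y - q) \<le> 0"
  have "((\<lambda>t. y + t *\<^sub>R (y - q)) has_derivative (\<lambda>h. h *\<^sub>R (y - q))) (at 0)" by (auto intro!: derivative_eq_intros)
  then have "((\<lambda>t. cutoff \<delta> (y + t *\<^sub>R (y - q))) has_real_derivative D (y - q)) (at 0)"
    by (rule has_real_derivative_compose_curve) (use D in simp)
  then obtain d where d: "d > 0" "\<And>h. 0 < h \<Longrightarrow> h < d \<Longrightarrow> cutoff \<delta> (y + 0 *\<^sub>R (y - q)) < cutoff \<delta> (y + (0 + h) *\<^sub>R (y - q))"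
    using DERIV_pos_inc_right[of "\<lambda>t. cutoff \<delta> (y + t *\<^sub>R (y - q))" "D (y - q)" 0] \<open>\<not> D (y - q) \<le> 0\<close> by auto
  obtain r where r: "r > 0" "ball y r \<subseteq> P" using open_image y open_contains_ball by blast
  have nr: "norm (y - q) + 1 > 0" using norm_ge_zero[of "y - q"] by linarith
  define s where "s = min (d / 2) (r / (2 * (norm (y - q) + 1)))"
  have s1: "s \<le> d / 2" and s2: "s \<le> r / (2 * (norm (y - q) + 1))"
    unfolding s_def by (rule min.cobounded1, rule min.cobounded2)
  have "0 < s" using d(1) r(1) nr by (simp add: s_def)
  then have s: "0 < s" "s < d" using s1 d(1) by auto
  define y' where "y' = y + s *\<^sub>R (y - q)"
  have "s * norm (y - q) \<le> (r / (2 * (norm (y - q) + 1))) * (norm (y - q) + 1)"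
    using s(1) s2 r(1) nr by (intro mult_mono) auto
  also have "\<dots> = r / 2" using nr by (simp add: field_simps)
  finally have "y' \<in> ball y r" using s r by (simp add: y'_def dist_norm)
  then have y': "y' \<in> P" using r by blast
  define d' where "d' y = infdist y (- P)" for y
  \<comment> \<open>The weight \<open>s / (1 + s)\<close> makes \<open>y\<close> the convex
    combination of the point \<open>y'\<close> further out and the centre \<open>q\<close>;
    concavity then bounds the distance at \<open>y'\<close>. If \<open>y\<close> is further inside
    than \<open>q\<close>, the cutoff has already reached its maximum 1.\<close>
  have "- d' ((1 - s / (1 + s)) *\<^sub>R y' + (s / (1 + s)) *\<^sub>R q) \<le> (1 - s / (1 + s)) * - d' y' + (s / (1 + s)) * - d' q"
    using convex_onD[OF infdist_complement_concave[OF convex_image complement_nonempty, unfolded concave_on_def], of "s / (1 + s)" y' q] s y' q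
    unfolding d'_def by simp
  moreover have "(1 - s / (1 + s)) *\<^sub>R y' + (s / (1 + s)) *\<^sub>R q = y"
  proof -
    have c: "1 - s / (1 + s) = 1 / (1 + s)" using s by (simp add: field_simps)
    have "(1 / (1 + s)) *\<^sub>R y' + (s / (1 + s)) *\<^sub>R q = (1 / (1 + s)) *\<^sub>R (y' + s *\<^sub>R q)"
      by (simp add: scaleR_add_right)
    also have "y' + s *\<^sub>R q = (1 + s) *\<^sub>R y" by (simp add: y'_def algebra_simps)
    finally show ?thesis using s by (simp add: c)
  qed
  ultimately have "(1 - s / (1 + s)) * d' y' + (s / (1 + s)) * d' q \<le> d' y" by simp
  moreover have "(1 - s / (1 + s)) * d' y' + (s / (1 + s)) * d' q = (d' y' + s * d' q) / (1 + s)"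
  proof -
    have c: "1 - s / (1 + s) = 1 / (1 + s)" using s by (simp add: field_simps)
    show ?thesis unfolding c by (simp add: add_divide_distrib)
  qed
  ultimately have "(d' y' + s * d' q) / (1 + s) \<le> d' y" by simp
  then have "d' y' + s * d' q \<le> d' y * (1 + s)" using s by (simp only: pos_divide_le_eq add_pos_pos zero_less_one)
  then have dd: "d' y' \<le> d' y + s * (d' y - d' q)" by (simp add: algebra_simps)
  have "cutoff \<delta> y' \<le> cutoff \<delta> y"
  proof (cases "d' y \<le> d' q")
    case True
    then have "s * (d' y - d' q) \<le> 0" using s by (intro mult_nonneg_nonpos) auto
    then show ?thesis using dd by (intro cutoff_mono \<delta>(1)) (simp add: d'_def)
  next
    case False
    then have "cutoff \<delta> y = 1" using \<delta> by (intro cutoff_eq_1) (auto simp: d'_def)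
    then show ?thesis using cutoff_bounds(2)[OF \<delta>(1)] by simp
  qed
  moreover have "cutoff \<delta> y < cutoff \<delta> y'" using d(2)[OF s] by (simp add: y'_def)
  ultimately show False by simp
qed

lemma compact_cutoff_support:
  assumes "\<delta> > 0" shows "compact {x \<in> S. \<delta> \<le> infdist (F x) (- P)}" (is "compact ?K")
proof -
  let ?L = "{y. \<delta> \<le> infdist y (- P)}"
  have LP: "?L \<subseteq> P"
  proof
    fix y assume "y \<in> ?L"
    then have "infdist y (- P) > 0" using assms by simp
    then have "y \<notin> - P" by (metis infdist_zero less_irrefl)
    then show "y \<in> P" by simp
  qed
  have "closed ?L" by (intro closed_Collect_le continuous_intros)
  then have "compact ?L" using bounded_subset[OF bounded_P LP] by (simp add: compact_eq_bounded_closed)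
  moreover have "continuous_on ?L G"
    by (rule continuous_on_subset[OF G_continuous order_trans[OF LP closure_subset]])
  ultimately have "compact (G ` ?L)" by (rule compact_continuous_image[rotated])
  moreover have "?K = G ` ?L"
  proof
    show "?K \<subseteq> G ` ?L"
    proof
      fix x assume "x \<in> ?K"
      then have "x = G (F x)" "F x \<in> ?L" using G_F closure_subset[of S] by auto
      then show "x \<in> G ` ?L" by blast
    qed
    show "G ` ?L \<subseteq> ?K"
    proof
      fix x assume "x \<in> G ` ?L"
      then obtain y where y: "y \<in> ?L" "x = G y" by blast
      then have "y \<in> P" using LP by blast
      then show "x \<in> ?K" using y G_in[of y] F_G[of y] by auto
    qed
  qed
  ultimately show ?thesis by simp
qed

text \<open>The weak formula is applied to the components of \<open>V z\<close> times a cutoff of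
  the coordinate. In the divergence, the cutoff gradient contributes a term of nonpositive sign by
  \<open>cutoff_radial\<close>, the trace of \<open>dV\<close> is at most dimension times
  \<open>Kd\<close>, and the remaining term is the desired one. Letting the cutoff tend to 1 on
  \<open>S\<close> leaves no trace of the boundary.\<close>

lemma weak_divergence_inequality:
  fixes f :: "real^'a \<Rightarrow> real" and g :: "'a \<Rightarrow> real^'a \<Rightarrow> real" and z :: "real^'a \<Rightarrow> real"
    and Kd Kv L :: real
  assumes w: "\<And>i. has_weak_derivative_on f (g i) (axis i 1) S"
    and f0: "AE x in lebesgue. 0 \<le> f x"
    and Kd: "\<And>x. x \<in> S \<Longrightarrow> (V a has_derivative dV x) (at x)" "\<And>x h. x \<in> S \<Longrightarrow> norm (dV x h) \<le> Kd * norm h" "0 \<le> Kd"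
    and Kv: "\<And>x. x \<in> S \<Longrightarrow> norm (V a x) \<le> Kv" "0 \<le> Kv"
    and a: "a \<in> S"
    and z: "seg_lipschitz L S z" "0 \<le> L" "\<And>x. x \<in> S \<Longrightarrow> 0 \<le> z x" "\<And>x. x \<in> S \<Longrightarrow> z x \<le> 1"
    and zd: "AE x in lebesgue. x \<in> S \<longrightarrow> z differentiable (at x)"
  shows "integrable lebesgue (\<lambda>x. f x * (grad z x \<bullet> V a x))"
    "- (LINT x|lebesgue. f x * (grad z x \<bullet> V a x))
      \<le> (LINT x|lebesgue. (real CARD('a) * Kd * f x + Kv * (\<Sum>i\<in>UNIV. \<bar>g i x\<bar>)) * z x)"
proof -
  define N where "N = real CARD('a)"
  have f: "integrable lebesgue f" and fS: "\<And>x. x \<notin> S \<Longrightarrow> f x = 0"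
    using w by (auto simp: has_weak_derivative_on_def)
  have g: "\<And>i. integrable lebesgue (g i)" and gS: "\<And>i x. x \<notin> S \<Longrightarrow> g i x = 0"
    using w by (auto simp: has_weak_derivative_on_def)
  have zc: "continuous_on S z" by (rule seg_lipschitz_continuous_on[OF S z(1)])
  have Vc: "continuous_on S (\<lambda>x. V a x $ i)" for i by (intro continuous_on_component V_continuous)
  have FS: "continuous_on S F" by (rule continuous_on_subset[OF F_continuous closure_subset])
  have Vi: "\<bar>V a x $ i\<bar> \<le> Kv" if "x \<in> S" for x i
    using component_le_norm_cart[of "V a x" i] Kv(1)[OF that] by linarith
  have bm: "(\<lambda>x. indicator S x * h x) \<in> borel_measurable lebesgue" if "continuous_on S h" for h :: "real^'a \<Rightarrow> real"
  proof -
    have "(\<lambda>x. indicator S x * h x) \<in> borel_measurable lborel"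
      using borel_measurable_indicator_continuous[OF S that] by simp
    then show ?thesis by (rule measurable_completion)
  qed
  have zm: "(\<lambda>x. indicator S x * z x) \<in> borel_measurable lebesgue" by (rule bm[OF zc])
  define dz where "dz i x = indicator S x * (grad z x $ i)" for i x
  have zdir: "((\<lambda>t. (z (x + t *\<^sub>R axis i 1) - z x) / t) \<longlongrightarrow> grad z x $ i) (at 0)"
    if "z differentiable (at x)" for x i
    using has_derivative_directional[OF differentiable_GDERIV[OF that, unfolded gderiv_def], of "axis i 1"]
    by (simp add: inner_axis' inner_real_def)
  have near: "eventually (\<lambda>t. closed_segment x (x + t *\<^sub>R axis i 1) \<subseteq> S) (at 0)" if x: "x \<in> S" for x i
  proof -
    obtain r where r: "r > 0" "ball x r \<subseteq> S" using S x open_contains_ball by blast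
    show ?thesis unfolding eventually_at
    proof (intro exI[of _ r] conjI ballI impI r(1))
      fix t :: real assume "t \<noteq> 0 \<and> dist t 0 < r"
      then have "closed_segment x (x + t *\<^sub>R axis i 1) \<subseteq> ball x r"
        using r(1) by (intro closed_segment_subset) (auto simp: dist_norm)
      then show "closed_segment x (x + t *\<^sub>R axis i 1) \<subseteq> S" using r by blast
    qed
  qed
  have dz_bound: "\<bar>grad z x $ i\<bar> \<le> L" if x: "x \<in> S" and d: "z differentiable (at x)" for x i
  proof -
    have lim: "((\<lambda>t. \<bar>(z (x + t *\<^sub>R axis i 1) - z x) / t\<bar>) \<longlongrightarrow> \<bar>grad z x $ i\<bar>) (at 0)"
      by (rule tendsto_rabs[OF zdir[OF d]])
    have "eventually (\<lambda>t::real. t \<noteq> 0) (at 0)" by (simp add: eventually_at_filter)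
    then have "eventually (\<lambda>t. \<bar>(z (x + t *\<^sub>R axis i 1) - z x) / t\<bar> \<le> L) (at 0)"
      using near[OF x, of i]
    proof eventually_elim
      case (elim t)
      then have "norm (z x - z (x + t *\<^sub>R axis i 1)) \<le> L * norm (x - (x + t *\<^sub>R axis i 1))"
        using z(1) unfolding seg_lipschitz_def by blast
      then have "\<bar>z (x + t *\<^sub>R axis i 1) - z x\<bar> \<le> L * \<bar>t\<bar>" by (simp add: abs_minus_commute)
      then show ?case using elim(1) by (simp add: abs_divide pos_divide_le_eq)
    qed
    then show ?thesis using lim by (intro tendsto_upperbound[of _ _ "at (0::real)"]) auto
  qed
  \<comment> \<open>The gradient is a pointwise choice without evident measurability; almost
    everywhere it is a limit of difference quotients of the zero extension, which are Borel
    measurable.\<close>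
  have dzm: "dz i \<in> borel_measurable lebesgue" for i
  proof (rule borel_measurable_lebesgue_AE_LIMSEQ)
    let ?h = "\<lambda>n::nat. inverse (real (Suc n))"
    let ?zS = "\<lambda>x. indicator S x * z x"
    show "(\<lambda>x. indicator S x * ((?zS (x + ?h n *\<^sub>R axis i 1) - ?zS x) / ?h n)) \<in> borel_measurable lebesgue" for n
    proof -
      have m: "?zS \<in> borel_measurable borel" by (rule borel_measurable_indicator_continuous[OF S zc])
      have m2: "(\<lambda>x. ?zS (x + ?h n *\<^sub>R axis i 1)) \<in> borel_measurable borel"
        by (rule measurable_compose[OF _ m]) simp
      have "(indicator S :: _ \<Rightarrow> real) \<in> borel_measurable borel" using S by auto
      then have "(\<lambda>x. indicator S x * ((?zS (x + ?h n *\<^sub>R axis i 1) - ?zS x) / ?h n)) \<in> borel_measurable borel"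
        by (rule borel_measurable_times[OF _ borel_measurable_divide[OF borel_measurable_diff[OF m2 m] borel_measurable_const]])
      then have "(\<lambda>x. indicator S x * ((?zS (x + ?h n *\<^sub>R axis i 1) - ?zS x) / ?h n)) \<in> borel_measurable lborel"
        by simp
      then show ?thesis by (rule measurable_completion)
    qed
    show "AE x in lebesgue. (\<lambda>n. indicator S x * ((?zS (x + ?h n *\<^sub>R axis i 1) - ?zS x) / ?h n)) \<longlonglongrightarrow> dz i x"
      using zd
    proof eventually_elim
      case (elim x)
      show ?case
      proof (cases "x \<in> S")
        case True
        then have d: "z differentiable (at x)" using elim by blast
        have hl: "filterlim ?h (at 0) sequentially"
          using LIMSEQ_inverse_real_of_nat by (simp add: filterlim_at)
        have "eventually (\<lambda>t. indicator S x * ((?zS (x + t *\<^sub>R axis i 1) - ?zS x) / t) = (z (x + t *\<^sub>R axis i 1) - z x) / t) (at 0)"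
          using near[OF True, of i]
        proof eventually_elim
          case (elim t)
          then have "x + t *\<^sub>R axis i 1 \<in> S" by auto
          then show ?case using True by simp
        qed
        then have "((\<lambda>t. indicator S x * ((?zS (x + t *\<^sub>R axis i 1) - ?zS x) / t)) \<longlongrightarrow> grad z x $ i) (at 0)"
          by (rule tendsto_cong[THEN iffD2, OF _ zdir[OF d, of i]])
        from filterlim_compose[OF this hl] show ?thesis using True by (simp add: dz_def)
      qed (simp add: dz_def)
    qed
  qed
  define H where "H x = (\<Sum>i\<in>UNIV. dz i x * (indicator S x * V a x $ i))" for x
  have Hm: "H \<in> borel_measurable lebesgue" unfolding H_def[abs_def]
    by (intro borel_measurable_sum borel_measurable_times dzm bm Vc)
  have Heq: "H x = grad z x \<bullet> V a x" if "x \<in> S" for x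
    using that by (simp add: H_def dz_def inner_vec_def)
  have Hb: "AE x in lebesgue. \<bar>H x\<bar> \<le> N * (L * Kv)"
    using zd
  proof eventually_elim
    case (elim x)
    show ?case
    proof (cases "x \<in> S")
      case True
      have "\<bar>H x\<bar> \<le> (\<Sum>i\<in>UNIV. \<bar>dz i x * (indicator S x * V a x $ i)\<bar>)" unfolding H_def by (rule sum_abs)
      also have "\<dots> \<le> (\<Sum>i\<in>(UNIV::'a set). L * Kv)"
        unfolding abs_mult using True elim dz_bound Vi z(2) Kv(2)
        by (intro sum_mono mult_mono) (auto simp: dz_def)
      finally show ?thesis by (simp add: N_def)
    next
      case False
      then show ?thesis using z(2) Kv(2) by (simp add: H_def dz_def N_def)
    qed
  qed
  have fH: "f x * (grad z x \<bullet> V a x) = f x * H x" for x using Heq fS by (cases "x \<in> S") auto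
  show "integrable lebesgue (\<lambda>x. f x * (grad z x \<bullet> V a x))"
    unfolding fH by (rule integrable_mult_bounded(1)[OF f Hm]) (use Hb in \<open>auto elim: eventually_mono\<close>)
  define R where "R x = (N * Kd * f x + Kv * (\<Sum>i\<in>UNIV. \<bar>g i x\<bar>)) * z x" for x
  have iz: "integrable lebesgue (\<lambda>x. k x * z x)" if k: "integrable lebesgue k" "\<And>x. x \<notin> S \<Longrightarrow> k x = 0" for k
  proof -
    have "(\<lambda>x. k x * z x) = (\<lambda>x. k x * (indicator S x * z x))"
    proof
      show "k x * z x = k x * (indicator S x * z x)" for x using k(2) by (cases "x \<in> S") auto
    qed
    moreover have "integrable lebesgue (\<lambda>x. k x * (indicator S x * z x))"
      by (rule integrable_mult_bounded(1)[OF k(1) zm, of 1]) (use z in \<open>auto simp: indicator_def intro!: AE_I2\<close>)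
    ultimately show ?thesis by simp
  qed
  \<comment> \<open>At most half of the distance at the centre, as \<open>cutoff_radial\<close>
    requires; a centre on the boundary would leave no admissible width.\<close>
  define \<delta> where "\<delta> n = infdist (F a) (- P) / (2 * real (Suc n))" for n
  have da: "infdist (F a) (- P) > 0"
  proof -
    have "closed (- P)" using open_image by auto
    then have "infdist (F a) (- P) \<noteq> 0" using in_closed_iff_infdist_zero[OF _ complement_nonempty, of "F a"] a by auto
    then show ?thesis using infdist_nonneg[of "F a" "- P"] by linarith
  qed
  have \<delta>: "\<delta> n > 0" "2 * \<delta> n \<le> infdist (F a) (- P)" for n
    using da by (auto simp: \<delta>_def field_simps)
  define \<kappa> where "\<kappa> n x = cutoff (\<delta> n) (F x)" for n x
  have \<kappa>b: "0 \<le> \<kappa> n x" "\<kappa> n x \<le> 1" for n x using cutoff_bounds[OF \<delta>(1)] by (auto simp: \<kappa>_def)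
  have step: "- (LINT x|lebesgue. f x * (indicator S x * \<kappa> n x * H x)) \<le> (LINT x|lebesgue. R x)" for n
  proof -
    obtain KA where KA: "KA > 0" "\<And>x v. x \<in> S \<Longrightarrow> norm (A x *v v) \<le> KA * norm v" using A_bound by blast
    have Flip: "seg_lipschitz KA S F" by (rule seg_lipschitz_of_derivative[OF F_derivative KA(2)])
    define Lk where "Lk = 2 / \<delta> n * KA"
    have Lk: "Lk \<ge> 0" using KA \<delta>(1)[of n] by (simp add: Lk_def)
    have \<kappa>lip: "seg_lipschitz Lk S (\<kappa> n)"
      unfolding seg_lipschitz_def
    proof (intro allI impI)
      fix x y assume "closed_segment x y \<subseteq> S"
      then have "norm (F x - F y) \<le> KA * norm (x - y)" using Flip by (auto simp: seg_lipschitz_def)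
      then have "2 / \<delta> n * norm (F x - F y) \<le> 2 / \<delta> n * (KA * norm (x - y))"
        using \<delta>(1)[of n] by (intro mult_left_mono) auto
      then show "norm (\<kappa> n x - \<kappa> n y) \<le> Lk * norm (x - y)"
        using cutoff_lipschitz[OF \<delta>(1), of n "F x" "F y"] by (simp add: \<kappa>_def Lk_def)
    qed
    have \<kappa>c: "continuous_on S (\<kappa> n)" by (rule seg_lipschitz_continuous_on[OF S \<kappa>lip])
    define K where "K = {x \<in> S. \<delta> n \<le> infdist (F x) (- P)}"
    have K: "compact K" "K \<subseteq> S" using compact_cutoff_support[OF \<delta>(1)] by (auto simp: K_def)
    have \<kappa>0: "\<kappa> n x = 0" if "x \<in> S" "x \<notin> K" for x
      using that cutoff_eq_0[OF \<delta>(1)] by (auto simp: K_def \<kappa>_def)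
    obtain \<epsilon> where \<epsilon>: "\<epsilon> > 0" "(\<Union>x\<in>K. ball x \<epsilon>) \<subseteq> S"
      using compact_subset_open_imp_ball_epsilon_subset[OF K(1) S K(2)] .
    define \<phi> where "\<phi> i x = (if x \<in> S then V a x $ i * (z x * \<kappa> n x) else 0)" for i x
    have \<phi>0: "\<phi> i x = 0" if "x \<notin> K" for i x using that \<kappa>0 by (auto simp: \<phi>_def)
    have \<phi>c: "continuous_on UNIV (\<phi> i)" for i
    proof -
      have "continuous_on S (\<phi> i)"
        by (rule continuous_on_eq[of _ "\<lambda>x. V a x $ i * (z x * \<kappa> n x)"])
           (auto intro!: continuous_on_mult Vc zc \<kappa>c simp: \<phi>_def)
      moreover have "continuous_on (- K) (\<phi> i)"
        by (rule continuous_on_eq[of _ "\<lambda>x. 0"]) (auto simp: \<phi>0)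
      moreover have "open (- K)" using K(1) compact_imp_closed by blast
      ultimately have "continuous_on (S \<union> - K) (\<phi> i)" using S by (intro continuous_on_open_Un)
      moreover have "S \<union> - K = UNIV" using K(2) by blast
      ultimately show ?thesis by simp
    qed
    have Vlip: "seg_lipschitz Kd S (\<lambda>x. V a x $ i)" for i
      using seg_lipschitz_of_derivative[OF Kd(1,2)] component_le_norm_cart[of "V a _ - V a _" i]
      unfolding seg_lipschitz_def by (metis order_trans real_norm_def vector_minus_component)
    define L1 where "L1 = L * 1 + 1 * Lk"
    have zk: "seg_lipschitz L1 S (\<lambda>x. z x * \<kappa> n x)" unfolding L1_def
      by (rule seg_lipschitz_mult[OF z(1) _ \<kappa>lip]) (use z \<kappa>b in auto)
    define L2 where "L2 = Kd * 1 + Kv * L1"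
    have \<phi>lip: "seg_lipschitz L2 S (\<lambda>x. V a x $ i * (z x * \<kappa> n x))" for i unfolding L2_def
    proof (rule seg_lipschitz_mult[OF Vlip _ zk])
      show "\<bar>z x * \<kappa> n x\<bar> \<le> 1" if "x \<in> S" for x
        using z(3,4)[OF that] \<kappa>b[of n x] mult_mono[of "z x" 1 "\<kappa> n x" 1] by (simp add: abs_mult)
    qed (use Vi in auto)
    have L2: "L2 \<ge> 0" using Kd(3) Kv(2) z(2) Lk by (simp add: L2_def L1_def)
    \<comment> \<open>If one end of the step lies in \<open>K\<close>, both lie in a ball inside
      \<open>S\<close>, and the bound along the segment applies; otherwise both values are
      0.\<close>
    have dlip: "\<bar>\<phi> i (x + t *\<^sub>R axis i 1) - \<phi> i x\<bar> \<le> L2 * t" if t: "0 \<le> t" "t \<le> \<epsilon> / 2" for i x t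
    proof (cases "x \<in> K \<or> x + t *\<^sub>R axis i 1 \<in> K")
      case True
      then obtain k where k: "k \<in> K" "x \<in> ball k \<epsilon>" "x + t *\<^sub>R axis i 1 \<in> ball k \<epsilon>"
        using t \<epsilon>(1) by (auto simp: dist_norm)
      then have "closed_segment x (x + t *\<^sub>R axis i 1) \<subseteq> ball k \<epsilon>" by (intro closed_segment_subset) auto
      then have sub: "closed_segment x (x + t *\<^sub>R axis i 1) \<subseteq> S" using \<epsilon>(2) k(1) by blast
      then have "x \<in> S" "x + t *\<^sub>R axis i 1 \<in> S" by auto
      then show ?thesis using \<phi>lip[of i] sub t unfolding seg_lipschitz_def \<phi>_def
        by (force simp: abs_minus_commute)
    next
      case False
      then show ?thesis using \<phi>0 t L2 by simp
    qed
    have "negligible {x \<in> S. F x \<in> {y \<in> P. \<not> cutoff (\<delta> n) differentiable (at y)}}"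
      by (rule negligible_preimage[OF cutoff_differentiable_AE]) auto
    then have AEk: "AE x in lebesgue. x \<in> S \<longrightarrow> cutoff (\<delta> n) differentiable (at (F x))"
      unfolding AE_iff_null_sets_lebesgue by (rule negligible_subset) auto
    define dk where "dk x = grad (cutoff (\<delta> n)) (F x)" for x
    \<comment> \<open>The product rule for \<open>V a x $ i * (z x * \<kappa> n x)\<close> in the
      direction of the \<open>i\<close>-th axis; summed over \<open>i\<close> this is the
      divergence.\<close>
    define d where "d i x = V a x $ i * (z x * ((A x *v axis i 1) \<bullet> dk x) + (axis i 1 \<bullet> grad z x) * \<kappa> n x) + dV x (axis i 1) $ i * (z x * \<kappa> n x)" for i x
    have dlim: "AE x in lebesgue. x \<in> S \<longrightarrow> ((\<lambda>t. (\<phi> i (x + t *\<^sub>R axis i 1) - \<phi> i x) / t) \<longlongrightarrow> d i x) (at 0)" for i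
      using zd AEk
    proof eventually_elim
      case (elim x)
      show ?case
      proof
        assume x: "x \<in> S"
        have dF: "(F has_derivative (\<lambda>h. A x *v h)) (at x)" by (rule F_derivative[OF x])
        have "(cutoff (\<delta> n) has_derivative (\<lambda>h. h \<bullet> dk x)) (at (F x))"
          using elim x differentiable_GDERIV unfolding gderiv_def dk_def by blast
        from has_derivative_compose[OF dF this]
        have d\<kappa>: "(\<kappa> n has_derivative (\<lambda>h. (A x *v h) \<bullet> dk x)) (at x)" by (simp add: \<kappa>_def[abs_def])
        have dz': "(z has_derivative (\<lambda>h. h \<bullet> grad z x)) (at x)"
          using elim x differentiable_GDERIV unfolding gderiv_def by blast
        have dVi: "((\<lambda>x. V a x $ i) has_derivative (\<lambda>h. dV x h $ i)) (at x)"
          using Kd(1)[OF x] unfolding has_derivative_vec_iff by blast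
        have "((\<lambda>x. V a x $ i * (z x * \<kappa> n x)) has_derivative
           (\<lambda>h. V a x $ i * (z x * ((A x *v h) \<bullet> dk x) + (h \<bullet> grad z x) * \<kappa> n x) + dV x h $ i * (z x * \<kappa> n x))) (at x)"
          by (intro has_derivative_mult dVi dz' d\<kappa>)
        then have "(\<phi> i has_derivative
           (\<lambda>h. V a x $ i * (z x * ((A x *v h) \<bullet> dk x) + (h \<bullet> grad z x) * \<kappa> n x) + dV x h $ i * (z x * \<kappa> n x))) (at x)"
          by (rule has_derivative_transform_within_open[OF _ S x]) (simp add: \<phi>_def)
        from has_derivative_directional[OF this, of "axis i 1"]
        show "((\<lambda>t. (\<phi> i (x + t *\<^sub>R axis i 1) - \<phi> i x) / t) \<longlongrightarrow> d i x) (at 0)" by (simp add: d_def)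
      qed
    qed
    have W: "integrable lebesgue (\<lambda>x. f x * d i x)" "(LINT x|lebesgue. f x * d i x) = - (LINT x|lebesgue. g i x * \<phi> i x)" for i
    proof -
      have e2: "\<epsilon> / 2 > 0" using \<epsilon>(1) by simp
      have n1: "norm (axis i (1::real)) \<le> 1" by simp
      note wd = weak_derivative_lipschitz[OF w[of i] S n1 K \<phi>c[of i] \<phi>0 e2 dlip dlim[of i]]
      show "integrable lebesgue (\<lambda>x. f x * d i x)" "(LINT x|lebesgue. f x * d i x) = - (LINT x|lebesgue. g i x * \<phi> i x)"
        by (rule wd; simp)+
    qed
    have pt: "AE x in lebesgue. f x * (\<Sum>i\<in>UNIV. d i x) \<le> N * Kd * f x * z x + f x * (indicator S x * \<kappa> n x * H x)"
      using f0 AEk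
    proof eventually_elim
      case (elim x)
      show ?case
      proof (cases "x \<in> S")
        case x: True
        have D: "(cutoff (\<delta> n) has_derivative (\<lambda>h. h \<bullet> dk x)) (at (F x))"
          using elim x differentiable_GDERIV unfolding gderiv_def dk_def by blast
        have "(F x - F a) \<bullet> dk x \<le> 0"
          by (rule cutoff_radial[OF \<delta> _ _ D]) (use a x in auto)
        then have radial: "(A x *v V a x) \<bullet> dk x \<le> 0" using A_V[OF x] by simp
        have lin: "(\<Sum>i\<in>UNIV. V a x $ i * ((A x *v axis i 1) \<bullet> dk x)) = (A x *v V a x) \<bullet> dk x"
        proof -
          have l: "linear ((*v) (A x))" by (rule matrix_vector_mul_linear)
          have "A x *v V a x = A x *v (\<Sum>i\<in>UNIV. V a x $ i *s axis i 1)" by (simp only: basis_expansion)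
          also have "\<dots> = (\<Sum>i\<in>UNIV. V a x $ i *\<^sub>R (A x *v axis i 1))"
            by (simp add: linear_sum[OF l] linear_scale[OF l] scalar_mult_eq_scaleR)
          finally show ?thesis by (simp add: inner_sum_left)
        qed
        have "(\<Sum>i\<in>UNIV. d i x) = z x * (\<Sum>i\<in>UNIV. V a x $ i * ((A x *v axis i 1) \<bullet> dk x))
            + (\<Sum>i\<in>UNIV. V a x $ i * grad z x $ i) * \<kappa> n x + (\<Sum>i\<in>UNIV. dV x (axis i 1) $ i) * (z x * \<kappa> n x)"
          by (simp add: d_def sum.distrib sum_distrib_left sum_distrib_right inner_axis' algebra_simps)
        also have "\<dots> \<le> 0 + (\<Sum>i\<in>UNIV. V a x $ i * grad z x $ i) * \<kappa> n x + (N * Kd) * z x"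
        proof (intro add_mono order_refl)
          show "z x * (\<Sum>i\<in>UNIV. V a x $ i * ((A x *v axis i 1) \<bullet> dk x)) \<le> 0"
            unfolding lin using z(3)[OF x] radial by (rule mult_nonneg_nonpos)
          have "(\<Sum>i\<in>UNIV. dV x (axis i 1) $ i) \<le> (\<Sum>i\<in>(UNIV::'a set). Kd)"
          proof (rule sum_mono)
            fix i :: 'a
            have "dV x (axis i 1) $ i \<le> norm (dV x (axis i 1))"
              using component_le_norm_cart[of "dV x (axis i 1)" i] by linarith
            also have "\<dots> \<le> Kd" using Kd(2)[OF x, of "axis i 1"] by simp
            finally show "dV x (axis i 1) $ i \<le> Kd" .
          qed
          then have "(\<Sum>i\<in>UNIV. dV x (axis i 1) $ i) \<le> N * Kd" by (simp add: N_def)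
          then have "(\<Sum>i\<in>UNIV. dV x (axis i 1) $ i) * (z x * \<kappa> n x) \<le> (N * Kd) * (z x * \<kappa> n x)"
            using z(3)[OF x] \<kappa>b by (intro mult_right_mono) auto
          also have "\<dots> \<le> (N * Kd) * (z x * 1)"
            using z(3)[OF x] \<kappa>b Kd(3) by (intro mult_left_mono) (auto simp: N_def)
          finally show "(\<Sum>i\<in>UNIV. dV x (axis i 1) $ i) * (z x * \<kappa> n x) \<le> (N * Kd) * z x" by simp
        qed
        also have "(\<Sum>i\<in>UNIV. V a x $ i * grad z x $ i) = H x" using Heq[OF x] by (simp add: inner_vec_def mult.commute)
        finally have "f x * (\<Sum>i\<in>UNIV. d i x) \<le> f x * (H x * \<kappa> n x + N * Kd * z x)"
          using elim(1) by (intro mult_left_mono) auto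
        then show ?thesis using x by (simp add: algebra_simps)
      qed (simp add: fS)
    qed
    have hm: "(\<lambda>x. indicator S x * \<kappa> n x * H x) \<in> borel_measurable lebesgue"
      by (intro borel_measurable_times[OF bm[OF \<kappa>c] Hm])
    have hb: "AE x in lebesgue. \<bar>indicator S x * \<kappa> n x * H x\<bar> \<le> N * (L * Kv)"
      using Hb
    proof eventually_elim
      case (elim x)
      have "\<bar>indicator S x * \<kappa> n x * H x\<bar> \<le> 1 * \<bar>H x\<bar>" unfolding abs_mult
        using \<kappa>b[of n x] by (intro mult_right_mono) (auto simp: indicator_def)
      then show ?case using elim by simp
    qed
    have ih: "integrable lebesgue (\<lambda>x. f x * (indicator S x * \<kappa> n x * H x))"
      by (rule integrable_mult_bounded(1)[OF f hm]) (use hb in \<open>auto elim: eventually_mono\<close>)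
    have ifz: "integrable lebesgue (\<lambda>x. N * Kd * f x * z x)"
      using iz[OF f fS] by (simp add: mult.assoc)
    have igz: "integrable lebesgue (\<lambda>x. \<bar>g i x\<bar> * z x)" for i
      using g gS by (intro iz) auto
    have "(LINT x|lebesgue. f x * (\<Sum>i\<in>UNIV. d i x)) \<le> (LINT x|lebesgue. N * Kd * f x * z x + f x * (indicator S x * \<kappa> n x * H x))"
      by (rule integral_mono_AE[OF _ _ pt]) (use W(1) ifz ih in \<open>auto simp: sum_distrib_left\<close>)
    also have "\<dots> = (LINT x|lebesgue. N * Kd * f x * z x) + (LINT x|lebesgue. f x * (indicator S x * \<kappa> n x * H x))"
      by (rule Bochner_Integration.integral_add[OF ifz ih])
    finally have 1: "(LINT x|lebesgue. f x * (\<Sum>i\<in>UNIV. d i x)) \<le> (LINT x|lebesgue. N * Kd * f x * z x) + (LINT x|lebesgue. f x * (indicator S x * \<kappa> n x * H x))" .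
    have 2: "(LINT x|lebesgue. f x * (\<Sum>i\<in>UNIV. d i x)) = (\<Sum>i\<in>UNIV. - (LINT x|lebesgue. g i x * \<phi> i x))"
      unfolding sum_distrib_left using W by simp
    have 3: "(LINT x|lebesgue. g i x * \<phi> i x) \<le> (LINT x|lebesgue. Kv * (\<bar>g i x\<bar> * z x))" for i
    proof (rule integral_mono)
      obtain B where B: "\<And>x. \<bar>\<phi> i x\<bar> \<le> B"
      proof -
        have "\<bar>\<phi> i x\<bar> \<le> Kv" for x
        proof (cases "x \<in> S")
          case True
          have "\<bar>V a x $ i\<bar> * \<bar>z x * \<kappa> n x\<bar> \<le> Kv * 1"
            using Vi[OF True] z(3,4)[OF True] \<kappa>b[of n x] Kv(2) mult_mono[of "z x" 1 "\<kappa> n x" 1]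
            by (intro mult_mono) (auto simp: abs_mult)
          then show ?thesis using True by (simp add: \<phi>_def abs_mult)
        qed (use Kv in \<open>simp add: \<phi>_def\<close>)
        then show ?thesis using that by blast
      qed
      show "integrable lebesgue (\<lambda>x. g i x * \<phi> i x)"
        by (rule integrable_mult_bounded(1)[OF g borel_measurable_lebesgue_continuous[OF \<phi>c]]) (use B in auto)
      show "integrable lebesgue (\<lambda>x. Kv * (\<bar>g i x\<bar> * z x))" using igz by simp
      fix x
      show "g i x * \<phi> i x \<le> Kv * (\<bar>g i x\<bar> * z x)"
      proof (cases "x \<in> S")
        case True
        have "\<bar>\<phi> i x\<bar> = \<bar>V a x $ i\<bar> * (z x * \<kappa> n x)" using True z(3)[OF True] \<kappa>b by (simp add: \<phi>_def abs_mult)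
        also have "\<dots> \<le> Kv * (z x * 1)"
          using Vi[OF True] z(3)[OF True] \<kappa>b Kv(2) by (intro mult_mono mult_left_mono) auto
        finally have \<phi>le: "\<bar>\<phi> i x\<bar> \<le> Kv * z x" by simp
        have "g i x * \<phi> i x \<le> \<bar>g i x\<bar> * \<bar>\<phi> i x\<bar>" by (metis abs_ge_self abs_mult)
        also have "\<dots> \<le> \<bar>g i x\<bar> * (Kv * z x)" using \<phi>le by (rule mult_left_mono) simp
        finally show ?thesis by (simp add: mult_ac)
      qed (simp add: gS)
    qed
    have "(LINT x|lebesgue. R x) = (LINT x|lebesgue. N * Kd * f x * z x + (\<Sum>i\<in>UNIV. Kv * (\<bar>g i x\<bar> * z x)))"
      by (simp add: R_def algebra_simps sum_distrib_left sum_distrib_right)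
    also have "\<dots> = (LINT x|lebesgue. N * Kd * f x * z x) + (\<Sum>i\<in>UNIV. LINT x|lebesgue. Kv * (\<bar>g i x\<bar> * z x))"
      using ifz igz by simp
    finally have "(LINT x|lebesgue. R x) \<ge> (LINT x|lebesgue. N * Kd * f x * z x) + (\<Sum>i\<in>UNIV. LINT x|lebesgue. g i x * \<phi> i x)"
      using sum_mono[of UNIV, OF 3] by simp
    then show ?thesis using 1 2 by (simp add: sum_negf)
  qed
  have "(\<lambda>n. LINT x|lebesgue. f x * (indicator S x * \<kappa> n x * H x)) \<longlonglongrightarrow> (LINT x|lebesgue. f x * H x)"
  proof (rule integral_dominated_mult(2)[OF f, where B="N * (L * Kv)"])
    fix n
    have "continuous_on P (cutoff (\<delta> n))"
      unfolding cutoff_def[abs_def] using \<delta>(1)[of n] by (intro continuous_intros) auto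
    then have "continuous_on S (\<kappa> n)" unfolding \<kappa>_def[abs_def]
      by (rule continuous_on_compose2[OF _ FS]) auto
    then show "(\<lambda>x. indicator S x * \<kappa> n x * H x) \<in> borel_measurable lebesgue"
      by (intro borel_measurable_times[OF bm Hm])
    show "AE x in lebesgue. f x \<noteq> 0 \<longrightarrow> \<bar>indicator S x * \<kappa> n x * H x\<bar> \<le> N * (L * Kv)"
      using Hb
    proof eventually_elim
      case (elim x)
      have "\<bar>indicator S x * \<kappa> n x * H x\<bar> \<le> 1 * \<bar>H x\<bar>" unfolding abs_mult
        using \<kappa>b[of n x] by (intro mult_right_mono) (auto simp: indicator_def)
      then show ?case using elim by simp
    qed
  next
    show "AE x in lebesgue. f x \<noteq> 0 \<longrightarrow> (\<lambda>n. indicator S x * \<kappa> n x * H x) \<longlonglongrightarrow> H x"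
    proof (rule AE_I2, rule impI)
      fix x assume "f x \<noteq> 0"
      then have x: "x \<in> S" using fS by blast
      have "closed (- P)" using open_image by auto
      then have "infdist (F x) (- P) \<noteq> 0" using in_closed_iff_infdist_zero[OF _ complement_nonempty, of "F x"] x by auto
      then have pos: "infdist (F x) (- P) > 0" using infdist_nonneg[of "F x" "- P"] by linarith
      have "(\<lambda>n. infdist (F a) (- P) * inverse (real (Suc n))) \<longlonglongrightarrow> infdist (F a) (- P) * 0"
        by (intro tendsto_intros LIMSEQ_inverse_real_of_nat)
      then have "eventually (\<lambda>n. infdist (F a) (- P) * inverse (real (Suc n)) < infdist (F x) (- P)) sequentially"
        by (rule order_tendstoD(2)) (simp only: mult_zero_right pos)
      then have "eventually (\<lambda>n. indicator S x * \<kappa> n x * H x = H x) sequentially"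
      proof eventually_elim
        case (elim n)
        have "2 * \<delta> n = infdist (F a) (- P) * inverse (real (Suc n))"
          unfolding \<delta>_def by (simp only: divide_inverse inverse_mult_distrib) simp
        then have "2 * \<delta> n \<le> infdist (F x) (- P)" using elim by linarith
        then have "\<kappa> n x = 1" unfolding \<kappa>_def by (rule cutoff_eq_1[OF \<delta>(1)])
        then show ?case using x by simp
      qed
      then show "(\<lambda>n. indicator S x * \<kappa> n x * H x) \<longlonglongrightarrow> H x" by (rule tendsto_eventually)
    qed
  qed
  then have "(\<lambda>n. - (LINT x|lebesgue. f x * (indicator S x * \<kappa> n x * H x))) \<longlonglongrightarrow> - (LINT x|lebesgue. f x * H x)"
    by (rule tendsto_minus)
  then have "- (LINT x|lebesgue. f x * H x) \<le> (LINT x|lebesgue. R x)"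
    using step by (intro LIMSEQ_le_const2) auto
  then show "- (LINT x|lebesgue. f x * (grad z x \<bullet> V a x))
      \<le> (LINT x|lebesgue. (real CARD('a) * Kd * f x + Kv * (\<Sum>i\<in>UNIV. \<bar>g i x\<bar>)) * z x)"
    unfolding fH by (simp add: R_def N_def)
qed

end


section \<open>Generalized convex functions\<close>

text \<open>Stated for two arbitrary compact spaces because it is used for \<open>b\<close>-convex
  and, with the roles exchanged, for \<open>b\<^sup>*\<close>-convex functions. Both functions
  inherit the modulus of continuity of the bounded kernel, and continuity on a compact set turns the
  supremum into a maximum.\<close>

lemma transform_attained:
  fixes \<beta> :: "'a::metric_space \<Rightarrow> 'b::metric_space \<Rightarrow> real" and u :: "'a \<Rightarrow> real"
  assumes K: "compact K" "K \<noteq> {}" and L: "compact L" "L \<noteq> {}"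
    and c: "continuous_on (K \<times> L) (\<lambda>z. \<beta> (fst z) (snd z))"
    and h: "\<And>x. x \<in> K \<Longrightarrow> ereal (u x) = (SUP y\<in>L. ereal (\<beta> x y) - (SUP x\<in>K. ereal (\<beta> x y) - ereal (u x)))"
  obtains w where "continuous_on L w" "continuous_on K u"
    "\<And>x y. x \<in> K \<Longrightarrow> y \<in> L \<Longrightarrow> \<beta> x y - w y \<le> u x"
    "\<And>x. x \<in> K \<Longrightarrow> \<exists>y\<in>L. u x = \<beta> x y - w y"
proof -
  define W where "W y = (SUP x\<in>K. ereal (\<beta> x y) - ereal (u x))" for y
  have ge: "ereal (\<beta> x y - u x) \<le> W y" if "x \<in> K" for x y
    unfolding W_def using that by (intro SUP_upper2[of x]) auto
  have le: "W y \<le> ereal r" if "\<And>x. x \<in> K \<Longrightarrow> \<beta> x y - u x \<le> r" for y r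
    unfolding W_def using that by (intro SUP_least) auto
  obtain x0 where x0: "x0 \<in> K" using K(2) by blast
  have Wm: "W y \<noteq> - \<infinity>" for y using ge[OF x0, of y] by auto
  \<comment> \<open>If the inner transform were infinite everywhere, the outer supremum would be
    minus infinity and not a real number. Finiteness at one point spreads to all of \<open>L\<close>
    because the kernel is bounded.\<close>
  have "\<exists>y1\<in>L. W y1 \<noteq> \<infinity>"
  proof (rule ccontr)
    assume "\<not> ?thesis"
    then have "(SUP y\<in>L. ereal (\<beta> x0 y) - W y) = (SUP y\<in>L. - \<infinity>)" by (intro SUP_cong) auto
    also have "\<dots> = - \<infinity>" using L(2) by simp
    finally show False using h[OF x0] by (simp add: W_def)
  qed
  then obtain y1 where y1: "y1 \<in> L" "W y1 \<noteq> \<infinity>" by blast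
  then obtain w1 where w1: "W y1 = ereal w1" using Wm[of y1] by (cases "W y1") auto
  have cKL: "compact (K \<times> L)" using K L by (intro compact_Times)
  obtain B where B: "\<And>x y. x \<in> K \<Longrightarrow> y \<in> L \<Longrightarrow> \<bar>\<beta> x y\<bar> \<le> B"
  proof -
    obtain B where "\<forall>v\<in>(\<lambda>z. \<beta> (fst z) (snd z)) ` (K \<times> L). norm v \<le> B"
      using compact_imp_bounded[OF compact_continuous_image[OF c cKL]] bounded_iff by blast
    then show ?thesis using that[of B] by force
  qed
  have Wfin: "W y \<noteq> \<infinity>" if y: "y \<in> L" for y
  proof -
    have "W y \<le> ereal (2 * B + w1)"
    proof (rule le)
      fix x assume x: "x \<in> K"
      have "\<beta> x y1 - u x \<le> w1" using ge[OF x, of y1] w1 by simp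
      then show "\<beta> x y - u x \<le> 2 * B + w1" using B[OF x y] B[OF x y1(1)] by linarith
    qed
    then show ?thesis by auto
  qed
  define w where "w y = real_of_ereal (W y)" for y
  have Ww: "W y = ereal (w y)" if "y \<in> L" for y
    using Wfin[OF that] Wm[of y] by (cases "W y") (auto simp: w_def)
  have P1: "\<beta> x y - w y \<le> u x" if "x \<in> K" "y \<in> L" for x y
    using ge[OF that(1), of y] Ww[OF that(2)] by simp
  have P2: "w y \<le> r" if "y \<in> L" "\<And>x. x \<in> K \<Longrightarrow> \<beta> x y - u x \<le> r" for y r
    using le[OF that(2)] Ww[OF that(1)] by simp
  have P4: "u x \<le> r" if x: "x \<in> K" and r: "\<And>y. y \<in> L \<Longrightarrow> \<beta> x y - w y \<le> r" for x r
  proof -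
    have "ereal (u x) = (SUP y\<in>L. ereal (\<beta> x y) - W y)" using h[OF x] by (simp add: W_def)
    also have "\<dots> \<le> ereal r" by (rule SUP_least) (use r Ww in auto)
    finally show ?thesis by simp
  qed
  have uc: "uniformly_continuous_on (K \<times> L) (\<lambda>z. \<beta> (fst z) (snd z))"
    by (rule compact_uniformly_continuous[OF c cKL])
  have wc: "continuous_on L w"
    unfolding continuous_on_iff
  proof (intro ballI allI impI)
    fix y and e :: real assume y: "y \<in> L" and e: "e > 0"
    have "e / 2 > 0" using e by simp
    then obtain d where d: "d > 0" "\<And>z z'. z \<in> K \<times> L \<Longrightarrow> z' \<in> K \<times> L \<Longrightarrow> dist z' z < d \<Longrightarrow> dist (\<beta> (fst z') (snd z')) (\<beta> (fst z) (snd z)) < e / 2"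
      using uc unfolding uniformly_continuous_on_def by metis
    have *: "w y1 \<le> w y2 + e / 2" if "y1 \<in> L" "y2 \<in> L" "dist y1 y2 < d" for y1 y2
    proof (rule P2[OF that(1)])
      fix x assume x: "x \<in> K"
      have "dist (\<beta> x y1) (\<beta> x y2) < e / 2" using d(2)[of "(x, y2)" "(x, y1)"] x that by (simp add: dist_Pair_Pair)
      then have "\<beta> x y1 \<le> \<beta> x y2 + e / 2" unfolding dist_real_def by linarith
      then show "\<beta> x y1 - u x \<le> w y2 + e / 2" using P1[OF x that(2)] by linarith
    qed
    show "\<exists>d>0. \<forall>x'\<in>L. dist x' y < d \<longrightarrow> dist (w x') (w y) < e"
    proof (intro exI[of _ d] conjI ballI impI d(1))
      fix y' assume "y' \<in> L" "dist y' y < d"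
      then have "w y' \<le> w y + e / 2" "w y \<le> w y' + e / 2" using * y by (auto simp: dist_commute)
      then show "dist (w y') (w y) < e" using e unfolding dist_real_def by linarith
    qed
  qed
  have ucon: "continuous_on K u"
    unfolding continuous_on_iff
  proof (intro ballI allI impI)
    fix x and e :: real assume x: "x \<in> K" and e: "e > 0"
    have "e / 2 > 0" using e by simp
    then obtain d where d: "d > 0" "\<And>z z'. z \<in> K \<times> L \<Longrightarrow> z' \<in> K \<times> L \<Longrightarrow> dist z' z < d \<Longrightarrow> dist (\<beta> (fst z') (snd z')) (\<beta> (fst z) (snd z)) < e / 2"
      using uc unfolding uniformly_continuous_on_def by metis
    have *: "u x1 \<le> u x2 + e / 2" if "x1 \<in> K" "x2 \<in> K" "dist x1 x2 < d" for x1 x2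
    proof (rule P4[OF that(1)])
      fix y assume y: "y \<in> L"
      have "dist (\<beta> x1 y) (\<beta> x2 y) < e / 2" using d(2)[of "(x2, y)" "(x1, y)"] y that by (simp add: dist_Pair_Pair)
      then have "\<beta> x1 y \<le> \<beta> x2 y + e / 2" unfolding dist_real_def by linarith
      then show "\<beta> x1 y - w y \<le> u x2 + e / 2" using P1[OF that(2) y] by linarith
    qed
    show "\<exists>d>0. \<forall>x'\<in>K. dist x' x < d \<longrightarrow> dist (u x') (u x) < e"
    proof (intro exI[of _ d] conjI ballI impI d(1))
      fix x' assume "x' \<in> K" "dist x' x < d"
      then have "u x' \<le> u x + e / 2" "u x \<le> u x' + e / 2" using * x by (auto simp: dist_commute)
      then show "dist (u x') (u x) < e" using e unfolding dist_real_def by linarith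
    qed
  qed
  have att: "\<exists>y\<in>L. u x = \<beta> x y - w y" if x: "x \<in> K" for x
  proof -
    have "continuous_on L (\<lambda>y. \<beta> (fst (x, y)) (snd (x, y)))"
      by (rule continuous_on_compose2[OF c continuous_on_Pair[OF continuous_on_const continuous_on_id]])
         (use x in auto)
    then have "continuous_on L (\<lambda>y. \<beta> x y - w y)" using wc by (auto intro: continuous_on_diff)
    then obtain y where "y \<in> L" "\<And>y'. y' \<in> L \<Longrightarrow> \<beta> x y' - w y' \<le> \<beta> x y - w y"
      using continuous_attains_sup[OF L] by blast
    then show ?thesis using P1[OF x] P4[OF x] by (intro bexI[of _ y]) (auto intro!: antisym)
  qed
  show ?thesis by (rule that[OF wc ucon P1 att])
qed

text \<open>Touching \<open>u\<close> from below by some \<open>b(\<cdot>, y) - k\<close> at each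
  point gives one inequality; the other holds for every function by the definition of the two
  suprema.\<close>

lemma b_convexI:
  assumes "\<And>x. x \<in> closure X \<Longrightarrow> \<exists>y\<in>closure Y. \<exists>k. u x = b x y - k \<and> (\<forall>x'\<in>closure X. b x' y - k \<le> u x')"
  shows "b_convex X Y b u"
  unfolding b_convex_def
proof
  fix x assume x: "x \<in> closure X"
  let ?W = "bstar_transform X b (\<lambda>x. ereal (u x))"
  show "ereal (u x) = b_transform Y b ?W x"
  proof (rule antisym)
    obtain y k where y: "y \<in> closure Y" "u x = b x y - k" "\<forall>x'\<in>closure X. b x' y - k \<le> u x'"
      using assms[OF x] by blast
    have "?W y \<le> ereal k" unfolding bstar_transform_def
      by (rule SUP_least) (use y(3) in \<open>auto simp: algebra_simps\<close>)
    then have "ereal (b x y) - ereal k \<le> ereal (b x y) - ?W y" by (intro ereal_minus_mono) auto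
    also have "\<dots> \<le> b_transform Y b ?W x" unfolding b_transform_def using y(1) by (intro SUP_upper)
    finally show "ereal (u x) \<le> b_transform Y b ?W x" using y(2) by simp
    show "b_transform Y b ?W x \<le> ereal (u x)" unfolding b_transform_def
    proof (rule SUP_least)
      fix y assume "y \<in> closure Y"
      have "ereal (b x y) - ereal (u x) \<le> ?W y" unfolding bstar_transform_def using x by (intro SUP_upper)
      then have "ereal (b x y) - ?W y \<le> ereal (b x y) - (ereal (b x y) - ereal (u x))" by (intro ereal_minus_mono) auto
      then show "ereal (b x y) - ?W y \<le> ereal (u x)" by simp
    qed
  qed
qed

text \<open>\<open>w\<close> plays the role of the real-valued transform of \<open>u\<close>, that
  is, of a price schedule for which \<open>u\<close> is the indirect utility. The maximum is
  attained, so each type has an optimal product.\<close>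

definition b_support :: "(real^'n) set \<Rightarrow> (real^'n) set \<Rightarrow> (real^'n \<Rightarrow> real^'n \<Rightarrow> real) \<Rightarrow>
    (real^'n \<Rightarrow> real) \<Rightarrow> (real^'n \<Rightarrow> real) \<Rightarrow> bool" where
  "b_support X Y b u w \<longleftrightarrow> continuous_on (closure Y) w \<and> continuous_on (closure X) u \<and>
     (\<forall>x\<in>closure X. \<forall>y\<in>closure Y. b x y - w y \<le> u x) \<and>
     (\<forall>x\<in>closure X. \<exists>y\<in>closure Y. u x = b x y - w y)"

section \<open>Generalized convex functions in the coordinate attached to the null product\<close>

locale exclusion = bi_twisted +
  fixes y0
  assumes y0: "y0 \<in> closure Y" and X_nonempty: "X \<noteq> {}"
begin

lemma Y_nonempty: "Y \<noteq> {}"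
  using y0 by auto

lemma compact_X: "compact (closure X)" and compact_Y: "compact (closure Y)"
  using bX bY by (auto simp: compact_closure)

sublocale D: C2_diffeo_bounded X "\<lambda>x. Dy X Y b x y0" "\<lambda>x. \<chi> j i. E [Inr j, Inl i] (x, y0)"
  "\<lambda>j i k x. E [Inr j, Inl i, Inl k] (x, y0)"
proof -
  interpret C2_diffeo X "\<lambda>x. Dy X Y b x y0" "\<lambda>x. \<chi> j i. E [Inr j, Inl i] (x, y0)"
    "\<lambda>j i k x. E [Inr j, Inl i, Inl k] (x, y0)"
    by (rule C2_diffeo_Dy[OF y0 X_nonempty])
  show "C2_diffeo_bounded X (\<lambda>x. Dy X Y b x y0) (\<lambda>x. \<chi> j i. E [Inr j, Inl i] (x, y0))
    (\<lambda>j i k x. E [Inr j, Inl i, Inl k] (x, y0))"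
  proof
    show "bounded X" by (rule bX)
    show "convex ((\<lambda>x. Dy X Y b x y0) ` X)"
      using conv y0 X_nonempty clX by (auto simp: bi_convex_def)
    have "\<exists>M. \<forall>x\<in>X. \<bar>E [Inr j, Inl i, Inl k] (x, y0)\<bar> \<le> M" for j i k
    proof -
      have "compact (E [Inr j, Inl i, Inl k] ` (closure X \<times> closure Y))"
        by (intro compact_continuous_image E_continuous compact_Times compact_X compact_Y) simp
      then obtain M where "\<forall>v\<in>E [Inr j, Inl i, Inl k] ` (closure X \<times> closure Y). norm v \<le> M"
        using compact_imp_bounded bounded_iff by blast
      then show ?thesis using y0 clX by (intro exI[of _ M]) force
    qed
    then obtain M where M: "\<And>j i k x. x \<in> X \<Longrightarrow> \<bar>E [Inr j, Inl i, Inl k] (x, y0)\<bar> \<le> M j i k" by metis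
    show "\<exists>M. \<forall>x\<in>X. \<forall>j i k. \<bar>E [Inr j, Inl i, Inl k] (x, y0)\<bar> \<le> M"
    proof (intro exI[of _ "Max (range (\<lambda>(j, i, k). M j i k))"] ballI allI)
      fix x j i k assume "x \<in> X"
      then have "\<bar>E [Inr j, Inl i, Inl k] (x, y0)\<bar> \<le> M j i k" by (rule M)
      also have "\<dots> \<le> Max (range (\<lambda>(j, i, k). M j i k))" by (rule Max_ge) (auto intro: image_eqI[of _ _ "(j, i, k)"])
      finally show "\<bar>E [Inr j, Inl i, Inl k] (x, y0)\<bar> \<le> Max (range (\<lambda>(j, i, k). M j i k))" .
    qed
  qed
qed

lemma b_convex_support:
  assumes "b_convex X Y b u" obtains w where "b_support X Y b u w"
proof -
  have "ereal (u x) = (SUP y\<in>closure Y. ereal (b x y) - (SUP x\<in>closure X. ereal (b x y) - ereal (u x)))"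
    if "x \<in> closure X" for x
    using assms that unfolding b_convex_def b_transform_def bstar_transform_def by blast
  from transform_attained[OF compact_X _ compact_Y _ b_continuous this] X_nonempty Y_nonempty
  obtain w where "continuous_on (closure Y) w" "continuous_on (closure X) u"
    "\<And>x y. x \<in> closure X \<Longrightarrow> y \<in> closure Y \<Longrightarrow> b x y - w y \<le> u x"
    "\<And>x. x \<in> closure X \<Longrightarrow> \<exists>y\<in>closure Y. u x = b x y - w y" by (metis closure_eq_empty)
  then show ?thesis using that unfolding b_support_def by blast
qed

lemma bstar_convex_support:
  assumes "bstar_convex X Y b c"
  shows "continuous_on (closure Y) c"
    "\<exists>a\<in>closure X. \<forall>y\<in>closure Y. c y0 + b a y - b a y0 \<le> c y"
proof -
  have h: "ereal (c y) = (SUP x\<in>closure X. ereal (b x y) - (SUP y\<in>closure Y. ereal (b x y) - ereal (c y)))"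
    if "y \<in> closure Y" for y
    using assms that unfolding bstar_convex_def b_transform_def bstar_transform_def by blast
  have co: "continuous_on (closure Y \<times> closure X) (\<lambda>z. (\<lambda>y x. b x y) (fst z) (snd z))"
  proof -
    have "continuous_on (closure Y \<times> closure X) (\<lambda>z. b (fst (snd z, fst z)) (snd (snd z, fst z)))"
      by (rule continuous_on_compose2[OF b_continuous, of _ "\<lambda>z. (snd z, fst z)"]) (auto intro!: continuous_intros)
    then show ?thesis by simp
  qed
  from transform_attained[OF compact_Y _ compact_X _ co h] X_nonempty Y_nonempty
  obtain w where w: "continuous_on (closure Y) c"
    "\<And>y x. y \<in> closure Y \<Longrightarrow> x \<in> closure X \<Longrightarrow> b x y - w x \<le> c y"
    "\<And>y. y \<in> closure Y \<Longrightarrow> \<exists>x\<in>closure X. c y = b x y - w x" by (metis closure_eq_empty)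
  show "continuous_on (closure Y) c" by (rule w(1))
  obtain a where a: "a \<in> closure X" "c y0 = b a y0 - w a" using w(3)[OF y0] by blast
  show "\<exists>a\<in>closure X. \<forall>y\<in>closure Y. c y0 + b a y - b a y0 \<le> c y"
  proof (intro bexI[of _ a] ballI)
    fix y assume "y \<in> closure Y"
    then have "b a y - w a \<le> c y" using w(2) a(1) by blast
    then show "c y0 + b a y - b a y0 \<le> c y" using a(2) by linarith
  qed (rule a(1))
qed

lemma b_GDERIV: "x \<in> X \<Longrightarrow> y \<in> closure Y \<Longrightarrow> GDERIV (\<lambda>x. b x y) x :> Dx X Y b x y"
  using partials_grad_x[OF E oX oY] Dx_E clX by simp

lemma b_differentiable: "x \<in> X \<Longrightarrow> y \<in> closure Y \<Longrightarrow> (\<lambda>x. b x y) differentiable (at x)"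
  using b_GDERIV unfolding gderiv_def by (blast intro: differentiableI)

text \<open>\<open>u - b(\<cdot>, y)\<close> has a minimum at \<open>x\<close>, so the gradients
  agree, and injectivity of \<open>D_x b(x, \<cdot>)\<close> on the closure makes \<open>y\<close>
  the only product with this gradient.\<close>

lemma support_grad:
  assumes x: "x \<in> X" and y: "y \<in> closure Y" and eq: "u x = b x y - k"
    and le: "\<And>x'. x' \<in> X \<Longrightarrow> b x' y - k \<le> u x'" and d: "u differentiable (at x)"
  shows "grad u x = Dx X Y b x y" "y_b X Y b x (grad u x) = y"
proof -
  have "((\<lambda>x. u x - b x y) has_derivative (\<lambda>h. h \<bullet> grad u x - h \<bullet> Dx X Y b x y)) (at x)"
    using differentiable_GDERIV[OF d] b_GDERIV[OF x y] unfolding gderiv_def by (rule has_derivative_diff)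
  then have "(\<lambda>h. h \<bullet> grad u x - h \<bullet> Dx X Y b x y) = (\<lambda>h. 0)"
    by (rule differential_zero_maxmin[OF x oX]) (use le eq in force)
  then have "(grad u x - Dx X Y b x y) \<bullet> (grad u x - Dx X Y b x y) = 0"
    by (metis inner_diff_right)
  then show eq: "grad u x = Dx X Y b x y" by simp
  have "inj_on (\<lambda>y. Dx X Y b x y) (closure Y)"
    using twist clX[OF x] y by (auto simp: bi_twist_def diffeo_onto_range_def)
  then show "y_b X Y b x (grad u x) = y"
    unfolding y_b_def eq by (intro the_equality) (use y in \<open>auto dest: inj_onD\<close>)
qed

text \<open>A supremum of convex functions: the product \<open>y\<close> optimal at the intermediate
  point is also available at the two ends, and \<open>b(\<cdot>, y) - b(\<cdot>, y0)\<close> is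
  convex in the coordinate by \<open>b_difference_convex\<close>.\<close>

lemma support_convex:
  assumes u: "b_support X Y b u w"
  shows "convex_on D.P (\<lambda>q. u (D.G q) - b (D.G q) y0)"
proof (rule convex_onI)
  fix t :: real and q1 q2 assume t: "0 < t" "t < 1" and q: "q1 \<in> D.P" "q2 \<in> D.P"
  define q3 where "q3 = (1 - t) *\<^sub>R q1 + t *\<^sub>R q2"
  have q3: "q3 \<in> D.P" unfolding q3_def using t q D.convex_image by (intro convexD_alt) auto
  note G = D.G_in[OF q(1)] D.G_in[OF q(2)] D.G_in[OF q3]
  note Gc = clX[OF G(1)] clX[OF G(2)] clX[OF G(3)]
  obtain y where y: "y \<in> closure Y" "u (D.G q3) = b (D.G q3) y - w y" using u Gc(3) by (auto simp: b_support_def)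
  have "b (D.G q3) y - b (D.G q3) y0 \<le> (1 - t) * (b (D.G q1) y - b (D.G q1) y0) + t * (b (D.G q2) y - b (D.G q2) y0)"
    by (rule b_difference_convex[OF Gc(1,2) y0 y(1) _ _ Gc(3)]) (use t D.F_G q q3 in \<open>auto simp: q3_def\<close>)
  also have "\<dots> \<le> (1 - t) * (u (D.G q1) + w y - b (D.G q1) y0) + t * (u (D.G q2) + w y - b (D.G q2) y0)"
  proof -
    have "b (D.G q1) y - w y \<le> u (D.G q1)" "b (D.G q2) y - w y \<le> u (D.G q2)"
      using u Gc y(1) by (auto simp: b_support_def)
    then show ?thesis using t by (intro add_mono mult_left_mono) auto
  qed
  finally show "u (D.G ((1 - t) *\<^sub>R q1 + t *\<^sub>R q2)) - b (D.G ((1 - t) *\<^sub>R q1 + t *\<^sub>R q2)) y0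
      \<le> (1 - t) * (u (D.G q1) - b (D.G q1) y0) + t * (u (D.G q2) - b (D.G q2) y0)"
    unfolding q3_def[symmetric] y(2) by (simp add: algebra_simps)
qed (rule D.convex_image)

lemma support_differentiable_AE:
  assumes u: "b_support X Y b u w"
  shows "negligible {x \<in> X. \<not> u differentiable (at x)}"
proof -
  let ?F = "\<lambda>q. u (D.G q) - b (D.G q) y0"
  have neg: "negligible {x \<in> X. Dy X Y b x y0 \<in> {q \<in> D.P. \<not> ?F differentiable (at q)}}"
    by (rule D.negligible_preimage[OF convex_on_differentiable_AE[OF support_convex[OF u] D.open_image]]) auto
  have "u differentiable (at x)" if x: "x \<in> X" and d: "?F differentiable (at (Dy X Y b x y0))" for x
  proof -
    obtain F' where F': "(?F has_derivative F') (at (Dy X Y b x y0))" using d by (auto simp: differentiable_def)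
    have "((\<lambda>x. ?F (Dy X Y b x y0)) has_derivative (\<lambda>h. F' ((\<chi> j i. E [Inr j, Inl i] (x, y0)) *v h))) (at x)"
      by (rule has_derivative_compose[OF D.F_derivative[OF x] F'])
    then have "(\<lambda>x. ?F (Dy X Y b x y0)) differentiable (at x)" by (rule differentiableI)
    then have "(\<lambda>x. ?F (Dy X Y b x y0) + b x y0) differentiable (at x)"
      using b_differentiable[OF x y0] by (rule differentiable_add)
    then obtain f' where "((\<lambda>x. ?F (Dy X Y b x y0) + b x y0) has_derivative f') (at x)" by (auto simp: differentiable_def)
    then have "(u has_derivative f') (at x)"
      by (rule has_derivative_transform_within_open[OF _ oX x]) (simp add: D.G_F clX)
    then show ?thesis by (rule differentiableI)
  qed
  then show ?thesis by (intro negligible_subset[OF neg]) blast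
qed

text \<open>The tangent inequality at \<open>p\<close> of the convex function
  \<open>b(\<cdot>, y) - b(\<cdot>, y0)\<close> in the coordinate, evaluated at the image of
  \<open>a\<close>; the direction towards that image corresponds to
  \<open>- D.V a x\<close>.\<close>

lemma b_gradient_inequality:
  assumes x: "x \<in> X" and y: "y \<in> closure Y" and a: "a \<in> closure X"
  shows "- ((Dx X Y b x y - Dx X Y b x y0) \<bullet> D.V a x) \<le> (b a y - b a y0) - (b x y - b x y0)"
proof -
  define p where "p = Dy X Y b x y0"
  define v where "v = Dy X Y b a y0 - p"
  have p: "p \<in> D.P" using x by (simp add: p_def)
  \<comment> \<open>The image of \<open>a\<close> is only in the closure of \<open>D.P\<close>, so
    the segment is used without its end point and the derivative is taken from the right at
    0.\<close>
  have inP: "p + s *\<^sub>R v \<in> D.P" if s: "0 \<le> s" "s < 1" for s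
  proof (cases "s = 0 \<or> v = 0")
    case False
    have "Dy X Y b a y0 \<in> closure D.P" using a D.image_closure by blast
    then have "p + s *\<^sub>R v \<in> interior D.P"
      using mem_interior_closure_convex_shrink[OF D.convex_image, of p "Dy X Y b a y0" "1 - s"] p s D.open_image
      by (simp add: v_def interior_open algebra_simps)
    then show ?thesis using interior_subset by blast
  qed (use p in auto)
  define \<phi> where "\<phi> s = b (D.G (p + s *\<^sub>R v)) y - b (D.G (p + s *\<^sub>R v)) y0" for s
  have G0: "D.G p = x" using D.G_F clX x by (simp add: p_def)
  have le: "\<phi> s \<le> \<phi> 0 + s * ((b a y - b a y0) - (b x y - b x y0))" if s: "0 \<le> s" "s < 1" for s
  proof -
    have "Dy X Y b (D.G (p + s *\<^sub>R v)) y0 = (1 - s) *\<^sub>R Dy X Y b x y0 + s *\<^sub>R Dy X Y b a y0"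
      using D.F_G[OF inP[OF s]] by (simp add: v_def p_def algebra_simps)
    from b_difference_convex[OF clX[OF x] a y0 y _ _ clX[OF D.G_in[OF inP[OF s]]] this]
    show ?thesis using s G0 by (simp add: \<phi>_def algebra_simps)
  qed
  have "((\<lambda>s. p + s *\<^sub>R v) has_derivative (\<lambda>h. h *\<^sub>R v)) (at 0)" by (auto intro!: derivative_eq_intros)
  moreover have "((\<lambda>q. b (D.G q) y - b (D.G q) y0) has_derivative (\<lambda>h. D.G' p h \<bullet> Dx X Y b x y - D.G' p h \<bullet> Dx X Y b x y0)) (at p)"
    using has_derivative_compose[OF D.G_derivative[OF p], of "\<lambda>x. b x y"] has_derivative_compose[OF D.G_derivative[OF p], of "\<lambda>x. b x y0"]
      b_GDERIV[OF x y] b_GDERIV[OF x y0] unfolding G0 gderiv_def by (intro has_derivative_diff) auto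
  ultimately have der: "(\<phi> has_real_derivative (D.G' p v \<bullet> Dx X Y b x y - D.G' p v \<bullet> Dx X Y b x y0)) (at 0)"
    unfolding \<phi>_def[abs_def] by (intro has_real_derivative_compose_curve[where f="\<lambda>q. b (D.G q) y - b (D.G q) y0"]) auto
  have V: "D.G' p v = - D.V a x"
  proof -
    have "v = - (p - Dy X Y b a y0)" by (simp add: v_def)
    moreover have "linear (D.G' p)" using D.linear_G'[OF p] by (rule bounded_linear.linear)
    ultimately show ?thesis unfolding D.V_def p_def[symmetric] by (metis linear_neg)
  qed
  have "((\<lambda>s. (\<phi> s - \<phi> 0) / s) \<longlongrightarrow> D.G' p v \<bullet> Dx X Y b x y - D.G' p v \<bullet> Dx X Y b x y0) (at 0)"
    using der by (simp add: DERIV_def)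
  then have "((\<lambda>s. (\<phi> s - \<phi> 0) / s) \<longlongrightarrow> D.G' p v \<bullet> Dx X Y b x y - D.G' p v \<bullet> Dx X Y b x y0) (at_right 0)"
    by (rule filterlim_mono) (auto simp: at_within_le_at)
  moreover have "eventually (\<lambda>s. (\<phi> s - \<phi> 0) / s \<le> (b a y - b a y0) - (b x y - b x y0)) (at_right 0)"
    unfolding eventually_at_right_field
  proof (intro exI[of _ 1] conjI allI impI)
    fix s :: real assume s: "0 < s" "s < 1"
    then show "(\<phi> s - \<phi> 0) / s \<le> (b a y - b a y0) - (b x y - b x y0)"
      using le[of s] by (simp add: pos_divide_le_eq mult.commute)
  qed simp
  ultimately have "D.G' p v \<bullet> Dx X Y b x y - D.G' p v \<bullet> Dx X Y b x y0 \<le> (b a y - b a y0) - (b x y - b x y0)"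
    by (rule tendsto_upperbound) simp
  then show ?thesis unfolding V by (simp add: inner_diff_left inner_diff_right inner_commute)
qed

lemma Dx_bound: obtains K where "K > 0" "\<And>x y. x \<in> closure X \<Longrightarrow> y \<in> closure Y \<Longrightarrow> norm (Dx X Y b x y) \<le> K"
proof -
  have "compact ((\<lambda>z. Dx X Y b (fst z) (snd z)) ` (closure X \<times> closure Y))"
    by (intro compact_continuous_image Dx_continuous compact_Times compact_X compact_Y)
  then have "bounded ((\<lambda>z. Dx X Y b (fst z) (snd z)) ` (closure X \<times> closure Y))" by (rule compact_imp_bounded)
  then obtain K where K: "K > 0" "\<forall>v\<in>(\<lambda>z. Dx X Y b (fst z) (snd z)) ` (closure X \<times> closure Y). norm v \<le> K"
    unfolding bounded_pos by blast
  have "norm (Dx X Y b x y) \<le> K" if "x \<in> closure X" "y \<in> closure Y" for x y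
    using K(2)[rule_format, OF imageI[of "(x, y)"]] that by simp
  then show ?thesis using that[of K] K(1) by blast
qed

text \<open>A product optimal at one end is available at the other, so \<open>u\<close> varies no
  faster than \<open>b(\<cdot>, y)\<close>. The constant does not depend on \<open>u\<close>, and
  the minimizer and its competitors share it.\<close>

lemma support_seg_lipschitz:
  assumes K: "\<And>x y. x \<in> closure X \<Longrightarrow> y \<in> closure Y \<Longrightarrow> norm (Dx X Y b x y) \<le> K"
    and u: "b_support X Y b u w"
  shows "seg_lipschitz K X u"
  unfolding seg_lipschitz_def
proof (intro allI impI)
  fix x1 x2 assume sub: "closed_segment x1 x2 \<subseteq> X"
  have bl: "b x y - b x' y \<le> K * norm (x1 - x2)" if y: "y \<in> closure Y" and x: "{x, x'} = {x1, x2}" for x x' y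
  proof -
    have "seg_lipschitz K X (\<lambda>x. b x y)"
    proof (rule seg_lipschitz_of_derivative)
      fix z v assume z: "z \<in> X"
      show "((\<lambda>x. b x y) has_derivative (\<lambda>h. h \<bullet> Dx X Y b z y)) (at z)"
        using b_GDERIV[OF z y] by (simp add: gderiv_def)
      have "\<bar>v \<bullet> Dx X Y b z y\<bar> \<le> norm v * norm (Dx X Y b z y)" by (rule Cauchy_Schwarz_ineq2)
      also have "\<dots> \<le> norm v * K" using K[OF clX[OF z] y] by (intro mult_left_mono) auto
      finally show "norm (v \<bullet> Dx X Y b z y) \<le> K * norm v" by (simp add: mult.commute)
    qed
    then have "norm (b x1 y - b x2 y) \<le> K * norm (x1 - x2)" using sub by (auto simp: seg_lipschitz_def)
    moreover have "x = x1 \<and> x' = x2 \<or> x = x2 \<and> x' = x1" using x by (auto simp: doubleton_eq_iff)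
    ultimately show ?thesis by auto
  qed
  have c: "x1 \<in> closure X" "x2 \<in> closure X" using sub clX by auto
  obtain y1 where y1: "y1 \<in> closure Y" "u x1 = b x1 y1 - w y1" using u c by (auto simp: b_support_def)
  obtain y2 where y2: "y2 \<in> closure Y" "u x2 = b x2 y2 - w y2" using u c by (auto simp: b_support_def)
  have "b x2 y1 - w y1 \<le> u x2" "b x1 y2 - w y2 \<le> u x1" using u c y1 y2 by (auto simp: b_support_def)
  then show "norm (u x1 - u x2) \<le> K * norm (x1 - x2)"
    using bl[OF y1(1), of x1 x2] bl[OF y2(1), of x2 x1] y1 y2 by (simp add: abs_le_iff insert_commute)
qed


section \<open>The loss comparison\<close>

definition loss_density :: "(real^'a \<Rightarrow> real) \<Rightarrow> (real^'a \<Rightarrow> real) \<Rightarrow> real^'a \<Rightarrow> real" where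
  "loss_density c u x = u x + c (y_b X Y b x (grad u x)) - b x (y_b X Y b x (grad u x))"

lemma support_y_b:
  assumes u: "b_support X Y b u w" and x: "x \<in> X" and d: "u differentiable (at x)"
  obtains y where "y \<in> closure Y" "u x = b x y - w y" "grad u x = Dx X Y b x y" "y_b X Y b x (grad u x) = y"
proof -
  obtain y where y: "y \<in> closure Y" "u x = b x y - w y" using u clX[OF x] by (auto simp: b_support_def)
  have "b x' y - w y \<le> u x'" if "x' \<in> X" for x' using u clX[OF that] y(1) by (auto simp: b_support_def)
  from support_grad[OF x y this d] show ?thesis using that y by blast
qed

text \<open>On the set \<open>R\<close> of differentiability points the optimal product is unique.
  Its graph is then a level set of a continuous function, hence relatively closed, and with the
  compact \<open>closure Y\<close> as range the product depends continuously on the type in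
  \<open>R\<close>.\<close>

lemma loss_density_measurable:
  assumes u: "b_support X Y b u w" and c: "continuous_on (closure Y) c"
  shows "(\<lambda>x. indicator X x * loss_density c u x) \<in> borel_measurable lebesgue"
    "\<exists>B. AE x in lebesgue. x \<in> X \<longrightarrow> \<bar>loss_density c u x\<bar> \<le> B"
proof -
  define R where "R = {x \<in> X. u differentiable (at x)}"
  have neg: "negligible (X - R)"
    by (rule negligible_subset[OF support_differentiable_AE[OF u]]) (auto simp: R_def)
  have Xm: "X \<in> sets lebesgue" using oX by auto
  have "R = X - (X - R)" by (auto simp: R_def)
  then have Rm: "R \<in> sets lebesgue" using Xm neg by (metis negligible_imp_sets sets.Diff)
  define Yb where "Yb x = y_b X Y b x (grad u x)" for x
  have Yb: "Yb x \<in> closure Y" "u x = b x (Yb x) - w (Yb x)" if x: "x \<in> R" for x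
  proof -
    have "x \<in> X" "u differentiable (at x)" using x by (auto simp: R_def)
    from support_y_b[OF u this] show "Yb x \<in> closure Y" "u x = b x (Yb x) - w (Yb x)"
      unfolding Yb_def by metis+
  qed
  have uniq: "Yb x = y" if x: "x \<in> R" and y: "y \<in> closure Y" "u x = b x y - w y" for x y
  proof -
    have xX: "x \<in> X" "u differentiable (at x)" using x by (auto simp: R_def)
    have "b x' y - w y \<le> u x'" if "x' \<in> X" for x' using u clX[OF that] y(1) by (auto simp: b_support_def)
    from support_grad(2)[OF xX(1) y this xX(2)] show ?thesis by (simp add: Yb_def)
  qed
  have RX: "R \<subseteq> closure X" using clX by (auto simp: R_def)
  have bc: "continuous_on (R \<times> closure Y) (\<lambda>z. b (fst z) (snd z))"
    by (rule continuous_on_subset[OF b_continuous]) (use RX in auto)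
  have uc: "continuous_on R u" and wc: "continuous_on (closure Y) w"
    using u RX continuous_on_subset by (auto simp: b_support_def)
  have Ybc: "continuous_on R Yb"
  proof (rule continuous_closed_graph_eq[OF compact_Y, THEN iffD2])
    show "Yb \<in> R \<rightarrow> closure Y" using Yb by auto
    have g: "continuous_on (R \<times> closure Y) (\<lambda>z. u (fst z) - b (fst z) (snd z) + w (snd z))"
      by (intro continuous_on_add continuous_on_diff bc continuous_on_fst_curve[OF uc] continuous_on_snd_curve[OF wc])
    have "(\<lambda>x. (x, Yb x)) ` R = (R \<times> closure Y) \<inter> (\<lambda>z. u (fst z) - b (fst z) (snd z) + w (snd z)) -` {0}"
    proof (intro set_eqI iffI)
      fix z assume "z \<in> (\<lambda>x. (x, Yb x)) ` R"
      then show "z \<in> (R \<times> closure Y) \<inter> (\<lambda>z. u (fst z) - b (fst z) (snd z) + w (snd z)) -` {0}"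
        using Yb by auto
    next
      fix z assume z: "z \<in> (R \<times> closure Y) \<inter> (\<lambda>z. u (fst z) - b (fst z) (snd z) + w (snd z)) -` {0}"
      then have "u (fst z) = b (fst z) (snd z) - w (snd z)" by simp
      then have "Yb (fst z) = snd z" using z by (intro uniq) auto
      then show "z \<in> (\<lambda>x. (x, Yb x)) ` R" using z by (intro image_eqI[of _ _ "fst z"]) auto
    qed
    then show "closedin (top_of_set (R \<times> closure Y)) ((\<lambda>x. (x, Yb x)) ` R)"
      using continuous_closedin_preimage[OF g, of "{0}"] by simp
  qed
  have "continuous_on R (loss_density c u)"
  proof -
    have "continuous_on R (\<lambda>x. b (fst (x, Yb x)) (snd (x, Yb x)))"
      by (rule continuous_on_compose2[OF bc continuous_on_Pair[OF continuous_on_id Ybc]]) (use Yb in auto)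
    moreover have "continuous_on R (\<lambda>x. c (Yb x))"
      by (rule continuous_on_compose2[OF c Ybc]) (use Yb in auto)
    ultimately have "continuous_on R (\<lambda>x. u x + c (Yb x) - b x (Yb x))"
      by (auto intro!: continuous_on_add continuous_on_diff uc)
    then show ?thesis by (simp add: loss_density_def[abs_def] Yb_def)
  qed
  then have "loss_density c u \<in> borel_measurable (lebesgue_on R)"
    using Rm by (rule continuous_imp_measurable_on_sets_lebesgue)
  then have m: "(\<lambda>x. indicator R x * loss_density c u x) \<in> borel_measurable lebesgue"
    using Rm borel_measurable_restrict_space_iff[of R lebesgue "loss_density c u"] by simp
  have ae: "AE x in lebesgue. x \<in> X \<longrightarrow> x \<in> R"
    unfolding AE_iff_null_sets_lebesgue by (rule negligible_subset[OF neg]) auto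
  show "(\<lambda>x. indicator X x * loss_density c u x) \<in> borel_measurable lebesgue"
  proof (rule borel_measurable_lebesgue_AE[OF m])
    show "AE x in lebesgue. indicator R x * loss_density c u x = indicator X x * loss_density c u x"
      using ae by eventually_elim (auto simp: indicator_def R_def)
  qed
  obtain B1 where B1: "\<And>x. x \<in> closure X \<Longrightarrow> \<bar>u x\<bar> \<le> B1"
  proof -
    have "continuous_on (closure X) u" using u by (auto simp: b_support_def)
    then have "bounded (u ` closure X)" by (intro compact_imp_bounded compact_continuous_image compact_X)
    then obtain B where "\<forall>v\<in>u ` closure X. norm v \<le> B" using bounded_iff by blast
    then show ?thesis using that by auto
  qed
  obtain B2 where B2: "\<And>y. y \<in> closure Y \<Longrightarrow> \<bar>c y\<bar> \<le> B2"
  proof -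
    have "bounded (c ` closure Y)" by (intro compact_imp_bounded compact_continuous_image compact_Y c)
    then obtain B where "\<forall>v\<in>c ` closure Y. norm v \<le> B" using bounded_iff by blast
    then show ?thesis using that by auto
  qed
  obtain B3 where B3: "\<And>x y. x \<in> closure X \<Longrightarrow> y \<in> closure Y \<Longrightarrow> \<bar>b x y\<bar> \<le> B3"
  proof -
    have "bounded ((\<lambda>z. b (fst z) (snd z)) ` (closure X \<times> closure Y))"
      by (intro compact_imp_bounded compact_continuous_image compact_Times compact_X compact_Y b_continuous)
    then obtain B where "\<forall>v\<in>(\<lambda>z. b (fst z) (snd z)) ` (closure X \<times> closure Y). norm v \<le> B" using bounded_iff by blast
    then show ?thesis using that by force
  qed
  have "\<bar>loss_density c u x\<bar> \<le> B1 + B2 + B3" if "x \<in> R" for x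
    using B1[of x] B2[of "Yb x"] B3[of x "Yb x"] Yb(1)[OF that] RX that unfolding loss_density_def Yb_def[symmetric] by force
  then show "\<exists>B. AE x in lebesgue. x \<in> X \<longrightarrow> \<bar>loss_density c u x\<bar> \<le> B"
    using ae by (intro exI[of _ "B1 + B2 + B3"]) (auto elim: eventually_mono)
qed

definition lowered :: "real \<Rightarrow> (real^'a \<Rightarrow> real) \<Rightarrow> real \<Rightarrow> real^'a \<Rightarrow> real" where
  "lowered k u \<epsilon> x = max (u x - \<epsilon>) (b x y0 - k)"

lemma lowered_b_convex:
  assumes u: "b_support X Y b u w"
  shows "b_convex X Y b (lowered k u \<epsilon>)"
proof (rule b_convexI)
  fix x assume x: "x \<in> closure X"
  show "\<exists>y\<in>closure Y. \<exists>m. lowered k u \<epsilon> x = b x y - m \<and> (\<forall>x'\<in>closure X. b x' y - m \<le> lowered k u \<epsilon> x')"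
  proof (cases "b x y0 - k \<le> u x - \<epsilon>")
    case True
    obtain y where y: "y \<in> closure Y" "u x = b x y - w y" using u x by (auto simp: b_support_def)
    have "b x' y - w y \<le> u x'" if "x' \<in> closure X" for x' using u that y(1) by (auto simp: b_support_def)
    then show ?thesis using True y by (intro bexI[of _ y] exI[of _ "w y + \<epsilon>"]) (force simp: lowered_def max_def)+
  next
    case False
    then show ?thesis using y0 by (intro bexI[of _ y0] exI[of _ k]) (auto simp: lowered_def max_def)
  qed
qed

text \<open>An agent who keeps the product has the same gradient under both utilities, and the
  inequality is an equality with gain \<epsilon>. An agent who switches to \<open>y0\<close> causes
  loss 0 afterwards; the lower bound for \<open>c\<close> through \<open>a\<close> and
  \<open>b_gradient_inequality\<close> then estimate the loss before.\<close>

lemma loss_density_lowered: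
  assumes u: "b_support X Y b u w" and \<epsilon>: "\<epsilon> > 0"
    and a: "a \<in> closure X" "\<And>y. y \<in> closure Y \<Longrightarrow> c y0 + b a y - b a y0 \<le> c y"
    and x: "x \<in> X" and d: "u differentiable (at x)" "lowered (c y0) u \<epsilon> differentiable (at x)"
  shows "u x - lowered (c y0) u \<epsilon> x - (grad u x - grad (lowered (c y0) u \<epsilon>) x) \<bullet> D.V a x
     \<le> loss_density c u x - loss_density c (lowered (c y0) u \<epsilon>) x"
proof -
  let ?l = "lowered (c y0) u \<epsilon>"
  obtain y where y: "y \<in> closure Y" "u x = b x y - w y" "grad u x = Dx X Y b x y" "y_b X Y b x (grad u x) = y"
    using support_y_b[OF u x d(1)] .
  have supp: "b x' y - w y \<le> u x'" if "x' \<in> X" for x' using u clX[OF that] y(1) by (auto simp: b_support_def)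
  show ?thesis
  proof (cases "b x y0 - c y0 \<le> u x - \<epsilon>")
    case True
    have lx: "?l x = b x y - (w y + \<epsilon>)" using True y(2) by (simp add: lowered_def max_def)
    have "b x' y - (w y + \<epsilon>) \<le> ?l x'" if "x' \<in> X" for x' using supp[OF that] by (simp add: lowered_def)
    from support_grad[OF x y(1) lx this d(2)]
    show ?thesis using lx y by (simp add: loss_density_def)
  next
    case False
    have lx: "?l x = b x y0 - c y0" using False by (simp add: lowered_def max_def)
    have "b x' y0 - c y0 \<le> ?l x'" if "x' \<in> X" for x' by (simp add: lowered_def)
    from support_grad[OF x y0 lx this d(2)]
    have g: "grad ?l x = Dx X Y b x y0" "y_b X Y b x (grad ?l x) = y0" by auto
    have "loss_density c ?l x = 0" using lx g by (simp add: loss_density_def)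
    moreover have "loss_density c u x = u x + c y - b x y" using y by (simp add: loss_density_def)
    moreover have "- ((Dx X Y b x y - Dx X Y b x y0) \<bullet> D.V a x) \<le> (b a y - b a y0) - (b x y - b x y0)"
      by (rule b_gradient_inequality[OF x y(1) a(1)])
    ultimately show ?thesis using a(2)[OF y(1)] lx g y(3) by simp
  qed
qed

text \<open>Since \<open>u\<close> is nowhere below the reservation utility, equality is a sublevel
  condition; so the image \<open>C\<close> of the set is convex, and its frontier is negligible and
  stays so under the inverse of the coordinate.\<close>

lemma exclusion_boundary_negligible:
  assumes u: "b_support X Y b u w" and r: "\<And>x. x \<in> closure X \<Longrightarrow> b x y0 - k \<le> u x"
  shows "negligible {x \<in> X. u x = b x y0 - k \<and> x \<notin> interior {x \<in> closure X. u x = b x y0 - k}}"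
proof -
  define C where "C = {q \<in> D.P. u (D.G q) - b (D.G q) y0 \<le> - k}"
  have "convex C"
  proof -
    have "convex_on D.P (\<lambda>q. u (D.G q) - b (D.G q) y0)" by (rule support_convex[OF u])
    then show ?thesis unfolding C_def convex_alt
    proof (intro ballI allI impI)
      fix q1 q2 and t :: real
      assume cv: "convex_on D.P (\<lambda>q. u (D.G q) - b (D.G q) y0)"
        and q: "q1 \<in> {q \<in> D.P. u (D.G q) - b (D.G q) y0 \<le> - k}" "q2 \<in> {q \<in> D.P. u (D.G q) - b (D.G q) y0 \<le> - k}"
        and t: "0 \<le> t \<and> t \<le> 1"
      have "u (D.G ((1 - t) *\<^sub>R q1 + t *\<^sub>R q2)) - b (D.G ((1 - t) *\<^sub>R q1 + t *\<^sub>R q2)) y0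
         \<le> (1 - t) * (u (D.G q1) - b (D.G q1) y0) + t * (u (D.G q2) - b (D.G q2) y0)"
        using convex_onD[OF cv, of t q1 q2] t q by auto
      also have "\<dots> \<le> (1 - t) * (- k) + t * (- k)" using t q by (intro add_mono mult_left_mono) auto
      also have "\<dots> = - k" by (simp add: algebra_simps)
      finally show "(1 - t) *\<^sub>R q1 + t *\<^sub>R q2 \<in> {q \<in> D.P. u (D.G q) - b (D.G q) y0 \<le> - k}"
        using convexD_alt[OF D.convex_image, of q1 q2 t] t q by auto
    qed
  qed
  then have "negligible (frontier C \<inter> D.P)"
    using negligible_convex_frontier negligible_subset by blast
  then have n1: "negligible {x \<in> X. Dy X Y b x y0 \<in> frontier C \<inter> D.P}" by (rule D.negligible_preimage) auto
  have i1: "x \<in> interior {x \<in> closure X. u x = b x y0 - k}"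
    if x: "x \<in> X" "Dy X Y b x y0 \<in> interior C" for x
  proof (rule interiorI)
    have "continuous_on X (\<lambda>x. Dy X Y b x y0)" by (rule continuous_on_subset[OF D.F_continuous closure_subset])
    then show "open (X \<inter> (\<lambda>x. Dy X Y b x y0) -` interior C)"
      using oX by (intro continuous_open_preimage) auto
    show "x \<in> X \<inter> (\<lambda>x. Dy X Y b x y0) -` interior C" using x by auto
    show "X \<inter> (\<lambda>x. Dy X Y b x y0) -` interior C \<subseteq> {x \<in> closure X. u x = b x y0 - k}"
    proof
      fix z assume z: "z \<in> X \<inter> (\<lambda>x. Dy X Y b x y0) -` interior C"
      then have "Dy X Y b z y0 \<in> C" using interior_subset by auto
      then have "u z - b z y0 \<le> - k" using D.G_F z clX by (auto simp: C_def)
      then show "z \<in> {x \<in> closure X. u x = b x y0 - k}" using r[of z] z clX by force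
    qed
  qed
  have f1: "Dy X Y b x y0 \<in> frontier C \<inter> D.P"
    if "x \<in> X" "u x = b x y0 - k" "Dy X Y b x y0 \<notin> interior C" for x
  proof -
    have "Dy X Y b x y0 \<in> C" using that D.G_F clX by (auto simp: C_def)
    then show ?thesis using that closure_subset[of C] by (auto simp: frontier_def C_def)
  qed
  show ?thesis by (rule negligible_subset[OF n1]) (use i1 f1 in blast)
qed


lemma integrable_mult_continuous:
  fixes k h :: "real^'a \<Rightarrow> real"
  assumes k: "integrable lebesgue k" "\<And>x. x \<notin> X \<Longrightarrow> k x = 0"
    and h: "continuous_on X h" "\<And>x. x \<in> X \<Longrightarrow> \<bar>h x\<bar> \<le> B"
  shows "integrable lebesgue (\<lambda>x. k x * h x)"
proof -
  have "(\<lambda>x. indicator X x * h x) \<in> borel_measurable lborel"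
    using borel_measurable_indicator_continuous[OF oX h(1)] by simp
  then have m: "(\<lambda>x. indicator X x * h x) \<in> borel_measurable lebesgue" by (rule measurable_completion)
  have "(\<lambda>x. k x * h x) = (\<lambda>x. k x * (indicator X x * h x))"
  proof
    show "k x * h x = k x * (indicator X x * h x)" for x using k(2) by (cases "x \<in> X") auto
  qed
  moreover have "integrable lebesgue (\<lambda>x. k x * (indicator X x * h x))"
  proof (rule integrable_mult_bounded(1)[OF k(1) m, of B])
    show "AE x in lebesgue. k x \<noteq> 0 \<longrightarrow> \<bar>indicator X x * h x\<bar> \<le> B"
    proof (rule AE_I2, rule impI)
      fix x assume "k x \<noteq> 0"
      then have "x \<in> X" using k(2) by blast
      then show "\<bar>indicator X x * h x\<bar> \<le> B" using h(2) by simp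
    qed
  qed
  ultimately show ?thesis by simp
qed

lemma exclusion_contradiction:
  fixes f :: "real^'a \<Rightarrow> real" and g :: "'a \<Rightarrow> real^'a \<Rightarrow> real"
  assumes wd: "\<And>i. has_weak_derivative_on f (g i) (axis i 1) X"
    and f0: "AE x in lebesgue. 0 \<le> f x" and total: "(LINT x|lebesgue. f x) = 1"
    and u: "b_support X Y b u w" and r: "\<And>x. x \<in> closure X \<Longrightarrow> b x y0 - c y0 \<le> u x"
    and c: "continuous_on (closure Y) c"
    and a: "a \<in> closure X" "\<And>y. y \<in> closure Y \<Longrightarrow> c y0 + b a y - b a y0 \<le> c y"
    and minimal: "\<And>\<epsilon>. \<epsilon> > 0 \<Longrightarrow> (LINT x|lebesgue. f x * loss_density c u x)
       \<le> (LINT x|lebesgue. f x * loss_density c (lowered (c y0) u \<epsilon>) x)"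
    and null: "AE x in lebesgue. x \<in> interior {x \<in> closure X. u x = b x y0 - c y0} \<longrightarrow> f x = 0"
  shows False
proof -
  define U where "U = {x \<in> closure X. u x = b x y0 - c y0}"
  have f: "integrable lebesgue f" and fX: "\<And>x. x \<notin> X \<Longrightarrow> f x = 0"
    using wd by (auto simp: has_weak_derivative_on_def)
  have g: "\<And>i. integrable lebesgue (g i)" and gX: "\<And>i x. x \<notin> X \<Longrightarrow> g i x = 0"
    using wd by (auto simp: has_weak_derivative_on_def)
  obtain Kd dV where Kd: "Kd > 0" "\<And>a x. a \<in> closure X \<Longrightarrow> x \<in> X \<Longrightarrow> (D.V a has_derivative dV a x) (at x)"
    "\<And>a x h. a \<in> closure X \<Longrightarrow> x \<in> X \<Longrightarrow> norm (dV a x h) \<le> Kd * norm h"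
    using D.V_derivative by blast
  obtain Kv where Kv: "Kv > 0" "\<And>a x. a \<in> closure X \<Longrightarrow> x \<in> X \<Longrightarrow> norm (D.V a x) \<le> Kv"
    using D.V_bound by blast
  obtain KG where KG: "KG > 0" "\<And>q v. q \<in> D.P \<Longrightarrow> norm (D.G' q v) \<le> KG * norm v"
    using D.G_bound by blast
  obtain KD where KD: "KD > 0" "\<And>x y. x \<in> closure X \<Longrightarrow> y \<in> closure Y \<Longrightarrow> norm (Dx X Y b x y) \<le> KD"
    using Dx_bound by blast
  define N where "N = real CARD('a)"
  \<comment> \<open>The extra \<open>1\<close> in front of \<open>N * Kd\<close> absorbs the term
    with \<open>f z\<close>; the remaining terms are those of
    \<open>weak_divergence_inequality\<close>.\<close>
  define Q where "Q x = (1 + N * Kd) * f x + Kv * (\<Sum>i\<in>UNIV. \<bar>g i x\<bar>)" for x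
  have Qi: "integrable lebesgue Q" unfolding Q_def[abs_def]
    using f g by (intro Bochner_Integration.integrable_add integrable_mult_right impI integrable_sum integrable_abs) auto
  have QX: "Q x = 0" if "x \<notin> X" for x using that fX gX by (simp add: Q_def)
  \<comment> \<open>The cost of moving the centre from \<open>a\<close> to \<open>a'\<close>: the
    gradients differ by at most \<open>2 * KD\<close>, the two fields by \<open>KG\<close> times the
    distance of the centres in the coordinate.\<close>
  define C where "C = 2 * KD * KG"
  define z where "z \<epsilon> x = 1 - (u x - lowered (c y0) u \<epsilon> x) / \<epsilon>" for \<epsilon> x
  have zb: "0 \<le> z \<epsilon> x" "z \<epsilon> x \<le> 1" if "\<epsilon> > 0" "x \<in> X" for \<epsilon> x
    using that r[OF clX[OF that(2)]] by (auto simp: z_def lowered_def field_simps max_def)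
  have zc: "continuous_on X (z \<epsilon>)" if "\<epsilon> > 0" for \<epsilon>
  proof -
    have uc: "continuous_on X u" using u continuous_on_subset[OF _ closure_subset] unfolding b_support_def by blast
    obtain wl where "b_support X Y b (lowered (c y0) u \<epsilon>) wl" using b_convex_support[OF lowered_b_convex[OF u]] by blast
    then have "continuous_on X (lowered (c y0) u \<epsilon>)"
      using continuous_on_subset[OF _ closure_subset] unfolding b_support_def by blast
    then show ?thesis unfolding z_def[abs_def] using uc that by (intro continuous_intros) auto
  qed
  have main: "1 \<le> (LINT x|lebesgue. Q x * z \<epsilon> x) + C * \<epsilon>" if \<epsilon>: "\<epsilon> > 0" for \<epsilon>
  proof -
    define l where "l = lowered (c y0) u \<epsilon>"
    obtain wl where wl: "b_support X Y b l wl" unfolding l_def using b_convex_support[OF lowered_b_convex[OF u]] by blast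
    have aeu: "AE x in lebesgue. x \<in> X \<longrightarrow> u differentiable (at x)"
      unfolding AE_iff_null_sets_lebesgue by (rule support_differentiable_AE[OF u])
    have ael: "AE x in lebesgue. x \<in> X \<longrightarrow> l differentiable (at x)"
      unfolding AE_iff_null_sets_lebesgue by (rule support_differentiable_AE[OF wl])
    have zl: "z \<epsilon> x = 1 - (u x - l x) / \<epsilon>" for x by (simp add: z_def l_def)
    have gz: "GDERIV (z \<epsilon>) x :> - (inverse \<epsilon> *\<^sub>R (grad u x - grad l x))"
      if "u differentiable (at x)" "l differentiable (at x)" for x
    proof -
      have "((\<lambda>x. 1 - (u x - l x) * inverse \<epsilon>) has_derivative (\<lambda>h. 0 - (h \<bullet> grad u x - h \<bullet> grad l x) * inverse \<epsilon>)) (at x)"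
        using differentiable_GDERIV[OF that(1)] differentiable_GDERIV[OF that(2)] unfolding gderiv_def
        by (intro has_derivative_diff has_derivative_const has_derivative_mult_left)
      then show ?thesis unfolding gderiv_def zl[abs_def] divide_inverse by (simp add: inner_diff_right mult.commute)
    qed
    have zlip: "seg_lipschitz (2 * KD / \<epsilon>) X (z \<epsilon>)"
      unfolding seg_lipschitz_def
    proof (intro allI impI)
      fix x y assume sub: "closed_segment x y \<subseteq> X"
      have 1: "norm (u x - u y) \<le> KD * norm (x - y)" "norm (l x - l y) \<le> KD * norm (x - y)"
        using support_seg_lipschitz[OF KD(2) u] support_seg_lipschitz[OF KD(2) wl] sub by (auto simp: seg_lipschitz_def)
      have "z \<epsilon> x - z \<epsilon> y = ((l x - l y) - (u x - u y)) / \<epsilon>" using \<epsilon> by (simp add: zl field_simps)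
      then have "norm (z \<epsilon> x - z \<epsilon> y) = \<bar>(l x - l y) - (u x - u y)\<bar> / \<epsilon>" using \<epsilon> by (simp add: abs_divide)
      also have "\<dots> \<le> (2 * (KD * norm (x - y))) / \<epsilon>"
        using 1 \<epsilon> by (intro divide_right_mono) auto
      finally show "norm (z \<epsilon> x - z \<epsilon> y) \<le> 2 * KD / \<epsilon> * norm (x - y)" by simp
    qed
    \<comment> \<open>The divergence inequality needs a centre in \<open>X\<close>. Distance below
      \<open>\<epsilon> * \<epsilon>\<close> leaves an error \<open>C * \<epsilon>\<close> once the
      comparison is divided by \<open>\<epsilon>\<close>.\<close>
    have "Dy X Y b a y0 \<in> closure D.P" using a(1) D.image_closure by blast
    then obtain q where q: "q \<in> D.P" "dist q (Dy X Y b a y0) < \<epsilon> * \<epsilon>"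
      using \<epsilon> unfolding closure_approachable by (metis mult_pos_pos)
    then obtain a' where a': "a' \<in> X" "q = Dy X Y b a' y0" by auto
    note a'c = clX[OF a'(1)]
    have zd: "AE x in lebesgue. x \<in> X \<longrightarrow> z \<epsilon> differentiable (at x)"
      using aeu ael
    proof eventually_elim
      case (elim x)
      then show ?case using gz unfolding gderiv_def by (blast intro: differentiableI)
    qed
    have lip0: "0 \<le> 2 * KD / \<epsilon>" "0 \<le> Kd" "0 \<le> Kv" using KD \<epsilon> Kd Kv by auto
    note wdi = D.weak_divergence_inequality[OF wd f0 Kd(2)[OF a'c] Kd(3)[OF a'c] lip0(2) Kv(2)[OF a'c] lip0(3) a'(1) zlip lip0(1) zb(1)[OF \<epsilon>] zb(2)[OF \<epsilon>] zd]
    define H where "H x = grad (z \<epsilon>) x \<bullet> D.V a' x" for x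
    have fHi: "integrable lebesgue (\<lambda>x. f x * H x)" unfolding H_def by (rule wdi(1)) auto
    have fHle: "- (LINT x|lebesgue. f x * H x) \<le> (LINT x|lebesgue. (N * Kd * f x + Kv * (\<Sum>i\<in>UNIV. \<bar>g i x\<bar>)) * z \<epsilon> x)"
      unfolding H_def N_def by (rule wdi(2)) auto
    have fz: "integrable lebesgue (\<lambda>x. f x * z \<epsilon> x)"
      by (rule integrable_mult_continuous[OF f fX zc[OF \<epsilon>], of 1]) (use zb[OF \<epsilon>] in auto)
    have Lu: "integrable lebesgue (\<lambda>x. f x * loss_density c v x)" if v: "b_support X Y b v wv" for v wv
    proof -
      obtain B where B: "AE x in lebesgue. x \<in> X \<longrightarrow> \<bar>loss_density c v x\<bar> \<le> B"
        using loss_density_measurable(2)[OF v c] by blast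
      have "integrable lebesgue (\<lambda>x. f x * (indicator X x * loss_density c v x))"
      proof (rule integrable_mult_bounded(1)[OF f loss_density_measurable(1)[OF v c], of B])
        show "AE x in lebesgue. f x \<noteq> 0 \<longrightarrow> \<bar>indicator X x * loss_density c v x\<bar> \<le> B"
          using B
        proof eventually_elim
          case (elim x)
          show ?case
          proof
            assume "f x \<noteq> 0"
            then have "x \<in> X" using fX by blast
            then show "\<bar>indicator X x * loss_density c v x\<bar> \<le> B" using elim by simp
          qed
        qed
      qed
      moreover have "(\<lambda>x. f x * (indicator X x * loss_density c v x)) = (\<lambda>x. f x * loss_density c v x)"
      proof
        show "f x * (indicator X x * loss_density c v x) = f x * loss_density c v x" for x
          using fX by (cases "x \<in> X") auto
      qed
      ultimately show ?thesis by simp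
    qed
    have pt: "AE x in lebesgue. (\<epsilon> - C * (\<epsilon> * \<epsilon>)) * f x - \<epsilon> * (f x * z \<epsilon> x) + \<epsilon> * (f x * H x)
        \<le> f x * loss_density c u x - f x * loss_density c l x"
      using f0 aeu ael
    proof eventually_elim
      case (elim x)
      show ?case
      proof (cases "x \<in> X")
        case x: True
        then have d: "u differentiable (at x)" "l differentiable (at x)" using elim by auto
        have gzx: "grad (z \<epsilon>) x = - (inverse \<epsilon> *\<^sub>R (grad u x - grad l x))" by (rule grad_eqI[OF gz[OF d]])
        have ineq: "u x - l x - (grad u x - grad l x) \<bullet> D.V a x \<le> loss_density c u x - loss_density c l x"
          unfolding l_def by (rule loss_density_lowered[OF u \<epsilon> a x d[unfolded l_def]])
        have gb: "norm (grad u x - grad l x) \<le> 2 * KD"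
        proof -
          obtain y1 where "y1 \<in> closure Y" "grad u x = Dx X Y b x y1" using support_y_b[OF u x d(1)] by metis
          moreover obtain y2 where "y2 \<in> closure Y" "grad l x = Dx X Y b x y2" using support_y_b[OF wl x d(2)] by metis
          ultimately have "norm (grad u x) \<le> KD" "norm (grad l x) \<le> KD" using KD(2) clX[OF x] by auto
          then show ?thesis using norm_triangle_ineq4[of "grad u x" "grad l x"] by linarith
        qed
        have px: "Dy X Y b x y0 \<in> D.P" using x by blast
        have lin: "linear (D.G' (Dy X Y b x y0))" using D.linear_G'[OF px] by (rule bounded_linear.linear)
        have "D.V a x - D.V a' x = D.G' (Dy X Y b x y0) (q - Dy X Y b a y0)"
          unfolding D.V_def a'(2) by (simp add: linear_diff[OF lin, symmetric])
        then have "norm (D.V a x - D.V a' x) \<le> KG * norm (q - Dy X Y b a y0)" using KG(2)[OF px] by simp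
        also have "\<dots> \<le> KG * (\<epsilon> * \<epsilon>)" using q(2) KG(1) by (intro mult_left_mono) (auto simp: dist_norm)
        finally have Vd: "norm (D.V a x - D.V a' x) \<le> KG * (\<epsilon> * \<epsilon>)" .
        have "(grad u x - grad l x) \<bullet> (D.V a x - D.V a' x) \<le> norm (grad u x - grad l x) * norm (D.V a x - D.V a' x)"
          by (rule norm_cauchy_schwarz)
        also have "\<dots> \<le> (2 * KD) * (KG * (\<epsilon> * \<epsilon>))" using gb Vd KD(1) by (intro mult_mono) auto
        finally have err: "(grad u x - grad l x) \<bullet> D.V a x - (grad u x - grad l x) \<bullet> D.V a' x \<le> C * (\<epsilon> * \<epsilon>)"
          by (simp add: C_def inner_diff_right mult.assoc)
        have eH: "\<epsilon> * H x = - ((grad u x - grad l x) \<bullet> D.V a' x)"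
          unfolding H_def gzx using \<epsilon> by simp
        have ez: "\<epsilon> * z \<epsilon> x = \<epsilon> - (u x - l x)" 
          unfolding zl right_diff_distrib[of \<epsilon> 1] using \<epsilon> by simp
        have "\<epsilon> - C * (\<epsilon> * \<epsilon>) - \<epsilon> * z \<epsilon> x + \<epsilon> * H x \<le> loss_density c u x - loss_density c l x"
          using ineq err unfolding eH ez by linarith
        then have "f x * (\<epsilon> - C * (\<epsilon> * \<epsilon>) - \<epsilon> * z \<epsilon> x + \<epsilon> * H x) \<le> f x * (loss_density c u x - loss_density c l x)"
          using elim(1) by (intro mult_left_mono) auto
        then show ?thesis by (simp add: algebra_simps)
      qed (simp add: fX)
    qed
    have "(LINT x|lebesgue. (\<epsilon> - C * (\<epsilon> * \<epsilon>)) * f x - \<epsilon> * (f x * z \<epsilon> x) + \<epsilon> * (f x * H x))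
        \<le> (LINT x|lebesgue. f x * loss_density c u x - f x * loss_density c l x)"
      by (rule integral_mono_AE[OF _ _ pt]) (use f fz fHi Lu[OF u] Lu[OF wl] in auto)
    also have "\<dots> = (LINT x|lebesgue. f x * loss_density c u x) - (LINT x|lebesgue. f x * loss_density c l x)"
      by (rule Bochner_Integration.integral_diff[OF Lu[OF u] Lu[OF wl]])
    also have "\<dots> \<le> 0" using minimal[OF \<epsilon>] by (simp add: l_def)
    also have "(LINT x|lebesgue. (\<epsilon> - C * (\<epsilon> * \<epsilon>)) * f x - \<epsilon> * (f x * z \<epsilon> x) + \<epsilon> * (f x * H x))
       = (\<epsilon> - C * (\<epsilon> * \<epsilon>)) - \<epsilon> * (LINT x|lebesgue. f x * z \<epsilon> x) + \<epsilon> * (LINT x|lebesgue. f x * H x)"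
      using f fz fHi total by simp
    finally have "\<epsilon> * (1 - C * \<epsilon> - (LINT x|lebesgue. f x * z \<epsilon> x) + (LINT x|lebesgue. f x * H x)) \<le> 0"
      by (simp add: algebra_simps)
    then have "1 - C * \<epsilon> - (LINT x|lebesgue. f x * z \<epsilon> x) + (LINT x|lebesgue. f x * H x) \<le> 0"
      using \<epsilon> by (simp add: mult_le_0_iff)
    moreover have "(LINT x|lebesgue. Q x * z \<epsilon> x) = (LINT x|lebesgue. f x * z \<epsilon> x)
        + (LINT x|lebesgue. (N * Kd * f x + Kv * (\<Sum>i\<in>UNIV. \<bar>g i x\<bar>)) * z \<epsilon> x)"
    proof -
      have "integrable lebesgue (\<lambda>x. (N * Kd * f x + Kv * (\<Sum>i\<in>UNIV. \<bar>g i x\<bar>)) * z \<epsilon> x)"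
      proof (rule integrable_mult_continuous[OF _ _ zc[OF \<epsilon>], of _ 1])
        show "integrable lebesgue (\<lambda>x. N * Kd * f x + Kv * (\<Sum>i\<in>UNIV. \<bar>g i x\<bar>))"
          using f g by (intro Bochner_Integration.integrable_add integrable_mult_right impI integrable_sum integrable_abs) auto
      qed (use fX gX zb[OF \<epsilon>] in auto)
      from Bochner_Integration.integral_add[OF fz this] show ?thesis by (simp add: Q_def algebra_simps)
    qed
    ultimately show ?thesis using fHle by linarith
  qed
  \<comment> \<open>Intersecting with \<open>X\<close> gives an open set on which the weak
    derivative is defined; there it vanishes along with \<open>f\<close>, and so does
    \<open>Q\<close>.\<close>
  have AEU: "AE x in lebesgue. x \<in> interior U \<inter> X \<longrightarrow> f x = 0" using null by (auto simp: U_def elim: eventually_mono)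
  have AEg: "AE x in lebesgue. x \<in> interior U \<inter> X \<longrightarrow> g i x = 0" for i
    by (rule weak_derivative_vanishes[OF wd[of i] _ _ _ AEU]) (use oX bX in \<open>auto intro: bounded_subset\<close>)
  have "AE x in lebesgue. \<forall>i\<in>UNIV. x \<in> interior U \<inter> X \<longrightarrow> g i x = 0"
    using AEg by (intro AE_finite_allI) auto
  moreover have "AE x in lebesgue. x \<in> X \<longrightarrow> \<not> (u x = b x y0 - c y0 \<and> x \<notin> interior U)"
    unfolding AE_iff_null_sets_lebesgue U_def using exclusion_boundary_negligible[OF u r] by simp
  ultimately have QU: "AE x in lebesgue. Q x * indicator U x = 0"
    using AEU
  proof eventually_elim
    case (elim x)
    show ?case
    proof (cases "x \<in> X \<and> x \<in> U")
      case True
      then have "x \<in> interior U" using elim by (auto simp: U_def)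
      then show ?thesis using elim True by (simp add: Q_def)
    next
      case False
      then show ?thesis using QX by auto
    qed
  qed
  define h where "h n = inverse (real (Suc n))" for n
  have h: "h n > 0" for n by (simp add: h_def)
  have hlim: "h \<longlonglongrightarrow> 0" unfolding h_def by (rule LIMSEQ_inverse_real_of_nat)
  \<comment> \<open>On \<open>U\<close> the function \<open>z\<close> is constantly 1; at any other
    point it is 0 as soon as \<open>h n\<close> is below the distance of \<open>u\<close> from the
    reservation utility.\<close>
  have "(\<lambda>n. LINT x|lebesgue. Q x * (indicator X x * z (h n) x)) \<longlonglongrightarrow> (LINT x|lebesgue. Q x * indicator U x)"
  proof (rule integral_dominated_mult(2)[OF Qi, where B=1])
    fix n
    have "(\<lambda>x. indicator X x * z (h n) x) \<in> borel_measurable lborel"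
      using borel_measurable_indicator_continuous[OF oX zc[OF h]] by simp
    then show "(\<lambda>x. indicator X x * z (h n) x) \<in> borel_measurable lebesgue" by (rule measurable_completion)
    show "AE x in lebesgue. Q x \<noteq> 0 \<longrightarrow> \<bar>indicator X x * z (h n) x\<bar> \<le> 1"
      using zb[OF h] by (intro AE_I2) (auto simp: indicator_def)
  next
    show "AE x in lebesgue. Q x \<noteq> 0 \<longrightarrow> (\<lambda>n. indicator X x * z (h n) x) \<longlonglongrightarrow> indicator U x"
    proof (rule AE_I2, rule impI)
      fix x assume "Q x \<noteq> 0"
      then have x: "x \<in> X" using QX by blast
      show "(\<lambda>n. indicator X x * z (h n) x) \<longlonglongrightarrow> indicator U x"
      proof (cases "x \<in> U")
        case True
        then have "z (h n) x = 1" for n using h[of n] by (simp add: z_def lowered_def U_def max_def)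
        then show ?thesis using True x by simp
      next
        case False
        then have pos: "u x - (b x y0 - c y0) > 0" using r[OF clX[OF x]] clX[OF x] by (auto simp: U_def)
        have "eventually (\<lambda>n. h n < u x - (b x y0 - c y0)) sequentially"
          by (rule order_tendstoD(2)[OF hlim pos])
        then have "eventually (\<lambda>n. indicator X x * z (h n) x = indicator U x) sequentially"
        proof eventually_elim
          case (elim n)
          then have "lowered (c y0) u (h n) x = u x - h n" by (simp add: lowered_def max_def)
          then have "z (h n) x = 0" using h[of n] by (simp add: z_def)
          then show ?case using False by simp
        qed
        then show ?thesis by (rule tendsto_eventually)
      qed
    qed
  qed
  moreover have "(LINT x|lebesgue. Q x * indicator U x) = 0"
    using integral_eq_zero_AE[OF QU] by simp
  moreover have "(LINT x|lebesgue. Q x * (indicator X x * z (h n) x)) = (LINT x|lebesgue. Q x * z (h n) x)" for n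
  proof (rule Bochner_Integration.integral_cong[OF refl])
    show "Q x * (indicator X x * z (h n) x) = Q x * z (h n) x" for x using QX by (cases "x \<in> X") auto
  qed
  ultimately have "(\<lambda>n. LINT x|lebesgue. Q x * z (h n) x) \<longlonglongrightarrow> 0" by simp
  then have "(\<lambda>n. (LINT x|lebesgue. Q x * z (h n) x) + C * h n) \<longlonglongrightarrow> 0 + C * 0"
    by (intro tendsto_intros hlim)
  then have "1 \<le> 0 + C * 0" by (rule LIMSEQ_le_const) (use main[OF h] in auto)
  then show False by simp
qed

end

section \<open>From the distribution of types to integrals over the whole space\<close>

theorem theorem4p7:
  fixes X Y :: "(real^'n) set"
    and b :: "real^'n \<Rightarrow> real^'n \<Rightarrow> real"
    and c f u :: "real^'n \<Rightarrow> real"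
    and y0 :: "real^'n"
    and \<mu> :: "(real^'n) measure"
  assumes "B0 X Y b"
    and "bi_twist X Y b"
    and "bi_convex X Y b"
    and "nonneg_cross_curvature X Y b"
    and "W11 X f"
    and "AE x in lebesgue_on (closure X). 0 \<le> f x"
    and "\<mu> = density_on_closure X f"
    and "prob_space \<mu>"
    and "bstar_convex X Y b c"
    and "y0 \<in> closure Y"
    and "\<not> has_boundary_facet ((\<lambda>x. Dy X Y b x y0) ` X)"
    and "u \<in> admissible_utilities X Y b c y0"
    and "\<forall>w \<in> admissible_utilities X Y b c y0. net_losses X Y b c \<mu> u \<le> net_losses X Y b c \<mu> w"
  shows "measure \<mu> (interior (exclusion_set X b c y0 u)) > 0
    \<and> (\<forall>x \<in> interior (exclusion_set X b c y0 u).
         u differentiable (at x) \<and> y_b X Y b x (grad u x) = y0)"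
proof -
  let ?M = "lebesgue_on (closure X)"
  obtain E where E: "partials_of E X Y b" using B0_partials[OF assms(1)] .
  have XY: "open X" "open Y" "bounded X" "bounded Y" using assms(1) by (auto simp: B0_def)
  interpret \<mu>: prob_space \<mu> by fact
  have space: "space \<mu> = closure X" and sets: "sets \<mu> = sets ?M"
    unfolding assms(7) density_on_closure_def by (simp_all add: space_restrict_space)
  have "X \<noteq> {}" using \<mu>.not_empty space by auto
  interpret exclusion X Y b E y0
    by unfold_locales (use E XY assms(2-4,10) \<open>X \<noteq> {}\<close> in auto)
  define U where "U = exclusion_set X b c y0 u"
  have U: "U = {x \<in> closure X. u x = b x y0 - c y0}" by (simp add: U_def exclusion_set_def)
  have bu: "b_convex X Y b u" and r: "\<And>x. x \<in> closure X \<Longrightarrow> b x y0 - c y0 \<le> u x"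
    using assms(12) by (auto simp: admissible_utilities_def)
  obtain w where w: "b_support X Y b u w" using b_convex_support[OF bu] .
  have cc: "continuous_on (closure Y) c" by (rule bstar_convex_support(1)[OF assms(9)])
  obtain a where a: "a \<in> closure X" "\<And>y. y \<in> closure Y \<Longrightarrow> c y0 + b a y - b a y0 \<le> c y"
    using bstar_convex_support(2)[OF assms(9)] by blast
  have Xm: "X \<in> sets lebesgue" and clm: "closure X \<in> sets lebesgue" using XY by auto
  have clm': "closure X \<inter> space lebesgue \<in> sets lebesgue" using clm by simp
  obtain g where g: "\<And>i. i \<in> Basis \<Longrightarrow>
    has_weak_derivative_on (\<lambda>x. indicator X x * f x) (\<lambda>x. indicator X x * (g x \<bullet> i)) i X"
    by (rule W11_weak_derivative[OF assms(5) Xm]) (rule that)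
  define F where "F x = indicator X x * f x" for x
  have wd: "has_weak_derivative_on F (\<lambda>x. indicator X x * (g x \<bullet> axis i 1)) (axis i 1) X" for i
    unfolding F_def by (rule g) (simp add: axis_in_Basis_iff)
  have Fi: "integrable lebesgue F" using wd by (auto simp: has_weak_derivative_on_def)
  \<comment> \<open>The measure is a density on the closure, while W11 speaks of the open set only.
    As the difference is negligible, \<open>F\<close> represents the density, and \<open>f\<close>
    is measurable on the closure too.\<close>
  have bd: "AE x in lebesgue. x \<notin> closure X - X"
    using D.negligible_boundary negligible_iff_null_sets AE_not_in by blast
  have fm: "f \<in> borel_measurable ?M"
  proof -
    have "(\<lambda>x. indicator (closure X) x * f x) \<in> borel_measurable lebesgue"
    proof (rule borel_measurable_lebesgue_AE)
      show "F \<in> borel_measurable lebesgue" using Fi by (rule borel_measurable_integrable)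
      show "AE x in lebesgue. F x = indicator (closure X) x * f x"
        using bd by eventually_elim (use clX in \<open>auto simp: F_def indicator_def\<close>)
    qed
    then show ?thesis using borel_measurable_restrict_space_iff[OF clm', of f] by simp
  qed
  have integral_\<mu>: "(LINT x|\<mu>. h x) = (LINT x|lebesgue. F x * h x)" if h: "h \<in> borel_measurable ?M" for h :: "real^'n \<Rightarrow> real"
  proof -
    have "(LINT x|\<mu>. h x) = (LINT x|?M. f x *\<^sub>R h x)"
      unfolding assms(7) density_on_closure_def by (rule integral_density[OF h fm assms(6)])
    also have "\<dots> = (LINT x|lebesgue. indicator (closure X) x *\<^sub>R (f x *\<^sub>R h x))"
      by (rule integral_restrict_space[OF clm'])
    also have "\<dots> = (LINT x|lebesgue. F x * h x)"
    proof (rule integral_cong_AE)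
      have "(\<lambda>x. f x *\<^sub>R h x) \<in> borel_measurable ?M" using fm h by simp
      then show m: "(\<lambda>x. indicator (closure X) x *\<^sub>R (f x *\<^sub>R h x)) \<in> borel_measurable lebesgue"
        using borel_measurable_restrict_space_iff[OF clm', of "\<lambda>x. f x *\<^sub>R h x"] by simp
      show ae: "AE x in lebesgue. indicator (closure X) x *\<^sub>R (f x *\<^sub>R h x) = F x * h x"
        using bd by eventually_elim (use clX in \<open>auto simp: F_def indicator_def\<close>)
      show "(\<lambda>x. F x * h x) \<in> borel_measurable lebesgue" by (rule borel_measurable_lebesgue_AE[OF m ae])
    qed
    finally show ?thesis .
  qed
  have F0: "AE x in lebesgue. 0 \<le> F x"
  proof -
    have "AE x in lebesgue. x \<in> closure X \<longrightarrow> 0 \<le> f x"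
      by (rule AE_restrict_space_iff[OF clm', THEN iffD1, OF assms(6)])
    then show ?thesis by eventually_elim (use clX in \<open>auto simp: F_def indicator_def\<close>)
  qed
  have total: "(LINT x|lebesgue. F x) = 1"
    using integral_\<mu>[of "\<lambda>x. 1"] \<mu>.prob_space by simp
  have losses: "net_losses X Y b c \<mu> v = (LINT x|lebesgue. F x * loss_density c v x)" if v: "b_support X Y b v wv" for v wv
  proof -
    have "(\<lambda>x. indicator X x * loss_density c v x) \<in> borel_measurable ?M"
      using loss_density_measurable(1)[OF v cc] by (rule measurable_restrict_space1)
    from integral_\<mu>[OF this]
    have "net_losses X Y b c \<mu> v = (LINT x|lebesgue. F x * (indicator X x * loss_density c v x))"
      by (simp add: net_losses_def set_lebesgue_integral_def loss_density_def)
    also have "\<dots> = (LINT x|lebesgue. F x * loss_density c v x)"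
      by (intro Bochner_Integration.integral_cong refl) (auto simp: F_def indicator_def)
    finally show ?thesis .
  qed
  have minimal: "(LINT x|lebesgue. F x * loss_density c u x) \<le> (LINT x|lebesgue. F x * loss_density c (lowered (c y0) u \<epsilon>) x)" for \<epsilon>
  proof -
    have bl: "b_convex X Y b (lowered (c y0) u \<epsilon>)" by (rule lowered_b_convex[OF w])
    obtain wl where wl: "b_support X Y b (lowered (c y0) u \<epsilon>) wl" using b_convex_support[OF bl] .
    have "lowered (c y0) u \<epsilon> \<in> admissible_utilities X Y b c y0"
      using bl by (auto simp: admissible_utilities_def lowered_def)
    then show ?thesis using assms(13) losses[OF w] losses[OF wl] by auto
  qed
  have Um: "interior U \<in> sets ?M"
  proof -
    have "interior U \<subseteq> closure X" using interior_subset U by auto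
    then show ?thesis by (simp add: sets_restrict_space_iff clm)
  qed
  have "measure \<mu> (interior U) > 0"
  proof (rule ccontr)
    assume "\<not> measure \<mu> (interior U) > 0"
    then have "measure \<mu> (interior U) = 0" using measure_nonneg[of \<mu> "interior U"] by linarith
    moreover have "(LINT x|\<mu>. indicator (interior U) x) = measure \<mu> (interior U)"
    proof -
      have "interior U \<subseteq> closure X" using interior_subset U by auto
      then have "interior U \<inter> space \<mu> = interior U" using space by blast
      then show ?thesis by simp
    qed
    moreover have "(LINT x|\<mu>. indicator (interior U) x) = (LINT x|lebesgue. F x * indicator (interior U) x)"
      by (rule integral_\<mu>) (use Um in simp)
    ultimately have 0: "(LINT x|lebesgue. F x * indicator (interior U) x) = 0" by simp
    have i: "integrable lebesgue (\<lambda>x. F x * indicator (interior U) x)"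
    proof (rule integrable_mult_bounded(1)[OF Fi, of _ 1])
      have "interior U \<in> sets lebesgue" by auto
      then show "(\<lambda>x. indicator (interior U) x :: real) \<in> borel_measurable lebesgue"
        by (rule borel_measurable_indicator)
    qed (auto simp: indicator_def)
    have "AE x in lebesgue. 0 \<le> F x * indicator (interior U) x"
      using F0 by eventually_elim (simp add: indicator_def)
    then have "AE x in lebesgue. F x * indicator (interior U) x = 0"
      using integral_nonneg_eq_0_iff_AE[OF i] 0 by blast
    then have null: "AE x in lebesgue. x \<in> interior {x \<in> closure X. u x = b x y0 - c y0} \<longrightarrow> F x = 0"
      unfolding U by eventually_elim (auto simp: indicator_def)
    show False
      by (rule exclusion_contradiction[OF wd F0 total w _ cc a(1) _ minimal null]) (auto intro: r a(2))
  qed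
  moreover have "u differentiable (at x) \<and> y_b X Y b x (grad u x) = y0" if x: "x \<in> interior U" for x
  proof -
    \<comment> \<open>\<open>U\<close> is a subset of the closure; that its interior points lie in
      \<open>X\<close>, where \<open>b(\<cdot>, y0)\<close> is differentiable, rests on
      \<open>D.interior_closure_eq\<close>.\<close>
    have "interior U \<subseteq> interior (closure X)" using U by (intro interior_mono) auto
    then have xX: "x \<in> X" using x D.interior_closure_eq by blast
    obtain D where D: "((\<lambda>x. b x y0) has_derivative D) (at x)"
      using b_differentiable[OF xX y0] by (auto simp: differentiable_def)
    have "((\<lambda>x. b x y0 - c y0) has_derivative (\<lambda>h. D h - 0)) (at x)"
      by (intro has_derivative_diff D has_derivative_const)
    then have "(u has_derivative (\<lambda>h. D h - 0)) (at x)"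
    proof (rule has_derivative_transform_within_open[OF _ open_interior x])
      fix z assume "z \<in> interior U"
      then have "z \<in> U" using interior_subset by blast
      then show "b z y0 - c y0 = u z" by (simp add: U)
    qed
    then have d: "u differentiable (at x)" by (rule differentiableI)
    have "x \<in> U" using x interior_subset by blast
    then have "u x = b x y0 - c y0" by (simp add: U)
    from support_grad(2)[OF xX y0 this r[OF clX] d] d show ?thesis by blast
  qed
  ultimately show ?thesis by (simp add: U_def)
qed

end
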